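(* Let $\mathcal{K}=\{K_{D,\phi}\}$ be the set of all superclasses of $U$ and $\mathcal{X}=\{\xi_{D,\phi}\}$ the set of all supercharacters of $U$, where $(D,\phi)$ runs over all basic pairs for $U$. Then $\mathcal{K}$ and $\mathcal{X}$ form a supercharacter theory for $U$; that is, $\mathcal{K}$ is a partition of $U$, $\mathcal{X}$ is a set of complex characters of $U$, and: (S1) $|\mathcal{K}|=|\mathcal{X}|$; (S2) every irreducible character of $U$ is a constituent of a unique $\xi\in\mathcal{X}$; (S3) the characters in $\mathcal{X}$ are constant on the members of $\mathcal{K}$.
   Context: Let $p$ be an odd prime, $q=p^{e}$ ($e\ge 1$), $\mathbb{F}_q$ the field with $q$ elements, $\mathbb{F}_q^{\times}=\mathbb{F}_q\setminus\{0\}$, and $n\ge 1$. Let $G$ be one of $Sp_{2n}(q)$, $O_{2n}(q)$, $O_{2n+1}(q)$; put $m=2n$ in the first two cases and $m=2n+1$ in the third. $U_m(q)$ is the group of unipotent upper-triangular $m\times m$ matrices over $\mathbb{F}_q$, and $U=G\cap U_m(q)$. Explicitly, with $J$ the $n\times n$ matrix with $1$'s on the anti-diagonal and $0$'s elsewhere, $U$ consists of all block matrices $\begin{pmatrix} x & xv & xw\\ 0 & I_r & -v^{T}J\\ 0&0&Jx^{-T}J\end{pmatrix}$ with $x\in U_n(q)$, $v$ an $n\times r$ matrix, $w$ an $n\times n$ matrix over $\mathbb{F}_q$, where: $r=0$ and $Jw^T-wJ=0$ if $G=Sp_{2n}(q)$; $r=0$ and $Jw^T+wJ=0$ if $G=O_{2n}(q)$;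 $r=1$ and $Jw^T+wJ=-vv^T$ if $G=O_{2n+1}(q)$. Characters are complex characters. Indexing. Rows and columns of $m\times m$ matrices are indexed by $1\prec 2\prec\cdots\prec n\prec 0\prec -n\prec\cdots\prec -2\prec -1$ (index $0$ present only if $G=O_{2n+1}(q)$); $e_{i,j}$ denotes a matrix unit. Roots. $\varepsilon_1,\dots,\varepsilon_n$ are formal independent symbols; $\Phi=\{\varepsilon_i\pm\varepsilon_j:1\le i<j\le n\}\cup\Phi'$ with $\Phi'=\{2\varepsilon_i:1\le i\le n\}$ if $G=Sp_{2n}(q)$, $\Phi'=\emptyset$ if $G=O_{2n}(q)$, $\Phi'=\{\varepsilon_i:1\le i\le n\}$ if $G=O_{2n+1}(q)$. For $\alpha\in\Phi$ let $\mathcal{E}(\alpha)$ be: $\{(i,j),(-j,-i)\}$ if $\alpha=\varepsilon_i-\varepsilon_j$; $\{(i,-j),(j,-i)\}$ if $\alpha=\varepsilon_i+\varepsilon_j$ ($i<j$); $\{(i,-i)\}$ if $\alpha=2\varepsilon_i$; $\{(i,0),(0,-i)\}$ if $\alpha=\varepsilon_i$. For $\Psi\subseteq\Phi$, $\mathcal{E}(\Psi)=\bigcup_{\alpha\in\Psi}\mathcal{E}(\alpha)$. Each $\mathcal{E}(\alpha)$ contains exactly one entry $(i,j)$ with $1\le i\le n$ and $i\prec j\preceq -i$; it is called the positive entry of $\alpha$. Basic pairs. $D\subseteq\Phi$ is basic if $\mathcal{E}(D)$ contains at most one entry from each row and at most one from each column. A basic pair for $U$ is $(D,\phi)$ with $D\subseteq\Phi$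 basic (possibly empty) and $\phi:D\to\mathbb{F}_q^\times$ a map. Superclasses. Let $e_\alpha$ be: $e_{i,j}-e_{-j,-i}$ if $\alpha=\varepsilon_i-\varepsilon_j$; $e_{i,-j}+e_{j,-i}$ if $\alpha=\varepsilon_i+\varepsilon_j$ and $G=Sp_{2n}(q)$; $e_{i,-j}-e_{j,-i}$ if $\alpha=\varepsilon_i+\varepsilon_j$ and $G$ is orthogonal; $e_{i,-i}$ if $\alpha=2\varepsilon_i$; $e_{i,0}-e_{0,-i}$ if $\alpha=\varepsilon_i$. Put $e_{D,\phi}=\sum_{\alpha\in D}\phi(\alpha)e_\alpha$, $V_{D,\phi}=U_m(q)\,e_{D,\phi}\,U_m(q)$ and $K_{D,\phi}=\{x\in U: x-1\in V_{D,\phi}\}$ (so $K_{D,\phi}=\{1\}$ if $D=\emptyset$). The sets $K_{D,\phi}$ are the superclasses of $U$. Supercharacters. Fix a nontrivial linear character $\vartheta:\mathbb{F}_q\to\mathbb{C}^\times$ of the additive group of $\mathbb{F}_q$. Define subgroups $U_\alpha\le U$: if $\alpha=\varepsilon_i-\varepsilon_j$, $U_\alpha=\{x\in U:x_{i,k}=0,\ i<k<j\}$; if $\alpha=\varepsilon_i+\varepsilon_j$ ($i<j$), $U_\alpha=\{x\in U:x_{i,k}=x_{j,l}=0,\ i<k\le n,\ j\prec l\preceq 0\}$ (when the index $0$ is absent, $l$ runs over $j<l\le n$); if $\alpha=2\varepsilon_i$ or $\alpha=\varepsilon_i$, $U_\alpha=\{x\in U:x_{i,k}=0,\ i<k\le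 n\}$. For $r\in\mathbb{F}_q^\times$, $\lambda_{\alpha,r}(x)=\vartheta(r x_{i,j})$, with $(i,j)$ the positive entry of $\alpha$, is a linear character of $U_\alpha$; the elementary character is the induced character $\xi_{\alpha,r}=(\lambda_{\alpha,r})^U$. The supercharacter of a basic pair is $\xi_{D,\phi}=\prod_{\alpha\in D}\xi_{\alpha,\phi(\alpha)}$ (the trivial character $1_U$ if $D=\emptyset$). *)

theory Defs
  imports
    "HOL-Library.Disjoint_Sets"
    "HOL-Library.Cardinality"
    "HOL-Computational_Algebra.Primes"
    "Jordan_Normal_Form.VS_Connect"
begin

section \<open>Complex characters of a group\<close>

definition mat_tr :: "'a::comm_monoid_add mat \<Rightarrow> 'a" where
  "mat_tr A = (\<Sum>i<dim_row A. A $$ (i, i))"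

text \<open>Representations are nonzero: the degree is positive.\<close>

definition matrix_rep :: "('g, 'x) monoid_scheme \<Rightarrow> nat \<Rightarrow> ('g \<Rightarrow> complex mat) \<Rightarrow> bool" where
  "matrix_rep G d \<rho> \<longleftrightarrow> 0 < d \<and>
     \<rho> \<in> carrier G \<rightarrow> carrier_mat d d \<and>
     \<rho> \<one>\<^bsub>G\<^esub> = 1\<^sub>m d \<and>
     (\<forall>g\<in>carrier G. \<forall>h\<in>carrier G. \<rho> (g \<otimes>\<^bsub>G\<^esub> h) = \<rho> g * \<rho> h)"

definition irreducible_rep :: "('g, 'x) monoid_scheme \<Rightarrow> nat \<Rightarrow> ('g \<Rightarrow> complex mat) \<Rightarrow> bool" where
  "irreducible_rep G d \<rho> \<longleftrightarrow> matrix_rep G d \<rho> \<and>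
     (\<forall>W. subspace class_ring W (module_vec TYPE(complex) d) \<longrightarrow>
          (\<forall>g\<in>carrier G. \<forall>w\<in>W. \<rho> g *\<^sub>v w \<in> W) \<longrightarrow>
          W = {0\<^sub>v d} \<or> W = carrier_vec d)"

text \<open>Functions on a group \<open>G\<close> are extensional (\<open>undefined\<close> outside \<open>carrier G\<close>), so that
  equality of characters is equality as functions on \<open>G\<close>.\<close>

definition rep_character :: "('g, 'x) monoid_scheme \<Rightarrow> ('g \<Rightarrow> complex mat) \<Rightarrow> 'g \<Rightarrow> complex" where
  "rep_character G \<rho> = (\<lambda>g\<in>carrier G. mat_tr (\<rho> g))"

definition is_character :: "('g, 'x) monoid_scheme \<Rightarrow> ('g \<Rightarrow> complex) \<Rightarrow> bool" where
  "is_character G \<chi> \<longleftrightarrow> (\<exists>d \<rho>. matrix_rep G d \<rho> \<and> \<chi> = rep_character G \<rho>)"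

definition irreducible_character :: "('g, 'x) monoid_scheme \<Rightarrow> ('g \<Rightarrow> complex) \<Rightarrow> bool" where
  "irreducible_character G \<chi> \<longleftrightarrow> (\<exists>d \<rho>. irreducible_rep G d \<rho> \<and> \<chi> = rep_character G \<rho>)"

definition char_inner :: "('g, 'x) monoid_scheme \<Rightarrow> ('g \<Rightarrow> complex) \<Rightarrow> ('g \<Rightarrow> complex) \<Rightarrow> complex" where
  "char_inner G \<xi> \<chi> = (\<Sum>g\<in>carrier G. \<xi> g * cnj (\<chi> g)) / of_nat (card (carrier G))"

definition constituent :: "('g, 'x) monoid_scheme \<Rightarrow> ('g \<Rightarrow> complex) \<Rightarrow> ('g \<Rightarrow> complex) \<Rightarrow> bool" where
  "constituent G \<chi> \<xi> \<longleftrightarrow> irreducible_character G \<chi> \<and> char_inner G \<xi> \<chi> \<noteq> 0"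

definition induced_char ::
  "('g, 'x) monoid_scheme \<Rightarrow> 'g set \<Rightarrow> ('g \<Rightarrow> complex) \<Rightarrow> 'g \<Rightarrow> complex" where
  "induced_char G H \<psi> = (\<lambda>g\<in>carrier G.
     (\<Sum>x\<in>carrier G. let y = inv\<^bsub>G\<^esub> x \<otimes>\<^bsub>G\<^esub> g \<otimes>\<^bsub>G\<^esub> x in if y \<in> H then \<psi> y else 0) / of_nat (card H))"

definition supercharacter_theory ::
  "('g, 'x) monoid_scheme \<Rightarrow> 'g set set \<Rightarrow> ('g \<Rightarrow> complex) set \<Rightarrow> bool" where
  "supercharacter_theory G \<K> \<X> \<longleftrightarrow>
     partition_on (carrier G) \<K> \<and>
     (\<forall>\<xi>\<in>\<X>. is_character G \<xi>) \<and>
     card \<K> = card \<X> \<and>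
     (\<forall>\<chi>. irreducible_character G \<chi> \<longrightarrow> (\<exists>!\<xi>. \<xi> \<in> \<X> \<and> constituent G \<chi> \<xi>)) \<and>
     (\<forall>\<xi>\<in>\<X>. \<forall>K\<in>\<K>. \<forall>x\<in>K. \<forall>y\<in>K. \<xi> x = \<xi> y)"


section \<open>The unipotent groups\<close>

text \<open>The families \<open>Sp\<^sub>2\<^sub>n\<close>, \<open>O\<^sub>2\<^sub>n\<close>, \<open>O\<^sub>2\<^sub>n\<^sub>+\<^sub>1\<close>.\<close>

datatype family = Sp | OEven | OOdd

definition mid :: "family \<Rightarrow> nat" where
  "mid T = (if T = OOdd then 1 else 0)"

definition mdim :: "family \<Rightarrow> nat \<Rightarrow> nat" where
  "mdim T n = 2 * n + mid T"

definition unitri :: "nat \<Rightarrow> 'a::field mat set" where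
  "unitri m = {x \<in> carrier_mat m m. upper_triangular x \<and> (\<forall>i<m. x $$ (i, i) = 1)}"

definition antidiag :: "nat \<Rightarrow> 'a::field mat" where
  "antidiag n = mat n n (\<lambda>(i, j). if i + j = n - 1 then 1 else 0)"

definition w_condition :: "family \<Rightarrow> nat \<Rightarrow> 'a::field mat \<Rightarrow> 'a mat \<Rightarrow> bool" where
  "w_condition T n v w \<longleftrightarrow>
     (case T of
        Sp \<Rightarrow> antidiag n * w\<^sup>T - w * antidiag n = 0\<^sub>m n n
      | OEven \<Rightarrow> antidiag n * w\<^sup>T + w * antidiag n = 0\<^sub>m n n
      | OOdd \<Rightarrow> antidiag n * w\<^sup>T + w * antidiag n = - (v * v\<^sup>T))"

text \<open>The block matrix with rows \<open>(x, xv, xw)\<close>, \<open>(0, I\<^sub>r, -v\<^sup>TJ)\<close>, \<open>(0, 0, Jy\<^sup>TJ)\<close>;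
  below, \<open>y\<close> is the inverse of \<open>x\<close>.\<close>

definition U_block ::
  "family \<Rightarrow> nat \<Rightarrow> 'a::field mat \<Rightarrow> 'a mat \<Rightarrow> 'a mat \<Rightarrow> 'a mat \<Rightarrow> 'a mat" where
  "U_block T n x y v w =
     four_block_mat
       (four_block_mat x (x * v) (0\<^sub>m (mid T) n) (1\<^sub>m (mid T)))
       ((x * w) @\<^sub>r (- (v\<^sup>T * antidiag n)))
       (0\<^sub>m n (n + mid T))
       (antidiag n * y\<^sup>T * antidiag n)"

definition U_set :: "family \<Rightarrow> nat \<Rightarrow> 'a::field mat set" where
  "U_set T n = {U_block T n x y v w | x y v w.
     x \<in> unitri n \<and> y \<in> carrier_mat n n \<and> inverts_mat x y \<and>
     v \<in> carrier_mat n (mid T) \<and> w \<in> carrier_mat n n \<and> w_condition T n v w}"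

definition U_group :: "family \<Rightarrow> nat \<Rightarrow> 'a::field mat monoid" where
  "U_group T n = \<lparr>carrier = U_set T n, monoid.mult = (*), one = 1\<^sub>m (mdim T n)\<rparr>"


section \<open>Roots and basic pairs\<close>

text \<open>Rows and columns are labelled by \<open>1, \<dots>, n, 0, -n, \<dots>, -1\<close> in this order; \<open>idx\<close> gives the
  (zero-based) position of a label. The label \<open>0\<close> is used only for \<open>OOdd\<close>.\<close>

definition idx :: "family \<Rightarrow> nat \<Rightarrow> int \<Rightarrow> nat" where
  "idx T n i = (if 0 < i then nat i - 1 else if i = 0 then n else nat (int (mdim T n) + i))"

abbreviation entry :: "family \<Rightarrow> nat \<Rightarrow> 'a mat \<Rightarrow> int \<Rightarrow> int \<Rightarrow> 'a" where
  "entry T n x i j \<equiv> x $$ (idx T n i, idx T n j)"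

text \<open>\<open>Diff i j\<close>, \<open>Add i j\<close>, \<open>Two i\<close>, \<open>One i\<close> stand for
  \<open>\<epsilon>\<^sub>i - \<epsilon>\<^sub>j\<close>, \<open>\<epsilon>\<^sub>i + \<epsilon>\<^sub>j\<close>, \<open>2\<epsilon>\<^sub>i\<close>, \<open>\<epsilon>\<^sub>i\<close>.\<close>

datatype root = Diff nat nat | Add nat nat | Two nat | One nat

definition roots :: "family \<Rightarrow> nat \<Rightarrow> root set" where
  "roots T n =
     {Diff i j | i j. 1 \<le> i \<and> i < j \<and> j \<le> n} \<union>
     {Add i j | i j. 1 \<le> i \<and> i < j \<and> j \<le> n} \<union>
     (case T of
        Sp \<Rightarrow> {Two i | i. 1 \<le> i \<and> i \<le> n}
      | OEven \<Rightarrow> {}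
      | OOdd \<Rightarrow> {One i | i. 1 \<le> i \<and> i \<le> n})"

fun root_entries :: "root \<Rightarrow> (int \<times> int) set" where
  "root_entries (Diff i j) = {(int i, int j), (- int j, - int i)}"
| "root_entries (Add i j) = {(int i, - int j), (int j, - int i)}"
| "root_entries (Two i) = {(int i, - int i)}"
| "root_entries (One i) = {(int i, 0), (0, - int i)}"

definition positive_entry :: "family \<Rightarrow> nat \<Rightarrow> root \<Rightarrow> int \<times> int" where
  "positive_entry T n \<alpha> = (THE p. p \<in> root_entries \<alpha> \<and>
     (case p of (i, j) \<Rightarrow> 1 \<le> i \<and> i \<le> int n \<and>
        idx T n i < idx T n j \<and> idx T n j \<le> idx T n (- i)))"

definition basic :: "family \<Rightarrow> nat \<Rightarrow> root set \<Rightarrow> bool" where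
  "basic T n D \<longleftrightarrow> D \<subseteq> roots T n \<and>
     (let E = (\<Union>\<alpha>\<in>D. root_entries \<alpha>) in
        (\<forall>i j k. (i, j) \<in> E \<longrightarrow> (i, k) \<in> E \<longrightarrow> j = k) \<and>
        (\<forall>i j k. (i, k) \<in> E \<longrightarrow> (j, k) \<in> E \<longrightarrow> i = j))"

definition basic_pairs :: "family \<Rightarrow> nat \<Rightarrow> (root set \<times> (root \<Rightarrow> 'a::field)) set" where
  "basic_pairs T n = {(D, \<phi>). basic T n D \<and> \<phi> \<in> D \<rightarrow>\<^sub>E (UNIV - {0})}"


section \<open>Superclasses\<close>

definition mat_unit :: "family \<Rightarrow> nat \<Rightarrow> int \<Rightarrow> int \<Rightarrow> 'a::field mat" where
  "mat_unit T n i j = mat (mdim T n) (mdim T n)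
     (\<lambda>(a, b). if a = idx T n i \<and> b = idx T n j then 1 else 0)"

fun root_mat :: "family \<Rightarrow> nat \<Rightarrow> root \<Rightarrow> 'a::field mat" where
  "root_mat T n (Diff i j) = mat_unit T n (int i) (int j) - mat_unit T n (- int j) (- int i)"
| "root_mat T n (Add i j) =
     (if T = Sp then mat_unit T n (int i) (- int j) + mat_unit T n (int j) (- int i)
      else mat_unit T n (int i) (- int j) - mat_unit T n (int j) (- int i))"
| "root_mat T n (Two i) = mat_unit T n (int i) (- int i)"
| "root_mat T n (One i) = mat_unit T n (int i) 0 - mat_unit T n 0 (- int i)"

text \<open>The matrix sum \<open>\<Sum>\<alpha>\<in>D. \<phi> \<alpha> \<cdot>\<^sub>m root_mat T n \<alpha>\<close>, written entrywise because the type of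
  matrices of all sizes has no additive monoid structure.\<close>

definition pair_mat :: "family \<Rightarrow> nat \<Rightarrow> root set \<Rightarrow> (root \<Rightarrow> 'a::field) \<Rightarrow> 'a mat" where
  "pair_mat T n D \<phi> = mat (mdim T n) (mdim T n)
     (\<lambda>(a, b). \<Sum>\<alpha>\<in>D. \<phi> \<alpha> * root_mat T n \<alpha> $$ (a, b))"

definition V_orbit :: "family \<Rightarrow> nat \<Rightarrow> root set \<Rightarrow> (root \<Rightarrow> 'a::field) \<Rightarrow> 'a mat set" where
  "V_orbit T n D \<phi> =
     {x * pair_mat T n D \<phi> * y | x y. x \<in> unitri (mdim T n) \<and> y \<in> unitri (mdim T n)}"

definition superclass :: "family \<Rightarrow> nat \<Rightarrow> root set \<Rightarrow> (root \<Rightarrow> 'a::field) \<Rightarrow> 'a mat set" where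
  "superclass T n D \<phi> = {x \<in> carrier (U_group T n). x - 1\<^sub>m (mdim T n) \<in> V_orbit T n D \<phi>}"

definition superclasses :: "family \<Rightarrow> nat \<Rightarrow> 'a::field mat set set" where
  "superclasses T n = {superclass T n D \<phi> | D \<phi>. (D, \<phi>) \<in> basic_pairs T n}"


section \<open>Supercharacters\<close>

definition nontrivial_additive_character :: "('a::field \<Rightarrow> complex) \<Rightarrow> bool" where
  "nontrivial_additive_character \<theta> \<longleftrightarrow>
     (\<forall>x. \<theta> x \<noteq> 0) \<and> (\<forall>x y. \<theta> (x + y) = \<theta> x * \<theta> y) \<and> (\<exists>x. \<theta> x \<noteq> 1)"

fun root_subgroup :: "family \<Rightarrow> nat \<Rightarrow> root \<Rightarrow> 'a::field mat set" where
  "root_subgroup T n (Diff i j) =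
     {x \<in> carrier (U_group T n). \<forall>k. i < k \<and> k < j \<longrightarrow> entry T n x (int i) (int k) = 0}"
| "root_subgroup T n (Add i j) =
     {x \<in> carrier (U_group T n).
        (\<forall>k. i < k \<and> k \<le> n \<longrightarrow> entry T n x (int i) (int k) = 0) \<and>
        (\<forall>l. j < l \<and> l \<le> n \<longrightarrow> entry T n x (int j) (int l) = 0) \<and>
        (T = OOdd \<longrightarrow> entry T n x (int j) 0 = 0)}"
| "root_subgroup T n (Two i) =
     {x \<in> carrier (U_group T n). \<forall>k. i < k \<and> k \<le> n \<longrightarrow> entry T n x (int i) (int k) = 0}"
| "root_subgroup T n (One i) =
     {x \<in> carrier (U_group T n). \<forall>k. i < k \<and> k \<le> n \<longrightarrow> entry T n x (int i) (int k) = 0}"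

definition root_char ::
  "family \<Rightarrow> nat \<Rightarrow> ('a::field \<Rightarrow> complex) \<Rightarrow> root \<Rightarrow> 'a \<Rightarrow> 'a mat \<Rightarrow> complex" where
  "root_char T n \<theta> \<alpha> r =
     (\<lambda>x\<in>root_subgroup T n \<alpha>. case positive_entry T n \<alpha> of (i, j) \<Rightarrow> \<theta> (r * entry T n x i j))"

definition elementary_char ::
  "family \<Rightarrow> nat \<Rightarrow> ('a::field \<Rightarrow> complex) \<Rightarrow> root \<Rightarrow> 'a \<Rightarrow> 'a mat \<Rightarrow> complex" where
  "elementary_char T n \<theta> \<alpha> r =
     induced_char (U_group T n) (root_subgroup T n \<alpha>) (root_char T n \<theta> \<alpha> r)"

definition supercharacter ::
  "family \<Rightarrow> nat \<Rightarrow> ('a::field \<Rightarrow> complex) \<Rightarrow> root set \<Rightarrow> (root \<Rightarrow> 'a) \<Rightarrow> 'a mat \<Rightarrow> complex" where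
  "supercharacter T n \<theta> D \<phi> =
     (\<lambda>x\<in>carrier (U_group T n). \<Prod>\<alpha>\<in>D. elementary_char T n \<theta> \<alpha> (\<phi> \<alpha>) x)"

definition supercharacters ::
  "family \<Rightarrow> nat \<Rightarrow> ('a::field \<Rightarrow> complex) \<Rightarrow> ('a mat \<Rightarrow> complex) set" where
  "supercharacters T n \<theta> = {supercharacter T n \<theta> D \<phi> | D \<phi>. (D, \<phi>) \<in> basic_pairs T n}"

end

theory Submission
  imports Defs
begin

text \<open>Let \<open>\<Omega>\<close> be the matrix of the form. The Cayley transform identifies \<open>U\<close> with the space of those
  (skew-)symmetric matrices \<open>S\<close> that vanish on and below the antidiagonal; \<open>S\<close> is \<open>X - 1\<close> times
  \<open>\<Omega>\<close>, corrected by a unitriangular factor. Under this identification the superclasses become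
  congruence orbits \<open>{g S g\<^sup>T}\<close> of the full unitriangular group: every orbit contains a monomial matrix
  by Gaussian elimination, and exactly one, because two monomial matrices \<open>P\<close>, \<open>P'\<close> with
  \<open>A P = P' B\<close> for unitriangular \<open>A\<close> and \<open>B\<^sup>T\<close> coincide.

  An elementary character is, up to a scalar, the exponential sum of \<open>\<theta> (c s\<^sup>T S t)\<close> over pairs of vectors
  \<open>s\<close>, \<open>t\<close> with prescribed leading entries, and this is visibly invariant under congruence. Expanding a product of
  two supercharacters and summing over \<open>S\<close>, orthogonality reduces to the same uniqueness of pivots, now for
  \<open>H\<^sup>T P H\<close> truncated to the region above the antidiagonal.

  Finally, pairwise orthogonal characters, as many as there are superclasses and constant on them, span the
  functions constant on superclasses. One of these functions is supported at \<open>1\<close>, so every irreducible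
  character is a constituent of some supercharacter.\<close>

section \<open>Unitary representations and their constituents\<close>

text \<open>The definitions relate two unlike objects: superclasses are cut out by two-sided
  multiplication with \<open>unitri m\<close>, while elementary characters are induced inside the
  smaller group U from subgroups given by vanishing entries. Neither \<open>X - 1\<close> nor its
  product with the form is symmetric, so no congruence action is visible on U itself. Dividing by
  \<open>(1 + X)/2\<close>, possible because 2 is invertible, makes the symmetry exact. The error
  made in returning to \<open>X - 1\<close> is quadratic and vanishes on the pairs of vectors that
  survive in the induced character. Uniqueness of the monomial matrix is proved for independent left
  and right factors; together with existence under congruence, this shows that a two-sided orbit
  meets the symmetric matrices in a single congruence orbit. On the character side nothing is
  decomposed into irreducibles. Explicit unitary matrices turn orthogonality of two characters into
  orthogonality of all their matrix coefficients, and an irreducible representation cannot pair with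
  both families. Representations are indexed by arbitrary finite sets, so that cosets and choice
  functions serve as bases without being numbered.\<close>

definition urep ::
  "('g, 'x) monoid_scheme \<Rightarrow> 'i set \<Rightarrow> ('g \<Rightarrow> 'i \<Rightarrow> 'i \<Rightarrow> complex) \<Rightarrow> bool" where
  "urep G I \<rho> \<longleftrightarrow> finite I \<and> I \<noteq> {} \<and>
     (\<forall>a\<in>I. \<forall>b\<in>I. \<rho> \<one>\<^bsub>G\<^esub> a b = (if a = b then 1 else 0)) \<and>
     (\<forall>g\<in>carrier G. \<forall>h\<in>carrier G. \<forall>a\<in>I. \<forall>c\<in>I.
        \<rho> (g \<otimes>\<^bsub>G\<^esub> h) a c = (\<Sum>b\<in>I. \<rho> g a b * \<rho> h b c)) \<and>
     (\<forall>g\<in>carrier G. \<forall>a\<in>I. \<forall>b\<in>I. \<rho> (inv\<^bsub>G\<^esub> g) a b = cnj (\<rho> g b a))"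

definition utrace :: "'i set \<Rightarrow> ('g \<Rightarrow> 'i \<Rightarrow> 'i \<Rightarrow> complex) \<Rightarrow> 'g \<Rightarrow> complex" where
  "utrace I \<rho> g = (\<Sum>a\<in>I. \<rho> g a a)"

lemma urepD:
  assumes "urep G I \<rho>"
  shows "finite I" "I \<noteq> {}"
    "\<And>a b. a \<in> I \<Longrightarrow> b \<in> I \<Longrightarrow> \<rho> \<one>\<^bsub>G\<^esub> a b = (if a = b then 1 else 0)"
    "\<And>g h a c. g \<in> carrier G \<Longrightarrow> h \<in> carrier G \<Longrightarrow> a \<in> I \<Longrightarrow> c \<in> I \<Longrightarrow>
       \<rho> (g \<otimes>\<^bsub>G\<^esub> h) a c = (\<Sum>b\<in>I. \<rho> g a b * \<rho> h b c)"
    "\<And>g a b. g \<in> carrier G \<Longrightarrow> a \<in> I \<Longrightarrow> b \<in> I \<Longrightarrow> \<rho> (inv\<^bsub>G\<^esub> g) a b = cnj (\<rho> g b a)"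
  using assms unfolding urep_def by auto

lemma urep_is_character:
  assumes "urep G I \<rho>" "group G"
  shows "is_character G (\<lambda>g\<in>carrier G. utrace I \<rho> g)"
proof -
  note u = urepD[OF assms(1)]
  interpret group G by fact
  obtain f where f: "bij_betw f {..<card I} I"
    using u(1) ex_bij_betw_nat_finite[of I] by (auto simp: atLeast0LessThan)
  let ?d = "card I"
  have fI: "f i \<in> I" if "i < ?d" for i using f that by (auto simp: bij_betw_def)
  have finj: "f i = f j \<longleftrightarrow> i = j" if "i < ?d" "j < ?d" for i j
    using f that by (auto simp: bij_betw_def inj_on_def)
  have resum: "(\<Sum>i<?d. h (f i)) = (\<Sum>a\<in>I. h a)" for h :: "_ \<Rightarrow> complex"
    by (rule sum.reindex_bij_betw[OF f])
  define R where "R g = mat ?d ?d (\<lambda>(i, j). \<rho> g (f i) (f j))" for g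
  have "matrix_rep G ?d R"
    unfolding matrix_rep_def
  proof (intro conjI ballI)
    show "0 < ?d" using u(1,2) by (simp add: card_gt_0_iff)
    show "R \<in> carrier G \<rightarrow> carrier_mat ?d ?d" by (auto simp: R_def)
    show "R \<one>\<^bsub>G\<^esub> = 1\<^sub>m ?d" by (rule eq_matI) (auto simp: R_def u(3) fI finj)
    fix g h assume gh: "g \<in> carrier G" "h \<in> carrier G"
    show "R (g \<otimes>\<^bsub>G\<^esub> h) = R g * R h"
    proof (rule eq_matI)
      fix i j assume "i < dim_row (R g * R h)" "j < dim_col (R g * R h)"
      hence ij: "i < ?d" "j < ?d" by (auto simp: R_def)
      have "(R g * R h) $$ (i, j) = (\<Sum>k<?d. \<rho> g (f i) (f k) * \<rho> h (f k) (f j))"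
        using ij by (simp add: R_def scalar_prod_def atLeast0LessThan)
      also have "\<dots> = R (g \<otimes>\<^bsub>G\<^esub> h) $$ (i, j)"
        using ij by (simp add: R_def u(4)[OF gh fI fI] resum[of "\<lambda>b. \<rho> g (f i) b * \<rho> h b (f j)"])
      finally show "R (g \<otimes>\<^bsub>G\<^esub> h) $$ (i, j) = (R g * R h) $$ (i, j)" by simp
    qed (auto simp: R_def)
  qed
  moreover have "(\<lambda>g\<in>carrier G. utrace I \<rho> g) = rep_character G R"
    using resum[of "\<lambda>a. \<rho> x a a" for x]
    by (auto simp: rep_character_def fun_eq_iff utrace_def mat_tr_def R_def)
  ultimately show ?thesis unfolding is_character_def by blast
qed

text \<open>The squared absolute values of these coefficients add up to \<open>|G|\<close> times the sum in \<open>orth\<close>.\<close>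

lemma urep_orthogonal_coefficients:
  assumes G: "group G" "finite (carrier G)"
    and u: "urep G I \<sigma>" and u': "urep G J \<tau>"
    and orth: "(\<Sum>g\<in>carrier G. utrace J \<tau> g * cnj (utrace I \<sigma> g)) = 0"
    and ij: "i \<in> J" "j \<in> J" "k \<in> I" "l \<in> I"
  shows "(\<Sum>g\<in>carrier G. \<tau> g i j * cnj (\<sigma> g k l)) = 0"
proof -
  interpret group G by fact
  note U = urepD[OF u] and U' = urepD[OF u']
  let ?G = "carrier G"
  define c where "c i j k l = (\<Sum>g\<in>?G. \<tau> g i j * cnj (\<sigma> g k l))" for i j k l
  \<comment> \<open>By unitarity \<open>cnj (\<tau> h i j)\<close> is the \<open>(j, i)\<close>
    entry at the inverse of \<open>h\<close>, so the Frobenius product of two matrices of one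
    representation is a character value.\<close>
  have tr: "(\<Sum>i\<in>J. \<Sum>j\<in>J. \<tau> g i j * cnj (\<tau> h i j)) = utrace J \<tau> (g \<otimes>\<^bsub>G\<^esub> inv\<^bsub>G\<^esub> h)"
    if "g \<in> ?G" "h \<in> ?G" for g h
    unfolding utrace_def using that by (intro sum.cong refl) (simp add: U'(4,5))
  have tr': "(\<Sum>i\<in>I. \<Sum>j\<in>I. \<sigma> g i j * cnj (\<sigma> h i j)) = utrace I \<sigma> (g \<otimes>\<^bsub>G\<^esub> inv\<^bsub>G\<^esub> h)"
    if "g \<in> ?G" "h \<in> ?G" for g h
    unfolding utrace_def using that by (intro sum.cong refl) (simp add: U(4,5))
  have "(\<Sum>i\<in>J. \<Sum>j\<in>J. \<Sum>k\<in>I. \<Sum>l\<in>I. c i j k l * cnj (c i j k l)) =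
    (\<Sum>i\<in>J. \<Sum>j\<in>J. \<Sum>k\<in>I. \<Sum>l\<in>I. \<Sum>g\<in>?G. \<Sum>h\<in>?G.
      (\<tau> g i j * cnj (\<tau> h i j)) * cnj (\<sigma> g k l * cnj (\<sigma> h k l)))"
    unfolding c_def cnj_sum sum_product by (intro sum.cong refl) (simp add: algebra_simps)
  also have "\<dots> = (\<Sum>g\<in>?G. \<Sum>h\<in>?G. \<Sum>i\<in>J. \<Sum>j\<in>J. \<Sum>k\<in>I. \<Sum>l\<in>I.
      (\<tau> g i j * cnj (\<tau> h i j)) * cnj (\<sigma> g k l * cnj (\<sigma> h k l)))"
    by (simp only: sum.swap[where A = I and B = ?G] sum.swap[where A = J and B = ?G])
  also have "\<dots> = (\<Sum>g\<in>?G. \<Sum>h\<in>?G. (\<Sum>i\<in>J. \<Sum>j\<in>J. \<tau> g i j * cnj (\<tau> h i j)) *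
      cnj (\<Sum>k\<in>I. \<Sum>l\<in>I. \<sigma> g k l * cnj (\<sigma> h k l)))"
    by (simp only: cnj_sum sum_distrib_left[symmetric] sum_distrib_right[symmetric])
  also have "\<dots> = (\<Sum>g\<in>?G. \<Sum>h\<in>?G. utrace J \<tau> (g \<otimes>\<^bsub>G\<^esub> inv\<^bsub>G\<^esub> h) * cnj (utrace I \<sigma> (g \<otimes>\<^bsub>G\<^esub> inv\<^bsub>G\<^esub> h)))"
    by (intro sum.cong refl) (simp only: tr tr')
  also have "\<dots> = (\<Sum>h\<in>?G. \<Sum>g\<in>?G. utrace J \<tau> (g \<otimes>\<^bsub>G\<^esub> inv\<^bsub>G\<^esub> h) * cnj (utrace I \<sigma> (g \<otimes>\<^bsub>G\<^esub> inv\<^bsub>G\<^esub> h)))"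
    by (rule sum.swap)
  \<comment> \<open>Right translation removes \<open>h\<close> and leaves one copy of the sum in
    \<open>orth\<close> for every group element.\<close>
  also have "\<dots> = (\<Sum>h\<in>?G. \<Sum>g\<in>?G. utrace J \<tau> g * cnj (utrace I \<sigma> g))"
  proof (rule sum.cong[OF refl])
    fix h assume "h \<in> ?G"
    hence "bij_betw (\<lambda>g. g \<otimes>\<^bsub>G\<^esub> inv\<^bsub>G\<^esub> h) ?G ?G"
      by (intro bij_betw_byWitness[where f' = "\<lambda>g. g \<otimes>\<^bsub>G\<^esub> h"]) (auto simp: m_assoc)
    thus "(\<Sum>g\<in>?G. utrace J \<tau> (g \<otimes>\<^bsub>G\<^esub> inv\<^bsub>G\<^esub> h) * cnj (utrace I \<sigma> (g \<otimes>\<^bsub>G\<^esub> inv\<^bsub>G\<^esub> h))) =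
      (\<Sum>g\<in>?G. utrace J \<tau> g * cnj (utrace I \<sigma> g))"
      by (rule sum.reindex_bij_betw)
  qed
  also have "\<dots> = 0" by (simp add: orth)
  finally have "(\<Sum>i\<in>J. \<Sum>j\<in>J. \<Sum>k\<in>I. \<Sum>l\<in>I. (cmod (c i j k l))\<^sup>2) = 0"
    by (simp only: complex_norm_square[symmetric] of_real_sum[symmetric] of_real_eq_0_iff)
  hence "(\<Sum>p\<in>J \<times> J \<times> I \<times> I. (cmod (case p of (i, j, k, l) \<Rightarrow> c i j k l))\<^sup>2) = 0"
    by (simp add: sum.cartesian_product split_def)
  moreover have "finite (J \<times> J \<times> I \<times> I)" using U(1) U'(1) by simp
  ultimately have "\<forall>p\<in>J \<times> J \<times> I \<times> I. (cmod (case p of (i, j, k, l) \<Rightarrow> c i j k l))\<^sup>2 = 0"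
    by (subst (asm) sum_nonneg_eq_0_iff) auto
  thus ?thesis using ij by (force simp: c_def)
qed

section \<open>Orthogonal characters have no common irreducible constituent\<close>

lemma subspace_class_ringI:
  assumes "W \<subseteq> carrier_vec d" "0\<^sub>v d \<in> W"
    "\<And>v w. v \<in> W \<Longrightarrow> w \<in> W \<Longrightarrow> v + w \<in> W" "\<And>c v. v \<in> W \<Longrightarrow> c \<cdot>\<^sub>v v \<in> W"
  shows "subspace class_ring W (module_vec TYPE('b::field) d)"
proof -
  interpret vec_space "TYPE('b)" d .
  show ?thesis unfolding subspace_def submodule_def
    using assms vectorspace_axioms module_axioms by (auto simp: module_vec_simps)
qed

text \<open>The vectors of \<pi> annihilated by all averages of \<pi> against coefficients of \<tau>
  form an invariant subspace \<open>W\<close>. Averaging against a coefficient of \<sigma> produces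
  a nonzero vector, which lies in \<open>W\<close> because coefficients of \<sigma> and \<tau> are
  orthogonal. Irreducibility makes \<open>W\<close> the whole space, so \<tau> cannot pair with
  \<pi>.\<close>

lemma urep_no_common_constituent:
  assumes G: "group G" "finite (carrier G)"
    and u: "urep G I \<sigma>" and u': "urep G J \<tau>"
    and orth: "(\<Sum>g\<in>carrier G. utrace J \<tau> g * cnj (utrace I \<sigma> g)) = 0"
    and irr: "irreducible_rep G d \<pi>"
    and c: "(\<Sum>g\<in>carrier G. utrace I \<sigma> g * cnj (mat_tr (\<pi> g))) \<noteq> 0"
    and c': "(\<Sum>g\<in>carrier G. utrace J \<tau> g * cnj (mat_tr (\<pi> g))) \<noteq> 0"
  shows False
proof -
  interpret group G by fact
  note U = urepD[OF u] and U' = urepD[OF u']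
  let ?G = "carrier G"
  have mr: "matrix_rep G d \<pi>" using irr by (simp add: irreducible_rep_def)
  have pc: "\<pi> g \<in> carrier_mat d d" if "g \<in> ?G" for g using mr that by (auto simp: matrix_rep_def)
  have pd: "dim_row (\<pi> g) = d" "dim_col (\<pi> g) = d" if "g \<in> ?G" for g using pc[OF that] by auto
  have pm: "\<pi> (g \<otimes>\<^bsub>G\<^esub> h) = \<pi> g * \<pi> h" if "g \<in> ?G" "h \<in> ?G" for g h
    using mr that by (auto simp: matrix_rep_def)
  have nz: "\<exists>k\<in>K. \<exists>a<d. (\<Sum>g\<in>?G. cnj (\<kappa> g k k) * \<pi> g $$ (a, a)) \<noteq> 0"
    if "(\<Sum>g\<in>?G. utrace K \<kappa> g * cnj (mat_tr (\<pi> g))) \<noteq> 0" for K :: "'z set" and \<kappa>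
  proof (rule ccontr)
    assume neg: "\<not> ?thesis"
    have "cnj (\<Sum>g\<in>?G. utrace K \<kappa> g * cnj (mat_tr (\<pi> g))) =
      (\<Sum>g\<in>?G. \<Sum>k\<in>K. \<Sum>a<d. cnj (\<kappa> g k k) * \<pi> g $$ (a, a))"
      by (simp add: utrace_def mat_tr_def pd sum_product)
    also have "\<dots> = (\<Sum>k\<in>K. \<Sum>a<d. \<Sum>g\<in>?G. cnj (\<kappa> g k k) * \<pi> g $$ (a, a))"
      by (simp only: sum.swap[where A = ?G])
    also have "\<dots> = 0" using neg
      by (auto intro!: sum.neutral[of K] sum.neutral[of "{..<d}"])
    finally show False using that by (simp only: complex_cnj_zero_iff)
  qed
  obtain k a where ka: "k \<in> I" "a < d" "(\<Sum>g\<in>?G. cnj (\<sigma> g k k) * \<pi> g $$ (a, a)) \<noteq> 0"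
    using nz[OF c] by blast
  obtain i b where ib: "i \<in> J" "b < d" "(\<Sum>g\<in>?G. cnj (\<tau> g i i) * \<pi> g $$ (b, b)) \<noteq> 0"
    using nz[OF c'] by blast
  \<comment> \<open>Coordinate \<open>e\<close> of the vector obtained by averaging
    \<open>\<pi> g *\<^sub>v v\<close> against the conjugate of the coefficient
    \<open>(i, j)\<close> of \<tau>.\<close>
  define F where "F i j v e = (\<Sum>g\<in>?G. cnj (\<tau> g i j) * (\<pi> g *\<^sub>v v) $ e)" for i j v e
  define W where "W = {v \<in> carrier_vec d. \<forall>i\<in>J. \<forall>j\<in>J. \<forall>e<d. F i j v e = 0}"
  have sub: "subspace class_ring W (module_vec TYPE(complex) d)"
  proof (rule subspace_class_ringI)
    show "W \<subseteq> carrier_vec d" by (auto simp: W_def)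
    show "0\<^sub>v d \<in> W" by (auto simp: W_def F_def pd scalar_prod_def)
  next
    fix v w assume "v \<in> W" "w \<in> W"
    hence vw: "v \<in> carrier_vec d" "w \<in> carrier_vec d"
      and z: "\<And>i j e. i \<in> J \<Longrightarrow> j \<in> J \<Longrightarrow> e < d \<Longrightarrow> F i j v e = 0 \<and> F i j w e = 0" by (auto simp: W_def)
    have "F i j (v + w) e = F i j v e + F i j w e" if "e < d" for i j e
      unfolding F_def sum.distrib[symmetric] using that vw
      by (intro sum.cong refl) (simp add: pd mult_add_distrib_mat_vec[OF pc] algebra_simps)
    thus "v + w \<in> W" using vw z by (auto simp: W_def)
  next
    fix x v assume "v \<in> W"
    hence vw: "v \<in> carrier_vec d"
      and z: "\<And>i j e. i \<in> J \<Longrightarrow> j \<in> J \<Longrightarrow> e < d \<Longrightarrow> F i j v e = 0" by (auto simp: W_def)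
    have "F i j (x \<cdot>\<^sub>v v) e = x * F i j v e" if "e < d" for i j e
      unfolding F_def sum_distrib_left using that vw
      by (intro sum.cong refl) (simp add: pd mult_mat_vec[OF pc] algebra_simps)
    thus "x \<cdot>\<^sub>v v \<in> W" using vw z by (auto simp: W_def)
  qed
  have inv: "\<pi> h *\<^sub>v v \<in> W" if h: "h \<in> ?G" and v: "v \<in> W" for h v
  proof -
    have vc: "v \<in> carrier_vec d" using v by (simp add: W_def)
    have "F i j (\<pi> h *\<^sub>v v) e = 0" if ij: "i \<in> J" "j \<in> J" "e < d" for i j e
    proof -
      have "F i j (\<pi> h *\<^sub>v v) e = (\<Sum>g\<in>?G. cnj (\<tau> g i j) * (\<pi> (g \<otimes>\<^bsub>G\<^esub> h) *\<^sub>v v) $ e)"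
        unfolding F_def using h vc by (intro sum.cong refl) (simp add: pm assoc_mult_mat_vec[OF pc pc])
      also have "\<dots> = (\<Sum>g\<in>?G. cnj (\<tau> ((g \<otimes>\<^bsub>G\<^esub> h) \<otimes>\<^bsub>G\<^esub> inv\<^bsub>G\<^esub> h) i j) * (\<pi> (g \<otimes>\<^bsub>G\<^esub> h) *\<^sub>v v) $ e)"
        using h by (intro sum.cong refl) (simp add: m_assoc)
      also have "\<dots> = (\<Sum>g\<in>?G. cnj (\<tau> (g \<otimes>\<^bsub>G\<^esub> inv\<^bsub>G\<^esub> h) i j) * (\<pi> g *\<^sub>v v) $ e)"
      proof -
        have "bij_betw (\<lambda>g. g \<otimes>\<^bsub>G\<^esub> h) ?G ?G" using h
          by (intro bij_betw_byWitness[where f' = "\<lambda>g. g \<otimes>\<^bsub>G\<^esub> inv\<^bsub>G\<^esub> h"]) (auto simp: m_assoc)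
        from sum.reindex_bij_betw[OF this] show ?thesis .
      qed
      also have "\<dots> = (\<Sum>g\<in>?G. \<Sum>b\<in>J. cnj (\<tau> (inv\<^bsub>G\<^esub> h) b j) * (cnj (\<tau> g i b) * (\<pi> g *\<^sub>v v) $ e))"
        using h ij by (intro sum.cong refl) (simp add: U'(4) sum_distrib_left sum_distrib_right algebra_simps)
      also have "\<dots> = (\<Sum>b\<in>J. cnj (\<tau> (inv\<^bsub>G\<^esub> h) b j) * F i b v e)"
        unfolding F_def by (subst sum.swap) (simp add: sum_distrib_left)
      also have "\<dots> = 0" using v ij by (intro sum.neutral ballI) (simp add: W_def)
      finally show ?thesis .
    qed
    moreover have "\<pi> h *\<^sub>v v \<in> carrier_vec d" using pc[OF h] vc by auto
    ultimately show ?thesis by (simp add: W_def)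
  qed
  \<comment> \<open>Column \<open>a\<close> of the average of \<pi> against the coefficient
    \<open>(k, k)\<close> of \<sigma>; its entry \<open>a\<close> is the nonzero number found in
    \<open>ka\<close>.\<close>
  define w where "w = vec d (\<lambda>e. \<Sum>g\<in>?G. cnj (\<sigma> g k k) * \<pi> g $$ (e, a))"
  have wW: "w \<in> W"
  proof -
    have "F i j w e = 0" if ij: "i \<in> J" "j \<in> J" "e < d" for i j e
    proof -
      have "F i j w e = (\<Sum>g\<in>?G. cnj (\<tau> g i j) * (\<Sum>h\<in>?G. cnj (\<sigma> h k k) * \<pi> (g \<otimes>\<^bsub>G\<^esub> h) $$ (e, a)))"
        unfolding F_def
      proof (rule sum.cong[OF refl], rule arg_cong2[where f = "(*)", OF refl])
        fix g assume g: "g \<in> ?G"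
        have "(\<pi> g *\<^sub>v w) $ e = (\<Sum>c<d. \<pi> g $$ (e, c) * (\<Sum>h\<in>?G. cnj (\<sigma> h k k) * \<pi> h $$ (c, a)))"
          using ij g by (simp add: w_def scalar_prod_def pd atLeast0LessThan)
        also have "\<dots> = (\<Sum>h\<in>?G. cnj (\<sigma> h k k) * (\<Sum>c<d. \<pi> g $$ (e, c) * \<pi> h $$ (c, a)))"
          unfolding sum_distrib_left by (subst sum.swap) (simp add: algebra_simps)
        also have "\<dots> = (\<Sum>h\<in>?G. cnj (\<sigma> h k k) * \<pi> (g \<otimes>\<^bsub>G\<^esub> h) $$ (e, a))"
          using ij g ka by (intro sum.cong refl) (simp add: pm scalar_prod_def pd atLeast0LessThan)
        finally show "(\<pi> g *\<^sub>v w) $ e = (\<Sum>h\<in>?G. cnj (\<sigma> h k k) * \<pi> (g \<otimes>\<^bsub>G\<^esub> h) $$ (e, a))" .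
      qed
      also have "\<dots> = (\<Sum>g\<in>?G. cnj (\<tau> g i j) * (\<Sum>h\<in>?G. cnj (\<sigma> (inv\<^bsub>G\<^esub> g \<otimes>\<^bsub>G\<^esub> h) k k) * \<pi> h $$ (e, a)))"
      proof (rule sum.cong[OF refl], rule arg_cong2[where f = "(*)", OF refl])
        fix g assume g: "g \<in> ?G"
        have "bij_betw (\<lambda>h. inv\<^bsub>G\<^esub> g \<otimes>\<^bsub>G\<^esub> h) ?G ?G" using g
          by (intro bij_betw_byWitness[where f' = "\<lambda>h. g \<otimes>\<^bsub>G\<^esub> h"]) (auto simp: m_assoc[symmetric])
        from sum.reindex_bij_betw[OF this, of "\<lambda>h. cnj (\<sigma> h k k) * \<pi> (g \<otimes>\<^bsub>G\<^esub> h) $$ (e, a)"]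
        show "(\<Sum>h\<in>?G. cnj (\<sigma> h k k) * \<pi> (g \<otimes>\<^bsub>G\<^esub> h) $$ (e, a)) =
          (\<Sum>h\<in>?G. cnj (\<sigma> (inv\<^bsub>G\<^esub> g \<otimes>\<^bsub>G\<^esub> h) k k) * \<pi> h $$ (e, a))"
          using g by (simp add: m_assoc[symmetric])
      qed
      \<comment> \<open>Multiplicativity and unitarity split the coefficient of \<sigma> at a
        quotient into a factor depending on \<open>g\<close> and one depending on \<open>h\<close>;
        the sum over \<open>g\<close> is then an inner product of a coefficient of \<tau> with one
        of \<sigma>.\<close>
      also have "\<dots> = (\<Sum>g\<in>?G. \<Sum>h\<in>?G. \<Sum>l\<in>I. (cnj (\<sigma> h l k) * \<pi> h $$ (e, a)) * (cnj (\<tau> g i j) * \<sigma> g l k))"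
        using ka by (intro sum.cong refl)
          (simp add: U(4,5) sum_distrib_left sum_distrib_right algebra_simps)
      also have "\<dots> = (\<Sum>h\<in>?G. \<Sum>l\<in>I. (cnj (\<sigma> h l k) * \<pi> h $$ (e, a)) * (\<Sum>g\<in>?G. cnj (\<tau> g i j) * \<sigma> g l k))"
        unfolding sum_distrib_left
        by (rule trans[OF sum.swap], rule sum.cong[OF refl], rule sum.swap)
      also have "\<dots> = 0"
      proof (intro sum.neutral ballI)
        fix h l assume "l \<in> I"
        hence "(\<Sum>g\<in>?G. \<tau> g i j * cnj (\<sigma> g l k)) = 0"
          using urep_orthogonal_coefficients[OF G u u' orth ij(1,2) _ ka(1)] by blast
        from arg_cong[OF this, of cnj]
        show "(cnj (\<sigma> h l k) * \<pi> h $$ (e, a)) * (\<Sum>g\<in>?G. cnj (\<tau> g i j) * \<sigma> g l k) = 0" by simp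
      qed
      finally show ?thesis .
    qed
    thus ?thesis by (simp add: W_def w_def)
  qed
  have "w $ a \<noteq> 0" using ka by (simp add: w_def)
  hence "w \<noteq> 0\<^sub>v d" using ka(2) by auto
  hence "W \<noteq> {0\<^sub>v d}" using wW by blast
  hence "W = carrier_vec d" using irr sub inv unfolding irreducible_rep_def by blast
  hence "unit_vec d b \<in> W" by simp
  hence "F i i (unit_vec d b) b = 0" using ib(1,2) by (auto simp only: W_def)
  moreover have "F i i (unit_vec d b) b = (\<Sum>g\<in>?G. cnj (\<tau> g i i) * \<pi> g $$ (b, b))"
    unfolding F_def using ib by (intro sum.cong refl) (simp add: pd)
  ultimately show False using ib by simp
qed

text \<open>This is the tensor product over \<open>D\<close>: choice functions form its basis, and
  the product of sums expands over them. For empty \<open>D\<close> there is one such function,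
  which gives the trivial representation.\<close>

lemma urep_PiE:
  assumes D: "finite D" and u: "\<And>\<alpha>. \<alpha> \<in> D \<Longrightarrow> urep G (I \<alpha>) (\<rho> \<alpha>)"
  shows "urep G (PiE D I) (\<lambda>g f f'. \<Prod>\<alpha>\<in>D. \<rho> \<alpha> g (f \<alpha>) (f' \<alpha>))"
  unfolding urep_def
proof (intro conjI ballI)
  have fin: "\<And>\<alpha>. \<alpha> \<in> D \<Longrightarrow> finite (I \<alpha>)" using urepD(1)[OF u] by blast
  show "finite (PiE D I)" using D fin by (intro finite_PiE)
  show "PiE D I \<noteq> {}" using urepD(2)[OF u] by (auto simp: PiE_eq_empty_iff)
next
  fix f f' assume f: "f \<in> PiE D I" "f' \<in> PiE D I"
  have "(\<Prod>\<alpha>\<in>D. \<rho> \<alpha> \<one>\<^bsub>G\<^esub> (f \<alpha>) (f' \<alpha>)) = (\<Prod>\<alpha>\<in>D. if f \<alpha> = f' \<alpha> then 1 else 0)"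
    using f by (intro prod.cong refl) (auto simp: urepD(3)[OF u] PiE_mem)
  also have "\<dots> = (if \<forall>\<alpha>\<in>D. f \<alpha> = f' \<alpha> then 1 else 0)" using D by (auto simp: prod_zero_iff)
  also have "(\<forall>\<alpha>\<in>D. f \<alpha> = f' \<alpha>) \<longleftrightarrow> f = f'" using f by (auto intro: PiE_ext)
  finally show "(\<Prod>\<alpha>\<in>D. \<rho> \<alpha> \<one>\<^bsub>G\<^esub> (f \<alpha>) (f' \<alpha>)) = (if f = f' then 1 else 0)" .
next
  have fin: "\<And>\<alpha>. \<alpha> \<in> D \<Longrightarrow> finite (I \<alpha>)" using urepD(1)[OF u] by blast
  fix g h f f' assume gh: "g \<in> carrier G" "h \<in> carrier G" and f: "f \<in> PiE D I" "f' \<in> PiE D I"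
  have "(\<Prod>\<alpha>\<in>D. \<rho> \<alpha> (g \<otimes>\<^bsub>G\<^esub> h) (f \<alpha>) (f' \<alpha>)) =
    (\<Prod>\<alpha>\<in>D. \<Sum>b\<in>I \<alpha>. \<rho> \<alpha> g (f \<alpha>) b * \<rho> \<alpha> h b (f' \<alpha>))"
    using f gh by (intro prod.cong refl) (auto simp: urepD(4)[OF u] PiE_mem)
  also have "\<dots> = (\<Sum>b\<in>PiE D I. \<Prod>\<alpha>\<in>D. \<rho> \<alpha> g (f \<alpha>) (b \<alpha>) * \<rho> \<alpha> h (b \<alpha>) (f' \<alpha>))"
    using D fin by (rule prod_sum_PiE)
  finally show "(\<Prod>\<alpha>\<in>D. \<rho> \<alpha> (g \<otimes>\<^bsub>G\<^esub> h) (f \<alpha>) (f' \<alpha>)) =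
    (\<Sum>b\<in>PiE D I. (\<Prod>\<alpha>\<in>D. \<rho> \<alpha> g (f \<alpha>) (b \<alpha>)) * (\<Prod>\<alpha>\<in>D. \<rho> \<alpha> h (b \<alpha>) (f' \<alpha>)))"
    by (simp add: prod.distrib)
next
  fix g f f' assume "g \<in> carrier G" "f \<in> PiE D I" "f' \<in> PiE D I"
  thus "(\<Prod>\<alpha>\<in>D. \<rho> \<alpha> (inv\<^bsub>G\<^esub> g) (f \<alpha>) (f' \<alpha>)) = cnj (\<Prod>\<alpha>\<in>D. \<rho> \<alpha> g (f' \<alpha>) (f \<alpha>))"
    unfolding cnj_prod by (intro prod.cong refl) (auto simp: urepD(5)[OF u] PiE_mem)
qed

lemma utrace_PiE:
  assumes "finite D" "\<And>\<alpha>. \<alpha> \<in> D \<Longrightarrow> finite (I \<alpha>)"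
  shows "utrace (PiE D I) (\<lambda>g f f'. \<Prod>\<alpha>\<in>D. \<rho> \<alpha> g (f \<alpha>) (f' \<alpha>)) g = (\<Prod>\<alpha>\<in>D. utrace (I \<alpha>) (\<rho> \<alpha>) g)"
  unfolding utrace_def using prod_sum_PiE[OF assms, where f = "\<lambda>\<alpha> b. \<rho> \<alpha> g b b"] by simp

text \<open>The induced representation is written in a basis of coset representatives: entry
  \<open>(a, b)\<close> at \<open>g\<close> is \<psi> extended by zero, evaluated at the inverse of
  \<open>a\<close> times \<open>g\<close> times \<open>b\<close>. These matrices are monomial, so in
  a product of two of them a single middle index survives.\<close>

lemma induced_char_urep:
  fixes G :: "('g, 'x) monoid_scheme" (structure)
  assumes G: "group G" "finite (carrier G)" and H: "subgroup H G"
    and hom: "\<And>x y. x \<in> H \<Longrightarrow> y \<in> H \<Longrightarrow> \<psi> (x \<otimes>\<^bsub>G\<^esub> y) = \<psi> x * \<psi> y"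
    and one: "\<psi> \<one>\<^bsub>G\<^esub> = 1"
    and unitary: "\<And>x. x \<in> H \<Longrightarrow> \<psi> (inv\<^bsub>G\<^esub> x) = cnj (\<psi> x)"
  shows "\<exists>(I :: 'g set) \<rho>. urep G I \<rho> \<and>
    (\<forall>g\<in>carrier G. utrace I \<rho> g = induced_char G H \<psi> g)"
proof -
  interpret group G by fact
  interpret H: subgroup H G by fact
  let ?G = "carrier G"
  have can: "b \<otimes> (inv b \<otimes> c) = c" if "b \<in> ?G" "c \<in> ?G" for b c
    using that by (simp add: m_assoc[symmetric])
  have can': "inv b \<otimes> (b \<otimes> c) = c" if "b \<in> ?G" "c \<in> ?G" for b c
    using that by (simp add: m_assoc[symmetric])
  have HG: "\<And>x. x \<in> H \<Longrightarrow> x \<in> ?G" by (rule H.mem_carrier)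
  \<comment> \<open>A choice of representative for the left coset of \<open>g\<close>;
    \<open>req\<close> shows that it depends only on the coset.\<close>
  define r where "r g = (SOME x. x \<in> ?G \<and> inv g \<otimes> x \<in> H)" for g
  have r: "r g \<in> ?G" "inv g \<otimes> r g \<in> H" if "g \<in> ?G" for g
  proof -
    have "g \<in> ?G \<and> inv g \<otimes> g \<in> H" using that by simp
    from someI[of "\<lambda>x. x \<in> ?G \<and> inv g \<otimes> x \<in> H", OF this] show "r g \<in> ?G" "inv g \<otimes> r g \<in> H"
      unfolding r_def by auto
  qed
  have tr: "inv a \<otimes> c \<in> H" if "inv a \<otimes> b \<in> H" "inv b \<otimes> c \<in> H" "a \<in> ?G" "b \<in> ?G" "c \<in> ?G" for a b c
    using H.m_closed[OF that(1,2)] that(3-5) by (simp add: m_assoc can)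
  have sy: "inv b \<otimes> a \<in> H" if "inv a \<otimes> b \<in> H" "a \<in> ?G" "b \<in> ?G" for a b
    using H.m_inv_closed[OF that(1)] that(2,3) by (simp add: inv_mult_group)
  have req: "r a = r b" if "inv a \<otimes> b \<in> H" "a \<in> ?G" "b \<in> ?G" for a b
  proof -
    have "(inv a \<otimes> x \<in> H) = (inv b \<otimes> x \<in> H)" if "x \<in> ?G" for x
      using tr[of a b x] tr[of b a x] sy[of a b] \<open>inv a \<otimes> b \<in> H\<close> \<open>a \<in> ?G\<close> \<open>b \<in> ?G\<close> that by blast
    thus ?thesis unfolding r_def by (intro arg_cong[where f = Eps] ext) auto
  qed
  define R where "R = r ` ?G"
  have RG: "\<And>a. a \<in> R \<Longrightarrow> a \<in> ?G" using r by (auto simp: R_def)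
  have finR: "finite R" using G(2) by (simp add: R_def)
  have rR: "r g \<in> R" if "g \<in> ?G" for g using that by (simp add: R_def)
  have rr: "r a = a" if "a \<in> R" for a using that req[OF r(2) _ r(1), symmetric] r(1) by (auto simp: R_def)
  have Req: "inv a \<otimes> b \<in> H \<longleftrightarrow> a = b" if "a \<in> R" "b \<in> R" for a b
    using req[of a b] rr[OF that(1)] rr[OF that(2)] RG[OF that(1)] RG[OF that(2)] by auto
  define \<psi>0 where "\<psi>0 x = (if x \<in> H then \<psi> x else 0)" for x
  define \<rho> where "\<rho> g a b = \<psi>0 (inv a \<otimes> g \<otimes> b)" for g a b
  have "urep G R \<rho>" unfolding urep_def
  proof (intro conjI ballI)
    show "finite R" by fact
    show "R \<noteq> {}" using rR[of \<one>] by auto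
  next
    fix a b assume ab: "a \<in> R" "b \<in> R"
    thus "\<rho> \<one> a b = (if a = b then 1 else 0)"
      using Req[OF ab] RG[OF ab(1)] RG[OF ab(2)] by (auto simp: \<rho>_def \<psi>0_def one)
  next
    fix g h a c assume gh: "g \<in> ?G" "h \<in> ?G" and ac: "a \<in> R" "c \<in> R"
    note ac' = RG[OF ac(1)] RG[OF ac(2)]
    \<comment> \<open>The coset of \<open>h \<otimes> c\<close> is the only middle index for which
      the second factor is nonzero.\<close>
    define b where "b = r (h \<otimes> c)"
    have bR: "b \<in> R" and bG: "b \<in> ?G" using rR[of "h \<otimes> c"] r(1)[of "h \<otimes> c"] gh ac' by (auto simp: b_def)
    have bH: "inv b \<otimes> h \<otimes> c \<in> H"
      using sy[of "h \<otimes> c" b] r(2)[of "h \<otimes> c"] gh ac' bG by (simp add: b_def m_assoc)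
    have zero: "\<rho> h b' c = 0" if "b' \<in> R - {b}" for b'
    proof -
      have "inv b' \<otimes> h \<otimes> c \<notin> H"
      proof
        assume "inv b' \<otimes> h \<otimes> c \<in> H"
        hence "r b' = r (h \<otimes> c)" using req[of b' "h \<otimes> c"] that RG gh ac' by (simp add: m_assoc)
        thus False using that rr by (auto simp: b_def)
      qed
      thus ?thesis by (simp add: \<rho>_def \<psi>0_def)
    qed
    have "(\<Sum>b'\<in>R. \<rho> g a b' * \<rho> h b' c) = \<rho> g a b * \<rho> h b c"
      using sum.remove[OF finR bR, of "\<lambda>b'. \<rho> g a b' * \<rho> h b' c"] zero by simp
    also have "\<dots> = \<rho> (g \<otimes> h) a c"
    proof -
      have e: "inv a \<otimes> (g \<otimes> h) \<otimes> c = (inv a \<otimes> g \<otimes> b) \<otimes> (inv b \<otimes> h \<otimes> c)"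
        using gh ac' bG by (simp add: m_assoc can)
      have e': "inv a \<otimes> g \<otimes> b = (inv a \<otimes> (g \<otimes> h) \<otimes> c) \<otimes> inv (inv b \<otimes> h \<otimes> c)"
        using gh ac' bG unfolding e by (simp add: m_assoc)
      have "inv a \<otimes> g \<otimes> b \<in> H \<longleftrightarrow> inv a \<otimes> (g \<otimes> h) \<otimes> c \<in> H"
      proof
        assume "inv a \<otimes> g \<otimes> b \<in> H" thus "inv a \<otimes> (g \<otimes> h) \<otimes> c \<in> H" unfolding e using bH by simp
      next
        assume "inv a \<otimes> (g \<otimes> h) \<otimes> c \<in> H"
        thus "inv a \<otimes> g \<otimes> b \<in> H" by (subst e') (use bH in simp)
      qed
      thus ?thesis using bH hom unfolding \<rho>_def \<psi>0_def e by auto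
    qed
    finally show "\<rho> (g \<otimes> h) a c = (\<Sum>b'\<in>R. \<rho> g a b' * \<rho> h b' c)" by simp
  next
    fix g a b assume g: "g \<in> ?G" and ab: "a \<in> R" "b \<in> R"
    note ab' = RG[OF ab(1)] RG[OF ab(2)]
    have e: "inv (inv b \<otimes> g \<otimes> a) = inv a \<otimes> inv g \<otimes> b"
      using g ab' by (simp add: inv_mult_group m_assoc)
    have "inv b \<otimes> g \<otimes> a \<in> H \<longleftrightarrow> inv a \<otimes> inv g \<otimes> b \<in> H"
    proof
      assume "inv b \<otimes> g \<otimes> a \<in> H"
      from H.m_inv_closed[OF this] show "inv a \<otimes> inv g \<otimes> b \<in> H" unfolding e .
    next
      assume "inv a \<otimes> inv g \<otimes> b \<in> H"
      hence "inv (inv (inv b \<otimes> g \<otimes> a)) \<in> H" unfolding e by (rule H.m_inv_closed)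
      thus "inv b \<otimes> g \<otimes> a \<in> H" using g ab' by simp
    qed
    thus "\<rho> (inv g) a b = cnj (\<rho> g b a)"
      using unitary[of "inv b \<otimes> g \<otimes> a"] by (auto simp: \<rho>_def \<psi>0_def e)
  qed
  moreover have "utrace R \<rho> g = induced_char G H \<psi> g" if g: "g \<in> ?G" for g
  proof -
    \<comment> \<open>A linear character is invariant under conjugation by its own subgroup, so the
      summand depends only on the coset of the conjugating element.\<close>
    have cj: "\<psi>0 (inv (a \<otimes> h) \<otimes> g \<otimes> (a \<otimes> h)) = \<psi>0 (inv a \<otimes> g \<otimes> a)" if a: "a \<in> ?G" and h: "h \<in> H" for a h
    proof -
      have hG: "h \<in> ?G" using h HG by simp
      define y where "y = inv a \<otimes> g \<otimes> a"
      have yG: "y \<in> ?G" using a g by (simp add: y_def)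
      have e: "inv (a \<otimes> h) \<otimes> g \<otimes> (a \<otimes> h) = inv h \<otimes> y \<otimes> h"
        using a hG g by (simp add: y_def inv_mult_group m_assoc)
      have e': "y = h \<otimes> (inv h \<otimes> y \<otimes> h) \<otimes> inv h" using hG yG by (simp add: m_assoc can)
      have mem: "inv h \<otimes> y \<otimes> h \<in> H \<longleftrightarrow> y \<in> H"
      proof
        assume "inv h \<otimes> y \<otimes> h \<in> H" thus "y \<in> H" by (subst e') (use h in simp)
      qed (use h in simp)
      have "\<psi> h * \<psi> (inv h) = 1" using hom[of h "inv h"] h hG one by simp
      hence "\<psi> (inv h \<otimes> y \<otimes> h) = \<psi> y" if "y \<in> H"
        using hom[of "inv h \<otimes> y" h] hom[of "inv h" y] h that by (simp add: mult.commute[of _ "\<psi> h"] mult.assoc[symmetric])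
      thus ?thesis unfolding e y_def[symmetric] using mem by (auto simp: \<psi>0_def)
    qed
    \<comment> \<open>Writing the group as representatives times \<open>H\<close> turns the sum over
      the group into \<open>card H\<close> copies of the trace, which cancels the denominator of
      \<open>induced_char\<close>.\<close>
    have bij: "bij_betw (\<lambda>(a, h). a \<otimes> h) (R \<times> H) ?G"
    proof (rule bij_betw_byWitness[where f' = "\<lambda>x. (r x, inv (r x) \<otimes> x)"])
      show "\<forall>p\<in>R \<times> H. (r (case p of (a, h) \<Rightarrow> a \<otimes> h), inv (r (case p of (a, h) \<Rightarrow> a \<otimes> h)) \<otimes> (case p of (a, h) \<Rightarrow> a \<otimes> h)) = p"
      proof (clarify)
        fix a h assume a: "a \<in> R" and h: "h \<in> H"
        have "r a = r (a \<otimes> h)" using can'[OF RG[OF a] HG[OF h]] h RG[OF a] HG[OF h] by (intro req) auto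
        hence "r (a \<otimes> h) = a" using rr[OF a] by simp
        thus "r (a \<otimes> h) = a \<and> inv r (a \<otimes> h) \<otimes> (a \<otimes> h) = h" using can'[OF RG[OF a] HG[OF h]] by simp
      qed
      show "\<forall>x\<in>?G. (case (r x, inv (r x) \<otimes> x) of (a, h) \<Rightarrow> a \<otimes> h) = x"
        using can[OF r(1)] by simp
      show "(\<lambda>(a, h). a \<otimes> h) ` (R \<times> H) \<subseteq> ?G" using RG HG by auto
      show "(\<lambda>x. (r x, inv (r x) \<otimes> x)) ` ?G \<subseteq> R \<times> H"
        using rR sy[OF r(2) _ r(1)] by blast
    qed
    have finH: "finite H" by (rule finite_subset[OF H.subset G(2)])
    have cH: "card H > 0" using finH H.one_closed by (simp only: card_gt_0_iff) blast
    have "(\<Sum>x\<in>?G. let y = inv x \<otimes> g \<otimes> x in if y \<in> H then \<psi> y else 0) = (\<Sum>x\<in>?G. \<psi>0 (inv x \<otimes> g \<otimes> x))"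
      by (simp add: \<psi>0_def Let_def)
    also have "\<dots> = (\<Sum>(a, h)\<in>R \<times> H. \<psi>0 (inv (a \<otimes> h) \<otimes> g \<otimes> (a \<otimes> h)))"
      using sum.reindex_bij_betw[OF bij, of "\<lambda>x. \<psi>0 (inv x \<otimes> g \<otimes> x)"] by (simp add: split_def)
    also have "\<dots> = (\<Sum>(a, h)\<in>R \<times> H. \<psi>0 (inv a \<otimes> g \<otimes> a))"
      by (intro sum.cong refl) (auto simp: cj RG)
    also have "\<dots> = of_nat (card H) * utrace R \<rho> g"
      unfolding sum.cartesian_product[symmetric] by (simp add: utrace_def \<rho>_def sum_distrib_left)
    finally show ?thesis using g cH by (simp add: induced_char_def)
  qed
  ultimately show ?thesis by blast
qed

text \<open>A common index set \<open>P\<close> makes the table of values on classes square.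
  Orthogonality of the rows provides a one-sided inverse, hence a two-sided one, and this yields
  orthogonality of the columns. The column of the identity class expresses the indicator of the
  identity through the \<xi>, and pairing that expression with an irreducible character gives its
  degree, which is not zero.\<close>

lemma supercharacter_theoryI:
  fixes G :: "('g, 'x) monoid_scheme" (structure) and \<xi> :: "'p \<Rightarrow> 'g \<Rightarrow> complex" and \<kappa> :: "'p \<Rightarrow> 'g set"
  assumes G: "group G" "finite (carrier G)" and P: "finite P"
    and rep: "\<And>p. p \<in> P \<Longrightarrow> \<exists>(I :: 'i set) \<rho>. urep G I \<rho> \<and> \<xi> p = (\<lambda>g\<in>carrier G. utrace I \<rho> g)"
    and orth: "\<And>p q. p \<in> P \<Longrightarrow> q \<in> P \<Longrightarrow> p \<noteq> q \<Longrightarrow> (\<Sum>g\<in>carrier G. \<xi> p g * cnj (\<xi> q g)) = 0"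
    and ne: "\<And>p. p \<in> P \<Longrightarrow> \<kappa> p \<noteq> {}"
    and disj: "\<And>p q. p \<in> P \<Longrightarrow> q \<in> P \<Longrightarrow> p \<noteq> q \<Longrightarrow> \<kappa> p \<inter> \<kappa> q = {}"
    and cover: "(\<Union>p\<in>P. \<kappa> p) = carrier G"
    and p0: "p0 \<in> P" "\<kappa> p0 = {\<one>\<^bsub>G\<^esub>}"
    and const: "\<And>p q x y. p \<in> P \<Longrightarrow> q \<in> P \<Longrightarrow> x \<in> \<kappa> q \<Longrightarrow> y \<in> \<kappa> q \<Longrightarrow> \<xi> p x = \<xi> p y"
  shows "supercharacter_theory G (\<kappa> ` P) (\<xi> ` P)"
proof -
  interpret group G by fact
  let ?G = "carrier G"
  have x1: "\<xi> p \<one> \<noteq> 0" if p: "p \<in> P" for p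
  proof -
    obtain I :: "'i set" and \<rho> where u: "urep G I \<rho>" "\<xi> p = (\<lambda>g\<in>?G. utrace I \<rho> g)" using rep[OF p] by blast
    have "\<xi> p \<one> = of_nat (card I)" by (simp add: u(2) utrace_def urepD(3)[OF u(1)])
    thus ?thesis using urepD(1,2)[OF u(1)] by simp
  qed
  define nn where "nn p = (\<Sum>g\<in>?G. \<xi> p g * cnj (\<xi> p g))" for p
  have nn: "nn p \<noteq> 0" if "p \<in> P" for p
  proof -
    have "nn p = of_real (\<Sum>g\<in>?G. (cmod (\<xi> p g))\<^sup>2)"
      unfolding nn_def of_real_sum complex_norm_square ..
    moreover have "(\<Sum>g\<in>?G. (cmod (\<xi> p g))\<^sup>2) > 0"
      using G(2) x1[OF that] by (intro sum_pos2[of _ \<one>]) auto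
    ultimately show ?thesis by (simp only: of_real_eq_0_iff)
  qed
  have inj\<xi>: "inj_on \<xi> P"
  proof (rule inj_onI, rule ccontr)
    fix p q assume "p \<in> P" "q \<in> P" "\<xi> p = \<xi> q" "p \<noteq> q"
    thus False using orth[of p q] nn[of p] by (simp add: nn_def)
  qed
  have inj\<kappa>: "inj_on \<kappa> P"
  proof (rule inj_onI, rule ccontr)
    fix p q assume "p \<in> P" "q \<in> P" "\<kappa> p = \<kappa> q" "p \<noteq> q"
    thus False using disj[of p q] ne[of p] by simp
  qed
  have \<kappa>G: "\<kappa> p \<subseteq> ?G" if "p \<in> P" for p using cover that by blast
  have fin\<kappa>: "finite (\<kappa> p)" if "p \<in> P" for p by (rule finite_subset[OF \<kappa>G[OF that] G(2)])
  define t where "t p = (SOME x. x \<in> \<kappa> p)" for p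
  have t: "t p \<in> \<kappa> p" if "p \<in> P" for p using ne[OF that] some_in_eq unfolding t_def by blast
  have sumG: "(\<Sum>g\<in>?G. \<xi> p g * cnj (\<xi> q g)) = (\<Sum>k\<in>P. of_nat (card (\<kappa> k)) * (\<xi> p (t k) * cnj (\<xi> q (t k))))"
    if pq: "p \<in> P" "q \<in> P" for p q
  proof -
    have "(\<Sum>g\<in>?G. \<xi> p g * cnj (\<xi> q g)) = (\<Sum>k\<in>P. \<Sum>g\<in>\<kappa> k. \<xi> p g * cnj (\<xi> q g))"
      unfolding cover[symmetric] using P fin\<kappa> disj by (intro sum.UNION_disjoint) auto
    also have "\<dots> = (\<Sum>k\<in>P. \<Sum>g\<in>\<kappa> k. \<xi> p (t k) * cnj (\<xi> q (t k)))"
    proof (intro sum.cong refl)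
      fix k g assume "k \<in> P" "g \<in> \<kappa> k"
      thus "\<xi> p g * cnj (\<xi> q g) = \<xi> p (t k) * cnj (\<xi> q (t k))"
        using const[OF pq(1), of k g "t k"] const[OF pq(2), of k g "t k"] t by simp
    qed
    finally show ?thesis by simp
  qed
  let ?N = "card P"
  obtain f where f: "bij_betw f {..<?N} P" using ex_bij_betw_nat_finite[OF P] by (auto simp: atLeast0LessThan)
  have fP: "f i \<in> P" if "i < ?N" for i using f that by (auto simp: bij_betw_def)
  have finj: "f i = f j \<longleftrightarrow> i = j" if "i < ?N" "j < ?N" for i j
    using f that by (auto simp: bij_betw_def inj_on_def)
  \<comment> \<open>\<open>A\<close> is the table at chosen class representatives; \<open>B\<close>
    is its conjugate transpose, weighted by the class sizes and divided by the square norms of the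
    rows.\<close>
  define A where "A = mat ?N ?N (\<lambda>(i, j). \<xi> (f i) (t (f j)))"
  define B where "B = mat ?N ?N (\<lambda>(j, i). of_nat (card (\<kappa> (f j))) * cnj (\<xi> (f i) (t (f j))) / nn (f i))"
  have Ac: "A \<in> carrier_mat ?N ?N" and Bc: "B \<in> carrier_mat ?N ?N" by (auto simp: A_def B_def)
  have AB: "A * B = 1\<^sub>m ?N"
  proof (rule eq_matI)
    fix i j assume "i < dim_row (1\<^sub>m ?N :: complex mat)" "j < dim_col (1\<^sub>m ?N :: complex mat)"
    hence ij: "i < ?N" "j < ?N" by auto
    have "(A * B) $$ (i, j) = (\<Sum>k<?N. of_nat (card (\<kappa> (f k))) * (\<xi> (f i) (t (f k)) * cnj (\<xi> (f j) (t (f k))))) / nn (f j)"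
      using ij by (simp add: A_def B_def scalar_prod_def atLeast0LessThan sum_divide_distrib algebra_simps)
    also have "\<dots> = (\<Sum>g\<in>?G. \<xi> (f i) g * cnj (\<xi> (f j) g)) / nn (f j)"
      using sum.reindex_bij_betw[OF f, of "\<lambda>k. of_nat (card (\<kappa> k)) * (\<xi> (f i) (t k) * cnj (\<xi> (f j) (t k)))"]
      by (simp add: sumG[OF fP fP] ij)
    also have "\<dots> = 1\<^sub>m ?N $$ (i, j)"
      using orth[OF fP fP, of i j] nn[OF fP, of j] ij by (auto simp: finj nn_def[symmetric])
    finally show "(A * B) $$ (i, j) = 1\<^sub>m ?N $$ (i, j)" .
  qed (auto simp: A_def B_def)
  have BA: "B * A = 1\<^sub>m ?N" by (rule mat_mult_left_right_inverse[OF Ac Bc AB])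
  have t0: "t p0 = \<one>" using t[OF p0(1)] p0(2) by simp
  \<comment> \<open>This is the row of \<open>B * A = 1\<close> belonging to the class
    \<open>p0\<close>, where the class size is 1.\<close>
  have delta: "(\<Sum>p\<in>P. cnj (\<xi> p \<one>) / nn p * \<xi> p x) = (if x = \<one> then 1 else 0)" if x: "x \<in> ?G" for x
  proof -
    obtain q where q: "q \<in> P" "x \<in> \<kappa> q" using cover x by blast
    have "p0 \<in> f ` {..<?N}" "q \<in> f ` {..<?N}" using p0(1) q(1) by (simp_all only: bij_betw_imp_surj_on[OF f])
    then obtain i j where i: "i < ?N" "f i = p0" and j: "j < ?N" "f j = q" by auto
    have "(B * A) $$ (i, j) = (\<Sum>k<?N. cnj (\<xi> (f k) \<one>) / nn (f k) * \<xi> (f k) (t q))"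
      using i j p0 by (simp add: A_def B_def scalar_prod_def atLeast0LessThan t0)
    also have "\<dots> = (\<Sum>p\<in>P. cnj (\<xi> p \<one>) / nn p * \<xi> p (t q))"
      by (rule sum.reindex_bij_betw[OF f])
    also have "\<dots> = (\<Sum>p\<in>P. cnj (\<xi> p \<one>) / nn p * \<xi> p x)"
      using const[OF _ q(1) q(2) t[OF q(1)]] by (intro sum.cong refl) simp
    finally have "(\<Sum>p\<in>P. cnj (\<xi> p \<one>) / nn p * \<xi> p x) = 1\<^sub>m ?N $$ (i, j)" by (simp add: BA)
    also have "\<dots> = (if p0 = q then 1 else 0)" using finj[OF i(1) j(1)] i j by simp
    also have "p0 = q \<longleftrightarrow> x = \<one>" using disj[OF p0(1) q(1)] q(2) p0(2) by auto
    finally show ?thesis .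
  qed
  show ?thesis unfolding supercharacter_theory_def
  proof (intro conjI allI impI)
    show "partition_on ?G (\<kappa> ` P)"
      using ne disj cover unfolding partition_on_def disjoint_def by blast
    show "\<forall>\<xi>'\<in>\<xi> ` P. is_character G \<xi>'"
    proof
      fix \<xi>' assume "\<xi>' \<in> \<xi> ` P"
      then obtain p where p: "p \<in> P" "\<xi>' = \<xi> p" by blast
      obtain I :: "'i set" and \<rho> where u: "urep G I \<rho>" "\<xi> p = (\<lambda>g\<in>?G. utrace I \<rho> g)" using rep[OF p(1)] by blast
      show "is_character G \<xi>'" unfolding p(2) u(2) by (rule urep_is_character[OF u(1) G(1)])
    qed
    show "card (\<kappa> ` P) = card (\<xi> ` P)" using inj\<xi> inj\<kappa> by (simp add: card_image)
    show "\<forall>\<xi>'\<in>\<xi> ` P. \<forall>K\<in>\<kappa> ` P. \<forall>x\<in>K. \<forall>y\<in>K. \<xi>' x = \<xi>' y" using const by blast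
  next
    fix \<chi> assume irr: "irreducible_character G \<chi>"
    then obtain d \<pi> where \<pi>: "irreducible_rep G d \<pi>" "\<chi> = rep_character G \<pi>"
      unfolding irreducible_character_def by blast
    have cG: "of_nat (card ?G) \<noteq> (0::complex)" using G(2) one_closed by auto
    have con: "constituent G \<chi> \<xi>' \<longleftrightarrow> (\<Sum>g\<in>?G. \<xi>' g * cnj (mat_tr (\<pi> g))) \<noteq> 0" for \<xi>'
      using irr cG by (simp add: constituent_def char_inner_def \<pi>(2) rep_character_def)
    have "(\<Sum>p\<in>P. cnj (\<xi> p \<one>) / nn p * (\<Sum>g\<in>?G. \<xi> p g * cnj (mat_tr (\<pi> g)))) =
      (\<Sum>g\<in>?G. (\<Sum>p\<in>P. cnj (\<xi> p \<one>) / nn p * \<xi> p g) * cnj (mat_tr (\<pi> g)))"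
      unfolding sum_distrib_left sum_distrib_right by (subst sum.swap) (simp add: mult.assoc)
    also have "\<dots> = (\<Sum>g\<in>?G. if g = \<one> then cnj (mat_tr (\<pi> \<one>)) else 0)"
    proof (rule sum.cong[OF refl])
      fix g assume "g \<in> ?G"
      show "(\<Sum>p\<in>P. cnj (\<xi> p \<one>) / nn p * \<xi> p g) * cnj (mat_tr (\<pi> g)) =
        (if g = \<one> then cnj (mat_tr (\<pi> \<one>)) else 0)"
        unfolding delta[OF \<open>g \<in> ?G\<close>] by simp
    qed
    also have "\<dots> = cnj (mat_tr (\<pi> \<one>))" using G(2) by simp
    also have "\<dots> = of_nat d" using \<pi>(1) by (simp add: irreducible_rep_def matrix_rep_def mat_tr_def)
    also have "\<dots> \<noteq> 0" using \<pi>(1) by (simp add: irreducible_rep_def matrix_rep_def)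
    finally have "\<exists>p\<in>P. (\<Sum>g\<in>?G. \<xi> p g * cnj (mat_tr (\<pi> g))) \<noteq> 0"
      by (rule contrapos_np) (auto intro!: sum.neutral)
    then obtain p where p: "p \<in> P" "constituent G \<chi> (\<xi> p)" using con by blast
    show "\<exists>!\<xi>'. \<xi>' \<in> \<xi> ` P \<and> constituent G \<chi> \<xi>'"
    proof (rule ex1I[of _ "\<xi> p"])
      fix \<xi>' assume "\<xi>' \<in> \<xi> ` P \<and> constituent G \<chi> \<xi>'"
      then obtain q where q: "q \<in> P" "\<xi>' = \<xi> q" "constituent G \<chi> (\<xi> q)" by blast
      have "q = p"
      proof (rule ccontr)
        assume "q \<noteq> p"
        obtain I :: "'i set" and \<sigma> where u: "urep G I \<sigma>" "\<xi> p = (\<lambda>g\<in>?G. utrace I \<sigma> g)" using rep[OF p(1)] by blast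
        obtain J :: "'i set" and \<tau> where v: "urep G J \<tau>" "\<xi> q = (\<lambda>g\<in>?G. utrace J \<tau> g)" using rep[OF q(1)] by blast
        show False
        proof (rule urep_no_common_constituent[OF G u(1) v(1) _ \<pi>(1)])
          show "(\<Sum>g\<in>?G. utrace J \<tau> g * cnj (utrace I \<sigma> g)) = 0"
            using orth[OF q(1) p(1) \<open>q \<noteq> p\<close>] unfolding u(2) v(2) by simp
          show "(\<Sum>g\<in>?G. utrace I \<sigma> g * cnj (mat_tr (\<pi> g))) \<noteq> 0"
            using p(2) unfolding con u(2) by simp
          show "(\<Sum>g\<in>?G. utrace J \<tau> g * cnj (mat_tr (\<pi> g))) \<noteq> 0"
            using q(3) unfolding con v(2) by simp
        qed
      qed
      thus "\<xi>' = \<xi> p" using q by simp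
    qed (use p in auto)
  qed
qed

section \<open>The unipotent groups as fixed points of an involution\<close>

lemma unitri_iff:
  "X \<in> unitri m \<longleftrightarrow> X \<in> carrier_mat m m \<and> (\<forall>i<m. \<forall>j<i. X $$ (i, j) = 0) \<and> (\<forall>i<m. X $$ (i, i) = 1)"
  by (auto simp: unitri_def upper_triangular_def)

lemma unitri_carrier: "X \<in> unitri m \<Longrightarrow> X \<in> carrier_mat m m"
  by (simp add: unitri_def)

lemma unitri_zero: "X \<in> unitri m \<Longrightarrow> i < m \<Longrightarrow> j < i \<Longrightarrow> X $$ (i, j) = 0"
  by (simp add: unitri_iff)

lemma unitri_diag: "X \<in> unitri m \<Longrightarrow> i < m \<Longrightarrow> X $$ (i, i) = 1"
  by (simp add: unitri_iff)

lemma mult_index: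
  assumes "A \<in> carrier_mat m k" "B \<in> carrier_mat k l" "i < m" "j < l"
  shows "(A * B) $$ (i, j) = (\<Sum>a<k. A $$ (i, a) * B $$ (a, j))"
  using assms by (simp add: scalar_prod_def atLeast0LessThan)

lemma mult_index_transpose:
  assumes "A \<in> carrier_mat m k" "B \<in> carrier_mat l k" "i < m" "j < l"
  shows "(A * B\<^sup>T) $$ (i, j) = (\<Sum>a<k. A $$ (i, a) * B $$ (j, a))"
  using assms by (subst mult_index[of _ m k]) auto

declare index_mult_mat(1) [simp del]

lemma unitri_one: "1\<^sub>m m \<in> unitri m" by (simp add: unitri_iff)

lemma unitri_mult:
  assumes X: "X \<in> unitri m" and Y: "Y \<in> unitri m"
  shows "X * Y \<in> unitri m"
proof -
  have e: "(X * Y) $$ (i, j) = (\<Sum>a<m. X $$ (i, a) * Y $$ (a, j))" if "i < m" "j < m" for i j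
    using mult_index[OF unitri_carrier[OF X] unitri_carrier[OF Y] that] .
  have "(X * Y) $$ (i, j) = 0" if ij: "i < m" "j < i" for i j
  proof -
    have "X $$ (i, a) * Y $$ (a, j) = 0" if "a < m" for a
      using unitri_zero[OF X, of i a] unitri_zero[OF Y, of a j] ij that by (cases "a < i") auto
    thus ?thesis using ij by (subst e) (auto intro!: sum.neutral)
  qed
  moreover have "(X * Y) $$ (i, i) = 1" if i: "i < m" for i
  proof -
    have z: "X $$ (i, a) * Y $$ (a, i) = (if a = i then 1 else 0)" if "a < m" for a
      using unitri_zero[OF X i, of a] unitri_zero[OF Y that, of i] unitri_diag[OF X i] unitri_diag[OF Y i] that
      by (cases a i rule: linorder_cases) auto
    thus ?thesis using i by (simp add: e sum.delta)
  qed
  moreover have "X * Y \<in> carrier_mat m m" using unitri_carrier[OF X] unitri_carrier[OF Y] by simp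
  ultimately show ?thesis unfolding unitri_iff by blast
qed

lemma finite_carrier_mat: "finite (carrier_mat m k :: 'a::finite mat set)"
proof -
  have "(carrier_mat m k :: 'a mat set) \<subseteq> (\<lambda>f. mat m k f) ` (({..<m} \<times> {..<k}) \<rightarrow>\<^sub>E UNIV)"
  proof
    fix A :: "'a mat" assume A: "A \<in> carrier_mat m k"
    have e: "A = mat m k (restrict (\<lambda>p. A $$ p) ({..<m} \<times> {..<k}))" using A by (intro eq_matI) auto
    show "A \<in> (\<lambda>f. mat m k f) ` (({..<m} \<times> {..<k}) \<rightarrow>\<^sub>E UNIV)" by (subst e) (intro imageI, simp only: restrict_PiE_iff, simp)
  qed
  thus ?thesis by (rule finite_subset) (simp add: finite_PiE)
qed

lemma finite_carrier_vec: "finite (carrier_vec m :: 'a::finite vec set)"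
proof -
  have "(carrier_vec m :: 'a vec set) \<subseteq> (\<lambda>f. vec m f) ` ({..<m} \<rightarrow>\<^sub>E UNIV)"
  proof
    fix A :: "'a vec" assume A: "A \<in> carrier_vec m"
    have e: "A = vec m (restrict (\<lambda>p. A $ p) {..<m})" using A by (intro eq_vecI) auto
    show "A \<in> (\<lambda>f. vec m f) ` ({..<m} \<rightarrow>\<^sub>E UNIV)" by (subst e) (intro imageI, simp only: restrict_PiE_iff, simp)
  qed
  thus ?thesis by (rule finite_subset) (simp add: finite_PiE)
qed

lemma finite_unitri: "finite (unitri m :: 'a::{field,finite} mat set)"
  by (rule finite_subset[OF _ finite_carrier_mat]) (auto simp: unitri_def)

text \<open>Multiplication by \<open>X\<close> permutes the finite set of unitriangular matrices.\<close>

lemma unitri_inverse: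
  fixes X :: "'a::{field,finite} mat"
  assumes X: "X \<in> unitri m"
  obtains Y where "Y \<in> unitri m" "X * Y = 1\<^sub>m m" "Y * X = 1\<^sub>m m"
proof -
  have Xc: "X \<in> carrier_mat m m" using X by (rule unitri_carrier)
  have "diag_mat X = replicate m 1"
    using X by (intro nth_equalityI) (auto simp: diag_mat_def unitri_iff)
  hence "det X = 1" using X det_upper_triangular[of X m] by (simp add: unitri_def)
  hence "X \<in> Units (ring_mat TYPE('a) m ())" by (intro det_non_zero_imp_unit[OF Xc]) simp
  \<comment> \<open>\<open>Z\<close> is used only to cancel \<open>X\<close>; a unitriangular
    inverse comes from the permutation of the finite set.\<close>
  then obtain Z where Z: "Z \<in> carrier_mat m m" "Z * X = 1\<^sub>m m"
    unfolding Units_def ring_mat_simps by blast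
  have "inj_on ((*) X) (unitri m)"
  proof (rule inj_onI)
    fix A B assume "A \<in> unitri m" "B \<in> unitri m" and eq: "X * A = X * B"
    hence c: "A \<in> carrier_mat m m" "B \<in> carrier_mat m m" by (auto intro: unitri_carrier)
    have "A = Z * (X * A)" using assoc_mult_mat[OF Z(1) Xc c(1)] Z(2) c by simp
    also have "\<dots> = Z * (X * B)" by (simp only: eq)
    also have "\<dots> = B" using assoc_mult_mat[OF Z(1) Xc c(2)] Z(2) c by simp
    finally show "A = B" .
  qed
  moreover have "(*) X ` unitri m \<subseteq> unitri m" using X unitri_mult by blast
  ultimately have "(*) X ` unitri m = unitri m" by (intro endo_inj_surj finite_unitri)
  hence "1\<^sub>m m \<in> (*) X ` unitri m" using unitri_one[of m] by simp
  then obtain Y where Y: "Y \<in> unitri m" "X * Y = 1\<^sub>m m" by auto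
  show thesis using that[OF Y mat_mult_left_right_inverse[OF Xc unitri_carrier[OF Y(1)] Y(2)]] .
qed

text \<open>Odd characteristic enters as the invertibility of 2; \<open>ty\<close> merely names the
  field.\<close>

locale unipotent =
  fixes T :: family and n :: nat and ty :: "'a::{field,finite} itself"
  assumes two: "(2::'a) \<noteq> 0"
begin

abbreviation "m \<equiv> mdim T n"

text \<open>The signs on the antidiagonal of the form: the lower half is negative in the symplectic
  case.\<close>

definition sg :: "nat \<Rightarrow> 'a" where "sg k = (if T = Sp \<and> n \<le> k then -1 else 1)"

text \<open>The sign of the form under transposition, -1 for alternating and 1 for symmetric forms;
  it also compares the signs at mirror positions, see \<open>sg_flip\<close>.\<close>

definition dl :: 'a where "dl = (if T = Sp then -1 else 1)"

definition Om :: "'a mat" where "Om = mat m m (\<lambda>(a, b). if a + b + 1 = m then sg a else 0)"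

text \<open>The adjoint with respect to the form, that is \<open>Om\<close> times the transpose of
  \<open>A\<close> times the inverse of \<open>Om\<close>. In coordinates it is reflection in the
  antidiagonal with signs, which makes it visible that upper triangular matrices are
  preserved.\<close>

definition adj :: "'a mat \<Rightarrow> 'a mat" where
  "adj A = mat m m (\<lambda>(a, b). sg a * sg b * A $$ (m - Suc b, m - Suc a))"

text \<open>Unitriangular isometries of the form. Stating the condition through \<open>adj\<close>
  displays the inverse as a matrix with known entries.\<close>

definition UU :: "'a mat set" where "UU = {X \<in> unitri m. X * adj X = 1\<^sub>m m}"

lemma m_cases: "T = Sp \<and> m = 2 * n \<or> T = OEven \<and> m = 2 * n \<or> T = OOdd \<and> m = 2 * n + 1"
  by (cases T) (auto simp: mdim_def mid_def)

lemma mult_carrier [simp]: "A \<in> carrier_mat m m \<Longrightarrow> B \<in> carrier_mat m m \<Longrightarrow> A * B \<in> carrier_mat m m"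
  by (rule mult_carrier_mat)

lemmas mult_assoc = assoc_mult_mat[of _ m m _ m _ m]

lemma sg_sq [simp]: "sg a * sg a = 1" "sg a * (sg a * x) = x" by (simp_all add: sg_def)

lemma dl_sq [simp]: "dl * dl = 1" "dl * (dl * x) = x" by (simp_all add: dl_def)

lemma sg_flip: "a < m \<Longrightarrow> sg (m - Suc a) = dl * sg a"
  using m_cases by (auto simp: sg_def dl_def)

lemma Om_carrier [simp]: "Om \<in> carrier_mat m m" by (simp add: Om_def)

lemma Om_carrier' [simp]: "dim_row Om = m" "dim_col Om = m" by (simp_all add: Om_def)

lemma adj_carrier [simp]: "adj A \<in> carrier_mat m m" by (simp add: adj_def)

lemma adj_dim [simp]: "dim_row (adj A) = m" "dim_col (adj A) = m" by (simp_all add: adj_def)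

lemma adj_index: "a < m \<Longrightarrow> b < m \<Longrightarrow> adj A $$ (a, b) = sg a * sg b * A $$ (m - Suc b, m - Suc a)"
  by (simp add: adj_def)

lemma flip_sum: "(\<Sum>a<m. f (m - Suc a)) = (\<Sum>a<m. f a)" for f :: "nat \<Rightarrow> 'b::comm_monoid_add"
  by (rule sum.reindex_bij_witness[of _ "\<lambda>a. m - Suc a" "\<lambda>a. m - Suc a"]) auto

lemma Om_mult_right:
  assumes "A \<in> carrier_mat m m" "a < m" "b < m"
  shows "(A * Om) $$ (a, b) = A $$ (a, m - Suc b) * sg (m - Suc b)"
proof -
  have "(A * Om) $$ (a, b) = (\<Sum>k<m. if k = m - Suc b then A $$ (a, k) * sg k else 0)"
    unfolding mult_index[OF assms(1) Om_carrier assms(2,3)]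
    using assms by (intro sum.cong refl) (auto simp: Om_def)
  thus ?thesis using assms by (simp add: sum.delta)
qed

lemma adj_mult:
  assumes "A \<in> carrier_mat m m" "B \<in> carrier_mat m m"
  shows "adj (A * B) = adj B * adj A"
proof (rule eq_matI)
  fix i j assume "i < dim_row (adj B * adj A)" "j < dim_col (adj B * adj A)"
  hence ij: "i < m" "j < m" by auto
  have "adj (A * B) $$ (i, j) = sg i * sg j * (\<Sum>k<m. A $$ (m - Suc j, k) * B $$ (k, m - Suc i))"
    using ij assms by (simp add: adj_index mult_index[OF assms])
  also have "\<dots> = sg i * sg j * (\<Sum>k<m. A $$ (m - Suc j, m - Suc k) * B $$ (m - Suc k, m - Suc i))"
    by (simp only: flip_sum[of "\<lambda>k. A $$ (m - Suc j, k) * B $$ (k, m - Suc i)"])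
  also have "\<dots> = (\<Sum>k<m. adj B $$ (i, k) * adj A $$ (k, j))"
    unfolding sum_distrib_left using ij by (intro sum.cong refl) (simp add: adj_index algebra_simps)
  finally show "adj (A * B) $$ (i, j) = (adj B * adj A) $$ (i, j)"
    using ij by (simp add: mult_index[OF adj_carrier adj_carrier])
qed auto

lemma adj_adj: "A \<in> carrier_mat m m \<Longrightarrow> adj (adj A) = A"
  by (rule eq_matI) (auto simp: adj_index sg_flip algebra_simps)

lemma adj_one: "adj (1\<^sub>m m) = 1\<^sub>m m"
  by (rule eq_matI) (auto simp: adj_index)

lemma adj_unitri: "X \<in> unitri m \<Longrightarrow> adj X \<in> unitri m"
  unfolding unitri_iff by (auto simp: adj_index)

lemma adj_Om:
  assumes "A \<in> carrier_mat m m"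
  shows "adj A * Om = Om * A\<^sup>T"
proof (rule eq_matI)
  fix i j assume "i < dim_row (Om * A\<^sup>T)" "j < dim_col (Om * A\<^sup>T)"
  hence ij: "i < m" "j < m" using assms by auto
  have "(Om * A\<^sup>T) $$ (i, j) = (\<Sum>k<m. if k = m - Suc i then sg i * A $$ (j, k) else 0)"
    unfolding mult_index_transpose[OF Om_carrier assms ij]
    using ij by (intro sum.cong refl) (auto simp: Om_def)
  thus "(adj A * Om) $$ (i, j) = (Om * A\<^sup>T) $$ (i, j)"
    using ij by (simp add: Om_mult_right adj_index algebra_simps)
qed (use assms in auto)

lemma UU_unitri: "X \<in> UU \<Longrightarrow> X \<in> unitri m" by (simp add: UU_def)

lemma UU_carrier: "X \<in> UU \<Longrightarrow> X \<in> carrier_mat m m" by (simp add: UU_def unitri_def)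

lemma UU_right: "X \<in> UU \<Longrightarrow> X * adj X = 1\<^sub>m m" by (simp add: UU_def)

lemma UU_left: "X \<in> UU \<Longrightarrow> adj X * X = 1\<^sub>m m"
  using mat_mult_left_right_inverse[of X m "adj X"] by (simp add: UU_carrier UU_right)

lemma UU_adj: "X \<in> UU \<Longrightarrow> adj X \<in> UU"
  using UU_left[of X] adj_adj[OF UU_carrier, of X] adj_unitri[OF UU_unitri, of X] by (simp add: UU_def)

lemma UU_one: "1\<^sub>m m \<in> UU" by (simp add: UU_def unitri_one adj_one)

lemma UU_mult:
  assumes "X \<in> UU" "Y \<in> UU" shows "X * Y \<in> UU"
proof -
  note c = UU_carrier[OF assms(1)] UU_carrier[OF assms(2)]
  have "X * Y * (adj Y * adj X) = X * ((Y * adj Y) * adj X)"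
    using c by (simp add: mult_assoc)
  also have "\<dots> = 1\<^sub>m m" using assms by (simp add: UU_right)
  finally show ?thesis using assms c by (simp add: UU_def unitri_mult adj_mult)
qed

lemma finite_UU: "finite UU" by (rule finite_subset[OF _ finite_unitri]) (auto simp: UU_def)

end

lemma antidiag_carrier [simp]: "antidiag n \<in> carrier_mat n n" "dim_row (antidiag n) = n" "dim_col (antidiag n) = n"
  by (simp_all add: antidiag_def)

lemma antidiag_mult_left:
  assumes "A \<in> carrier_mat n k" "i < n" "j < k"
  shows "(antidiag n * A) $$ (i, j) = A $$ (n - Suc i, j)"
proof -
  have "(antidiag n * A) $$ (i, j) = (\<Sum>a<n. if a = n - Suc i then A $$ (a, j) else 0)"
    unfolding mult_index[OF antidiag_carrier(1) assms]
    using assms by (intro sum.cong refl) (auto simp: antidiag_def)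
  thus ?thesis using assms by (simp add: sum.delta)
qed

lemma antidiag_mult_right:
  assumes "A \<in> carrier_mat k n" "i < k" "j < n"
  shows "(A * antidiag n) $$ (i, j) = A $$ (i, n - Suc j)"
proof -
  have "(A * antidiag n) $$ (i, j) = (\<Sum>a<n. if a = n - Suc j then A $$ (i, a) else 0)"
    unfolding mult_index[OF assms(1) antidiag_carrier(1) assms(2,3)]
    using assms by (intro sum.cong refl) (auto simp: antidiag_def)
  thus ?thesis using assms by (simp add: sum.delta)
qed

section \<open>The block matrices of U are exactly the unitriangular isometries\<close>

context unipotent
begin

abbreviation "r \<equiv> mid T"

lemma m_eq: "m = 2 * n + r" by (simp add: mdim_def)

lemma r_cases: "T \<noteq> OOdd \<and> r = 0 \<or> T = OOdd \<and> r = 1" by (simp add: mid_def)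

text \<open>The last block is enumerated from the right end, so that a position and its mirror image
  carry the same local index.\<close>

lemma sum_blocks:
  fixes f :: "nat \<Rightarrow> 'b::comm_monoid_add"
  shows "(\<Sum>a<m. f a) = (\<Sum>a<n. f a) + (\<Sum>j<r. f (n + j)) + (\<Sum>a<n. f (m - Suc a))"
proof -
  have "(\<Sum>a<m. f a) = (\<Sum>a\<in>({..<n} \<union> {n..<n + r}) \<union> {n + r..<m}. f a)"
    by (intro sum.cong) (auto simp: m_eq)
  also have "\<dots> = (\<Sum>a<n. f a) + (\<Sum>a=n..<n + r. f a) + (\<Sum>a=n + r..<m. f a)"
    by (subst sum.union_disjoint; (subst sum.union_disjoint)?) auto
  also have "(\<Sum>a=n..<n + r. f a) = (\<Sum>j<r. f (n + j))"
    by (rule sum.reindex_bij_witness[of _ "\<lambda>j. n + j" "\<lambda>a. a - n"]) auto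
  also have "(\<Sum>a=n + r..<m. f a) = (\<Sum>a<n. f (m - Suc a))"
    by (rule sum.reindex_bij_witness[of _ "\<lambda>a. m - Suc a" "\<lambda>a. m - Suc a"]) (auto simp: m_eq)
  finally show ?thesis .
qed

lemma index_cases:
  assumes "k < m"
  obtains (low) k' where "k' < n" "k = k'" | (mid) i where "i < r" "k = n + i" | (high) k' where "k' < n" "k = m - Suc k'"
proof (cases "k < n")
  case False
  show thesis
  proof (cases "k < n + r")
    case True thus thesis using False mid[of "k - n"] by auto
  next
    case False thus thesis using assms high[of "m - Suc k"] by (auto simp: m_eq)
  qed
qed (use low in blast)

text \<open>The value of the form on rows \<open>k\<close> and \<open>l\<close> of \<open>X\<close>,
  that is, an entry of \<open>X * Om * X\<^sup>T\<close>.\<close>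

definition frm :: "'a mat \<Rightarrow> nat \<Rightarrow> nat \<Rightarrow> 'a" where
  "frm X k l = (\<Sum>a<m. sg a * (X $$ (k, a) * X $$ (l, m - Suc a)))"

lemma UU_iff_frm:
  assumes "X \<in> unitri m"
  shows "X \<in> UU \<longleftrightarrow> (\<forall>k<m. \<forall>l<m. frm X k l = (if k + l + 1 = m then sg k else 0))"
proof -
  note c = unitri_carrier[OF assms]
  have e: "(X * adj X) $$ (k, l) = sg l * frm X k (m - Suc l)" if "k < m" "l < m" for k l
    unfolding mult_index[OF c adj_carrier that] frm_def sum_distrib_left
    using that by (intro sum.cong refl) (simp add: adj_index algebra_simps)
  have e': "frm X k l = sg (m - Suc l) * (X * adj X) $$ (k, m - Suc l)" if "k < m" "l < m" for k l
    using e[OF that(1), of "m - Suc l"] that by simp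
  show ?thesis
  proof
    assume "X \<in> UU"
    thus "\<forall>k<m. \<forall>l<m. frm X k l = (if k + l + 1 = m then sg k else 0)"
      by (auto simp: e' UU_right)
  next
    assume *: "\<forall>k<m. \<forall>l<m. frm X k l = (if k + l + 1 = m then sg k else 0)"
    have "X * adj X = 1\<^sub>m m"
      by (rule eq_matI) (use c * in \<open>auto simp: e\<close>)
    thus "X \<in> UU" using assms by (simp add: UU_def)
  qed
qed

lemma frm_split:
  "frm X k l = (\<Sum>a<n. X $$ (k, a) * X $$ (l, m - Suc a)) + (\<Sum>j<r. X $$ (k, n + j) * X $$ (l, n + j)) +
     dl * (\<Sum>a<n. X $$ (k, m - Suc a) * X $$ (l, a))"
proof -
  have "(\<Sum>a<n. sg a * (X $$ (k, a) * X $$ (l, m - Suc a))) = (\<Sum>a<n. X $$ (k, a) * X $$ (l, m - Suc a))"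
    by (intro sum.cong refl) (simp add: sg_def)
  moreover have "(\<Sum>j<r. sg (n + j) * (X $$ (k, n + j) * X $$ (l, m - Suc (n + j)))) = (\<Sum>j<r. X $$ (k, n + j) * X $$ (l, n + j))"
  proof (intro sum.cong refl)
    fix j assume "j \<in> {..<r}"
    hence T: "T = OOdd" "r = 1" "j = 0" using r_cases by auto
    have "sg n = 1" using T(1) unfolding sg_def by simp
    moreover have "m - Suc n = n" by (simp add: m_eq T(2))
    ultimately show "sg (n + j) * (X $$ (k, n + j) * X $$ (l, m - Suc (n + j))) = X $$ (k, n + j) * X $$ (l, n + j)"
      using T(3) by simp
  qed
  moreover have "(\<Sum>a<n. sg (m - Suc a) * (X $$ (k, m - Suc a) * X $$ (l, m - Suc (m - Suc a)))) =
    dl * (\<Sum>a<n. X $$ (k, m - Suc a) * X $$ (l, a))"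
    unfolding sum_distrib_left
  proof (intro sum.cong refl)
    fix a assume "a \<in> {..<n}"
    hence a: "a < n" "a < m" by (auto simp: m_eq)
    hence "sg (m - Suc a) = dl" "m - Suc (m - Suc a) = a" by (simp_all add: sg_flip) (simp add: sg_def)
    thus "sg (m - Suc a) * (X $$ (k, m - Suc a) * X $$ (l, m - Suc (m - Suc a))) = dl * (X $$ (k, m - Suc a) * X $$ (l, a))"
      by simp
  qed
  ultimately show ?thesis unfolding frm_def sum_blocks by simp
qed

lemma frm_sym: "frm X l k = dl * frm X k l"
proof -
  have "frm X l k = (\<Sum>a<m. sg (m - Suc a) * (X $$ (l, m - Suc a) * X $$ (k, m - Suc (m - Suc a))))"
    unfolding frm_def by (rule flip_sum[symmetric])
  also have "\<dots> = dl * frm X k l"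
    unfolding frm_def sum_distrib_left by (intro sum.cong refl) (simp add: sg_flip algebra_simps)
  finally show ?thesis .
qed

text \<open>The sign \<open>dl\<close> and a sum that is empty for \<open>r = 0\<close> merge the
  three families into one equation.\<close>

lemma w_condition_iff:
  assumes "v \<in> carrier_mat n r" "w \<in> carrier_mat n n"
  shows "w_condition T n v w \<longleftrightarrow> (\<forall>k<n. \<forall>l<n.
    w $$ (l, n - Suc k) + (\<Sum>j<r. v $$ (k, j) * v $$ (l, j)) + dl * w $$ (k, n - Suc l) = 0)"
proof -
  have i: "(antidiag n * w\<^sup>T) $$ (k, l) = w $$ (l, n - Suc k)" "(w * antidiag n) $$ (k, l) = w $$ (k, n - Suc l)"
    "(v * v\<^sup>T) $$ (k, l) = (\<Sum>j<r. v $$ (k, j) * v $$ (l, j))" if "k < n" "l < n" for k l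
    using that assms antidiag_mult_left[of "w\<^sup>T" n n k l] antidiag_mult_right[of w n n k l]
      mult_index_transpose[OF assms(1) assms(1), of k l] by auto
  have eq: "A = B \<longleftrightarrow> (\<forall>k<n. \<forall>l<n. A $$ (k, l) = B $$ (k, l))"
    if "A \<in> carrier_mat n n" "B \<in> carrier_mat n n" for A B :: "'a mat"
    using that by auto
  have c: "antidiag n * w\<^sup>T \<in> carrier_mat n n" "w * antidiag n \<in> carrier_mat n n" "v * v\<^sup>T \<in> carrier_mat n n"
    using assms by auto
  have d: "dim_row w = n" "dim_col w = n" "dim_row v = n" using assms by auto
  show ?thesis
  proof (cases T)
    case Sp
    thus ?thesis using c d unfolding w_condition_def dl_def by (simp add: eq[OF minus_carrier_mat] eq i mid_def)
  next
    case OEven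
    thus ?thesis using c d unfolding w_condition_def dl_def by (simp add: eq[OF minus_carrier_mat] eq i mid_def)
  next
    case OOdd
    thus ?thesis using c d unfolding w_condition_def dl_def
      by (simp add: eq i eq_neg_iff_add_eq_0 algebra_simps)
  qed
qed

text \<open>Counting the last rows and columns from the end absorbs both antidiagonal factors around
  the transpose of \<open>y\<close>, so that the lower right block becomes a plain
  transpose.\<close>

lemma U_block_index:
  fixes x y v w :: "'a mat"
  assumes c: "x \<in> carrier_mat n n" "y \<in> carrier_mat n n" "v \<in> carrier_mat n r" "w \<in> carrier_mat n n"
  defines "X \<equiv> U_block T n x y v w"
  shows "X \<in> carrier_mat m m"
    and "\<And>k a. k < n \<Longrightarrow> a < n \<Longrightarrow> X $$ (k, a) = x $$ (k, a)"
    and "\<And>k j. k < n \<Longrightarrow> j < r \<Longrightarrow> X $$ (k, n + j) = (x * v) $$ (k, j)"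
    and "\<And>k a. k < n \<Longrightarrow> a < n \<Longrightarrow> X $$ (k, m - Suc a) = (x * w) $$ (k, n - Suc a)"
    and "\<And>i a. i < r \<Longrightarrow> a < n \<Longrightarrow> X $$ (n + i, a) = 0"
    and "\<And>i j. i < r \<Longrightarrow> j < r \<Longrightarrow> X $$ (n + i, n + j) = (if i = j then 1 else 0)"
    and "\<And>i a. i < r \<Longrightarrow> a < n \<Longrightarrow> X $$ (n + i, m - Suc a) = - v $$ (a, i)"
    and "\<And>k a. k < n \<Longrightarrow> a < n \<Longrightarrow> X $$ (m - Suc k, a) = 0"
    and "\<And>k j. k < n \<Longrightarrow> j < r \<Longrightarrow> X $$ (m - Suc k, n + j) = 0"
    and "\<And>k a. k < n \<Longrightarrow> a < n \<Longrightarrow> X $$ (m - Suc k, m - Suc a) = y $$ (a, k)"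
proof -
  have d: "dim_row x = n" "dim_col x = n" "dim_row y = n" "dim_col y = n" "dim_row v = n" "dim_col v = r"
    "dim_row w = n" "dim_col w = n" using c by auto
  have jy: "antidiag n * y\<^sup>T \<in> carrier_mat n n" using c by auto
  have JyJ: "(antidiag n * y\<^sup>T * antidiag n) $$ (i, j) = y $$ (n - Suc j, n - Suc i)" if "i < n" "j < n" for i j
    using that c by (subst antidiag_mult_right[OF jy]) (auto simp: antidiag_mult_left)
  have vJ: "(v\<^sup>T * antidiag n) $$ (i, j) = v $$ (n - Suc j, i)" if "i < r" "j < n" for i j
    using that c by (subst antidiag_mult_right[of _ r]) auto
  have s: "m - Suc a - (n + r) = n - Suc a" "m - Suc (a + (n + r)) = n - Suc a" "\<not> m - Suc a < n + r" "m - Suc a < m" "m - Suc a < n + r + n"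
    "\<not> m - Suc a < n" if "a < n" for a using that by (auto simp: m_eq)
  show "X \<in> carrier_mat m m" unfolding X_def U_block_def using c by (auto simp: m_eq append_rows_def)
  note defs = X_def U_block_def append_rows_def
  fix k a assume k: "k < n" and a: "a < n"
  show "X $$ (k, a) = x $$ (k, a)" using k a unfolding defs by (simp add: d)
  show "X $$ (k, m - Suc a) = (x * w) $$ (k, n - Suc a)" using k a unfolding defs by (simp add: d s)
  show "X $$ (m - Suc k, a) = 0" using k a unfolding defs by (simp add: d s)
  show "X $$ (m - Suc k, m - Suc a) = y $$ (a, k)" using k a unfolding defs by (simp add: d s JyJ)
next
  have d: "dim_row x = n" "dim_col x = n" "dim_row y = n" "dim_col y = n" "dim_row v = n" "dim_col v = r"
    "dim_row w = n" "dim_col w = n" using c by auto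
  have vJ: "(v\<^sup>T * antidiag n) $$ (i, j) = v $$ (n - Suc j, i)" if "i < r" "j < n" for i j
    using that c by (subst antidiag_mult_right[of _ r]) auto
  have s: "m - Suc a - (n + r) = n - Suc a" "m - Suc (a + (n + r)) = n - Suc a" "\<not> m - Suc a < n + r" "m - Suc a < m" "m - Suc a < n + r + n"
    "\<not> m - Suc a < n" if "a < n" for a using that by (auto simp: m_eq)
  note defs = X_def U_block_def append_rows_def
  fix i a assume i: "i < r" and a: "a < n"
  show "X $$ (n + i, a) = 0" using i a unfolding defs by (simp add: d s)
  show "X $$ (n + i, m - Suc a) = - v $$ (a, i)" using i a unfolding defs by (simp add: d s vJ)
  show "X $$ (a, n + i) = (x * v) $$ (a, i)" using i a unfolding defs by (simp add: d s)
  show "X $$ (m - Suc a, n + i) = 0" using i a unfolding defs by (simp add: d s)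
next
  have d: "dim_row x = n" "dim_col x = n" "dim_row y = n" "dim_col y = n" "dim_row v = n" "dim_col v = r"
    "dim_row w = n" "dim_col w = n" using c by auto
  fix i j assume i: "i < r" and j: "j < r"
  show "X $$ (n + i, n + j) = (if i = j then 1 else 0)"
    using i j unfolding X_def U_block_def append_rows_def by (simp add: d)
qed

text \<open>With \<open>W\<close> standing for \<open>w\<close> times the antidiagonal matrix, the
  pairing of the top rows is the defining condition on \<open>w\<close>, transformed by the
  invertible block \<open>A\<close>. Thus that condition says that the top rows span an isotropic
  space.\<close>

lemma frm_low:
  assumes c: "A \<in> carrier_mat n n" "v \<in> carrier_mat n r" "W \<in> carrier_mat n n"
    and X: "\<And>k a. k < n \<Longrightarrow> a < n \<Longrightarrow> X $$ (k, a) = A $$ (k, a)"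
      "\<And>k j. k < n \<Longrightarrow> j < r \<Longrightarrow> X $$ (k, n + j) = (A * v) $$ (k, j)"
      "\<And>k a. k < n \<Longrightarrow> a < n \<Longrightarrow> X $$ (k, m - Suc a) = (A * W) $$ (k, a)"
    and kl: "k < n" "l < n"
  shows "frm X k l = (A * (W\<^sup>T + v * v\<^sup>T + dl \<cdot>\<^sub>m W) * A\<^sup>T) $$ (k, l)"
proof -
  have c': "A * v \<in> carrier_mat n r" "A * W \<in> carrier_mat n n" "W\<^sup>T \<in> carrier_mat n n" "v * v\<^sup>T \<in> carrier_mat n n"
    "A\<^sup>T \<in> carrier_mat n n" "v\<^sup>T \<in> carrier_mat r n" "dl \<cdot>\<^sub>m W \<in> carrier_mat n n"
    "A * W\<^sup>T \<in> carrier_mat n n" "A * (v * v\<^sup>T) \<in> carrier_mat n n"  "W\<^sup>T + v * v\<^sup>T \<in> carrier_mat n n"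
    "A * W\<^sup>T + A * (v * v\<^sup>T) \<in> carrier_mat n n" "dl \<cdot>\<^sub>m (A * W) \<in> carrier_mat n n"
    using c by auto
  have "A * (W\<^sup>T + v * v\<^sup>T + dl \<cdot>\<^sub>m W) * A\<^sup>T = A * W\<^sup>T * A\<^sup>T + A * (v * v\<^sup>T) * A\<^sup>T + dl \<cdot>\<^sub>m (A * W) * A\<^sup>T"
    using c c' by (simp only: mult_add_distrib_mat[of _ n n _ n] add_mult_distrib_mat[of _ n n _ _ n] mult_smult_distrib[of _ n n _ n])
  also have "A * W\<^sup>T * A\<^sup>T = A * (A * W)\<^sup>T"
    using c c' by (simp add: transpose_mult[of _ n n _ n] assoc_mult_mat[of _ n n _ n _ n])
  also have "A * (v * v\<^sup>T) * A\<^sup>T = (A * v) * (A * v)\<^sup>T"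
    using c c' by (simp add: transpose_mult[of _ n n _ r] assoc_mult_mat[of _ n n _ n _ n] assoc_mult_mat[of _ n n _ r _ n] assoc_mult_mat[of _ n r _ n _ n])
  finally have e: "A * (W\<^sup>T + v * v\<^sup>T + dl \<cdot>\<^sub>m W) * A\<^sup>T = A * (A * W)\<^sup>T + (A * v) * (A * v)\<^sup>T + dl \<cdot>\<^sub>m (A * W) * A\<^sup>T" .
  have "(dl \<cdot>\<^sub>m (A * W) * A\<^sup>T) $$ (k, l) = dl * (\<Sum>a<n. (A * W) $$ (k, a) * A $$ (l, a))"
    unfolding mult_index_transpose[OF c'(12) c(1) kl] sum_distrib_left
    using c c' kl by (intro sum.cong refl) simp
  thus ?thesis unfolding e frm_split
    using c c' kl by (simp add: mult_index_transpose[of _ n n _ n] mult_index_transpose[of _ n r _ n] X)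
qed

lemma sandwich_zero:
  fixes A y Q :: "'a mat"
  assumes "A \<in> carrier_mat n n" "y \<in> carrier_mat n n" "A * y = 1\<^sub>m n" "Q \<in> carrier_mat n n"
  shows "A * Q * A\<^sup>T = 0\<^sub>m n n \<longleftrightarrow> Q = 0\<^sub>m n n"
proof
  assume z: "A * Q * A\<^sup>T = 0\<^sub>m n n"
  have yA: "y * A = 1\<^sub>m n" by (rule mat_mult_left_right_inverse[OF assms(1-3)])
  hence "A\<^sup>T * y\<^sup>T = 1\<^sub>m n" using transpose_mult[OF assms(2,1)] by simp
  hence "Q = (y * A) * Q * (A\<^sup>T * y\<^sup>T)" using assms yA by simp
  also have "\<dots> = y * (A * Q * A\<^sup>T) * y\<^sup>T" using assms by (simp add: assoc_mult_mat[of _ n n _ n _ n])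
  also have "\<dots> = 0\<^sub>m n n" unfolding z using assms by simp
  finally show "Q = 0\<^sub>m n n" .
qed (use assms in simp)

lemma w_condition_iff_mat:
  assumes "v \<in> carrier_mat n r" "w \<in> carrier_mat n n"
  defines "W \<equiv> w * antidiag n"
  shows "w_condition T n v w \<longleftrightarrow> W\<^sup>T + v * v\<^sup>T + dl \<cdot>\<^sub>m W = 0\<^sub>m n n"
proof -
  have W: "W \<in> carrier_mat n n" using assms by auto
  have i: "W $$ (k, l) = w $$ (k, n - Suc l)" if "k < n" "l < n" for k l
    unfolding W_def using that assms by (simp add: antidiag_mult_right)
  have d: "dim_row W = n" "dim_col W = n" "dim_row v = n" using W assms by auto
  have e: "(W\<^sup>T + v * v\<^sup>T + dl \<cdot>\<^sub>m W) $$ (k, l) =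
      w $$ (l, n - Suc k) + (\<Sum>j<r. v $$ (k, j) * v $$ (l, j)) + dl * w $$ (k, n - Suc l)"
    if "k < n" "l < n" for k l
    using that by (simp add: d i mult_index_transpose[OF assms(1) assms(1)])
  have "A = 0\<^sub>m n n \<longleftrightarrow> (\<forall>k<n. \<forall>l<n. A $$ (k, l) = 0)" if "A \<in> carrier_mat n n" for A :: "'a mat"
    using that by auto
  from this[of "W\<^sup>T + v * v\<^sup>T + dl \<cdot>\<^sub>m W"] have "W\<^sup>T + v * v\<^sup>T + dl \<cdot>\<^sub>m W = 0\<^sub>m n n \<longleftrightarrow>
    (\<forall>k<n. \<forall>l<n. (W\<^sup>T + v * v\<^sup>T + dl \<cdot>\<^sub>m W) $$ (k, l) = 0)"
    using W assms(1) by simp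
  also have "\<dots> \<longleftrightarrow> w_condition T n v w"
    unfolding w_condition_iff[OF assms(1,2)] by (simp add: e)
  finally show ?thesis ..
qed

text \<open>By \<open>frm_sym\<close> only rows \<open>k \<le> l\<close> need pairing. Two top rows
  give the condition on \<open>w\<close>, a top and a middle row cancel by the choice of the entry
  \<open>- v\<close>, and a top and a bottom row give \<open>x * y = 1\<close>.\<close>

lemma U_block_in_UU:
  assumes x: "x \<in> unitri n" and y: "y \<in> carrier_mat n n" "x * y = 1\<^sub>m n"
    and v: "v \<in> carrier_mat n r" and w: "w \<in> carrier_mat n n" and cond: "w_condition T n v w"
  shows "U_block T n x y v w \<in> UU"
proof -
  let ?X = "U_block T n x y v w"
  have xc: "x \<in> carrier_mat n n" using x by (rule unitri_carrier)
  note U = U_block_index[OF xc y(1) v w]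
  have y': "y \<in> unitri n"
  proof -
    obtain Y where Y: "Y \<in> unitri n" "Y * x = 1\<^sub>m n" using unitri_inverse[OF x] by blast
    have "Y = Y * (x * y)" using Y unitri_carrier[OF Y(1)] by (simp add: y)
    also have "\<dots> = y" using assoc_mult_mat[OF unitri_carrier[OF Y(1)] xc y(1)] Y(2) y(1) by simp
    finally show ?thesis using Y by simp
  qed
  have "?X \<in> unitri m" unfolding unitri_iff
  proof (intro conjI allI impI U(1))
    fix k assume "k < m"
    thus "?X $$ (k, k) = 1"
      by (cases k rule: index_cases) (auto simp: U unitri_diag[OF x] unitri_diag[OF y'])
  next
    fix k l assume "k < m" "l < k"
    hence "l < m" by simp
    from \<open>k < m\<close> \<open>l < m\<close> \<open>l < k\<close> show "?X $$ (k, l) = 0"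
      by (elim index_cases) (simp_all add: U, auto simp: unitri_zero[OF x] unitri_zero[OF y'] m_eq)
  qed
  moreover have "frm ?X k l = (if k + l + 1 = m then sg k else 0)" if kl: "k < m" "l < m" for k l
  proof -
    define W where "W = w * antidiag n"
    have W: "W \<in> carrier_mat n n" using w by (auto simp: W_def)
    have xW: "(x * W) $$ (k, a) = (x * w) $$ (k, n - Suc a)" if "k < n" "a < n" for k a
      using that w xc antidiag_mult_right[of "x * w" n n k a]
      by (simp add: W_def assoc_mult_mat[of _ n n _ n _ n, symmetric])
    have lowlow: "frm ?X k l = 0" if "k < n" "l < n" for k l
    proof -
      have "frm ?X k l = (x * (W\<^sup>T + v * v\<^sup>T + dl \<cdot>\<^sub>m W) * x\<^sup>T) $$ (k, l)"
        by (rule frm_low[OF xc v W]) (use that in \<open>auto simp: U xW\<close>)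
      also have "\<dots> = 0" using cond unfolding w_condition_iff_mat[OF v w] W_def[symmetric]
        using that xc by simp
      finally show ?thesis .
    qed
    have sgl: "sg k = 1" if "k < n" for k using that by (simp add: sg_def)
    have main: "frm ?X k l = (if k + l + 1 = m then sg k else 0)" if kl: "k < m" "l < m" "k \<le> l" for k l
      using kl(1)
    proof (cases k rule: index_cases)
      case (low k')
      show ?thesis using kl(2)
      proof (cases l rule: index_cases)
        case (low l')
        have "k + l + 1 \<noteq> m" using low \<open>k' < n\<close> \<open>k = k'\<close> by (simp add: m_eq)
        thus ?thesis using low \<open>k' < n\<close> \<open>k = k'\<close> by (simp add: lowlow)
      next
        case (mid i)
        have "frm ?X k l = (\<Sum>j<r. (x * v) $$ (k, j) * (if i = j then 1 else 0)) - (x * v) $$ (k, i)"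
          using mid low by (simp add: frm_split U mult_index[OF xc v] sum_negf)
        also have "\<dots> = 0" using mid by (simp add: if_distrib[where f = "\<lambda>c. _ * c"] sum.delta cong: if_cong)
        finally have "frm ?X k l = 0" .
        moreover have "k + l + 1 \<noteq> m" using mid low by (simp add: m_eq)
        ultimately show ?thesis by simp
      next
        case (high l')
        have "frm ?X k l = (x * y) $$ (k, l')" using low high
          by (simp add: frm_split U mult_index[OF xc y(1)])
        hence "frm ?X k l = (if k = l' then 1 else 0)" using low high by (simp add: y(2))
        moreover have "k + l + 1 = m \<longleftrightarrow> k = l'" using low high by (auto simp: m_eq)
        ultimately show ?thesis using low by (simp add: sgl)
      qed
    next
      case (mid i)
      show ?thesis using kl(2)
      proof (cases l rule: index_cases)
        case (low l')
        thus ?thesis using mid kl by simp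
      next
        case (mid j)
        have ij: "i = 0" "j = 0" "r = 1" and "T = OOdd" using mid \<open>i < r\<close> r_cases by auto
        have "frm ?X k l = (\<Sum>h<r. (if i = h then 1 else 0) * (if j = h then 1 else 0))"
          using mid \<open>i < r\<close> \<open>k = n + i\<close> by (simp add: frm_split U)
        hence "frm ?X k l = 1" by (simp add: ij)
        moreover have "sg n = 1" using \<open>T = OOdd\<close> unfolding sg_def by simp
        ultimately show ?thesis using mid \<open>k = n + i\<close> by (simp add: ij(1,2)) (simp add: m_eq ij(3))
      next
        case (high l')
        have "frm ?X k l = 0" using mid high by (simp add: frm_split U)
        moreover have "k + l + 1 \<noteq> m" using mid high by (simp add: m_eq)
        ultimately show ?thesis by simp
      qed
    next
      case (high k')
      show ?thesis using kl(2)
      proof (cases l rule: index_cases)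
        case (high l')
        have "frm ?X k l = 0" using high \<open>k = m - Suc k'\<close> \<open>k' < n\<close> by (simp add: frm_split U)
        moreover have "k + l + 1 \<noteq> m" using high \<open>k = m - Suc k'\<close> \<open>k' < n\<close> by (simp add: m_eq)
        ultimately show ?thesis by simp
      qed (use high kl in \<open>auto simp: m_eq\<close>)
    qed
    show ?thesis
    proof (cases "k \<le> l")
      case False
      have "sg k = dl * sg l" if "l + k + 1 = m"
        using that sg_flip[of l] kl by (simp add: add.commute flip: that)
      moreover have "frm ?X k l = dl * frm ?X l k" by (rule frm_sym)
      ultimately show ?thesis using main[of l k] kl False by (simp add: add.commute)
    qed (use main kl in blast)
  qed
  ultimately show ?thesis by (simp add: UU_iff_frm)
qed

text \<open>The parameters \<open>x\<close>, \<open>v\<close>, \<open>w\<close> are read off the top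
  rows. All remaining entries are forced: pairing the top rows with the others gives linear
  equations with the invertible coefficient matrix \<open>x\<close>.\<close>

lemma UU_in_U_set:
  assumes X: "X \<in> UU"
  shows "X \<in> U_set T n"
proof -
  note Xu = UU_unitri[OF X] and Xc = UU_carrier[OF X]
  have frm: "frm X k l = (if k + l + 1 = m then sg k else 0)" if "k < m" "l < m" for k l
    using UU_iff_frm[OF Xu] X that by blast
  define x where "x = mat n n (\<lambda>(k, a). X $$ (k, a))"
  define B where "B = mat n r (\<lambda>(k, j). X $$ (k, n + j))"
  define C where "C = mat n n (\<lambda>(k, a). X $$ (k, m - Suc a))"
  have c: "x \<in> carrier_mat n n" "B \<in> carrier_mat n r" "C \<in> carrier_mat n n" by (auto simp: x_def B_def C_def)
  have x: "x \<in> unitri n" unfolding unitri_iff x_def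
    using unitri_zero[OF Xu] unitri_diag[OF Xu] by (auto simp: m_eq)
  obtain y where y: "y \<in> unitri n" "x * y = 1\<^sub>m n" "y * x = 1\<^sub>m n" using unitri_inverse[OF x] by blast
  have yc: "y \<in> carrier_mat n n" by (rule unitri_carrier[OF y(1)])
  \<comment> \<open>The top blocks of \<open>U_block\<close> carry a factor \<open>x\<close> on the
    left, which \<open>y\<close> removes here and in \<open>w\<close>.\<close>
  define v where "v = y * B"
  define w where "w = y * C * antidiag n"
  define W where "W = w * antidiag n"
  have vw: "v \<in> carrier_mat n r" "w \<in> carrier_mat n n" "W \<in> carrier_mat n n" using c yc by (auto simp: v_def w_def W_def)
  have WC: "W = y * C"
  proof (rule eq_matI)
    fix k l assume "k < dim_row (y * C)" "l < dim_col (y * C)"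
    hence kl: "k < n" "l < n" using c yc by auto
    have yC: "y * C \<in> carrier_mat n n" using yc c by auto
    have "W $$ (k, l) = w $$ (k, n - Suc l)" unfolding W_def by (rule antidiag_mult_right[OF vw(2) kl])
    also have "\<dots> = (y * C) $$ (k, l)" unfolding w_def using kl by (subst antidiag_mult_right[OF yC]) auto
    finally show "W $$ (k, l) = (y * C) $$ (k, l)" .
  qed (use vw c yc in auto)
  have xv: "x * v = B" unfolding v_def using assoc_mult_mat[OF c(1) yc c(2)] y(2) c(2) by simp
  have xW: "x * W = C" unfolding WC using assoc_mult_mat[OF c(1) yc c(3)] y(2) c(3) by simp
  have low: "k < m" if "k < n" for k using that by (simp add: m_eq)
  have "x * (W\<^sup>T + v * v\<^sup>T + dl \<cdot>\<^sub>m W) * x\<^sup>T = 0\<^sub>m n n"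
  proof (rule eq_matI)
    fix k l assume "k < dim_row (0\<^sub>m n n :: 'a mat)" "l < dim_col (0\<^sub>m n n :: 'a mat)"
    hence kl: "k < n" "l < n" by auto
    have "(x * (W\<^sup>T + v * v\<^sup>T + dl \<cdot>\<^sub>m W) * x\<^sup>T) $$ (k, l) = frm X k l"
      by (rule frm_low[OF c(1) vw(1,3), symmetric]) (use kl in \<open>simp_all add: xv xW\<close>, simp_all add: x_def B_def C_def)
    also have "\<dots> = 0" using kl by (simp add: frm low) (simp add: m_eq)
    finally show "(x * (W\<^sup>T + v * v\<^sup>T + dl \<cdot>\<^sub>m W) * x\<^sup>T) $$ (k, l) = 0\<^sub>m n n $$ (k, l)" using kl by simp
  qed (use c in auto)
  hence cond: "w_condition T n v w"
    unfolding w_condition_iff_mat[OF vw(1,2)] W_def[symmetric]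
    using sandwich_zero[OF c(1) yc y(2), of "W\<^sup>T + v * v\<^sup>T + dl \<cdot>\<^sub>m W"] vw by simp
  have yx: "y * (x * M) = M" if "M \<in> carrier_mat n k" for M k
    using assoc_mult_mat[OF yc c(1) that] y(3) that by simp
  have yentry: "X $$ (m - Suc k, m - Suc a) = y $$ (a, k)" if ak: "a < n" "k < n" for a k
  proof -
    \<comment> \<open>The lower right block, mirrored and transposed. Since the bottom rows vanish
      outside it, pairing them with the top rows says exactly that \<open>M\<close> is a right
      inverse of \<open>x\<close>.\<close>
    define M where "M = mat n n (\<lambda>(a, k). X $$ (m - Suc k, m - Suc a))"
    have Mc: "M \<in> carrier_mat n n" by (simp add: M_def)
    have "x * M = 1\<^sub>m n"
    proof (rule eq_matI)
      fix k l assume "k < dim_row (1\<^sub>m n :: 'a mat)" "l < dim_col (1\<^sub>m n :: 'a mat)"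
      hence kl: "k < n" "l < n" by auto
      have z: "X $$ (m - Suc l, n + j) = 0" if "j < r" for j
        using unitri_zero[OF Xu, of "m - Suc l" "n + j"] kl that by (simp add: m_eq)
      have z': "X $$ (m - Suc l, a) = 0" if "a < n" for a
        using unitri_zero[OF Xu, of "m - Suc l" a] kl that by (simp add: m_eq)
      have "(x * M) $$ (k, l) = frm X k (m - Suc l)"
        unfolding mult_index[OF c(1) Mc kl] frm_split using kl by (simp add: z z') (simp add: x_def M_def)
      also have "\<dots> = 1\<^sub>m n $$ (k, l)" using kl by (subst frm) (auto simp: sg_def m_eq)
      finally show "(x * M) $$ (k, l) = 1\<^sub>m n $$ (k, l)" .
    qed (auto simp: x_def M_def)
    hence "M = y" using yx[OF Mc] yc by simp
    hence "y $$ (a, k) = M $$ (a, k)" by simp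
    thus ?thesis using ak by (simp add: M_def)
  qed
  have ventry: "X $$ (n + i, m - Suc a) = - v $$ (a, i)" if ai: "a < n" "i < r" for a i
  proof -
    \<comment> \<open>The unknown part of the middle row. Its entry 1 on the diagonal contributes
      the summand \<open>B\<close> when it is paired with the top rows.\<close>
    define M where "M = mat n r (\<lambda>(a, i). X $$ (n + i, m - Suc a))"
    have Mc: "M \<in> carrier_mat n r" by (simp add: M_def)
    have "x * M = - B"
    proof (rule eq_matI)
      fix k i assume "k < dim_row (- B)" "i < dim_col (- B)"
      hence ki: "k < n" "i < r" using c by auto
      have i: "i = 0" "r = 1" using ki r_cases by auto
      have z: "X $$ (n + i, a) = 0" if "a < n" for a
        using unitri_zero[OF Xu, of "n + i" a] ki that by (simp add: m_eq)
      have d: "X $$ (n, n) = 1" using unitri_diag[OF Xu, of n] i by (simp add: m_eq)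
      have "frm X k (n + i) = (x * M) $$ (k, i) + B $$ (k, i)"
        unfolding mult_index[OF c(1) Mc ki] frm_split using ki z d by (simp add: i(2)) (simp add: x_def M_def B_def i)
      moreover have "frm X k (n + i) = 0" using ki i by (subst frm) (simp_all add: m_eq)
      ultimately show "(x * M) $$ (k, i) = (- B) $$ (k, i)" using ki c by (simp add: eq_neg_iff_add_eq_0)
    qed (use c in \<open>auto simp: M_def\<close>)
    hence "M = y * (- B)" using yx[OF Mc] by simp
    also have "\<dots> = - v" unfolding v_def using c yc by (intro eq_matI) (auto simp: mult_index[of _ n n _ r] sum_negf)
    finally have "M $$ (a, i) = (- v) $$ (a, i)" by simp
    thus ?thesis using ai vw by (simp add: M_def)
  qed
  have xw: "(x * w) $$ (k, n - Suc a) = C $$ (k, a)" if "k < n" "a < n" for k a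
  proof -
    have xwc: "x * w \<in> carrier_mat n n" using c vw by auto
    have "C $$ (k, a) = (x * w * antidiag n) $$ (k, a)"
      unfolding xW[symmetric] W_def using assoc_mult_mat[OF c(1) vw(2) antidiag_carrier(1)] by simp
    thus ?thesis using antidiag_mult_right[OF xwc that] by simp
  qed
  note U = U_block_index[OF c(1) yc vw(1,2)]
  have "X = U_block T n x y v w"
  proof (rule eq_matI)
    fix k l assume "k < dim_row (U_block T n x y v w)" "l < dim_col (U_block T n x y v w)"
    hence kl: "k < m" "l < m" using U(1) by auto
    show "X $$ (k, l) = U_block T n x y v w $$ (k, l)"
      using kl(1)
    proof (cases k rule: index_cases)
      case (low k')
      from kl(2) show ?thesis
        by (cases l rule: index_cases) (use low in \<open>simp_all add: U xv xw, simp_all add: x_def B_def C_def\<close>)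
    next
      case (mid i)
      from kl(2) show ?thesis
      proof (cases l rule: index_cases)
        case (low l')
        thus ?thesis using mid unitri_zero[OF Xu kl(1), of l] by (simp add: U)
      next
        case (mid j)
        hence "i = j" using \<open>i < r\<close> r_cases by auto
        thus ?thesis using mid \<open>k = n + i\<close> unitri_diag[OF Xu kl(1)] by (simp add: U)
      qed (use mid in \<open>simp add: U ventry\<close>)
    next
      case (high k')
      from kl(2) show ?thesis
      proof (cases l rule: index_cases)
        case (low l')
        have "l < k" using low high by (simp add: m_eq)
        thus ?thesis using low high unitri_zero[OF Xu kl(1), of l] by (simp add: U)
      next
        case (mid j)
        have "l < k" using mid high by (simp add: m_eq)
        thus ?thesis using mid high unitri_zero[OF Xu kl(1), of l] by (simp add: U)
      qed (use high in \<open>simp add: U yentry\<close>)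
    qed
  qed (use Xc U(1) in auto)
  moreover have "inverts_mat x y" using y(2) c(1) by (simp add: inverts_mat_def)
  ultimately show ?thesis unfolding U_set_def using x yc vw cond by blast
qed

lemma U_set_eq_UU: "U_set T n = UU"
proof
  show "U_set T n \<subseteq> UU"
    unfolding U_set_def using U_block_in_UU by (auto simp: inverts_mat_def unitri_def)
qed (use UU_in_U_set in blast)

lemma carrier_U_group: "carrier (U_group T n) = UU"
  by (simp add: U_group_def U_set_eq_UU)

lemma U_group_ops: "mult (U_group T n) = (*)" "one (U_group T n) = (1\<^sub>m m :: 'a mat)"
  by (simp_all add: U_group_def)

lemma group_U_group: "group (U_group T n :: 'a mat monoid)"
proof (rule groupI)
  fix X assume "X \<in> carrier (U_group T n :: 'a mat monoid)"
  hence X: "X \<in> UU" by (simp add: carrier_U_group)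
  show "\<exists>Y\<in>carrier (U_group T n). Y \<otimes>\<^bsub>U_group T n\<^esub> X = \<one>\<^bsub>U_group T n\<^esub>"
    using UU_adj[OF X] UU_left[OF X] by (auto simp: carrier_U_group U_group_ops)
qed (auto simp: carrier_U_group U_group_ops UU_mult UU_one UU_carrier mult_assoc left_mult_one_mat[of _ m m])

lemma inv_U_group:
  assumes "X \<in> UU"
  shows "inv\<^bsub>U_group T n\<^esub> X = adj X"
proof -
  interpret group "U_group T n :: 'a mat monoid" by (rule group_U_group)
  show ?thesis
    using inv_equality[of "adj X" X] UU_left[OF assms] UU_adj[OF assms] assms
    by (simp add: carrier_U_group U_group_ops)
qed

section \<open>The Cayley transform\<close>

text \<open>The symmetry sign on the side of the Lie algebra, opposite to that of the form:
  symmetric matrices for the symplectic group, alternating ones for the orthogonal groups.\<close>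

definition ep :: 'a where "ep = - dl"

text \<open>The nilpotent Lie algebra of U multiplied by the form. Strict upper triangularity
  becomes vanishing on and below the antidiagonal.\<close>

definition LL :: "'a mat set" where
  "LL = {S \<in> carrier_mat m m. (\<forall>k<m. \<forall>l<m. S $$ (l, k) = ep * S $$ (k, l)) \<and>
     (\<forall>k<m. \<forall>l<m. m \<le> k + l + 1 \<longrightarrow> S $$ (k, l) = 0)}"

definition uinv :: "'a mat \<Rightarrow> 'a mat" where
  "uinv A = (SOME Y. Y \<in> unitri m \<and> A * Y = 1\<^sub>m m \<and> Y * A = 1\<^sub>m m)"

lemma uinv:
  assumes "A \<in> unitri m"
  shows "uinv A \<in> unitri m" "A * uinv A = 1\<^sub>m m" "uinv A * A = 1\<^sub>m m"
proof -
  obtain Y where "Y \<in> unitri m" "A * Y = 1\<^sub>m m" "Y * A = 1\<^sub>m m" using unitri_inverse[OF assms] by blast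
  hence "\<exists>Y. Y \<in> unitri m \<and> A * Y = 1\<^sub>m m \<and> Y * A = 1\<^sub>m m" by blast
  from someI_ex[OF this] show "uinv A \<in> unitri m" "A * uinv A = 1\<^sub>m m" "uinv A * A = 1\<^sub>m m"
    unfolding uinv_def by auto
qed

lemma uinv_unique:
  assumes "A \<in> unitri m" "B \<in> carrier_mat m m" "A * B = 1\<^sub>m m"
  shows "B = uinv A"
proof -
  note u = uinv[OF assms(1)]
  have "B = (uinv A * A) * B" using assms u by simp
  also have "\<dots> = uinv A * (A * B)" using assms unitri_carrier[OF u(1)] unitri_carrier[OF assms(1)] by (simp add: mult_assoc)
  finally show ?thesis using assms unitri_carrier[OF u(1)] by simp
qed

lemma uinv_uinv: "A \<in> unitri m \<Longrightarrow> uinv (uinv A) = A"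
  by (rule uinv_unique[symmetric]) (simp_all add: uinv unitri_carrier)

definition half :: 'a where "half = inverse 2"

lemma half [simp]: "half + half = 1" "half * 2 = 1" "2 * half = 1" "2 * (half * x) = x" "half * (2 * x) = x"
proof -
  show "half * 2 = 1" using two by (simp add: half_def)
  thus h: "2 * half = 1" by (simp add: mult.commute)
  thus "half + half = 1" unfolding mult_2 .
  show "2 * (half * x) = x" "half * (2 * x) = x" using h \<open>half * 2 = 1\<close> by (simp_all add: mult.assoc[symmetric])
qed

definition mid_mat :: "'a mat \<Rightarrow> 'a mat" where "mid_mat X = half \<cdot>\<^sub>m (1\<^sub>m m + X)"

definition cay :: "'a mat \<Rightarrow> 'a mat" where "cay X = uinv (mid_mat X)"

text \<open>The Cayley transform \<open>2 (X - 1)\<close> divided by \<open>X + 1\<close>, times the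
  form. The factor 2 makes its leading term equal to \<open>MM X\<close>.\<close>

definition SS :: "'a mat \<Rightarrow> 'a mat" where "SS X = (2 \<cdot>\<^sub>m (1\<^sub>m m - cay X)) * Om"

text \<open>The uncorrected matrix. Root subgroups and their linear characters are visible in its
  entries, whereas only \<open>SS X\<close> has the symmetry.\<close>

definition MM :: "'a mat \<Rightarrow> 'a mat" where "MM X = (X - 1\<^sub>m m) * Om"

lemma minus_carrier [simp]: "B \<in> carrier_mat m m \<Longrightarrow> A - B \<in> carrier_mat m m"
  by (rule minus_carrier_mat)

lemma mid_mat_unitri:
  assumes "X \<in> unitri m" shows "mid_mat X \<in> unitri m"
proof -
  have d: "dim_row X = m" "dim_col X = m" using unitri_carrier[OF assms] by auto
  have "half * (1 + 1) = 1" by simp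
  thus ?thesis using d unfolding unitri_iff mid_mat_def
    by (auto simp: unitri_zero[OF assms] unitri_diag[OF assms])
qed

lemma cay:
  assumes "X \<in> unitri m"
  shows "cay X \<in> unitri m" "mid_mat X * cay X = 1\<^sub>m m" "cay X * mid_mat X = 1\<^sub>m m"
  using uinv[OF mid_mat_unitri[OF assms]] by (simp_all add: cay_def)

lemma two_minus_cay:
  assumes "X \<in> unitri m"
  shows "2 \<cdot>\<^sub>m (1\<^sub>m m - cay X) = (X - 1\<^sub>m m) * cay X"
proof -
  note c = unitri_carrier[OF assms] unitri_carrier[OF cay(1)[OF assms]] unitri_carrier[OF mid_mat_unitri[OF assms]]
  have N: "X - 1\<^sub>m m = 2 \<cdot>\<^sub>m (mid_mat X - 1\<^sub>m m)"
    using c by (intro eq_matI) (auto simp: mid_mat_def algebra_simps simp flip: mult.assoc)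
  show "2 \<cdot>\<^sub>m (1\<^sub>m m - cay X) = (X - 1\<^sub>m m) * cay X"
    unfolding N using c cay[OF assms]
    by (simp add: mult_smult_assoc_mat[of _ m m _ m] minus_mult_distrib_mat[of _ m m _ _ m])
qed

lemma SS_carrier [simp]: "X \<in> unitri m \<Longrightarrow> SS X \<in> carrier_mat m m"
  using unitri_carrier[OF cay(1)] by (simp add: SS_def)

lemma MM_carrier: "X \<in> carrier_mat m m \<Longrightarrow> MM X \<in> carrier_mat m m" by (simp add: MM_def)

text \<open>Passing \<open>cay X\<close> across the form turns it into the transpose of a
  unitriangular matrix. The two matrices thus differ by a lower unitriangular factor on the right,
  which preserves the vanishing of final segments of rows.\<close>

lemma SS_eq_MM:
  assumes "X \<in> unitri m"
  shows "SS X = MM X * (adj (cay X))\<^sup>T"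
proof -
  note c = unitri_carrier[OF assms] unitri_carrier[OF cay(1)[OF assms]]
  have "cay X * Om = Om * (adj (cay X))\<^sup>T" using adj_Om[of "adj (cay X)"] c by (simp add: adj_adj)
  thus ?thesis unfolding SS_def two_minus_cay[OF assms] MM_def using c
    by (simp add: mult_assoc minus_carrier_mat)
qed

text \<open>The multiplicative identity inverts \<open>SS_eq_MM\<close>; the additive one isolates
  the quadratic error, which is later shown to vanish on the relevant vectors.\<close>

lemma MM_eq_SS:
  assumes "X \<in> unitri m"
  shows "MM X = SS X * (adj (mid_mat X))\<^sup>T" "MM X = SS X + half \<cdot>\<^sub>m ((X - 1\<^sub>m m) * SS X)"
proof -
  note c = unitri_carrier[OF assms] unitri_carrier[OF cay(1)[OF assms]] unitri_carrier[OF mid_mat_unitri[OF assms]]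
  have N: "X - 1\<^sub>m m \<in> carrier_mat m m" "1\<^sub>m m - cay X \<in> carrier_mat m m" using c by (auto simp: minus_carrier_mat)
  have e: "mid_mat X * Om = Om * (adj (mid_mat X))\<^sup>T" using adj_Om[of "adj (mid_mat X)"] c by (simp add: adj_adj)
  have "SS X * (adj (mid_mat X))\<^sup>T = (X - 1\<^sub>m m) * cay X * (Om * (adj (mid_mat X))\<^sup>T)"
    unfolding SS_def two_minus_cay[OF assms] using c N by (simp add: mult_assoc)
  also have "\<dots> = (X - 1\<^sub>m m) * (cay X * mid_mat X) * Om" unfolding e[symmetric] using c N by (simp add: mult_assoc)
  also have "\<dots> = MM X" using N by (simp add: cay[OF assms] MM_def)
  finally show "MM X = SS X * (adj (mid_mat X))\<^sup>T" ..
  have "half \<cdot>\<^sub>m ((X - 1\<^sub>m m) * (2 \<cdot>\<^sub>m (1\<^sub>m m - cay X))) = (X - 1\<^sub>m m) * (1\<^sub>m m - cay X)"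
    using N by (intro eq_matI) (auto simp: mult_smult_distrib[of _ m m _ m])
  also have "\<dots> = (X - 1\<^sub>m m) - (X - 1\<^sub>m m) * cay X" using N c by (simp add: mult_minus_distrib_mat[of _ m m _ m])
  finally have "half \<cdot>\<^sub>m ((X - 1\<^sub>m m) * (2 \<cdot>\<^sub>m (1\<^sub>m m - cay X))) = (X - 1\<^sub>m m) - 2 \<cdot>\<^sub>m (1\<^sub>m m - cay X)"
    by (simp add: two_minus_cay[OF assms])
  moreover have "half \<cdot>\<^sub>m (N * (A * Om)) = N * Om - A * Om"
    if "half \<cdot>\<^sub>m (N * A) = N - A" "N \<in> carrier_mat m m" "A \<in> carrier_mat m m" for N A
  proof -
    have "half \<cdot>\<^sub>m (N * (A * Om)) = half \<cdot>\<^sub>m (N * A) * Om"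
      using that(2,3) by (simp add: mult_assoc mult_smult_assoc_mat[of _ m m _ m])
    also have "\<dots> = N * Om - A * Om"
      using that(2,3) by (simp add: that(1) minus_mult_distrib_mat[of _ m m _ _ m])
    finally show ?thesis .
  qed
  ultimately have "half \<cdot>\<^sub>m ((X - 1\<^sub>m m) * SS X) = MM X - SS X"
    unfolding SS_def MM_def using N by simp
  thus "MM X = SS X + half \<cdot>\<^sub>m ((X - 1\<^sub>m m) * SS X)"
    using MM_carrier[OF c(1)] carrier_matD[OF SS_carrier[OF assms]] by (intro eq_matI) auto
qed

text \<open>With \<open>Z = (1 + X)/2\<close>, the equation \<open>X * adj X = 1\<close> reads \<open>2 Z * adj Z = Z + adj Z\<close>, which
  is equivalent to \<open>c + adj c = 2\<close> for \<open>c = Z\<^sup>-\<^sup>1\<close>.\<close>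

lemma UU_iff_cay:
  assumes X: "X \<in> unitri m"
  shows "X \<in> UU \<longleftrightarrow> cay X + adj (cay X) = 2 \<cdot>\<^sub>m 1\<^sub>m m"
proof -
  let ?Z = "mid_mat X" and ?c = "cay X"
  note c = unitri_carrier[OF X] unitri_carrier[OF cay(1)[OF X]] unitri_carrier[OF mid_mat_unitri[OF X]]
  note k = cay[OF X]
  have aZ: "adj ?Z = half \<cdot>\<^sub>m (1\<^sub>m m + adj X)"
    using c by (intro eq_matI) (auto simp: mid_mat_def adj_index algebra_simps)
  have Zi: "?Z $$ (i, j) = half * (1\<^sub>m m $$ (i, j) + X $$ (i, j))"
    "adj ?Z $$ (i, j) = half * (1\<^sub>m m $$ (i, j) + adj X $$ (i, j))" if "i < m" "j < m" for i j
    using that c unfolding aZ by (simp_all add: mid_mat_def)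
  have ak: "adj ?Z * adj ?c = 1\<^sub>m m" "adj ?c * adj ?Z = 1\<^sub>m m"
    by (simp_all only: adj_mult[OF c(2,3), symmetric] adj_mult[OF c(3,2), symmetric] k adj_one)
  have "?Z * adj ?Z = half \<cdot>\<^sub>m (half \<cdot>\<^sub>m ((1\<^sub>m m + X) * (1\<^sub>m m + adj X)))"
    unfolding aZ unfolding mid_mat_def using c by (simp add: mult_smult_assoc_mat[of _ m m _ m] mult_smult_distrib[of _ m m _ m])
  also have "(1\<^sub>m m + X) * (1\<^sub>m m + adj X) = 1\<^sub>m m + X + (adj X + X * adj X)"
    using c by (simp add: mult_add_distrib_mat[of _ m m _ m] add_mult_distrib_mat[of _ m m _ _ m])
  finally have ZZ: "2 \<cdot>\<^sub>m (?Z * adj ?Z) = half \<cdot>\<^sub>m (1\<^sub>m m + X + (adj X + X * adj X))"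
    using c by (intro eq_matI) auto
  have "X \<in> UU \<longleftrightarrow> X * adj X = 1\<^sub>m m" using X by (simp add: UU_def)
  also have "\<dots> \<longleftrightarrow> 2 \<cdot>\<^sub>m (?Z * adj ?Z) = ?Z + adj ?Z"
  proof
    assume "X * adj X = 1\<^sub>m m"
    thus "2 \<cdot>\<^sub>m (?Z * adj ?Z) = ?Z + adj ?Z" unfolding ZZ
      using c by (intro eq_matI) (auto simp: Zi algebra_simps)
  next
    assume *: "2 \<cdot>\<^sub>m (?Z * adj ?Z) = ?Z + adj ?Z"
    have eq: "half \<cdot>\<^sub>m (1\<^sub>m m + X + (adj X + X * adj X)) = ?Z + adj ?Z" using * unfolding ZZ .
    show "X * adj X = 1\<^sub>m m"
    proof (rule eq_matI)
      fix i j assume "i < dim_row (1\<^sub>m m :: 'a mat)" "j < dim_col (1\<^sub>m m :: 'a mat)"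
      hence ij: "i < m" "j < m" by auto
      have "half * (1\<^sub>m m $$ (i, j) + X $$ (i, j) + (adj X $$ (i, j) + (X * adj X) $$ (i, j))) =
        half * (1\<^sub>m m $$ (i, j) + X $$ (i, j)) + half * (1\<^sub>m m $$ (i, j) + adj X $$ (i, j))"
        using arg_cong[OF eq, of "\<lambda>A. A $$ (i, j)"] ij c by (simp add: Zi)
      hence "2 * (half * (1\<^sub>m m $$ (i, j) + X $$ (i, j) + (adj X $$ (i, j) + (X * adj X) $$ (i, j)))) =
        2 * (half * (1\<^sub>m m $$ (i, j) + X $$ (i, j)) + half * (1\<^sub>m m $$ (i, j) + adj X $$ (i, j)))" by (simp only:)
      hence "1\<^sub>m m $$ (i, j) + X $$ (i, j) + (adj X $$ (i, j) + (X * adj X) $$ (i, j)) =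
        (1\<^sub>m m $$ (i, j) + X $$ (i, j)) + (1\<^sub>m m $$ (i, j) + adj X $$ (i, j))"
        by (simp only: distrib_left[of 2] half)
      thus "(X * adj X) $$ (i, j) = 1\<^sub>m m $$ (i, j)" by (simp only: add_left_cancel add.commute[of "adj X $$ (i, j)"] add_right_cancel)
    qed (use c in auto)
  qed
  also have "\<dots> \<longleftrightarrow> ?c + adj ?c = 2 \<cdot>\<^sub>m 1\<^sub>m m"
  proof
    assume *: "2 \<cdot>\<^sub>m (?Z * adj ?Z) = ?Z + adj ?Z"
    have "?c * (?Z + adj ?Z) * adj ?c = (?c * ?Z) * adj ?c + ?c * (adj ?Z * adj ?c)"
      using c by (simp add: mult_add_distrib_mat[of _ m m _ m] add_mult_distrib_mat[of _ m m _ _ m] mult_assoc)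
    also have "\<dots> = adj ?c + ?c" using c k ak by simp
    also have "\<dots> = ?c + adj ?c" using c by (intro comm_add_mat[of _ m m]) auto
    finally have "?c + adj ?c = ?c * (2 \<cdot>\<^sub>m (?Z * adj ?Z)) * adj ?c" by (simp add: *)
    also have "\<dots> = 2 \<cdot>\<^sub>m ((?c * ?Z) * (adj ?Z * adj ?c))"
      using c by (simp add: mult_smult_assoc_mat[of _ m m _ m] mult_smult_distrib[of _ m m _ m] mult_assoc)
    finally show "?c + adj ?c = 2 \<cdot>\<^sub>m 1\<^sub>m m" by (simp add: k ak)
  next
    assume *: "?c + adj ?c = 2 \<cdot>\<^sub>m 1\<^sub>m m"
    have "?Z * (?c + adj ?c) * adj ?Z = (?Z * ?c) * adj ?Z + ?Z * (adj ?c * adj ?Z)"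
      using c by (simp add: mult_add_distrib_mat[of _ m m _ m] add_mult_distrib_mat[of _ m m _ _ m] mult_assoc)
    also have "\<dots> = adj ?Z + ?Z" using c k ak by simp
    also have "\<dots> = ?Z + adj ?Z" using c by (intro comm_add_mat[of _ m m]) auto
    finally have "?Z + adj ?Z = ?Z * (2 \<cdot>\<^sub>m 1\<^sub>m m) * adj ?Z" by (simp add: *)
    also have "\<dots> = 2 \<cdot>\<^sub>m (?Z * adj ?Z)"
      using c by (simp add: mult_smult_assoc_mat[of _ m m _ m] mult_smult_distrib[of _ m m _ m])
    finally show "2 \<cdot>\<^sub>m (?Z * adj ?Z) = ?Z + adj ?Z" ..
  qed
  finally show ?thesis .
qed

lemma SS_index:
  assumes "X \<in> unitri m" "k < m" "l < m"
  shows "SS X $$ (k, l) = 2 * ((if k = m - Suc l then 1 else 0) - cay X $$ (k, m - Suc l)) * sg (m - Suc l)"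
  using assms unitri_carrier[OF cay(1)[OF assms(1)]] by (simp add: SS_def Om_mult_right minus_carrier_mat)

lemma cay_index:
  assumes "X \<in> unitri m" "k < m" "l < m"
  shows "cay X $$ (k, l) = (if k = l then 1 else 0) - half * (SS X $$ (k, m - Suc l) * sg l)"
proof -
  have "SS X $$ (k, m - Suc l) = 2 * ((if k = l then 1 else 0) - cay X $$ (k, l)) * sg l"
    using SS_index[OF assms(1,2), of "m - Suc l"] assms(3) by simp
  thus ?thesis by (simp only: mult.assoc sg_sq half) (simp add: mult.commute[of _ "sg l"])
qed

text \<open>The left side says that \<open>1 - cay X\<close> is skew for the adjoint. Multiplication
  by the form converts this into a symmetry whose sign is minus the sign of the form.\<close>

lemma cay_skew_iff:
  assumes X: "X \<in> unitri m"
  shows "cay X + adj (cay X) = 2 \<cdot>\<^sub>m 1\<^sub>m m \<longleftrightarrow> (\<forall>k<m. \<forall>l<m. SS X $$ (l, k) = ep * SS X $$ (k, l))"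
proof -
  have c: "cay X \<in> carrier_mat m m" by (rule unitri_carrier[OF cay(1)[OF X]])
  have e: "SS X $$ (l, m - Suc k) - ep * SS X $$ (m - Suc k, l) =
      2 * sg k * (2 * (if l = k then 1 else 0) - cay X $$ (l, k) - adj (cay X) $$ (l, k))"
    if kl: "k < m" "l < m" for k l
  proof -
    have i: "(m - Suc k = m - Suc l) \<longleftrightarrow> l = k" using kl by auto
    have 1: "SS X $$ (l, m - Suc k) = 2 * ((if l = k then 1 else 0) - cay X $$ (l, k)) * sg k"
      using SS_index[OF X, of l "m - Suc k"] kl by simp
    have 0: "SS X $$ (m - Suc k, l) = 2 * ((if l = k then 1 else 0) - cay X $$ (m - Suc k, m - Suc l)) * (dl * sg l)"
      using SS_index[OF X, of "m - Suc k" l] kl by (simp only: i sg_flip[OF kl(2)] diff_Suc_less)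
    have 2: "ep * SS X $$ (m - Suc k, l) = - (2 * ((if l = k then 1 else 0) - cay X $$ (m - Suc k, m - Suc l)) * sg l)"
      unfolding 0 by (simp add: ep_def algebra_simps)
    have 3: "adj (cay X) $$ (l, k) = sg k * sg l * cay X $$ (m - Suc k, m - Suc l)"
      using kl by (simp add: adj_index algebra_simps)
    show ?thesis unfolding 1 2 3 by (cases "l = k") (simp_all add: algebra_simps)
  qed
  have sg0: "sg k \<noteq> 0" for k by (simp add: sg_def)
  have "cay X + adj (cay X) = 2 \<cdot>\<^sub>m 1\<^sub>m m \<longleftrightarrow>
      (\<forall>k<m. \<forall>l<m. 2 * (if l = k then 1 else 0) - cay X $$ (l, k) - adj (cay X) $$ (l, k) = 0)" (is "?A \<longleftrightarrow> ?B")
  proof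
    assume A: ?A
    show ?B
    proof (intro allI impI)
      fix k l assume "k < m" "l < m"
      thus "2 * (if l = k then 1 else 0) - cay X $$ (l, k) - adj (cay X) $$ (l, k) = 0"
        using arg_cong[OF A, of "\<lambda>M. M $$ (l, k)"] c by (auto simp: algebra_simps)
    qed
  next
    assume ?B
    thus ?A using c by (intro eq_matI) (auto simp: algebra_simps)
  qed
  also have "\<dots> \<longleftrightarrow> (\<forall>k<m. \<forall>l<m. SS X $$ (l, m - Suc k) = ep * SS X $$ (m - Suc k, l))"
  proof -
    have "2 * (if l = k then 1 else 0) - cay X $$ (l, k) - adj (cay X) $$ (l, k) = 0 \<longleftrightarrow>
        SS X $$ (l, m - Suc k) = ep * SS X $$ (m - Suc k, l)" if "k < m" "l < m" for k l
      unfolding eq_iff_diff_eq_0[of "SS X $$ (l, m - Suc k)"] e[OF that] using two sg0 by simp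
    thus ?thesis by blast
  qed
  also have "\<dots> \<longleftrightarrow> (\<forall>k<m. \<forall>l<m. SS X $$ (l, k) = ep * SS X $$ (k, l))"
  proof -
    have "(\<forall>k<m. P (m - Suc k)) \<longleftrightarrow> (\<forall>k<m. P k)" for P
    proof
      assume *: "\<forall>k<m. P (m - Suc k)"
      show "\<forall>k<m. P k"
      proof (intro allI impI)
        fix k assume "k < m"
        thus "P k" using *[rule_format, of "m - Suc k"] by simp
      qed
    qed simp
    from this[of "\<lambda>k. \<forall>l<m. SS X $$ (l, k) = ep * SS X $$ (k, l)"] show ?thesis .
  qed
  finally show ?thesis .
qed

lemma SS_in_LL:
  assumes "X \<in> UU"
  shows "SS X \<in> LL"
proof -
  have X: "X \<in> unitri m" by (rule UU_unitri[OF assms])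
  have "SS X $$ (k, l) = 0" if "k < m" "l < m" "m \<le> k + l + 1" for k l
  proof (cases "k = m - Suc l")
    case True
    show ?thesis unfolding SS_index[OF X that(1,2)] True[symmetric] unitri_diag[OF cay(1)[OF X] that(1)] by simp
  next
    case False
    hence "m - Suc l < k" using that by simp
    thus ?thesis unfolding SS_index[OF X that(1,2)] using unitri_zero[OF cay(1)[OF X] that(1), of "m - Suc l"] by simp
  qed
  moreover have "\<forall>k<m. \<forall>l<m. SS X $$ (l, k) = ep * SS X $$ (k, l)"
    using assms UU_iff_cay[OF X] cay_skew_iff[OF X] by blast
  ultimately show ?thesis unfolding LL_def using SS_carrier[OF X] by blast
qed

lemma bij_SS: "bij_betw SS UU LL"
  unfolding bij_betw_def
proof
  show "inj_on SS UU"
  proof (rule inj_onI)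
    fix X Y assume "X \<in> UU" "Y \<in> UU" and eq: "SS X = SS Y"
    hence u: "X \<in> unitri m" "Y \<in> unitri m" by (auto intro: UU_unitri)
    note c = unitri_carrier[OF cay(1)[OF u(1)]] unitri_carrier[OF cay(1)[OF u(2)]] unitri_carrier[OF u(1)] unitri_carrier[OF u(2)]
    have "cay X = cay Y"
    proof (rule eq_matI)
      fix k l assume "k < dim_row (cay Y)" "l < dim_col (cay Y)"
      hence kl: "k < m" "l < m" using c by auto
      show "cay X $$ (k, l) = cay Y $$ (k, l)"
        unfolding cay_index[OF u(1) kl] cay_index[OF u(2) kl] eq ..
    qed (simp_all add: carrier_matD[OF c(1)] carrier_matD[OF c(2)])
    hence "uinv (cay X) = uinv (cay Y)" by (rule arg_cong)
    hence "mid_mat X = mid_mat Y" unfolding cay_def uinv_uinv[OF mid_mat_unitri[OF u(1)]] uinv_uinv[OF mid_mat_unitri[OF u(2)]] .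
    hence *: "2 \<cdot>\<^sub>m mid_mat X - 1\<^sub>m m = 2 \<cdot>\<^sub>m mid_mat Y - 1\<^sub>m m" by simp
    have "2 \<cdot>\<^sub>m mid_mat A - 1\<^sub>m m = A" if "A \<in> carrier_mat m m" for A
      using that by (intro eq_matI) (auto simp: mid_mat_def)
    with c(3,4) * show "X = Y" by metis
  qed
  show "SS ` UU = LL"
  proof
    show "SS ` UU \<subseteq> LL" using SS_in_LL by blast
    show "LL \<subseteq> SS ` UU"
    proof
      fix S assume S: "S \<in> LL"
      hence Sc: "S \<in> carrier_mat m m" by (simp add: LL_def)
      \<comment> \<open>The solution of \<open>S = 2 (1 - c) Om\<close>. It is unitriangular because
        \<open>S\<close> vanishes on and below the antidiagonal, and \<open>X\<close> is recovered
        from \<open>(1 + X)/2\<close> being its inverse.\<close>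
      define c where "c = mat m m (\<lambda>(k, l). (if k = l then 1 else 0) - half * S $$ (k, m - Suc l) * sg l)"
      have Sz: "S $$ (k, l) = 0" if "k < m" "l < m" "m \<le> k + l + 1" for k l
        using S that unfolding LL_def by blast
      have cu: "c \<in> unitri m" by (auto simp: unitri_iff c_def Sz)
      define X where "X = 2 \<cdot>\<^sub>m uinv c - 1\<^sub>m m"
      note uc = uinv[OF cu]
      have Xu: "X \<in> unitri m" unfolding unitri_iff X_def
        using unitri_zero[OF uc(1)] unitri_diag[OF uc(1)] unitri_carrier[OF uc(1)] by auto
      have "mid_mat X = uinv c" using unitri_carrier[OF uc(1)]
        by (intro eq_matI) (auto simp: mid_mat_def X_def)
      hence cX: "cay X = c" by (simp add: cay_def uinv_uinv[OF cu])
      have SX: "SS X = S"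
      proof (rule eq_matI)
        fix k l assume "k < dim_row S" "l < dim_col S"
        hence "k < m" "l < m" using Sc by auto
        thus "SS X $$ (k, l) = S $$ (k, l)"
          by (simp add: SS_index[OF Xu] cX) (simp add: c_def algebra_simps)
      qed (use Sc carrier_matD[OF SS_carrier[OF Xu]] in simp_all)
      have "\<forall>k<m. \<forall>l<m. SS X $$ (l, k) = ep * SS X $$ (k, l)" using S unfolding SX LL_def by blast
      hence "X \<in> UU" using UU_iff_cay[OF Xu] cay_skew_iff[OF Xu] by blast
      thus "S \<in> SS ` UU" using SX by blast
    qed
  qed
qed

end

section \<open>Exponential sums attached to a bilinear form\<close>

lemma sum_mix:
  fixes f :: "'p \<Rightarrow> 'c::comm_semiring_0"
  shows "(\<Sum>v\<in>A. \<Sum>w\<in>B. \<Sum>p\<in>W. f p * g p v * h p w) = (\<Sum>p\<in>W. f p * (\<Sum>v\<in>A. g p v) * (\<Sum>w\<in>B. h p w))"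
proof -
  have "(\<Sum>p\<in>W. f p * (\<Sum>v\<in>A. g p v) * (\<Sum>w\<in>B. h p w)) = (\<Sum>p\<in>W. \<Sum>v\<in>A. \<Sum>w\<in>B. f p * g p v * h p w)"
    by (simp only: sum_distrib_left[of "f _"] sum_product)
  also have "\<dots> = (\<Sum>v\<in>A. \<Sum>p\<in>W. \<Sum>w\<in>B. f p * g p v * h p w)" by (rule sum.swap)
  also have "\<dots> = (\<Sum>v\<in>A. \<Sum>w\<in>B. \<Sum>p\<in>W. f p * g p v * h p w)" by (intro sum.cong refl sum.swap)
  finally show ?thesis ..
qed

context unipotent
begin

definition lv :: "'a mat \<Rightarrow> 'a vec \<Rightarrow> nat \<Rightarrow> 'a" where
  "lv S s l = (\<Sum>k<m. s $ k * S $$ (k, l))"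

definition bil :: "'a mat \<Rightarrow> 'a vec \<Rightarrow> 'a vec \<Rightarrow> 'a" where
  "bil S s t = (\<Sum>l<m. lv S s l * t $ l)"

definition VV :: "nat \<Rightarrow> 'a vec set" where
  "VV i = {s \<in> carrier_vec m. s $ i = 1 \<and> (\<forall>k<i. s $ k = 0)}"

text \<open>Tails: directions in which a vector can be moved without changing its first
  \<open>c\<close> coordinates.\<close>

definition TT :: "nat \<Rightarrow> 'a vec set" where
  "TT c = {v \<in> carrier_vec m. \<forall>k<c. v $ k = 0}"

text \<open>For equal leading positions, which occur for the roots
  \<open>2\<epsilon>\<^sub>i\<close>, the pair collapses to one vector and the bilinear form to a
  quadratic one.\<close>

definition WW :: "nat \<Rightarrow> nat \<Rightarrow> ('a vec \<times> 'a vec) set" where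
  "WW i j = {(s, t). s \<in> VV i \<and> t \<in> VV j \<and> (i = j \<longrightarrow> s = t)}"

lemma finite_VV: "finite (VV i)" by (rule finite_subset[OF _ finite_carrier_vec]) (auto simp: VV_def)

lemma finite_TT: "finite (TT c)" by (rule finite_subset[OF _ finite_carrier_vec]) (auto simp: TT_def)

lemma finite_WW: "finite (WW i j)"
  by (rule finite_subset[of _ "VV i \<times> VV j"]) (auto simp: WW_def finite_VV)

lemma TT_zero: "c \<le> m \<Longrightarrow> 0\<^sub>v m \<in> TT c" by (auto simp: TT_def)

lemma card_TT: "c \<le> m \<Longrightarrow> card (TT c) > 0"
  using finite_TT TT_zero by (auto simp: card_gt_0_iff)

lemma VV_add: "s \<in> VV i \<Longrightarrow> v \<in> TT c \<Longrightarrow> i < c \<Longrightarrow> c \<le> m \<Longrightarrow> s + v \<in> VV i"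
  by (auto simp: VV_def TT_def)

lemma VV_diff: "s \<in> VV i \<Longrightarrow> v \<in> TT c \<Longrightarrow> i < c \<Longrightarrow> c \<le> m \<Longrightarrow> s - v \<in> VV i"
  by (auto simp: VV_def TT_def)

lemma lv_add: "s \<in> carrier_vec m \<Longrightarrow> v \<in> carrier_vec m \<Longrightarrow> lv S (s + v) l = lv S s l + lv S v l"
  unfolding lv_def sum.distrib[symmetric] by (intro sum.cong refl) (simp add: distrib_right)

lemma bil_add_left: "s \<in> carrier_vec m \<Longrightarrow> v \<in> carrier_vec m \<Longrightarrow> bil S (s + v) t = bil S s t + bil S v t"
  unfolding bil_def sum.distrib[symmetric] by (intro sum.cong refl) (simp add: lv_add distrib_right)

lemma bil_add_right: "t \<in> carrier_vec m \<Longrightarrow> v \<in> carrier_vec m \<Longrightarrow> bil S s (t + v) = bil S s t + bil S s v"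
  unfolding bil_def sum.distrib[symmetric] by (intro sum.cong refl) (simp add: distrib_left)

lemma bil_double: "bil S s t = (\<Sum>k<m. \<Sum>l<m. s $ k * S $$ (k, l) * t $ l)"
  unfolding bil_def lv_def sum_distrib_right by (rule sum.swap)

lemma LL_sym: "S \<in> LL \<Longrightarrow> k < m \<Longrightarrow> l < m \<Longrightarrow> S $$ (l, k) = ep * S $$ (k, l)"
  unfolding LL_def by blast

lemma LL_zero: "S \<in> LL \<Longrightarrow> k < m \<Longrightarrow> l < m \<Longrightarrow> m \<le> k + l + 1 \<Longrightarrow> S $$ (k, l) = 0"
  unfolding LL_def by blast

lemma ep_nz: "ep \<noteq> 0" by (simp add: ep_def dl_def)

lemma LL_carrier: "S \<in> LL \<Longrightarrow> S \<in> carrier_mat m m" by (simp add: LL_def)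

lemma bil_sym:
  assumes "S \<in> LL" shows "bil S s t = ep * bil S t s"
proof -
  have "bil S s t = (\<Sum>k<m. \<Sum>l<m. ep * (t $ l * S $$ (l, k) * s $ k))"
    unfolding bil_double
  proof (intro sum.cong refl)
    fix k l assume "k \<in> {..<m}" "l \<in> {..<m}"
    hence "S $$ (k, l) = ep * S $$ (l, k)" using LL_sym[OF assms, of l k] by blast
    thus "s $ k * S $$ (k, l) * t $ l = ep * (t $ l * S $$ (l, k) * s $ k)" by (simp only: mult_ac)
  qed
  also have "\<dots> = ep * bil S t s"
    unfolding bil_double sum_distrib_left by (rule sum.swap)
  finally show ?thesis .
qed

lemma bil_tails:
  assumes "S \<in> LL" "v \<in> TT c" "w \<in> TT c'" "m \<le> c + c'"
  shows "bil S v w = 0"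
  unfolding bil_double
proof (intro sum.neutral ballI)
  fix k l assume kl: "k \<in> {..<m}" "l \<in> {..<m}"
  show "v $ k * S $$ (k, l) * w $ l = 0"
  proof (cases "k < c \<or> l < c'")
    case True thus ?thesis using assms(2,3) by (auto simp: TT_def)
  next
    case False thus ?thesis using LL_zero[OF assms(1), of k l] kl assms(4) by simp
  qed
qed

lemma lv_mult:
  assumes "A \<in> carrier_mat m m" "B \<in> carrier_mat m m" "l < m"
  shows "lv (A * B) s l = (\<Sum>b<m. lv A s b * B $$ (b, l))"
proof -
  have "lv (A * B) s l = (\<Sum>k<m. \<Sum>b<m. s $ k * A $$ (k, b) * B $$ (b, l))"
    unfolding lv_def using assms
    by (intro sum.cong refl) (simp add: mult_index[OF assms(1,2)] sum_distrib_left mult.assoc)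
  also have "\<dots> = (\<Sum>b<m. lv A s b * B $$ (b, l))"
    unfolding lv_def sum_distrib_right by (rule sum.swap)
  finally show ?thesis .
qed

text \<open>A lower unitriangular factor on the right builds a column from that column and later
  ones, so a vanishing final segment persists.\<close>

lemma lv_tail:
  assumes "B \<in> carrier_mat m m" "L \<in> unitri m" and z: "\<And>b. b < m \<Longrightarrow> c \<le> b \<Longrightarrow> lv B s b = 0"
    and "l < m" "c \<le> l"
  shows "lv (B * L\<^sup>T) s l = 0"
proof -
  have L: "L\<^sup>T \<in> carrier_mat m m" "dim_row L = m" "dim_col L = m" using unitri_carrier[OF assms(2)] by auto
  have "lv B s b * L\<^sup>T $$ (b, l) = 0" if "b < m" for b
  proof (cases "b < l")
    case True thus ?thesis using unitri_zero[OF assms(2) assms(4) True] that assms(4) L by simp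
  next
    case False thus ?thesis using z[OF that] assms(5) by simp
  qed
  thus ?thesis unfolding lv_mult[OF assms(1) L(1) assms(4)] by (intro sum.neutral) simp
qed

lemma lv_MM:
  assumes "X \<in> carrier_mat m m" "k < m"
  shows "lv (MM X) s (m - Suc k) = lv (X - 1\<^sub>m m) s k * sg k"
  unfolding lv_def sum_distrib_right MM_def
proof (intro sum.cong refl)
  fix a assume "a \<in> {..<m}"
  hence "a < m" "m - Suc k < m" "m - Suc (m - Suc k) = k" using assms by auto
  moreover have "X - 1\<^sub>m m \<in> carrier_mat m m" by simp
  ultimately show "s $ a * ((X - 1\<^sub>m m) * Om) $$ (a, m - Suc k) = s $ a * (X - 1\<^sub>m m) $$ (a, k) * sg k"
    by (simp only: Om_mult_right) (simp only: mult.assoc)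
qed

lemma lv_MM_SS_tail:
  assumes "X \<in> unitri m"
  shows "(\<forall>l<m. c \<le> l \<longrightarrow> lv (MM X) s l = 0) \<longleftrightarrow> (\<forall>l<m. c \<le> l \<longrightarrow> lv (SS X) s l = 0)"
proof
  assume *: "\<forall>l<m. c \<le> l \<longrightarrow> lv (MM X) s l = 0"
  show "\<forall>l<m. c \<le> l \<longrightarrow> lv (SS X) s l = 0"
    unfolding SS_eq_MM[OF assms] using * assms
    by (intro allI impI lv_tail[where c = c]) (auto intro!: MM_carrier[OF unitri_carrier] adj_unitri cay(1))
next
  assume *: "\<forall>l<m. c \<le> l \<longrightarrow> lv (SS X) s l = 0"
  show "\<forall>l<m. c \<le> l \<longrightarrow> lv (MM X) s l = 0"
    unfolding MM_eq_SS(1)[OF assms] using * assms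
    by (intro allI impI lv_tail[where c = c]) (auto intro!: SS_carrier adj_unitri mid_mat_unitri)
qed

text \<open>The difference is half the value of \<open>(X - 1) * SS X\<close>. The condition on
  \<open>s\<close> confines the row vector \<open>s\<close> times \<open>X - 1\<close> to
  coordinates from \<open>c2\<close> on, and the condition on \<open>t\<close> kills
  \<open>SS X\<close> times \<open>t\<close> there.\<close>

lemma bil_MM_SS:
  assumes X: "X \<in> UU" and c: "c1 + c2 = m"
    and s: "\<And>l. l < m \<Longrightarrow> c1 \<le> l \<Longrightarrow> lv (SS X) s l = 0"
    and t: "\<And>l. l < m \<Longrightarrow> c2 \<le> l \<Longrightarrow> lv (SS X) t l = 0"
  shows "bil (MM X) s t = bil (SS X) s t"
proof -
  note Xu = UU_unitri[OF X]
  have N: "X - 1\<^sub>m m \<in> carrier_mat m m" by simp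
  note Sc = SS_carrier[OF Xu]
  have tS: "(\<Sum>l<m. SS X $$ (k, l) * t $ l) = 0" if "k < m" "c2 \<le> k" for k
  proof -
    have "(\<Sum>l<m. SS X $$ (k, l) * t $ l) = ep * lv (SS X) t k"
      unfolding lv_def sum_distrib_left
    proof (intro sum.cong refl)
      fix l assume "l \<in> {..<m}"
      hence "SS X $$ (k, l) = ep * SS X $$ (l, k)" using LL_sym[OF SS_in_LL[OF X]] that(1) by blast
      thus "SS X $$ (k, l) * t $ l = ep * (t $ l * SS X $$ (l, k))" by simp
    qed
    thus ?thesis using t[OF that] by simp
  qed
  \<comment> \<open>The tail condition moves from \<open>SS X\<close> to \<open>MM X\<close>; the
    form then mirrors the coordinates, and a zero tail from \<open>c1\<close> becomes a zero prefix
    of length \<open>c2\<close>.\<close>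
  have sN: "lv (X - 1\<^sub>m m) s k = 0" if "k < c2" for k
  proof -
    have k: "k < m" "m - Suc k < m" "c1 \<le> m - Suc k" using that c by auto
    have "\<forall>l<m. c1 \<le> l \<longrightarrow> lv (MM X) s l = 0" unfolding lv_MM_SS_tail[OF Xu] using s by blast
    hence "lv (MM X) s (m - Suc k) = 0" using k by blast
    hence "lv (X - 1\<^sub>m m) s k * sg k = 0" unfolding lv_MM[OF UU_carrier[OF X] k(1)] .
    moreover have "sg k \<noteq> 0" by (simp add: sg_def)
    ultimately show ?thesis by simp
  qed
  have "bil ((X - 1\<^sub>m m) * SS X) s t = (\<Sum>l<m. \<Sum>b<m. lv (X - 1\<^sub>m m) s b * (SS X $$ (b, l) * t $ l))"
    unfolding bil_def by (intro sum.cong refl) (simp add: lv_mult[OF N Sc] sum_distrib_right mult.assoc)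
  also have "\<dots> = (\<Sum>b<m. lv (X - 1\<^sub>m m) s b * (\<Sum>l<m. SS X $$ (b, l) * t $ l))"
    unfolding sum_distrib_left by (rule sum.swap)
  also have "\<dots> = 0"
  proof (intro sum.neutral ballI)
    fix b assume "b \<in> {..<m}"
    thus "lv (X - 1\<^sub>m m) s b * (\<Sum>l<m. SS X $$ (b, l) * t $ l) = 0"
      using tS[of b] sN[of b] by (cases "b < c2") auto
  qed
  finally have z: "bil ((X - 1\<^sub>m m) * SS X) s t = 0" .
  have lin: "bil (A + a \<cdot>\<^sub>m B) s t = bil A s t + a * bil B s t" if "A \<in> carrier_mat m m" "B \<in> carrier_mat m m" for a A B
  proof -
    have "lv (A + a \<cdot>\<^sub>m B) s l = lv A s l + a * lv B s l" if "l < m" for l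
      unfolding lv_def sum_distrib_left sum.distrib[symmetric] using that \<open>A \<in> _\<close> \<open>B \<in> _\<close>
      by (intro sum.cong refl) (simp add: algebra_simps)
    thus ?thesis unfolding bil_def sum_distrib_left sum.distrib[symmetric]
      by (intro sum.cong refl) (simp add: algebra_simps)
  qed
  have "bil (MM X) s t = bil (SS X + half \<cdot>\<^sub>m ((X - 1\<^sub>m m) * SS X)) s t" using MM_eq_SS(2)[OF Xu] by (rule arg_cong)
  also have "\<dots> = bil (SS X) s t" using lin[OF Sc mult_carrier[OF N Sc]] z by simp
  finally show ?thesis .
qed

end

section \<open>Exponential sums with an additive character of the field\<close>

locale unipotent_character = unipotent T n ty
  for T n and ty :: "'a::{field,finite} itself" +
  fixes \<theta> :: "'a \<Rightarrow> complex"
  assumes theta: "nontrivial_additive_character \<theta>"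
begin

lemma th_nz: "\<theta> x \<noteq> 0" using theta by (simp add: nontrivial_additive_character_def)

lemma th_add: "\<theta> (x + y) = \<theta> x * \<theta> y" using theta by (simp add: nontrivial_additive_character_def)

lemma th_0 [simp]: "\<theta> 0 = 1" using th_add[of 0 0] th_nz[of 0] by simp

lemma th_scaled: "a \<noteq> 0 \<Longrightarrow> \<exists>x. \<theta> (a * x) \<noteq> 1"
proof -
  assume a: "a \<noteq> 0"
  obtain y where y: "\<theta> y \<noteq> 1" using theta by (auto simp: nontrivial_additive_character_def)
  have "a * (inverse a * y) = y" using a by simp
  thus ?thesis using y by metis
qed

lemma th_sum: "\<theta> (sum f A) = (\<Prod>x\<in>A. \<theta> (f x))" if "finite A"
  using that by (induction A rule: finite_induct) (simp_all add: th_add)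

text \<open>All powers of \<open>\<theta> x\<close> are values of \<theta> on a finite field, hence
  bounded, so no value has modulus above 1; applied to \<open>x\<close> and \<open>- x\<close> this
  forces modulus 1.\<close>

lemma cmod_th: "cmod (\<theta> x) = 1"
proof -
  have le: "cmod (\<theta> x) \<le> 1" for x
  proof (rule ccontr)
    assume "\<not> cmod (\<theta> x) \<le> 1"
    hence gt: "cmod (\<theta> x) > 1" by simp
    have pow: "\<theta> (of_nat k * x) = \<theta> x ^ k" for k by (induction k) (simp_all add: th_add algebra_simps)
    obtain k where "cmod (\<theta> x) ^ k > (\<Sum>y\<in>UNIV. cmod (\<theta> y))" using real_arch_pow[OF gt] by blast
    moreover have "cmod (\<theta> (of_nat k * x)) \<le> (\<Sum>y\<in>UNIV. cmod (\<theta> y))" by (rule member_le_sum) auto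
    ultimately show False by (simp add: pow norm_power)
  qed
  have "cmod (\<theta> x) * cmod (\<theta> (- x)) = 1"
    using th_add[of x "- x"] by (simp add: norm_mult[symmetric])
  moreover have "cmod (\<theta> x) * cmod (\<theta> (- x)) \<le> cmod (\<theta> x) * 1" by (rule mult_left_mono) (auto simp: le)
  ultimately show ?thesis using le[of x] by simp
qed

lemma cnj_th: "cnj (\<theta> x) = \<theta> (- x)"
proof -
  have "\<theta> x * cnj (\<theta> x) = 1" by (simp add: complex_norm_square[symmetric] cmod_th)
  moreover have "\<theta> x * \<theta> (- x) = 1" using th_add[of x "- x"] by simp
  ultimately show ?thesis using th_nz[of x] by (metis mult_left_cancel)
qed

text \<open>A character of the vector space \<open>TT c\<close> sums to zero unless it is trivial. A
  coordinate with nonzero coefficient supplies a translation that multiplies the sum by a factor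
  different from 1.\<close>

lemma sum_TT:
  assumes c: "c \<le> m"
  shows "(\<Sum>v\<in>TT c. \<theta> (\<Sum>l<m. f l * v $ l)) = (if \<forall>l<m. c \<le> l \<longrightarrow> f l = 0 then of_nat (card (TT c)) else 0)"
proof (cases "\<forall>l<m. c \<le> l \<longrightarrow> f l = 0")
  case True
  have "(\<Sum>l<m. f l * v $ l) = 0" if "v \<in> TT c" for v
  proof (intro sum.neutral ballI)
    fix l assume "l \<in> {..<m}"
    thus "f l * v $ l = 0" using True that by (cases "l < c") (auto simp: TT_def)
  qed
  thus ?thesis using True by simp
next
  case False
  then obtain l where l: "l < m" "c \<le> l" "f l \<noteq> 0" by blast
  obtain x where x: "\<theta> (f l * x) \<noteq> 1" using th_scaled[OF l(3)] by blast
  let ?u = "x \<cdot>\<^sub>v unit_vec m l"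
  have u: "?u $ k = (if k = l then x else 0)" if "k < m" for k using that l by simp
  have uT: "?u \<in> TT c" using l c u by (auto simp: TT_def)
  have "bij_betw (\<lambda>v. v + ?u) (TT c) (TT c)"
    using uT c by (intro bij_betw_byWitness[where f' = "\<lambda>v. v - ?u"]) (auto simp: TT_def intro!: eq_vecI)
  hence "(\<Sum>v\<in>TT c. \<theta> (\<Sum>l<m. f l * v $ l)) = (\<Sum>v\<in>TT c. \<theta> (\<Sum>k<m. f k * (v + ?u) $ k))"
    by (rule sum.reindex_bij_betw[symmetric])
  also have "\<dots> = (\<Sum>v\<in>TT c. \<theta> (\<Sum>l<m. f l * v $ l) * \<theta> (f l * x))"
  proof (intro sum.cong refl)
    fix v assume "v \<in> TT c"
    have "(\<Sum>k<m. f k * (v + ?u) $ k) = (\<Sum>k<m. f k * v $ k + (if k = l then f l * x else 0))"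
      using u by (intro sum.cong refl) (simp add: algebra_simps)
    also have "\<dots> = (\<Sum>k<m. f k * v $ k) + f l * x" using l by (simp add: sum.distrib)
    finally show "\<theta> (\<Sum>k<m. f k * (v + ?u) $ k) = \<theta> (\<Sum>l<m. f l * v $ l) * \<theta> (f l * x)" by (simp only: th_add)
  qed
  finally have "(\<Sum>v\<in>TT c. \<theta> (\<Sum>l<m. f l * v $ l)) = 0"
    unfolding sum_distrib_right[symmetric] using x by simp
  thus ?thesis unfolding if_not_P[OF False] .
qed

definition GG :: "'a \<Rightarrow> nat \<Rightarrow> nat \<Rightarrow> 'a mat \<Rightarrow> complex" where
  "GG \<rho> i j S = (\<Sum>(s, t)\<in>WW i j. \<theta> (\<rho> * bil S s t))"

text \<open>The summand of \<open>GG\<close>, kept only when the row vectors \<open>s\<close> times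
  \<open>S\<close> and \<open>t\<close> times \<open>S\<close> vanish from \<open>c1\<close> and
  from \<open>c2\<close> on. For rows of a group element these conditions will express that a
  conjugate lies in the root subgroup.\<close>

definition HH :: "'a \<Rightarrow> nat \<Rightarrow> nat \<Rightarrow> 'a mat \<Rightarrow> 'a vec \<Rightarrow> 'a vec \<Rightarrow> complex" where
  "HH \<rho> c1 c2 S s t = (if (\<forall>l<m. c1 \<le> l \<longrightarrow> lv S s l = 0) \<and> (\<forall>l<m. c2 \<le> l \<longrightarrow> lv S t l = 0)
     then \<theta> (\<rho> * bil S s t) else 0)"

text \<open>Moving \<open>s\<close> by tails from \<open>c2\<close> and \<open>t\<close> by tails
  from \<open>c1\<close> permutes \<open>WW i j\<close>. The two tails pair to zero since
  \<open>c1 + c2 = m\<close>, so only cross terms appear, linear in each tail, and averaging over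
  the tails yields the two vanishing conditions. For \<open>i = j\<close> there is one vector, one
  tail and a cross term with factor 2.\<close>

lemma GG_eq_sum_HH:
  assumes S: "S \<in> LL" and \<rho>: "\<rho> \<noteq> 0" and c: "c1 + c2 = m" "i < c2" "j < c1"
    and diag: "i = j \<Longrightarrow> c1 = c2 \<and> ep = 1"
  shows "GG \<rho> i j S = (\<Sum>(s, t)\<in>WW i j. HH \<rho> c1 c2 S s t)"
proof (cases "i = j")
  case False
  let ?A = "TT c2" and ?B = "TT c1"
  have cm: "c1 \<le> m" "c2 \<le> m" using c by auto
  have W: "WW i j = VV i \<times> VV j" using False by (auto simp: WW_def)
  let ?f = "\<lambda>p. \<theta> (\<rho> * bil S (fst p) (snd p))"
  have shift: "GG \<rho> i j S = (\<Sum>(s, t)\<in>WW i j. \<theta> (\<rho> * bil S (s + v) (t + w)))" if vw: "v \<in> ?A" "w \<in> ?B" for v w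
  proof -
    have "bij_betw (\<lambda>p. (fst p + v, snd p + w)) (WW i j) (WW i j)"
      unfolding W using vw c cm
      by (intro bij_betw_byWitness[where f' = "\<lambda>p. (fst p - v, snd p - w)"])
        (auto simp: VV_add VV_diff, auto simp: VV_def TT_def intro!: eq_vecI)
    from sum.reindex_bij_betw[OF this, of ?f] show ?thesis
      unfolding GG_def by (simp add: split_def)
  qed
  \<comment> \<open>Symmetry rewrites the cross term of \<open>v\<close> with \<open>t\<close>
    through \<open>lv S t\<close>, so that both cross terms become linear functionals of the
    tails.\<close>
  have split: "\<theta> (\<rho> * bil S (s + v) (t + w)) = \<theta> (\<rho> * bil S s t) * \<theta> (\<Sum>l<m. (\<rho> * ep * lv S t l) * v $ l) *
      \<theta> (\<Sum>l<m. (\<rho> * lv S s l) * w $ l)" if "(s, t) \<in> WW i j" "v \<in> ?A" "w \<in> ?B" for s t v w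
  proof -
    have cc: "s \<in> carrier_vec m" "t \<in> carrier_vec m" "v \<in> carrier_vec m" "w \<in> carrier_vec m"
      using that by (auto simp: WW_def VV_def TT_def)
    have "bil S v w = 0" using bil_tails[OF S that(2,3)] c by simp
    hence "bil S (s + v) (t + w) = bil S s t + ep * bil S t v + bil S s w"
      using cc bil_sym[OF S, of v t] by (simp add: bil_add_left bil_add_right)
    hence "\<rho> * bil S (s + v) (t + w) = \<rho> * bil S s t + (\<Sum>l<m. (\<rho> * ep * lv S t l) * v $ l) + (\<Sum>l<m. (\<rho> * lv S s l) * w $ l)"
      by (simp add: bil_def distrib_left sum_distrib_left mult.assoc)
    thus ?thesis by (simp only: th_add)
  qed
  have "of_nat (card ?A) * of_nat (card ?B) * GG \<rho> i j S =
    (\<Sum>v\<in>?A. \<Sum>w\<in>?B. \<Sum>(s, t)\<in>WW i j. \<theta> (\<rho> * bil S (s + v) (t + w)))"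
    by (simp add: shift[symmetric])
  also have "\<dots> = (\<Sum>v\<in>?A. \<Sum>w\<in>?B. \<Sum>(s, t)\<in>WW i j. \<theta> (\<rho> * bil S s t) *
      \<theta> (\<Sum>l<m. (\<rho> * ep * lv S t l) * v $ l) * \<theta> (\<Sum>l<m. (\<rho> * lv S s l) * w $ l))"
    by (intro sum.cong refl) (auto simp: split)
  also have "\<dots> = (\<Sum>(s, t)\<in>WW i j. \<theta> (\<rho> * bil S s t) * (\<Sum>v\<in>?A. \<theta> (\<Sum>l<m. (\<rho> * ep * lv S t l) * v $ l)) *
      (\<Sum>w\<in>?B. \<theta> (\<Sum>l<m. (\<rho> * lv S s l) * w $ l)))"
    unfolding split_def by (rule sum_mix)
  also have "\<dots> = (\<Sum>(s, t)\<in>WW i j. of_nat (card ?A) * of_nat (card ?B) * HH \<rho> c1 c2 S s t)"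
    unfolding sum_TT[OF cm(1)] sum_TT[OF cm(2)]
    by (intro sum.cong refl) (use \<rho> ep_nz in \<open>auto simp: HH_def\<close>)
  also have "\<dots> = of_nat (card ?A) * of_nat (card ?B) * (\<Sum>(s, t)\<in>WW i j. HH \<rho> c1 c2 S s t)"
    by (simp add: sum_distrib_left split_def)
  finally show ?thesis using card_TT[OF cm(1)] card_TT[OF cm(2)] by simp
next
  case True
  hence cc: "c1 = c2" and e1: "ep = 1" using diag by auto
  let ?A = "TT c2"
  have cm: "c2 \<le> m" using c by simp
  have W: "(\<Sum>(s, t)\<in>WW i j. F s t) = (\<Sum>s\<in>VV i. F s s)" for F :: "'a vec \<Rightarrow> 'a vec \<Rightarrow> complex"
    using True by (intro sum.reindex_bij_witness[of _ "\<lambda>s. (s, s)" fst]) (auto simp: WW_def)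
  have shift: "GG \<rho> i j S = (\<Sum>s\<in>VV i. \<theta> (\<rho> * bil S (s + v) (s + v)))" if v: "v \<in> ?A" for v
  proof -
    have "bij_betw (\<lambda>s. s + v) (VV i) (VV i)"
      using v c cm by (intro bij_betw_byWitness[where f' = "\<lambda>s. s - v"])
        (auto simp: VV_add VV_diff, auto simp: VV_def TT_def intro!: eq_vecI)
    from sum.reindex_bij_betw[OF this, of "\<lambda>s. \<theta> (\<rho> * bil S s s)"] show ?thesis
      unfolding GG_def W by simp
  qed
  have split: "\<theta> (\<rho> * bil S (s + v) (s + v)) = \<theta> (\<rho> * bil S s s) * \<theta> (\<Sum>l<m. (\<rho> * 2 * lv S s l) * v $ l)"
    if "s \<in> VV i" "v \<in> ?A" for s v
  proof -
    have ccv: "s \<in> carrier_vec m" "v \<in> carrier_vec m" using that by (auto simp: VV_def TT_def)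
    have "bil S v v = 0" using bil_tails[OF S that(2,2)] c cc by simp
    hence "bil S (s + v) (s + v) = bil S s s + 2 * bil S s v"
      unfolding mult_2 using ccv bil_sym[OF S, of v s] e1
      by (simp only: bil_add_left bil_add_right add_carrier_vec) (simp only: add.assoc mult_1 add_0_right)
    hence "\<rho> * bil S (s + v) (s + v) = \<rho> * bil S s s + (\<Sum>l<m. (\<rho> * 2 * lv S s l) * v $ l)"
      by (simp add: bil_def distrib_left sum_distrib_left mult.assoc)
    thus ?thesis by (simp only: th_add)
  qed
  have "of_nat (card ?A) * GG \<rho> i j S = (\<Sum>v\<in>?A. \<Sum>s\<in>VV i. \<theta> (\<rho> * bil S (s + v) (s + v)))"
    by (simp add: shift[symmetric])
  also have "\<dots> = (\<Sum>v\<in>?A. \<Sum>s\<in>VV i. \<theta> (\<rho> * bil S s s) * \<theta> (\<Sum>l<m. (\<rho> * 2 * lv S s l) * v $ l))"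
    by (intro sum.cong refl) (simp add: split)
  also have "\<dots> = (\<Sum>s\<in>VV i. \<theta> (\<rho> * bil S s s) * (\<Sum>v\<in>?A. \<theta> (\<Sum>l<m. (\<rho> * 2 * lv S s l) * v $ l)))"
    unfolding sum_distrib_left by (rule sum.swap)
  also have "\<dots> = (\<Sum>s\<in>VV i. of_nat (card ?A) * HH \<rho> c1 c2 S s s)"
    unfolding sum_TT[OF cm] by (intro sum.cong refl) (use \<rho> two cc in \<open>auto simp: HH_def\<close>)
  also have "\<dots> = of_nat (card ?A) * (\<Sum>(s, t)\<in>WW i j. HH \<rho> c1 c2 S s t)"
    unfolding W by (simp add: sum_distrib_left)
  finally show ?thesis using card_TT[OF cm] by simp
qed

end

section \<open>Elementary characters as exponential sums\<close>

context unipotent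
begin

text \<open>The top left and top middle blocks can be prescribed freely, because 2 is invertible and
  the condition on \<open>w\<close> can therefore always be solved.\<close>

lemma UU_exists:
  assumes x: "x \<in> unitri n" and u: "u \<in> carrier_mat n r"
  obtains X where "X \<in> UU" "\<And>k a. k < n \<Longrightarrow> a < n \<Longrightarrow> X $$ (k, a) = x $$ (k, a)"
    "\<And>k j. k < n \<Longrightarrow> j < r \<Longrightarrow> X $$ (k, n + j) = u $$ (k, j)"
proof -
  obtain y where y: "y \<in> unitri n" "x * y = 1\<^sub>m n" using unitri_inverse[OF x] by blast
  have xc: "x \<in> carrier_mat n n" and yc: "y \<in> carrier_mat n n" using x y unitri_carrier by auto
  define v where "v = y * u"
  have v: "v \<in> carrier_mat n r" using yc u by (auto simp: v_def)
  have xv: "x * v = u" unfolding v_def using assoc_mult_mat[OF xc yc u] y(2) u by simp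
  define q where "q k l = (\<Sum>j<r. v $$ (k, j) * v $$ (l, j))" for k l
  \<comment> \<open>\<open>w\<close> times the antidiagonal matrix is minus half of \<open>v\<close>
    times its transpose, the symmetric solution of the condition; it is zero if
    \<open>r = 0\<close>.\<close>
  define w where "w = mat n n (\<lambda>(k, a). - half * q k (n - Suc a))"
  have w: "w \<in> carrier_mat n n" by (simp add: w_def)
  have "q l k = q k l" for k l by (simp add: q_def mult.commute)
  hence wi: "w $$ (l, n - Suc k) = - half * q k l" "w $$ (k, n - Suc l) = - half * q k l" if "k < n" "l < n" for k l
    using that by (simp_all add: w_def)
  have "w_condition T n v w"
    unfolding w_condition_iff[OF v w] q_def[symmetric]
  proof (intro allI impI)
    fix k l assume kl: "k < n" "l < n"
    show "w $$ (l, n - Suc k) + q k l + dl * w $$ (k, n - Suc l) = 0"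
    proof (cases "T = OOdd")
      case True
      hence "dl = 1" unfolding dl_def by simp
      hence "w $$ (l, n - Suc k) + q k l + dl * w $$ (k, n - Suc l) = q k l - (half + half) * q k l"
        unfolding wi[OF kl] by (simp only: distrib_right) (simp only: mult_1 mult_minus_left diff_conv_add_uminus minus_add_distrib add_ac)
      thus ?thesis by simp
    next
      case False
      hence "q k l = 0" using r_cases by (simp add: q_def)
      thus ?thesis unfolding wi[OF kl] by simp
    qed
  qed
  hence "U_block T n x y v w \<in> UU" by (rule U_block_in_UU[OF x yc y(2) v w])
  thus thesis using that U_block_index(2,3)[OF xc yc v w] xv by metis
qed

text \<open>\<open>e\<^sub>\<alpha>\<close> times the matrix of the form is nonzero exactly at \<open>(ri \<alpha>, rj \<alpha>)\<close> and \<open>(rj \<alpha>, ri \<alpha>)\<close>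
  (zero-based). The root subgroup consists of the \<open>X \<in> U\<close> such that \<open>MM X\<close> vanishes in
  row \<open>ri \<alpha>\<close> from column \<open>cut \<alpha>\<close> on and in row \<open>rj \<alpha>\<close> from column \<open>m - cut \<alpha>\<close> on.\<close>

fun ri :: "root \<Rightarrow> nat" where
  "ri (Diff i j) = i - 1" | "ri (Add i j) = i - 1" | "ri (Two i) = i - 1" | "ri (One i) = i - 1"

fun rj :: "root \<Rightarrow> nat" where
  "rj (Diff i j) = m - j" | "rj (Add i j) = j - 1" | "rj (Two i) = i - 1" | "rj (One i) = n"

fun cut :: "root \<Rightarrow> nat" where
  "cut (Diff i j) = Suc (m - j)" | "cut (Add i j) = n + r" | "cut (Two i) = n" | "cut (One i) = Suc n"

text \<open>The sign by which the positive entry of \<open>X\<close> differs from entry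
  \<open>(ri \<alpha>, rj \<alpha>)\<close> of \<open>MM X\<close>.\<close>

definition rsg :: "root \<Rightarrow> 'a" where "rsg \<alpha> = sg (m - Suc (rj \<alpha>))"

lemma roots_iff [simp]:
  "Diff i j \<in> roots T n \<longleftrightarrow> 1 \<le> i \<and> i < j \<and> j \<le> n"
  "Add i j \<in> roots T n \<longleftrightarrow> 1 \<le> i \<and> i < j \<and> j \<le> n"
  "Two i \<in> roots T n \<longleftrightarrow> T = Sp \<and> 1 \<le> i \<and> i \<le> n"
  "One i \<in> roots T n \<longleftrightarrow> T = OOdd \<and> 1 \<le> i \<and> i \<le> n"
  by (cases T; auto simp: roots_def)+

lemma root_cases:
  assumes "\<alpha> \<in> roots T n"
  obtains (Diff) i j where "\<alpha> = Diff i j" "1 \<le> i" "i < j" "j \<le> n"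
  | (Add) i j where "\<alpha> = Add i j" "1 \<le> i" "i < j" "j \<le> n"
  | (Two) i where "\<alpha> = Two i" "1 \<le> i" "i \<le> n" "m = 2 * n" "r = 0" "ep = 1"
  | (One) i where "\<alpha> = One i" "1 \<le> i" "i \<le> n" "m = Suc (2 * n)" "r = 1"
proof -
  note cs = Diff Add Two One
  show thesis
  proof (cases \<alpha>)
  case (Two i)
  hence T: "T = Sp" and i: "1 \<le> i" "i \<le> n" using assms by auto
  have "m = 2 * n" "r = 0" "ep = 1" using T unfolding mdim_def mid_def ep_def dl_def by simp_all
  thus thesis using cs Two i by blast
next
  case (One i)
  hence T: "T = OOdd" and i: "1 \<le> i" "i \<le> n" using assms by auto
  have "m = Suc (2 * n)" "r = 1" using T unfolding mdim_def mid_def by simp_all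
  thus thesis using cs One i by blast
  qed (use assms cs in auto)
qed

text \<open>These inequalities are what the exponential sums use of a root. The clauses on
  \<open>rj \<alpha>\<close> and \<open>n\<close> govern which initial parts of rows can be
  prescribed inside U; the last clause concerns the roots with a single entry, which occur only for
  symmetric matrices.\<close>

lemma root_bounds_all:
  assumes "\<alpha> \<in> roots T n"
  shows "ri \<alpha> < n \<and> ri \<alpha> \<le> rj \<alpha> \<and> ri \<alpha> + rj \<alpha> + 1 < m \<and> rj \<alpha> < cut \<alpha> \<and> cut \<alpha> \<le> m \<and> ri \<alpha> < m - cut \<alpha> \<and>
    m - cut \<alpha> \<le> n \<and> (rj \<alpha> < n \<longrightarrow> cut \<alpha> \<le> n + r) \<and> (n \<le> rj \<alpha> \<longrightarrow> cut \<alpha> = Suc (rj \<alpha>)) \<and>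
    (ri \<alpha> = rj \<alpha> \<longrightarrow> cut \<alpha> = m - cut \<alpha> \<and> ep = 1)"
  using assms
proof (cases rule: root_cases)
  case (Diff i j) thus ?thesis by (auto simp: m_eq)
next
  case (Add i j) thus ?thesis by (auto simp: m_eq)
next
  case (Two i) thus ?thesis by auto
next
  case (One i) thus ?thesis by auto
qed

lemma root_bounds:
  assumes "\<alpha> \<in> roots T n"
  shows "ri \<alpha> < n" "ri \<alpha> \<le> rj \<alpha>" "ri \<alpha> + rj \<alpha> + 1 < m" "rj \<alpha> < cut \<alpha>" "cut \<alpha> \<le> m" "ri \<alpha> < m - cut \<alpha>"
    "m - cut \<alpha> \<le> n" "rj \<alpha> < n \<Longrightarrow> cut \<alpha> \<le> n + r" "n \<le> rj \<alpha> \<Longrightarrow> cut \<alpha> = Suc (rj \<alpha>)"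
    "ri \<alpha> = rj \<alpha> \<Longrightarrow> cut \<alpha> = m - cut \<alpha> \<and> ep = 1"
  using root_bounds_all[OF assms] by blast+

lemma MM_index:
  assumes "k < m" "l < m"
  shows "MM X $$ (k, l) = (X - 1\<^sub>m m) $$ (k, m - Suc l) * sg (m - Suc l)"
  using assms by (simp add: MM_def Om_mult_right)

lemma MM_row_zero:
  assumes X: "X \<in> unitri m" and k: "k < m" and c: "c \<le> m"
  shows "(\<forall>l<m. c \<le> l \<longrightarrow> MM X $$ (k, l) = 0) \<longleftrightarrow> (\<forall>p. k < p \<and> p < m - c \<longrightarrow> X $$ (k, p) = 0)"
proof -
  have Xc: "X \<in> carrier_mat m m" using X by (rule unitri_carrier)
  have sg0: "sg l \<noteq> 0" for l by (simp add: sg_def)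
  have N: "(X - 1\<^sub>m m) $$ (k, p) = (if k < p then X $$ (k, p) else 0)" if "p < m" for p
    using that k Xc unitri_zero[OF X k, of p] unitri_diag[OF X k] by auto
  have e: "MM X $$ (k, m - Suc p) = 0 \<longleftrightarrow> (k < p \<longrightarrow> X $$ (k, p) = 0)" if "p < m" for p
    using MM_index[OF k, of "m - Suc p" X] that N[OF that] sg0 by auto
  show ?thesis
  proof
    assume L: "\<forall>l<m. c \<le> l \<longrightarrow> MM X $$ (k, l) = 0"
    show "\<forall>p. k < p \<and> p < m - c \<longrightarrow> X $$ (k, p) = 0"
    proof (intro allI impI)
      fix p assume p: "k < p \<and> p < m - c"
      hence pm: "p < m" and "m - Suc p < m" "c \<le> m - Suc p" by auto
      hence "MM X $$ (k, m - Suc p) = 0" using L by blast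
      thus "X $$ (k, p) = 0" using e[OF pm] p by blast
    qed
  next
    assume R: "\<forall>p. k < p \<and> p < m - c \<longrightarrow> X $$ (k, p) = 0"
    show "\<forall>l<m. c \<le> l \<longrightarrow> MM X $$ (k, l) = 0"
    proof (intro allI impI)
      fix l assume l: "l < m" "c \<le> l"
      hence p: "m - Suc l < m" "m - Suc l < m - c" "m - Suc (m - Suc l) = l" by auto
      have "k < m - Suc l \<longrightarrow> X $$ (k, m - Suc l) = 0" using R p by blast
      thus "MM X $$ (k, l) = 0" using e[OF p(1)] unfolding p(3) by blast
    qed
  qed
qed

lemma idx_simps [simp]:
  "1 \<le> i \<Longrightarrow> idx T n (int i) = i - 1" "idx T n 0 = n" "1 \<le> i \<Longrightarrow> idx T n (- int i) = m - i"
  by (auto simp: idx_def)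

text \<open>A uniform description by two rows. For \<open>Diff\<close> and \<open>One\<close> the
  second condition is empty, since there \<open>cut \<alpha>\<close> is the successor of
  \<open>rj \<alpha>\<close> and no column lies strictly between the diagonal and the cut.\<close>

lemma root_subgroup_iff:
  assumes a: "\<alpha> \<in> roots T n" and X: "X \<in> UU"
  shows "X \<in> root_subgroup T n \<alpha> \<longleftrightarrow>
    (\<forall>l<m. cut \<alpha> \<le> l \<longrightarrow> MM X $$ (ri \<alpha>, l) = 0) \<and> (\<forall>l<m. m - cut \<alpha> \<le> l \<longrightarrow> MM X $$ (rj \<alpha>, l) = 0)"
proof -
  note b = root_bounds[OF a]
  have lt: "ri \<alpha> < m" "rj \<alpha> < m" "m - cut \<alpha> \<le> m" "m - (m - cut \<alpha>) = cut \<alpha>" using b(3,5) by auto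
  note e = MM_row_zero[OF UU_unitri[OF X] lt(1) b(5)] MM_row_zero[OF UU_unitri[OF X] lt(2,3), unfolded lt(4)]
  \<comment> \<open>Labels start at 1 and positions at 0.\<close>
  have shift: "(\<forall>k. i < k \<and> k < j \<longrightarrow> P (k - 1)) \<longleftrightarrow> (\<forall>p. i - 1 < p \<and> p < j - 1 \<longrightarrow> P p)"
    if "1 \<le> i" for i j and P :: "nat \<Rightarrow> bool"
  proof
    assume L: "\<forall>k. i < k \<and> k < j \<longrightarrow> P (k - 1)"
    show "\<forall>p. i - 1 < p \<and> p < j - 1 \<longrightarrow> P p"
    proof (intro allI impI)
      fix p assume "i - 1 < p \<and> p < j - 1"
      hence "i < Suc p \<and> Suc p < j" using \<open>1 \<le> i\<close> by auto
      hence "P (Suc p - 1)" using L by blast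
      thus "P p" by simp
    qed
  next
    assume R: "\<forall>p. i - 1 < p \<and> p < j - 1 \<longrightarrow> P p"
    show "\<forall>k. i < k \<and> k < j \<longrightarrow> P (k - 1)"
    proof (intro allI impI)
      fix k assume "i < k \<and> k < j"
      hence "i - 1 < k - 1 \<and> k - 1 < j - 1" using \<open>1 \<le> i\<close> by auto
      thus "P (k - 1)" using R by blast
    qed
  qed
  have ent: "(\<forall>k. i < k \<and> k < j \<longrightarrow> X $$ (i - Suc 0, k - Suc 0) = 0) \<longleftrightarrow> (\<forall>p. i - Suc 0 < p \<and> p < j - Suc 0 \<longrightarrow> X $$ (i - Suc 0, p) = 0)"
    if "1 \<le> i" for i j
    using shift[OF that, of j "\<lambda>p. X $$ (i - 1, p) = 0"] unfolding One_nat_def .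
  have ent': "(\<forall>k. i < k \<and> k \<le> n \<longrightarrow> X $$ (i - Suc 0, k - Suc 0) = 0) \<longleftrightarrow> (\<forall>p. i - Suc 0 < p \<and> p < n \<longrightarrow> X $$ (i - Suc 0, p) = 0)"
    if "1 \<le> i" for i using ent[OF that, of "Suc n"] by (simp add: less_Suc_eq_le)
  from a show ?thesis
  proof (cases rule: root_cases)
    case (Diff i j)
    have c: "m - cut \<alpha> = j - 1" "rj \<alpha> = m - j" "cut \<alpha> = Suc (m - j)" "ri \<alpha> = i - 1" using Diff by (auto simp: m_eq)
    have v: "(\<forall>p. rj \<alpha> < p \<and> p < cut \<alpha> \<longrightarrow> X $$ (rj \<alpha>, p) = 0) \<longleftrightarrow> True" using c by auto
    show ?thesis unfolding e v unfolding c(1) unfolding c(2-4) using X Diff by (simp add: carrier_U_group ent)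
  next
    case (Add i j)
    have c: "m - cut \<alpha> = n" "rj \<alpha> = j - 1" "ri \<alpha> = i - 1" "cut \<alpha> = n + r" "1 \<le> j" using Add by (auto simp: m_eq)
    have "(\<forall>p. j - 1 < p \<and> p < n + r \<longrightarrow> X $$ (j - 1, p) = 0) \<longleftrightarrow>
      (\<forall>p. j - 1 < p \<and> p < n \<longrightarrow> X $$ (j - 1, p) = 0) \<and> (r = 1 \<longrightarrow> X $$ (j - 1, n) = 0)"
      (is "?L \<longleftrightarrow> ?R")
    proof (cases "r = 1")
      case True
      thus ?thesis using Add by (auto simp: less_Suc_eq)
    next
      case False
      hence "r = 0" using r_cases by blast
      thus ?thesis by simp
    qed
    moreover have "T = OOdd \<longleftrightarrow> r = 1" using r_cases by auto
    ultimately show ?thesis unfolding e unfolding c(1) unfolding c(2-4) using X c(5) Add by (simp add: carrier_U_group ent')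
  next
    case (Two i)
    have c: "m - cut \<alpha> = n" "rj \<alpha> = i - 1" "ri \<alpha> = i - 1" "cut \<alpha> = n" using Two by auto
    show ?thesis unfolding e unfolding c using X Two by (simp add: carrier_U_group ent')
  next
    case (One i)
    have c: "m - cut \<alpha> = n" "rj \<alpha> = n" "ri \<alpha> = i - 1" "cut \<alpha> = Suc n" using One by auto
    have v: "(\<forall>p. rj \<alpha> < p \<and> p < cut \<alpha> \<longrightarrow> X $$ (rj \<alpha>, p) = 0) \<longleftrightarrow> True" using c by auto
    show ?thesis unfolding e v unfolding c using X One by (simp add: carrier_U_group ent')
  qed
qed

lemma positive_entry:
  assumes a: "\<alpha> \<in> roots T n"
  shows "(case positive_entry T n \<alpha> of (i, j) \<Rightarrow> X $$ (idx T n i, idx T n j)) = X $$ (ri \<alpha>, m - Suc (rj \<alpha>))"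
proof -
  have pe: "positive_entry T n \<alpha> = p" if "p \<in> root_entries \<alpha>" "case p of (i, j) \<Rightarrow> 1 \<le> i \<and> i \<le> int n \<and> idx T n i < idx T n j \<and> idx T n j \<le> idx T n (- i)"
    "\<And>p'. p' \<in> root_entries \<alpha> \<Longrightarrow> (case p' of (i, j) \<Rightarrow> 1 \<le> i \<and> i \<le> int n \<and> idx T n i < idx T n j \<and> idx T n j \<le> idx T n (- i)) \<Longrightarrow> p' = p" for p
    unfolding positive_entry_def
  proof (rule the_equality)
    show "p \<in> root_entries \<alpha> \<and> (case p of (i, j) \<Rightarrow> 1 \<le> i \<and> i \<le> int n \<and> idx T n i < idx T n j \<and> idx T n j \<le> idx T n (- i))"
      using that(1,2) by (rule conjI)
    fix p' assume "p' \<in> root_entries \<alpha> \<and> (case p' of (i, j) \<Rightarrow> 1 \<le> i \<and> i \<le> int n \<and> idx T n i < idx T n j \<and> idx T n j \<le> idx T n (- i))"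
    thus "p' = p" by (elim conjE) (rule that(3))
  qed
  from a show ?thesis
  proof (cases rule: root_cases)
    case (Diff i j)
    have "positive_entry T n \<alpha> = (int i, int j)" by (rule pe) (use Diff in \<open>auto simp: m_eq\<close>)
    thus ?thesis using Diff by (simp add: m_eq)
  next
    case (Add i j)
    have "positive_entry T n \<alpha> = (int i, - int j)" by (rule pe) (use Add in \<open>auto simp: m_eq\<close>)
    thus ?thesis using Add by simp
  next
    case (Two i)
    have "positive_entry T n \<alpha> = (int i, - int i)" by (rule pe) (use Two in \<open>auto simp: m_eq\<close>)
    thus ?thesis using Two by simp
  next
    case (One i)
    have "positive_entry T n \<alpha> = (int i, 0)" by (rule pe) (use One in \<open>auto simp: m_eq\<close>)
    thus ?thesis using One by simp
  qed
qed

lemma positive_entry_MM: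
  assumes a: "\<alpha> \<in> roots T n" and X: "X \<in> UU"
  shows "(case positive_entry T n \<alpha> of (i, j) \<Rightarrow> entry T n X i j) = rsg \<alpha> * MM X $$ (ri \<alpha>, rj \<alpha>)"
proof -
  note b = root_bounds[OF a]
  have "(X - 1\<^sub>m m) $$ (ri \<alpha>, m - Suc (rj \<alpha>)) = X $$ (ri \<alpha>, m - Suc (rj \<alpha>))"
    using b(3) UU_carrier[OF X] by simp
  moreover have "ri \<alpha> < m" "rj \<alpha> < m" using b(3) by auto
  ultimately have e: "MM X $$ (ri \<alpha>, rj \<alpha>) = X $$ (ri \<alpha>, m - Suc (rj \<alpha>)) * rsg \<alpha>"
    by (simp only: MM_index rsg_def)
  show ?thesis unfolding positive_entry[OF a] e rsg_def by (simp add: mult.left_commute)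
qed

lemma MM_out:
  assumes X: "X \<in> unitri m" and "k < m" "l < m" "m \<le> k + l + 1"
  shows "MM X $$ (k, l) = 0"
proof -
  have p: "m - Suc l \<le> k" "m - Suc l < m" using assms by auto
  hence "(X - 1\<^sub>m m) $$ (k, m - Suc l) = 0"
    using unitri_zero[OF X assms(2), of "m - Suc l"] unitri_diag[OF X assms(2)] assms unitri_carrier[OF X]
    by (cases "m - Suc l = k") auto
  thus ?thesis unfolding MM_index[OF assms(2,3)] by simp
qed

lemma MM_adj:
  assumes X: "X \<in> UU"
  shows "MM (adj X) = - (MM X * X\<^sup>T)"
proof -
  have c: "X \<in> carrier_mat m m" "X\<^sup>T \<in> carrier_mat m m" using UU_carrier[OF X] by auto
  have "MM X * X\<^sup>T = (X - 1\<^sub>m m) * (adj X * Om)"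
    unfolding MM_def adj_Om[OF c(1)] using c by (simp add: mult_assoc)
  also have "\<dots> = (X - 1\<^sub>m m) * adj X * Om" using c by (simp add: mult_assoc)
  also have "(X - 1\<^sub>m m) * adj X = 1\<^sub>m m - adj X"
    using c by (simp add: minus_mult_distrib_mat[of _ m m _ _ m] UU_right[OF X])
  finally have e: "MM X * X\<^sup>T = (1\<^sub>m m - adj X) * Om" .
  have "- ((1\<^sub>m m - adj X) * Om) = (adj X - 1\<^sub>m m) * Om"
    using c by (intro eq_matI) (auto simp: minus_mult_distrib_mat[of _ m m _ _ m])
  thus ?thesis unfolding e by (simp add: MM_def)
qed

text \<open>\<open>MM X\<close> is symmetric up to the sign \<open>ep\<close> and a lower
  unitriangular factor on the right. This substitute for symmetry suffices to turn a zero tail of a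
  row into a zero tail of the corresponding column.\<close>

lemma MM_transpose:
  assumes X: "X \<in> UU" and kl: "k < m" "l < m"
  shows "MM X $$ (l, k) = ep * (MM X * X\<^sup>T) $$ (k, l)"
proof -
  have c: "X \<in> carrier_mat m m" using UU_carrier[OF X] .
  have p: "m - Suc k < m" "m - Suc l < m" using kl by auto
  have e1: "MM (adj X) $$ (k, l) = - ((MM X * X\<^sup>T) $$ (k, l))"
    unfolding MM_adj[OF X] using kl MM_carrier[OF c] c by simp
  have one: "1\<^sub>m m $$ (m - Suc l, k) = (1\<^sub>m m $$ (m - Suc k, l) :: 'a)"
    using kl p by (auto simp: one_mat_def)
  have "MM (adj X) $$ (k, l) = (adj X - 1\<^sub>m m) $$ (k, m - Suc l) * sg (m - Suc l)"
    by (rule MM_index[OF kl])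
  also have "\<dots> = sg k * X $$ (l, m - Suc k) - (if k = m - Suc l then sg (m - Suc l) else 0)"
    using kl p by (simp add: adj_index left_diff_distrib right_diff_distrib mult.assoc mult.commute[of _ "sg (m - Suc l)"])
  also have "\<dots> = sg k * (X - 1\<^sub>m m) $$ (l, m - Suc k)"
  proof (cases "k = m - Suc l")
    case True
    hence "m - Suc k = l" using kl by simp
    hence "(X - 1\<^sub>m m) $$ (l, m - Suc k) = X $$ (l, m - Suc k) - 1" using kl c by simp
    moreover have "(if k = m - Suc l then sg (m - Suc l) else 0) = sg k" unfolding True[symmetric] by simp
    ultimately show ?thesis by (simp only: right_diff_distrib mult_1_right)
  next
    case False
    hence "l \<noteq> m - Suc k" using kl by auto
    thus ?thesis using False kl p c by simp
  qed
  also have "\<dots> = dl * ((X - 1\<^sub>m m) $$ (l, m - Suc k) * sg (m - Suc k))"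
    unfolding sg_flip[OF kl(1)] by (simp add: mult.commute mult.left_commute)
  also have "\<dots> = dl * MM X $$ (l, k)" unfolding MM_index[OF kl(2,1)] ..
  finally have "dl * MM X $$ (l, k) = - ((MM X * X\<^sup>T) $$ (k, l))" using e1 by simp
  hence "dl * (dl * MM X $$ (l, k)) = dl * (- ((MM X * X\<^sup>T) $$ (k, l)))" by simp
  thus ?thesis by (simp add: ep_def)
qed

lemma MM_mult:
  assumes "X \<in> carrier_mat m m" "Y \<in> carrier_mat m m"
  shows "MM (X * Y) = MM X + MM Y + (X - 1\<^sub>m m) * MM Y"
proof -
  have "MM X + MM Y + (X - 1\<^sub>m m) * MM Y = (X - 1\<^sub>m m + (Y - 1\<^sub>m m) + (X - 1\<^sub>m m) * (Y - 1\<^sub>m m)) * Om"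
    unfolding MM_def using assms by (simp add: add_mult_distrib_mat[of _ m m _ _ m] mult_assoc)
  also have "(X - 1\<^sub>m m) * (Y - 1\<^sub>m m) = X * (Y - 1\<^sub>m m) - (Y - 1\<^sub>m m)"
    using assms by (simp add: minus_mult_distrib_mat[of _ m m _ _ m])
  also have "X * (Y - 1\<^sub>m m) = X * Y - X" using assms by (simp add: mult_minus_distrib_mat[of _ m m _ m])
  also have "X - 1\<^sub>m m + (Y - 1\<^sub>m m) + (X * Y - X - (Y - 1\<^sub>m m)) = X * Y - 1\<^sub>m m"
    using assms by (intro eq_matI) auto
  finally show ?thesis by (simp add: MM_def)
qed

section \<open>Root subgroups and their linear characters\<close>

definition tail_zero :: "'a mat \<Rightarrow> nat \<Rightarrow> nat \<Rightarrow> bool" where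
  "tail_zero A k c \<longleftrightarrow> (\<forall>l<m. c \<le> l \<longrightarrow> A $$ (k, l) = 0)"

lemma tail_zero_N:
  assumes X: "X \<in> UU" and k: "k < m" and z: "tail_zero (MM X) k c" and b: "b < m - c"
  shows "(X - 1\<^sub>m m) $$ (k, b) = 0"
proof -
  have l: "m - Suc b < m" "c \<le> m - Suc b" "m - Suc (m - Suc b) = b" using b by auto
  hence "MM X $$ (k, m - Suc b) = 0" using z unfolding tail_zero_def by blast
  hence "(X - 1\<^sub>m m) $$ (k, b) * sg b = 0" unfolding MM_index[OF k l(1)] l(3) .
  moreover have "sg b \<noteq> 0" by (simp add: sg_def)
  ultimately show ?thesis by simp
qed

text \<open>In \<open>MM (X * Y)\<close> the quadratic term has no contribution beyond the cut: row
  \<open>k\<close> of \<open>X - 1\<close> is zero before \<open>m - c\<close>, and from there on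
  column \<open>l\<close> of \<open>MM Y\<close> lies on or below the antidiagonal.\<close>

lemma tail_zero_mult:
  assumes X: "X \<in> UU" and Y: "Y \<in> UU" and k: "k < m" and c: "c \<le> m"
    and z: "tail_zero (MM X) k c" "tail_zero (MM Y) k c"
  shows "tail_zero (MM (X * Y)) k c"
  unfolding tail_zero_def
proof (intro allI impI)
  note cc = UU_carrier[OF X] UU_carrier[OF Y]
  fix l assume l: "l < m" "c \<le> l"
  have N: "X - 1\<^sub>m m \<in> carrier_mat m m" by simp
  have "((X - 1\<^sub>m m) * MM Y) $$ (k, l) = 0"
    unfolding mult_index[OF N MM_carrier[OF cc(2)] k l(1)]
  proof (intro sum.neutral ballI)
    fix b assume "b \<in> {..<m}"
    thus "(X - 1\<^sub>m m) $$ (k, b) * MM Y $$ (b, l) = 0"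
      using tail_zero_N[OF X k z(1), of b] MM_out[OF UU_unitri[OF Y], of b l] l by (cases "b < m - c") auto
  qed
  thus "MM (X * Y) $$ (k, l) = 0"
    using z l k MM_carrier[OF cc(1)] MM_carrier[OF cc(2)] unfolding MM_mult[OF cc] tail_zero_def by simp
qed

lemma tail_zero_adj:
  assumes X: "X \<in> UU" and k: "k < m" and z: "tail_zero (MM X) k c"
  shows "tail_zero (MM (adj X)) k c"
  unfolding tail_zero_def
proof (intro allI impI)
  note cc = UU_carrier[OF X]
  fix l assume l: "l < m" "c \<le> l"
  have "(MM X * X\<^sup>T) $$ (k, l) = 0"
    unfolding mult_index_transpose[OF MM_carrier[OF cc] cc k l(1)]
  proof (intro sum.neutral ballI)
    fix b assume b: "b \<in> {..<m}"
    show "MM X $$ (k, b) * X $$ (l, b) = 0"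
      using z b unitri_zero[OF UU_unitri[OF X] l(1), of b] l unfolding tail_zero_def by (cases "b < l") auto
  qed
  thus "MM (adj X) $$ (k, l) = 0"
    unfolding MM_adj[OF X] using k l MM_carrier[OF cc] cc by simp
qed

text \<open>This makes the function on the root subgroup a homomorphism. The quadratic term dies
  because row \<open>k\<close> of \<open>X - 1\<close> starts at \<open>c2\<close>, where column
  \<open>j\<close> of \<open>MM Y\<close> has already ended.\<close>

lemma MM_mult_entry:
  assumes X: "X \<in> UU" and Y: "Y \<in> UU" and k: "k < m" "j < m" and c: "c1 + c2 = m"
    and z: "tail_zero (MM X) k c1" "tail_zero (MM Y) j c2"
  shows "MM (X * Y) $$ (k, j) = MM X $$ (k, j) + MM Y $$ (k, j)"
proof -
  note cc = UU_carrier[OF X] UU_carrier[OF Y]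
  have N: "X - 1\<^sub>m m \<in> carrier_mat m m" by simp
  \<comment> \<open>The hypothesis concerns row \<open>j\<close> of \<open>MM Y\<close>;
    \<open>MM_transpose\<close> carries it over to column \<open>j\<close>.\<close>
  have col: "MM Y $$ (b, j) = 0" if b: "b < m" "c2 \<le> b" for b
  proof -
    have "(MM Y * Y\<^sup>T) $$ (j, b) = 0"
      unfolding mult_index_transpose[OF MM_carrier[OF cc(2)] cc(2) k(2) b(1)]
    proof (intro sum.neutral ballI)
      fix d assume d: "d \<in> {..<m}"
      show "MM Y $$ (j, d) * Y $$ (b, d) = 0"
        using z(2) d unitri_zero[OF UU_unitri[OF Y] b(1), of d] b unfolding tail_zero_def by (cases "d < b") auto
    qed
    thus ?thesis unfolding MM_transpose[OF Y k(2) b(1)] by simp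
  qed
  have "((X - 1\<^sub>m m) * MM Y) $$ (k, j) = 0"
    unfolding mult_index[OF N MM_carrier[OF cc(2)] k]
  proof (intro sum.neutral ballI)
    fix b assume "b \<in> {..<m}"
    thus "(X - 1\<^sub>m m) $$ (k, b) * MM Y $$ (b, j) = 0"
      using tail_zero_N[OF X k(1) z(1), of b] col[of b] c by (cases "b < m - c1") auto
  qed
  thus ?thesis
    using k MM_carrier[OF cc(1)] MM_carrier[OF cc(2)] unfolding MM_mult[OF cc] by simp
qed

lemma MM_one: "MM (1\<^sub>m m) = 0\<^sub>m m m"
proof -
  have e: "1\<^sub>m m - 1\<^sub>m m = (0\<^sub>m m m :: 'a mat)" by (intro eq_matI) auto
  show ?thesis unfolding MM_def e by simp
qed

lemma root_subgroup_UU: "root_subgroup T n \<alpha> \<subseteq> UU"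
  by (cases \<alpha>) (auto simp: carrier_U_group)

lemma root_subgroup_iff_tail:
  assumes "\<alpha> \<in> roots T n" "X \<in> UU"
  shows "X \<in> root_subgroup T n \<alpha> \<longleftrightarrow> tail_zero (MM X) (ri \<alpha>) (cut \<alpha>) \<and> tail_zero (MM X) (rj \<alpha>) (m - cut \<alpha>)"
  unfolding tail_zero_def by (rule root_subgroup_iff[OF assms])

lemma subgroup_root_subgroup:
  assumes a: "\<alpha> \<in> roots T n"
  shows "subgroup (root_subgroup T n \<alpha> :: 'a mat set) (U_group T n)"
proof -
  interpret group "U_group T n :: 'a mat monoid" by (rule group_U_group)
  note b = root_bounds[OF a]
  have lt: "ri \<alpha> < m" "rj \<alpha> < m" "cut \<alpha> \<le> m" "m - cut \<alpha> \<le> m" using b(3,5) by auto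
  note sub = root_subgroup_UU[THEN subsetD]
  note iff = root_subgroup_iff_tail[OF a]
  show ?thesis
  proof (rule subgroupI)
    show "(root_subgroup T n \<alpha> :: 'a mat set) \<subseteq> carrier (U_group T n)"
      unfolding carrier_U_group by (rule root_subgroup_UU)
    have "1\<^sub>m m \<in> (root_subgroup T n \<alpha> :: 'a mat set)" unfolding iff[OF UU_one] MM_one tail_zero_def using lt by simp
    thus "root_subgroup T n \<alpha> \<noteq> ({} :: 'a mat set)" by blast
  next
    fix X :: "'a mat" assume X: "X \<in> root_subgroup T n \<alpha>"
    show "inv\<^bsub>U_group T n\<^esub> X \<in> root_subgroup T n \<alpha>"
      unfolding inv_U_group[OF sub[OF X]] iff[OF UU_adj[OF sub[OF X]]]
      using X tail_zero_adj[OF sub[OF X]] lt unfolding iff[OF sub[OF X]] by blast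
  next
    fix X Y :: "'a mat" assume X: "X \<in> root_subgroup T n \<alpha>" and Y: "Y \<in> root_subgroup T n \<alpha>"
    show "X \<otimes>\<^bsub>U_group T n\<^esub> Y \<in> root_subgroup T n \<alpha>"
      unfolding U_group_ops iff[OF UU_mult[OF sub[OF X] sub[OF Y]]]
      using X Y tail_zero_mult[OF sub[OF X] sub[OF Y]] lt unfolding iff[OF sub[OF X]] iff[OF sub[OF Y]] by blast
  qed
qed

lemma root_subgroup_add:
  assumes a: "\<alpha> \<in> roots T n" and X: "X \<in> root_subgroup T n \<alpha>" and Y: "Y \<in> root_subgroup T n \<alpha>"
  shows "MM (X * Y) $$ (ri \<alpha>, rj \<alpha>) = MM X $$ (ri \<alpha>, rj \<alpha>) + MM Y $$ (ri \<alpha>, rj \<alpha>)"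
proof -
  note b = root_bounds[OF a]
  have lt: "ri \<alpha> < m" "rj \<alpha> < m" "cut \<alpha> + (m - cut \<alpha>) = m" using b(3,5) by auto
  have U: "X \<in> UU" "Y \<in> UU" using X Y root_subgroup_UU by auto
  show ?thesis using X Y unfolding root_subgroup_iff_tail[OF a U(1)] root_subgroup_iff_tail[OF a U(2)]
    by (intro MM_mult_entry[OF U lt]) auto
qed

end

context unipotent_character
begin

lemma root_char_eq:
  assumes a: "\<alpha> \<in> roots T n" and X: "X \<in> root_subgroup T n \<alpha>"
  shows "root_char T n \<theta> \<alpha> \<rho> X = \<theta> (\<rho> * rsg \<alpha> * MM X $$ (ri \<alpha>, rj \<alpha>))"
proof -
  have "X \<in> UU" using X root_subgroup_UU by blast
  from positive_entry_MM[OF a this]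
  have "\<theta> (\<rho> * (case positive_entry T n \<alpha> of (i, j) \<Rightarrow> entry T n X i j)) = \<theta> (\<rho> * (rsg \<alpha> * MM X $$ (ri \<alpha>, rj \<alpha>)))"
    by (rule arg_cong)
  thus ?thesis using X by (simp add: root_char_def split_def mult.assoc)
qed

lemma elementary_char_urep:
  assumes a: "\<alpha> \<in> roots T n"
  shows "\<exists>(I :: 'a mat set) \<sigma>. urep (U_group T n) I \<sigma> \<and>
    (\<forall>X\<in>UU. utrace I \<sigma> X = elementary_char T n \<theta> \<alpha> \<rho> X)"
proof -
  let ?G = "U_group T n :: 'a mat monoid"
  let ?H = "root_subgroup T n \<alpha> :: 'a mat set"
  interpret group ?G by (rule group_U_group)
  interpret H: subgroup ?H ?G by (rule subgroup_root_subgroup[OF a])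
  let ?\<psi> = "root_char T n \<theta> \<alpha> \<rho>"
  have one: "1\<^sub>m m \<in> ?H" using H.one_closed by (simp add: U_group_ops)
  have val1: "MM (1\<^sub>m m) $$ (ri \<alpha>, rj \<alpha>) = 0" unfolding MM_one using root_bounds(3)[OF a] by simp
  have "\<exists>(I :: 'a mat set) \<sigma>. urep ?G I \<sigma> \<and> (\<forall>g\<in>carrier ?G. utrace I \<sigma> g = induced_char ?G ?H ?\<psi> g)"
  proof (rule induced_char_urep)
    show "group ?G" by (rule group_U_group)
    show "finite (carrier ?G)" by (simp add: carrier_U_group finite_UU)
    show "subgroup ?H ?G" by (rule subgroup_root_subgroup[OF a])
    fix X Y :: "'a mat" assume X: "X \<in> ?H" and Y: "Y \<in> ?H"
    have XY: "X * Y \<in> ?H" using H.m_closed[OF X Y] by (simp add: U_group_ops)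
    show "?\<psi> (X \<otimes>\<^bsub>?G\<^esub> Y) = ?\<psi> X * ?\<psi> Y"
      unfolding U_group_ops root_char_eq[OF a XY] root_char_eq[OF a X] root_char_eq[OF a Y] root_subgroup_add[OF a X Y]
      by (simp only: distrib_left th_add)
  next
    show "?\<psi> \<one>\<^bsub>?G\<^esub> = 1" unfolding U_group_ops root_char_eq[OF a one] val1 by simp
  next
    fix X :: "'a mat" assume X: "X \<in> ?H"
    hence U: "X \<in> UU" using root_subgroup_UU by blast
    have aX: "adj X \<in> ?H" using H.m_inv_closed[OF X] by (simp add: inv_U_group[OF U])
    have "MM (X * adj X) $$ (ri \<alpha>, rj \<alpha>) = 0" unfolding UU_right[OF U] val1 ..
    hence "MM (adj X) $$ (ri \<alpha>, rj \<alpha>) = - MM X $$ (ri \<alpha>, rj \<alpha>)"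
      unfolding root_subgroup_add[OF a X aX] by (simp only: add_eq_0_iff)
    thus "?\<psi> (inv\<^bsub>?G\<^esub> X) = cnj (?\<psi> X)"
      unfolding inv_U_group[OF U] root_char_eq[OF a aX] root_char_eq[OF a X] cnj_th by simp
  qed
  thus ?thesis by (simp add: carrier_U_group elementary_char_def)
qed

end

section \<open>From free vectors to rows of group elements\<close>

context unipotent
begin

text \<open>Agreement on the initial parts of rows \<open>i\<close> and \<open>j\<close> on which
  \<open>HH\<close> depends: length \<open>c2\<close> for the first vector and \<open>c1\<close> for
  the second.\<close>

definition agree :: "nat \<Rightarrow> nat \<Rightarrow> nat \<Rightarrow> nat \<Rightarrow> 'a mat \<Rightarrow> 'a mat \<Rightarrow> bool" where
  "agree i j c1 c2 z z' \<longleftrightarrow> (\<forall>k<c2. z $$ (i, k) = z' $$ (i, k)) \<and> (\<forall>l<c1. z $$ (j, l) = z' $$ (j, l))"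

lemma agree_mult:
  assumes g: "g \<in> unitri m" and z: "z \<in> carrier_mat m m" "z' \<in> carrier_mat m m" and ij: "i < m" "j < m"
    and c: "c1 \<le> m" "c2 \<le> m" and ag: "agree i j c1 c2 z z'"
  shows "agree i j c1 c2 (z * g) (z' * g)"
proof -
  note gc = unitri_carrier[OF g]
  have "(z * g) $$ (i, k) = (z' * g) $$ (i, k)"
    if "\<forall>k<c. z $$ (i, k) = z' $$ (i, k)" "k < c" "c \<le> m" "i < m" for i k c
  proof -
    have k: "k < m" using that by simp
    show ?thesis unfolding mult_index[OF z(1) gc that(4) k] mult_index[OF z(2) gc that(4) k]
    proof (intro sum.cong refl)
      fix b assume "b \<in> {..<m}"
      thus "z $$ (i, b) * g $$ (b, k) = z' $$ (i, b) * g $$ (b, k)"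
        using that unitri_zero[OF g, of b k] by (cases "k < b") auto
    qed
  qed
  thus ?thesis using ag c ij unfolding agree_def by blast
qed

lemma row_UU: "z \<in> UU \<Longrightarrow> i < m \<Longrightarrow> row z i \<in> VV i"
  using unitri_zero[OF UU_unitri, of z i] unitri_diag[OF UU_unitri, of z i] UU_carrier[of z] by (auto simp: VV_def)

text \<open>Only initial parts of the two rows are prescribed, and these fit into the blocks
  \<open>x\<close> and \<open>u\<close> that \<open>UU_exists\<close> leaves free. If
  \<open>rj \<alpha>\<close> is not a top row, its initial part ends at the diagonal and is forced
  anyway.\<close>

lemma UU_rows_exist:
  assumes a: "\<alpha> \<in> roots T n" and st: "(s, t) \<in> WW (ri \<alpha>) (rj \<alpha>)"
  obtains z where "z \<in> UU" "\<And>k. k < m - cut \<alpha> \<Longrightarrow> z $$ (ri \<alpha>, k) = s $ k" "\<And>l. l < cut \<alpha> \<Longrightarrow> z $$ (rj \<alpha>, l) = t $ l"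
proof -
  note b = root_bounds[OF a]
  let ?i = "ri \<alpha>" and ?j = "rj \<alpha>"
  have s: "s $ ?i = 1" "\<And>k. k < ?i \<Longrightarrow> s $ k = 0" and t: "t $ ?j = 1" "\<And>k. k < ?j \<Longrightarrow> t $ k = 0"
    and eq: "?i = ?j \<Longrightarrow> s = t" using st by (auto simp: WW_def VV_def)
  define x where "x = mat n n (\<lambda>(p, q). if p = ?i then s $ q else if p = ?j then t $ q else if p = q then 1 else 0)"
  have x: "x \<in> unitri n" using s t by (auto simp: unitri_iff x_def)
  define u where "u = mat n r (\<lambda>(p, q). if p = ?j then t $ (n + q) else 0)"
  have u: "u \<in> carrier_mat n r" by (simp add: u_def)
  obtain z where z: "z \<in> UU" "\<And>k p. k < n \<Longrightarrow> p < n \<Longrightarrow> z $$ (k, p) = x $$ (k, p)"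
    "\<And>k q. k < n \<Longrightarrow> q < r \<Longrightarrow> z $$ (k, n + q) = u $$ (k, q)" using UU_exists[OF x u] by metis
  show thesis
  proof (rule that[OF z(1)])
    fix k assume "k < m - cut \<alpha>"
    hence "k < n" using b(7) by simp
    thus "z $$ (?i, k) = s $ k" using z(2)[OF b(1)] b(1) by (simp add: x_def)
  next
    fix l assume l: "l < cut \<alpha>"
    show "z $$ (?j, l) = t $ l"
    proof (cases "?j < n")
      case True
      hence "l < n + r" using b(8) l by simp
      show ?thesis
      proof (cases "l < n")
        case l: True
        thus ?thesis using z(2)[OF True l] True eq by (auto simp: x_def)
      next
        case False
        then obtain q where q: "l = n + q" "q < r" using \<open>l < n + r\<close> by (metis add_diff_inverse_nat nat_add_left_cancel_less)
        show ?thesis unfolding q(1) z(3)[OF True q(2)] using True q(2) by (simp add: u_def)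
      qed
    next
      case False
      \<comment> \<open>The initial part now consists of the zeros before the diagonal and the
        diagonal 1, in \<open>t\<close> as in \<open>z\<close>.\<close>
      hence c: "cut \<alpha> = Suc ?j" using b(9) by simp
      have j: "?j < m" using b(3) by simp
      show ?thesis
      proof (cases "l = ?j")
        case True thus ?thesis using unitri_diag[OF UU_unitri[OF z(1)] j] t by simp
      next
        case False
        hence "l < ?j" using l c by simp
        thus ?thesis using unitri_zero[OF UU_unitri[OF z(1)] j] t by simp
      qed
    qed
  qed
qed

end

context unipotent_character
begin

text \<open>A coordinate of \<open>s\<close> times \<open>S\<close> from \<open>c1\<close> on
  involves only the first \<open>c2\<close> coordinates of \<open>s\<close>, because
  \<open>S\<close> vanishes on and below the antidiagonal; similarly for \<open>t\<close>. Once the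
  tail conditions hold, the bilinear value also sees only these initial parts.\<close>

lemma HH_cong:
  assumes S: "S \<in> LL" and c: "c1 + c2 = m"
    and cv: "s \<in> carrier_vec m" "t \<in> carrier_vec m" "s' \<in> carrier_vec m" "t' \<in> carrier_vec m"
    and ag: "\<And>k. k < c2 \<Longrightarrow> s $ k = s' $ k" "\<And>l. l < c1 \<Longrightarrow> t $ l = t' $ l"
  shows "HH \<rho> c1 c2 S s t = HH \<rho> c1 c2 S s' t'"
proof -
  have lvc: "lv S v l = lv S v' l"
    if "\<And>k. k < d \<Longrightarrow> v $ k = v' $ k" "m \<le> d + l + 1" "l < m" for v v' d l
    unfolding lv_def
  proof (intro sum.cong refl)
    fix k assume "k \<in> {..<m}"
    thus "v $ k * S $$ (k, l) = v' $ k * S $$ (k, l)"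
      using that LL_zero[OF S, of k l] by (cases "k < d") auto
  qed
  have e1: "lv S s l = lv S s' l" if "l < m" "c1 \<le> l" for l using lvc[of c2 s s' l] ag(1) that c by simp
  have e2: "lv S t l = lv S t' l" if "l < m" "c2 \<le> l" for l using lvc[of c1 t t' l] ag(2) that c by simp
  show ?thesis
  proof (cases "(\<forall>l<m. c1 \<le> l \<longrightarrow> lv S s l = 0) \<and> (\<forall>l<m. c2 \<le> l \<longrightarrow> lv S t l = 0)")
    case True
    have "bil S s t = bil S s t'"
      unfolding bil_def
    proof (intro sum.cong refl)
      fix l assume "l \<in> {..<m}"
      thus "lv S s l * t $ l = lv S s l * t' $ l" using True ag(2) by (cases "l < c1") auto
    qed
    also have "\<dots> = ep * bil S t' s" by (rule bil_sym[OF S])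
    also have "bil S t' s = bil S t' s'"
      unfolding bil_def
    proof (intro sum.cong refl)
      fix l assume "l \<in> {..<m}"
      thus "lv S t' l * s $ l = lv S t' l * s' $ l" using True ag(1) e2 by (cases "l < c2") auto
    qed
    also have "ep * bil S t' s' = bil S s' t'" by (rule bil_sym[OF S, symmetric])
    finally have "bil S s t = bil S s' t'" .
    moreover have "(\<forall>l<m. c1 \<le> l \<longrightarrow> lv S s' l = 0) \<and> (\<forall>l<m. c2 \<le> l \<longrightarrow> lv S t' l = 0)" using True e1 e2 by simp
    ultimately show ?thesis using True unfolding HH_def by simp
  next
    case False
    hence "\<not> ((\<forall>l<m. c1 \<le> l \<longrightarrow> lv S s' l = 0) \<and> (\<forall>l<m. c2 \<le> l \<longrightarrow> lv S t' l = 0))" using e1 e2 by simp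
    thus ?thesis using False unfolding HH_def by (simp only: if_False)
  qed
qed

text \<open>Both sides of the following identity arise from the sum of \<open>HH\<close> over the pairs consisting of
  some \<open>z \<in> U\<close> and some \<open>(s, t)\<close> that agrees with the relevant parts of two rows of \<open>z\<close>; the fibres
  have constant size because \<open>U\<close> and the group of tails act on them.\<close>

lemma sum_HH_rows:
  assumes a: "\<alpha> \<in> roots T n"
  obtains K N :: nat where "K > 0" "N > 0"
    "\<And>S \<rho>. S \<in> LL \<Longrightarrow> of_nat N * (\<Sum>z\<in>UU. HH \<rho> (cut \<alpha>) (m - cut \<alpha>) S (row z (ri \<alpha>)) (row z (rj \<alpha>))) =
      of_nat K * (\<Sum>(s, t)\<in>WW (ri \<alpha>) (rj \<alpha>). HH \<rho> (cut \<alpha>) (m - cut \<alpha>) S s t)"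
proof -
  note b = root_bounds[OF a]
  let ?i = "ri \<alpha>" and ?j = "rj \<alpha>" and ?c1 = "cut \<alpha>" and ?c2 = "m - cut \<alpha>"
  have lt: "?i < m" "?j < m" "?c1 \<le> m" "?c2 \<le> m" "?c1 + ?c2 = m" using b(3,5) by auto
  let ?W = "WW ?i ?j"
  \<comment> \<open>The relation for the double count: the pair \<open>p\<close> shows the same
    initial parts as rows \<open>?i\<close> and \<open>?j\<close> of \<open>z\<close>.\<close>
  define rel where "rel z p \<longleftrightarrow> (\<forall>k<?c2. z $$ (?i, k) = fst p $ k) \<and> (\<forall>l<?c1. z $$ (?j, l) = snd p $ l)"
    for z :: "'a mat" and p :: "'a vec \<times> 'a vec"
  define K where "K = card {z \<in> UU. agree ?i ?j ?c1 ?c2 z (1\<^sub>m m)}"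
  define N where "N = card {p \<in> ?W. rel (1\<^sub>m m) p}"
  let ?e = "(row (1\<^sub>m m) ?i, row (1\<^sub>m m) ?j) :: 'a vec \<times> 'a vec"
  have rowsW: "(row z ?i, row z ?j) \<in> ?W" if "z \<in> UU" for z
    using row_UU[OF that lt(1)] row_UU[OF that lt(2)] by (auto simp: WW_def)
  have relrow: "rel z (row z ?i, row z ?j)" if "z \<in> UU" for z
    using UU_carrier[OF that] lt unfolding rel_def by auto
  have K0: "K > 0"
  proof -
    have "1\<^sub>m m \<in> {z \<in> UU. agree ?i ?j ?c1 ?c2 z (1\<^sub>m m)}" using UU_one by (simp add: agree_def)
    thus ?thesis unfolding K_def card_gt_0_iff using finite_UU by auto
  qed
  have N0: "N > 0"
  proof -
    have "?e \<in> {p \<in> ?W. rel (1\<^sub>m m) p}" using rowsW[OF UU_one] relrow[OF UU_one] by simp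
    thus ?thesis unfolding N_def card_gt_0_iff using finite_WW by auto
  qed
  \<comment> \<open>Right multiplication by some \<open>g\<close> realizing \<open>p\<close> carries
    the fibre over the identity rows to the fibre over \<open>p\<close>.\<close>
  have cardK: "card {z \<in> UU. rel z p} = K" if p: "p \<in> ?W" for p
  proof -
    obtain g where g: "g \<in> UU" "rel g p"
      using UU_rows_exist[OF a, of "fst p" "snd p"] p unfolding rel_def by (metis prod.collapse)
    have relg: "rel z p \<longleftrightarrow> agree ?i ?j ?c1 ?c2 z g" for z using g(2) unfolding rel_def agree_def by auto
    note gc = UU_carrier[OF g(1)] UU_carrier[OF UU_adj[OF g(1)]]
    have "bij_betw (\<lambda>z. z * g) {z \<in> UU. agree ?i ?j ?c1 ?c2 z (1\<^sub>m m)} {z \<in> UU. rel z p}"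
    proof (rule bij_betw_byWitness[where f' = "\<lambda>z. z * adj g"])
      have cancel: "z * g * adj g = z" "z * adj g * g = z" if "z \<in> UU" for z
        using UU_carrier[OF that] gc by (simp_all add: mult_assoc UU_right[OF g(1)] UU_left[OF g(1)])
      show "\<forall>z\<in>{z \<in> UU. agree ?i ?j ?c1 ?c2 z (1\<^sub>m m)}. z * g * adj g = z" using cancel by blast
      show "\<forall>z\<in>{z \<in> UU. rel z p}. z * adj g * g = z" using cancel by blast
      show "(\<lambda>z. z * g) ` {z \<in> UU. agree ?i ?j ?c1 ?c2 z (1\<^sub>m m)} \<subseteq> {z \<in> UU. rel z p}"
      proof clarify
        fix z assume z: "z \<in> UU" "agree ?i ?j ?c1 ?c2 z (1\<^sub>m m)"
        have "agree ?i ?j ?c1 ?c2 (z * g) (1\<^sub>m m * g)"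
          by (rule agree_mult[OF UU_unitri[OF g(1)] UU_carrier[OF z(1)] one_carrier_mat lt(1-4) z(2)])
        thus "z * g \<in> UU \<and> rel (z * g) p" using UU_mult[OF z(1) g(1)] gc by (simp add: relg)
      qed
      show "(\<lambda>z. z * adj g) ` {z \<in> UU. rel z p} \<subseteq> {z \<in> UU. agree ?i ?j ?c1 ?c2 z (1\<^sub>m m)}"
      proof clarify
        fix z assume z: "z \<in> UU" "rel z p"
        have "agree ?i ?j ?c1 ?c2 (z * adj g) (g * adj g)"
          using z(2) unfolding relg
          by (intro agree_mult[OF UU_unitri[OF UU_adj[OF g(1)]] UU_carrier[OF z(1)] gc(1) lt(1-4)])
        thus "z * adj g \<in> UU \<and> agree ?i ?j ?c1 ?c2 (z * adj g) (1\<^sub>m m)"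
          using UU_mult[OF z(1) UU_adj[OF g(1)]] by (simp add: UU_right[OF g(1)])
      qed
    qed
    from bij_betw_same_card[OF this] show ?thesis by (simp add: K_def)
  qed
  have cardN: "card {p \<in> ?W. rel z p} = N" if z: "z \<in> UU" for z
  proof -
    \<comment> \<open>The translations that carry identity rows to rows of \<open>z\<close>. They
      vanish up to the leading position, so leading entries are kept, and they coincide if the two
      rows do.\<close>
    define v where "v = row z ?i - row (1\<^sub>m m) ?i"
    define w where "w = row z ?j - row (1\<^sub>m m) ?j"
    have zc: "dim_row z = m" "dim_col z = m" using UU_carrier[OF z] by auto
    have vc: "v \<in> carrier_vec m" "w \<in> carrier_vec m" unfolding v_def w_def
      by (intro minus_carrier_vec row_carrier_vec[OF _ UU_carrier[OF z]] row_carrier_vec[OF _ one_carrier_mat] lt)+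
    have vi: "v $ k = z $$ (?i, k) - 1\<^sub>m m $$ (?i, k)" "w $ k = z $$ (?j, k) - 1\<^sub>m m $$ (?j, k)" if "k < m" for k
      using that zc lt by (simp_all add: v_def w_def)
    have vw: "?i = ?j \<Longrightarrow> v = w" by (simp add: v_def w_def)
    have v0: "v $ k = 0" if "k \<le> ?i" for k
      using that vi[of k] lt unitri_zero[OF UU_unitri[OF z] lt(1), of k] unitri_diag[OF UU_unitri[OF z] lt(1)]
      by (cases "k = ?i") auto
    have w0: "w $ k = 0" if "k \<le> ?j" for k
      using that vi[of k] lt unitri_zero[OF UU_unitri[OF z] lt(2), of k] unitri_diag[OF UU_unitri[OF z] lt(2)]
      by (cases "k = ?j") auto
    have "bij_betw (\<lambda>p. (fst p + v, snd p + w)) {p \<in> ?W. rel (1\<^sub>m m) p} {p \<in> ?W. rel z p}"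
    proof (rule bij_betw_byWitness[where f' = "\<lambda>p. (fst p - v, snd p - w)"])
      have carr: "fst p \<in> carrier_vec m" "snd p \<in> carrier_vec m" if "p \<in> ?W" for p
        using that by (auto simp: WW_def VV_def)
      have id: "x + y - y = x" "x - y + y = x" if "x \<in> carrier_vec m" "y \<in> carrier_vec m" for x y :: "'a vec"
        using that by (auto intro!: eq_vecI)
      show "\<forall>p\<in>{p \<in> ?W. rel (1\<^sub>m m) p}. (fst (fst p + v, snd p + w) - v, snd (fst p + v, snd p + w) - w) = p"
        using carr vc id by auto
      show "\<forall>p\<in>{p \<in> ?W. rel z p}. (fst (fst p - v, snd p - w) + v, snd (fst p - v, snd p - w) + w) = p"
        using carr vc id by auto
      have V: "x + v \<in> VV ?i" "x - v \<in> VV ?i" if "x \<in> VV ?i" for x using that vc v0 lt by (auto simp: VV_def)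
      have V': "x + w \<in> VV ?j" "x - w \<in> VV ?j" if "x \<in> VV ?j" for x using that vc w0 lt by (auto simp: VV_def)
      show "(\<lambda>p. (fst p + v, snd p + w)) ` {p \<in> ?W. rel (1\<^sub>m m) p} \<subseteq> {p \<in> ?W. rel z p}"
      proof (clarsimp)
        fix s t assume st: "(s, t) \<in> ?W" "rel (1\<^sub>m m) (s, t)"
        have "(s + v, t + w) \<in> ?W" using st(1) V V' vw by (auto simp: WW_def)
        moreover have "rel z (s + v, t + w)"
          using st(2) carr[OF st(1)] vc vi lt unfolding rel_def by auto
        ultimately show "(s + v, t + w) \<in> ?W \<and> rel z (s + v, t + w)" by blast
      qed
      show "(\<lambda>p. (fst p - v, snd p - w)) ` {p \<in> ?W. rel z p} \<subseteq> {p \<in> ?W. rel (1\<^sub>m m) p}"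
      proof (clarsimp)
        fix s t assume st: "(s, t) \<in> ?W" "rel z (s, t)"
        have "(s - v, t - w) \<in> ?W" using st(1) V V' vw by (auto simp: WW_def)
        moreover have "rel (1\<^sub>m m) (s - v, t - w)"
          using st(2) carr[OF st(1)] vc vi lt unfolding rel_def by auto
        ultimately show "(s - v, t - w) \<in> ?W \<and> rel (1\<^sub>m m) (s - v, t - w)" by blast
      qed
    qed
    from bij_betw_same_card[OF this] show ?thesis by (simp add: N_def)
  qed
  \<comment> \<open>Both sides count the related pairs \<open>(z, p)\<close>, weighted by
    \<open>HH\<close>; within a related pair the weight can be computed from either member.\<close>
  have "of_nat N * (\<Sum>z\<in>UU. HH \<rho> ?c1 ?c2 S (row z ?i) (row z ?j)) = of_nat K * (\<Sum>(s, t)\<in>?W. HH \<rho> ?c1 ?c2 S s t)"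
    if S: "S \<in> LL" for S \<rho>
  proof -
    let ?h = "\<lambda>p. HH \<rho> ?c1 ?c2 S (fst p) (snd p)"
    have "of_nat N * (\<Sum>z\<in>UU. HH \<rho> ?c1 ?c2 S (row z ?i) (row z ?j)) =
        (\<Sum>z\<in>UU. \<Sum>p\<in>{p \<in> ?W. rel z p}. HH \<rho> ?c1 ?c2 S (row z ?i) (row z ?j))"
      by (simp add: cardN sum_distrib_left)
    also have "\<dots> = (\<Sum>z\<in>UU. \<Sum>p\<in>{p \<in> ?W. rel z p}. ?h p)"
    proof (intro sum.cong refl)
      fix z p assume z: "z \<in> UU" and p: "p \<in> {p \<in> ?W. rel z p}"
      have zc: "z \<in> carrier_mat m m" using UU_carrier[OF z] .
      show "HH \<rho> ?c1 ?c2 S (row z ?i) (row z ?j) = ?h p"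
        by (rule HH_cong[OF S lt(5)]) (use p zc lt in \<open>auto simp: rel_def WW_def VV_def\<close>)
    qed
    also have "\<dots> = (\<Sum>z\<in>UU. \<Sum>p\<in>?W. if rel z p then ?h p else 0)"
      by (simp add: sum.If_cases finite_WW Int_def)
    also have "\<dots> = (\<Sum>p\<in>?W. \<Sum>z\<in>UU. if rel z p then ?h p else 0)" by (rule sum.swap)
    also have "\<dots> = (\<Sum>p\<in>?W. \<Sum>z\<in>{z \<in> UU. rel z p}. ?h p)"
      by (simp add: sum.If_cases finite_UU Int_def)
    also have "\<dots> = of_nat K * (\<Sum>(s, t)\<in>?W. HH \<rho> ?c1 ?c2 S s t)"
      by (simp add: cardK sum_distrib_left split_def)
    finally show ?thesis .
  qed
  thus thesis using that K0 N0 by blast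
qed

text \<open>Conjugation by \<open>z\<close> turns \<open>MM X\<close> into
  \<open>z * MM X * z\<^sup>T\<close>, whose rows come from rows of \<open>z\<close>. Membership of
  the conjugate in the root subgroup is a pair of tail conditions, insensitive to replacing
  \<open>MM X\<close> by \<open>SS X\<close>, and under them the character value is the bilinear
  form of \<open>SS X\<close>. The induced character is thus a sum of \<open>HH\<close> over rows of
  group elements. The constant collects the two fibre sizes and the order of the subgroup.\<close>

lemma elementary_char_formula:
  assumes a: "\<alpha> \<in> roots T n" and \<rho>: "\<rho> \<noteq> 0"
  obtains C where "C \<noteq> 0" "\<And>X. X \<in> UU \<Longrightarrow> elementary_char T n \<theta> \<alpha> \<rho> X = C * GG (\<rho> * rsg \<alpha>) (ri \<alpha>) (rj \<alpha>) (SS X)"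
proof -
  note b = root_bounds[OF a]
  let ?i = "ri \<alpha>" and ?j = "rj \<alpha>" and ?c1 = "cut \<alpha>" and ?c2 = "m - cut \<alpha>" and ?\<rho> = "\<rho> * rsg \<alpha>"
  let ?H = "root_subgroup T n \<alpha> :: 'a mat set"
  have lt: "?i < m" "?j < m" "?c1 + ?c2 = m" using b(3,5) by auto
  obtain K N :: nat where KN: "K > 0" "N > 0"
    "\<And>S \<rho>. S \<in> LL \<Longrightarrow> of_nat N * (\<Sum>z\<in>UU. HH \<rho> ?c1 ?c2 S (row z ?i) (row z ?j)) = of_nat K * (\<Sum>(s, t)\<in>WW ?i ?j. HH \<rho> ?c1 ?c2 S s t)"
    using sum_HH_rows[OF a] by blast
  have H1: "1\<^sub>m m \<in> ?H"
    using subgroup.one_closed[OF subgroup_root_subgroup[OF a]] by (simp add: U_group_ops)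
  have cH: "card ?H > 0" unfolding card_gt_0_iff using finite_subset[OF root_subgroup_UU finite_UU, of \<alpha>] H1 by blast
  have \<rho>0: "?\<rho> \<noteq> 0" using \<rho> by (simp add: rsg_def sg_def)
  define C where "C = (of_nat K / of_nat N / of_nat (card ?H) :: complex)"
  have "C \<noteq> 0" using KN cH by (simp add: C_def)
  moreover have "elementary_char T n \<theta> \<alpha> \<rho> X = C * GG ?\<rho> ?i ?j (SS X)" if X: "X \<in> UU" for X
  proof -
    have Xc: "X \<in> carrier_mat m m" using UU_carrier[OF X] .
    have S: "SS X \<in> LL" by (rule SS_in_LL[OF X])
    let ?f = "\<lambda>y. if y \<in> ?H then root_char T n \<theta> \<alpha> \<rho> y else 0"
    have term_z: "?f (z * X * adj z) = HH ?\<rho> ?c1 ?c2 (SS X) (row z ?i) (row z ?j)" if z: "z \<in> UU" for z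
    proof -
      have zc: "z \<in> carrier_mat m m" "z\<^sup>T \<in> carrier_mat m m" "(adj z)\<^sup>T \<in> carrier_mat m m" using UU_carrier[OF z] by auto
      have dz: "dim_row z = m" "dim_col z = m" using zc by auto
      define Y where "Y = z * X * adj z"
      have Y: "Y \<in> UU" unfolding Y_def using z X by (intro UU_mult UU_adj)
      have MX: "MM X \<in> carrier_mat m m" "MM X * z\<^sup>T \<in> carrier_mat m m" using MM_carrier[OF Xc] zc by auto
      have "Y - 1\<^sub>m m = z * (X - 1\<^sub>m m) * adj z"
        unfolding Y_def using zc Xc
        by (simp add: mult_minus_distrib_mat[of _ m m _ m] minus_mult_distrib_mat[of _ m m _ _ m] UU_right[OF z])
      hence "MM Y = z * (X - 1\<^sub>m m) * adj z * Om" by (simp add: MM_def)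
      also have "\<dots> = z * ((X - 1\<^sub>m m) * (adj z * Om))" using zc by (simp add: mult_assoc)
      also have "\<dots> = z * (MM X * z\<^sup>T)" unfolding adj_Om[OF zc(1)] MM_def using zc by (simp add: mult_assoc)
      finally have MY: "MM Y = z * (MM X * z\<^sup>T)" .
      have ent: "MM Y $$ (k, l) = lv (MM X * z\<^sup>T) (row z k) l" if "k < m" "l < m" for k l
        unfolding MY mult_index[OF zc(1) MX(2) that] lv_def using that dz by simp
      have bk: "MM X * z\<^sup>T * (adj z)\<^sup>T = MM X"
      proof -
        have "z\<^sup>T * (adj z)\<^sup>T = 1\<^sub>m m" using transpose_mult[OF adj_carrier zc(1), of z] UU_left[OF z] by simp
        thus ?thesis using MX zc by (simp add: mult_assoc)
      qed
      have tail: "tail_zero (MM Y) k c \<longleftrightarrow> (\<forall>l<m. c \<le> l \<longrightarrow> lv (SS X) (row z k) l = 0)" if k: "k < m" for k c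
      proof -
        have "tail_zero (MM Y) k c \<longleftrightarrow> (\<forall>l<m. c \<le> l \<longrightarrow> lv (MM X * z\<^sup>T) (row z k) l = 0)"
          unfolding tail_zero_def using ent[OF k] by auto
        also have "\<dots> \<longleftrightarrow> (\<forall>l<m. c \<le> l \<longrightarrow> lv (MM X) (row z k) l = 0)"
        proof
          assume *: "\<forall>l<m. c \<le> l \<longrightarrow> lv (MM X * z\<^sup>T) (row z k) l = 0"
          show "\<forall>l<m. c \<le> l \<longrightarrow> lv (MM X) (row z k) l = 0"
          proof (intro allI impI)
            fix l assume l: "l < m" "c \<le> l"
            have "lv (MM X * z\<^sup>T * (adj z)\<^sup>T) (row z k) l = 0"
              by (rule lv_tail[OF MX(2) adj_unitri[OF UU_unitri[OF z]] _ l]) (use * in blast)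
            thus "lv (MM X) (row z k) l = 0" unfolding bk .
          qed
        next
          assume *: "\<forall>l<m. c \<le> l \<longrightarrow> lv (MM X) (row z k) l = 0"
          show "\<forall>l<m. c \<le> l \<longrightarrow> lv (MM X * z\<^sup>T) (row z k) l = 0"
          proof (intro allI impI)
            fix l assume l: "l < m" "c \<le> l"
            show "lv (MM X * z\<^sup>T) (row z k) l = 0"
              by (rule lv_tail[OF MX(1) UU_unitri[OF z] _ l]) (use * in blast)
          qed
        qed
        also have "\<dots> \<longleftrightarrow> (\<forall>l<m. c \<le> l \<longrightarrow> lv (SS X) (row z k) l = 0)" by (rule lv_MM_SS_tail[OF UU_unitri[OF X]])
        finally show ?thesis .
      qed
      note iff = root_subgroup_iff_tail[OF a Y, unfolded tail[OF lt(1)] tail[OF lt(2)]]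
      show ?thesis
      proof (cases "Y \<in> ?H")
        case True
        have "MM Y $$ (?i, ?j) = bil (MM X) (row z ?i) (row z ?j)"
          unfolding ent[OF lt(1,2)] lv_mult[OF MX(1) zc(2) lt(2)] bil_def using lt dz by (intro sum.cong refl) simp
        also have "\<dots> = bil (SS X) (row z ?i) (row z ?j)"
          by (rule bil_MM_SS[OF X lt(3)]) (use True iff in blast)+
        finally have "root_char T n \<theta> \<alpha> \<rho> Y = \<theta> (?\<rho> * bil (SS X) (row z ?i) (row z ?j))"
          unfolding root_char_eq[OF a True] by (rule arg_cong)
        thus ?thesis unfolding Y_def[symmetric] HH_def using True iff by (simp only: if_True simp_thms)
      next
        case False
        thus ?thesis unfolding Y_def[symmetric] HH_def using iff by (simp only: if_False simp_thms)
      qed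
    qed
    \<comment> \<open>Replacing the conjugating element by its inverse puts \<open>z\<close> on the
      left of \<open>X\<close>, so that its rows, rather than its columns, enter.\<close>
    have "(\<Sum>x\<in>UU. ?f (adj x * X * x)) = (\<Sum>z\<in>UU. ?f (adj (adj z) * X * adj z))"
    proof -
      have "bij_betw adj UU UU"
        by (intro bij_betw_byWitness[where f' = adj]) (auto simp: UU_adj adj_adj UU_carrier)
      from sum.reindex_bij_betw[OF this, symmetric] show ?thesis .
    qed
    also have "\<dots> = (\<Sum>z\<in>UU. HH ?\<rho> ?c1 ?c2 (SS X) (row z ?i) (row z ?j))"
      using term_z by (intro sum.cong refl) (simp only: adj_adj[OF UU_carrier])
    also have "\<dots> = of_nat K / of_nat N * (\<Sum>(s, t)\<in>WW ?i ?j. HH ?\<rho> ?c1 ?c2 (SS X) s t)"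
      using KN(3)[OF S, of ?\<rho>] KN(2) by (simp add: field_simps)
    also have "(\<Sum>(s, t)\<in>WW ?i ?j. HH ?\<rho> ?c1 ?c2 (SS X) s t) = GG ?\<rho> ?i ?j (SS X)"
      using b lt \<rho>0 by (intro GG_eq_sum_HH[OF S, symmetric]) auto
    finally have "(\<Sum>x\<in>UU. ?f (adj x * X * x)) = of_nat K / of_nat N * GG ?\<rho> ?i ?j (SS X)" .
    moreover have "elementary_char T n \<theta> \<alpha> \<rho> X = (\<Sum>x\<in>UU. ?f (adj x * X * x)) / of_nat (card ?H)"
      unfolding elementary_char_def induced_char_def using X
      by (simp add: carrier_U_group U_group_ops inv_U_group Let_def cong: sum.cong)
    ultimately show ?thesis by (simp add: C_def)
  qed
  ultimately show thesis using that by blast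
qed

end

section \<open>Congruence normal forms\<close>

context unipotent
begin

text \<open>The row vector \<open>s\<close> times \<open>g\<close>. Congruence of the form by
  \<open>g\<close> becomes this substitution in both vectors.\<close>

definition act :: "'a mat \<Rightarrow> 'a vec \<Rightarrow> 'a vec" where
  "act g s = vec m (\<lambda>k. \<Sum>a<m. s $ a * g $$ (a, k))"

lemma act_carrier [simp]: "act g s \<in> carrier_vec m" by (simp add: act_def)

lemma act_mult:
  assumes "g \<in> carrier_mat m m" "h \<in> carrier_mat m m"
  shows "act h (act g s) = act (g * h) s"
proof (rule eq_vecI)
  fix k assume "k < dim_vec (act (g * h) s)"
  hence k: "k < m" by (simp add: act_def)
  have "act h (act g s) $ k = (\<Sum>b<m. \<Sum>a<m. s $ a * g $$ (a, b) * h $$ (b, k))"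
    using k by (simp add: act_def sum_distrib_right)
  also have "\<dots> = (\<Sum>a<m. \<Sum>b<m. s $ a * g $$ (a, b) * h $$ (b, k))" by (rule sum.swap)
  also have "\<dots> = act (g * h) s $ k"
    using k by (simp add: act_def mult_index[OF assms] sum_distrib_left mult.assoc)
  finally show "act h (act g s) $ k = act (g * h) s $ k" .
qed (simp add: act_def)

lemma act_one: "s \<in> carrier_vec m \<Longrightarrow> act (1\<^sub>m m) s = s"
proof (rule eq_vecI)
  fix k assume s: "s \<in> carrier_vec m" and "k < dim_vec s"
  hence k: "k < m" by simp
  have "act (1\<^sub>m m) s $ k = (\<Sum>a<m. if a = k then s $ a else 0)"
    using k unfolding act_def index_vec[OF k] by (intro sum.cong refl) simp
  thus "act (1\<^sub>m m) s $ k = s $ k" using k by simp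
qed (simp add: act_def)

lemma act_VV:
  assumes g: "g \<in> unitri m" and i: "i < m" and s: "s \<in> VV i"
  shows "act g s \<in> VV i"
proof -
  have "act g s $ k = (if k = i then 1 else 0)" if k: "k \<le> i" for k
  proof -
    have km: "k < m" using k i by simp
    have "s $ a * g $$ (a, k) = (if a = i \<and> k = i then 1 else 0)" if "a < m" for a
      using s k unitri_zero[OF g that, of k] unitri_diag[OF g i] that
      by (cases a i rule: linorder_cases) (auto simp: VV_def)
    hence "(\<Sum>a<m. s $ a * g $$ (a, k)) = (\<Sum>a<m. if a = i then (if k = i then 1 else 0) else 0)"
      by (intro sum.cong refl) simp
    thus ?thesis unfolding act_def index_vec[OF km] using i by simp
  qed
  thus ?thesis by (simp add: VV_def)
qed

lemma lv_act: "l < m \<Longrightarrow> S \<in> carrier_mat m m \<Longrightarrow> g \<in> carrier_mat m m \<Longrightarrow> lv S (act g s) l = lv (g * S) s l"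
proof -
  assume l: "l < m" and S: "S \<in> carrier_mat m m" and g: "g \<in> carrier_mat m m"
  have "lv S (act g s) l = (\<Sum>k<m. (\<Sum>a<m. s $ a * g $$ (a, k)) * S $$ (k, l))"
    unfolding lv_def by (intro sum.cong refl) (simp add: act_def)
  also have "\<dots> = lv (g * S) s l" unfolding lv_mult[OF g S l] by (simp add: lv_def)
  finally show ?thesis .
qed

lemma bil_cong:
  assumes S: "S \<in> carrier_mat m m" and g: "g \<in> carrier_mat m m"
  shows "bil (g * S * g\<^sup>T) s t = bil S (act g s) (act g t)"
proof -
  have gT: "g\<^sup>T \<in> carrier_mat m m" using g by simp
  have gS: "g * S \<in> carrier_mat m m" using g S by simp
  have "bil (g * S * g\<^sup>T) s t = (\<Sum>l<m. \<Sum>b<m. lv (g * S) s b * (t $ l * g $$ (l, b)))"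
    unfolding bil_def using g
    by (intro sum.cong refl) (simp add: lv_mult[OF gS gT] sum_distrib_right mult.assoc mult.commute[of "t $ _"])
  also have "\<dots> = (\<Sum>b<m. \<Sum>l<m. lv (g * S) s b * (t $ l * g $$ (l, b)))" by (rule sum.swap)
  also have "\<dots> = bil S (act g s) (act g t)"
    unfolding bil_def sum_distrib_left[symmetric]
  proof (intro sum.cong refl)
    fix b assume "b \<in> {..<m}"
    hence "lv (g * S) s b = lv S (act g s) b" "(\<Sum>l<m. t $ l * g $$ (l, b)) = act g t $ b"
      by (simp_all only: lv_act[OF _ S g] lessThan_iff) (simp add: act_def)
    thus "lv (g * S) s b * (\<Sum>l<m. t $ l * g $$ (l, b)) = lv S (act g s) b * act g t $ b" by (simp only:)
  qed
  finally show ?thesis .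
qed

lemma bij_act_WW:
  assumes g: "g \<in> unitri m" and ij: "i < m" "j < m"
  shows "bij_betw (\<lambda>p. (act g (fst p), act g (snd p))) (WW i j) (WW i j)"
proof -
  note u = uinv[OF g]
  note c = unitri_carrier[OF g] unitri_carrier[OF u(1)]
  have VVc: "s \<in> VV k \<Longrightarrow> s \<in> carrier_vec m" for s k by (simp add: VV_def)
  have can: "act (uinv g) (act g s) = s" "act g (act (uinv g) s) = s" if "s \<in> carrier_vec m" for s
    using that by (simp_all add: act_mult c u act_one)
  show ?thesis
    by (rule bij_betw_byWitness[where f' = "\<lambda>p. (act (uinv g) (fst p), act (uinv g) (snd p))"])
      (use ij act_VV[OF g] act_VV[OF u(1)] can VVc in \<open>auto simp: WW_def\<close>)
qed

text \<open>An upper triangular congruence forms each entry from entries with larger or equal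
  indices, and the region on and below the antidiagonal is closed under increasing indices.\<close>

lemma LL_cong:
  assumes S: "S \<in> LL" and g: "g \<in> unitri m"
  shows "g * S * g\<^sup>T \<in> LL"
proof -
  note gc = unitri_carrier[OF g] and Sc = LL_carrier[OF S]
  have gS: "g * S \<in> carrier_mat m m" using gc Sc by simp
  have e: "(g * S * g\<^sup>T) $$ (k, l) = (\<Sum>b<m. \<Sum>a<m. g $$ (k, a) * S $$ (a, b) * g $$ (l, b))" if "k < m" "l < m" for k l
    unfolding mult_index_transpose[OF gS gc that] using that
    by (intro sum.cong refl) (simp add: mult_index[OF gc Sc] sum_distrib_right)
  have z: "(g * S * g\<^sup>T) $$ (k, l) = 0" if kl: "k < m" "l < m" "m \<le> k + l + 1" for k l
    unfolding e[OF kl(1,2)]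
  proof (intro sum.neutral ballI)
    fix a b assume ab: "a \<in> {..<m}" "b \<in> {..<m}"
    show "g $$ (k, a) * S $$ (a, b) * g $$ (l, b) = 0"
      using unitri_zero[OF g kl(1), of a] unitri_zero[OF g kl(2), of b] LL_zero[OF S, of a b] ab kl
      by (cases "a < k"; cases "b < l") auto
  qed
  have "(g * S * g\<^sup>T) $$ (l, k) = ep * (g * S * g\<^sup>T) $$ (k, l)" if kl: "k < m" "l < m" for k l
  proof -
    have "(g * S * g\<^sup>T) $$ (l, k) = (\<Sum>a<m. \<Sum>b<m. g $$ (l, b) * S $$ (b, a) * g $$ (k, a))" by (rule e[OF kl(2,1)])
    also have "\<dots> = (\<Sum>a<m. \<Sum>b<m. ep * (g $$ (k, a) * S $$ (a, b) * g $$ (l, b)))"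
    proof (intro sum.cong refl)
      fix a b assume "a \<in> {..<m}" "b \<in> {..<m}"
      hence "S $$ (b, a) = ep * S $$ (a, b)" using LL_sym[OF S, of a b] by blast
      thus "g $$ (l, b) * S $$ (b, a) * g $$ (k, a) = ep * (g $$ (k, a) * S $$ (a, b) * g $$ (l, b))"
        by (simp only: mult_ac)
    qed
    also have "\<dots> = ep * (g * S * g\<^sup>T) $$ (k, l)" unfolding e[OF kl] sum_distrib_left by (rule sum.swap)
    finally show ?thesis .
  qed
  moreover have "g * S * g\<^sup>T \<in> carrier_mat m m" using gS gc by simp
  ultimately show ?thesis unfolding LL_def using z by blast
qed

section \<open>Gaussian elimination by congruence\<close>

lemma cong_mult:
  fixes g h S :: "'a mat"
  assumes "g \<in> carrier_mat m m" "h \<in> carrier_mat m m" "S \<in> carrier_mat m m"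
  shows "h * (g * S * g\<^sup>T) * h\<^sup>T = (h * g) * S * (h * g)\<^sup>T"
proof -
  have "g\<^sup>T \<in> carrier_mat m m" "h\<^sup>T \<in> carrier_mat m m" using assms by auto
  thus ?thesis using assms by (simp add: transpose_mult[OF assms(2,1)] mult_assoc)
qed

text \<open>A simultaneous row and column operation: \<open>p a\<close> times row \<open>k\<close>
  is added to each earlier row \<open>a\<close>, and likewise for columns. The last term records the
  double effect on entry \<open>(k, k)\<close>.\<close>

lemma row_operation:
  assumes S: "S \<in> LL" and k: "k < m" and p: "\<And>a. k \<le> a \<Longrightarrow> p a = 0"
  obtains g where "g \<in> unitri m"
    "\<And>a b. a < m \<Longrightarrow> b < m \<Longrightarrow>
      (g * S * g\<^sup>T) $$ (a, b) = S $$ (a, b) + p a * S $$ (k, b) + p b * (S $$ (a, k) + p a * S $$ (k, k))"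
proof -
  define g where "g = mat m m (\<lambda>(a, b). (if a = b then 1 else 0) + (if b = k then p a else 0))"
  have gu: "g \<in> unitri m" using p by (auto simp: unitri_iff g_def)
  note gc = unitri_carrier[OF gu] and Sc = LL_carrier[OF S]
  have gS: "(g * S) $$ (a, b) = S $$ (a, b) + p a * S $$ (k, b)" if "a < m" "b < m" for a b
  proof -
    have "(g * S) $$ (a, b) = (\<Sum>c<m. (if c = a then S $$ (c, b) else 0) + (if c = k then p a * S $$ (c, b) else 0))"
      unfolding mult_index[OF gc Sc that] using that
      by (intro sum.cong refl) (auto simp: g_def distrib_right)
    thus ?thesis using that k by (simp add: sum.distrib)
  qed
  have gSc: "g * S \<in> carrier_mat m m" using gc Sc by simp
  have "(g * S * g\<^sup>T) $$ (a, b) = S $$ (a, b) + p a * S $$ (k, b) + p b * (S $$ (a, k) + p a * S $$ (k, k))"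
    if "a < m" "b < m" for a b
  proof -
    have "(g * S * g\<^sup>T) $$ (a, b) = (\<Sum>c<m. (if c = b then (g * S) $$ (a, c) else 0) + (if c = k then p b * (g * S) $$ (a, c) else 0))"
      unfolding mult_index_transpose[OF gSc gc that] using that
      by (intro sum.cong refl) (auto simp: g_def distrib_left)
    thus ?thesis using that k by (simp add: sum.distrib gS)
  qed
  thus thesis using that gu by blast
qed

text \<open>The rows and columns outside \<open>I\<close> are already in normal form and decoupled from \<open>I\<close>.\<close>

definition reduced :: "'a mat \<Rightarrow> nat set \<Rightarrow> bool" where
  "reduced S I \<longleftrightarrow> (\<forall>a<m. a \<notin> I \<longrightarrow> (\<forall>b<m. S $$ (a, b) \<noteq> 0 \<longrightarrow> b \<notin> I) \<and>
     (\<forall>b<m. \<forall>c<m. S $$ (a, b) \<noteq> 0 \<longrightarrow> S $$ (a, c) \<noteq> 0 \<longrightarrow> b = c))"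

text \<open>Rows outside \<open>I\<close> are untouched, so it suffices that each row of
  \<open>J\<close> keeps at most one nonzero position and that this position lies in
  \<open>J\<close>.\<close>

lemma reduced_step:
  assumes red: "reduced S I" and J: "J \<subseteq> I"
    and same: "\<And>a b. a < m \<Longrightarrow> a \<notin> I \<Longrightarrow> b < m \<Longrightarrow> S' $$ (a, b) = S $$ (a, b)"
    and new: "\<And>a. a \<in> J \<Longrightarrow> \<exists>d\<in>J. \<forall>b<m. b \<noteq> d \<longrightarrow> S' $$ (a, b) = 0"
  shows "reduced S' (I - J)"
  unfolding reduced_def
proof (intro allI impI)
  fix a assume a: "a < m" "a \<notin> I - J"
  show "(\<forall>b<m. S' $$ (a, b) \<noteq> 0 \<longrightarrow> b \<notin> I - J) \<and>
     (\<forall>b<m. \<forall>c<m. S' $$ (a, b) \<noteq> 0 \<longrightarrow> S' $$ (a, c) \<noteq> 0 \<longrightarrow> b = c)"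
  proof (cases "a \<in> J")
    case True
    then obtain d where "d \<in> J" "\<forall>b<m. b \<noteq> d \<longrightarrow> S' $$ (a, b) = 0" using new by blast
    thus ?thesis by blast
  next
    case False
    hence aI: "a \<notin> I" using a by blast
    have r1: "\<And>b. b < m \<Longrightarrow> S $$ (a, b) \<noteq> 0 \<Longrightarrow> b \<notin> I"
      and r2: "\<And>b c. b < m \<Longrightarrow> c < m \<Longrightarrow> S $$ (a, b) \<noteq> 0 \<Longrightarrow> S $$ (a, c) \<noteq> 0 \<Longrightarrow> b = c"
      using red a(1) aI unfolding reduced_def by blast+
    show ?thesis
    proof (intro conjI allI impI)
      fix b assume "b < m" "S' $$ (a, b) \<noteq> 0"
      thus "b \<notin> I - J" using r1[of b] unfolding same[OF a(1) aI \<open>b < m\<close>] by blast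
    next
      fix b c assume "b < m" "c < m" "S' $$ (a, b) \<noteq> 0" "S' $$ (a, c) \<noteq> 0"
      thus "b = c" unfolding same[OF a(1) aI \<open>b < m\<close>] same[OF a(1) aI \<open>c < m\<close>] by (rule r2)
    qed
  qed
qed

text \<open>Induction on the number of remaining indices. The last one, \<open>k\<close>, is removed
  alone if its row is zero or has its last nonzero entry on the diagonal. Otherwise that entry lies
  at some \<open>l < k\<close>, and after clearing columns \<open>k\<close> and \<open>l\<close>
  both indices are removed.\<close>

lemma normal_form_aux:
  assumes "S \<in> LL" "I \<subseteq> {..<m}" "reduced S I"
  shows "\<exists>g\<in>unitri m. reduced (g * S * g\<^sup>T) {}"
  using assms
proof (induction "card I" arbitrary: S I rule: less_induct)
  case less
  note S = less.prems(1) and I = less.prems(2) and red = less.prems(3)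
  have finI: "finite I" by (rule finite_subset[OF I finite_lessThan])
  have step: ?case if g: "g \<in> unitri m" and J: "J \<subseteq> I" "J \<noteq> {}" and r: "reduced (g * S * g\<^sup>T) (I - J)" for g J
  proof -
    have "card (I - J) < card I" using J finI by (intro psubset_card_mono) auto
    moreover have "I - J \<subseteq> {..<m}" using I by blast
    ultimately obtain h where h: "h \<in> unitri m" "reduced (h * (g * S * g\<^sup>T) * h\<^sup>T) {}"
      using less.hyps[of "I - J" "g * S * g\<^sup>T"] LL_cong[OF S g] r by blast
    show ?thesis
      using h(2) unfolding cong_mult[OF unitri_carrier[OF g] unitri_carrier[OF h(1)] LL_carrier[OF S]]
      by (rule bexI[OF _ unitri_mult[OF h(1) g]])
  qed
  have sym0: "S' $$ (a, b) = 0 \<longleftrightarrow> S' $$ (b, a) = 0" if "S' \<in> LL" "a < m" "b < m" for S' a b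
    using LL_sym[OF that(1,2,3)] ep_nz by simp
  show ?case
  proof (cases "I = {}")
    case True
    have "1\<^sub>m m * S * (1\<^sub>m m)\<^sup>T = S" using LL_carrier[OF S] by simp
    thus ?thesis using True red by (intro bexI[OF _ unitri_one]) simp
  next
    case False
    \<comment> \<open>Admissible operations add a row only to earlier rows, so the last remaining
      row can act on all others in \<open>I\<close>.\<close>
    define k where "k = Max I"
    have k: "k \<in> I" "\<And>a. a \<in> I \<Longrightarrow> a \<le> k" using False finI by (auto simp: k_def)
    have km: "k < m" using k(1) I by auto
    have out: "S $$ (a, b) = 0" "S $$ (b, a) = 0" if "a < m" "a \<notin> I" "b \<in> I" for a b
    proof -
      have bm: "b < m" using that(3) I by auto
      show "S $$ (a, b) = 0" using red that bm unfolding reduced_def by blast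
      thus "S $$ (b, a) = 0" using sym0[OF S that(1) bm] by blast
    qed
    show ?thesis
    proof (cases "\<forall>b<m. S $$ (k, b) = 0")
      case True
      have "1\<^sub>m m * S * (1\<^sub>m m)\<^sup>T = S" using LL_carrier[OF S] by simp
      moreover have "reduced S (I - {k})"
        by (rule reduced_step[OF red]) (use True k in auto)
      ultimately show ?thesis using step[OF unitri_one, of "{k}"] k(1) by simp
    next
      case False
      define B where "B = {b. b < m \<and> S $$ (k, b) \<noteq> 0}"
      define l where "l = Max B"
      have finB: "finite B" by (rule finite_subset[of _ "{..<m}"]) (auto simp: B_def)
      have "B \<noteq> {}" using False by (auto simp: B_def)
      hence lB: "l \<in> B" and lmax: "\<And>b. b \<in> B \<Longrightarrow> b \<le> l" using finB by (auto simp: l_def)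
      have lm: "l < m" and kl: "S $$ (k, l) \<noteq> 0" using lB by (auto simp: B_def)
      have lI: "l \<in> I" using out(2)[OF lm _ k(1)] kl by blast
      have lk: "S $$ (l, k) \<noteq> 0" using sym0[OF S km lm] kl by blast
      have above: "S $$ (a, k) = 0" if "a < m" "l < a" for a
      proof -
        have "a \<notin> B" using lmax[of a] that by auto
        hence "S $$ (k, a) = 0" using that by (simp add: B_def)
        thus ?thesis using sym0[OF S km that(1)] by blast
      qed
      show ?thesis
      proof (cases "l = k")
        case True
        have kk: "S $$ (k, k) \<noteq> 0" using kl True by simp
        define p where "p a = (if a < k then - S $$ (a, k) / S $$ (k, k) else 0)" for a
        obtain g where g: "g \<in> unitri m" "\<And>a b. a < m \<Longrightarrow> b < m \<Longrightarrow>
            (g * S * g\<^sup>T) $$ (a, b) = S $$ (a, b) + p a * S $$ (k, b) + p b * (S $$ (a, k) + p a * S $$ (k, k))"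
          using row_operation[OF S km, of p] by (auto simp: p_def)
        have pout: "p a = 0" if "a < m" "a \<notin> I" for a using out(1)[OF that k(1)] by (simp add: p_def)
        have col: "(g * S * g\<^sup>T) $$ (b, k) = 0" if b: "b < m" "b \<noteq> k" for b
        proof (cases "b < k")
          case True
          have "p k = 0" by (simp add: p_def)
          thus ?thesis unfolding g(2)[OF b(1) km] using True kk by (simp add: p_def)
        next
          case False
          hence "b \<notin> I" using k(2)[of b] b(2) by auto
          thus ?thesis unfolding g(2)[OF b(1) km] using pout[OF b(1)] out(1)[OF b(1) _ k(1)] by (simp add: p_def)
        qed
        have "reduced (g * S * g\<^sup>T) (I - {k})"
        proof (rule reduced_step[OF red])
          show "{k} \<subseteq> I" using k by simp
          fix a b assume "a < m" "a \<notin> I" "b < m"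
          thus "(g * S * g\<^sup>T) $$ (a, b) = S $$ (a, b)" unfolding g(2)[OF \<open>a < m\<close> \<open>b < m\<close>] using pout out(1)[OF _ _ k(1)] by simp
        next
          fix a assume "a \<in> {k}"
          thus "\<exists>d\<in>{k}. \<forall>b<m. b \<noteq> d \<longrightarrow> (g * S * g\<^sup>T) $$ (a, b) = 0"
            using col sym0[OF LL_cong[OF S g(1)] km] by auto
        qed
        thus ?thesis using step[OF g(1), of "{k}"] k(1) by simp
      next
        case False
        hence llk: "l < k" using k(2)[OF lI] by simp
        \<comment> \<open>By the maximality of \<open>l\<close>, column \<open>k\<close> is zero
          below row \<open>l\<close>; adding multiples of row \<open>l\<close> to earlier rows
          clears the rest of it apart from the pivot.\<close>
        define q where "q a = (if a < l then - S $$ (a, k) / S $$ (l, k) else 0)" for a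
        obtain g where g: "g \<in> unitri m" "\<And>a b. a < m \<Longrightarrow> b < m \<Longrightarrow>
            (g * S * g\<^sup>T) $$ (a, b) = S $$ (a, b) + q a * S $$ (l, b) + q b * (S $$ (a, l) + q a * S $$ (l, l))"
          using row_operation[OF S lm, of q] by (auto simp: q_def)
        define S1 where "S1 = g * S * g\<^sup>T"
        note g2 = g(2)[folded S1_def]
        have S1: "S1 \<in> LL" unfolding S1_def by (rule LL_cong[OF S g(1)])
        have qout: "q a = 0" if "a < m" "a \<notin> I" for a using out(1)[OF that k(1)] by (simp add: q_def)
        have qk: "q k = 0" "q l = 0" using llk by (simp_all add: q_def)
        have S1out: "S1 $$ (a, b) = S $$ (a, b)" if "a < m" "a \<notin> I" "b < m" for a b
          unfolding g2[OF that(1,3)] using qout out(1)[OF _ _ lI] that by simp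
        have S1k: "S1 $$ (a, k) = (if a = l then S $$ (l, k) else 0)" if a: "a < m" for a
          unfolding g2[OF a km] qk using above[OF a] lk qk
          by (cases a l rule: linorder_cases) (simp_all add: q_def)
        have S1lk: "S1 $$ (l, k) \<noteq> 0" using S1k[OF lm] lk by simp
        have S1kl: "S1 $$ (k, l) \<noteq> 0" using sym0[OF S1 lm km] S1lk by blast
        have S1kk: "S1 $$ (k, k) = 0" using S1k[OF km] llk by simp
        \<comment> \<open>Entry \<open>(l, l)\<close> is corrected once by the row and once by the
          column operation, hence the factor \<open>half\<close>; if \<open>ep = - 1\<close>, that
          entry is zero already.\<close>
        define p where "p a = (if a < k then (if a = l then - half * S1 $$ (l, l) / S1 $$ (k, l) else - S1 $$ (a, l) / S1 $$ (k, l)) else 0)" for a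
        obtain h where h: "h \<in> unitri m" "\<And>a b. a < m \<Longrightarrow> b < m \<Longrightarrow>
            (h * S1 * h\<^sup>T) $$ (a, b) = S1 $$ (a, b) + p a * S1 $$ (k, b) + p b * (S1 $$ (a, k) + p a * S1 $$ (k, k))"
          using row_operation[OF S1 km, of p] by (auto simp: p_def)
        define S2 where "S2 = h * S1 * h\<^sup>T"
        note h2 = h(2)[folded S2_def, unfolded S1kk mult_zero_right add_0_right]
        have S2: "S2 \<in> LL" unfolding S2_def by (rule LL_cong[OF S1 h(1)])
        have S1outI: "S1 $$ (a, b) = 0" if "a < m" "a \<notin> I" "b \<in> I" for a b
          using S1out[OF that(1,2), of b] out(1)[OF that] that(3) I by auto
        have pout: "p a = 0" if "a < m" "a \<notin> I" for a
          using S1outI[OF that lI] that lI by (auto simp: p_def)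
        have pk: "p k = 0" by (simp add: p_def)
        have S2k: "S2 $$ (a, k) = 0" if "a < m" "a \<noteq> l" for a
          unfolding h2[OF that(1) km] pk using S1k[OF that(1)] that S1kk by simp
        have S2l: "S2 $$ (a, l) = 0" if a: "a < m" "a \<noteq> k" for a
        proof (cases "a = l")
          case True
          have pl: "p l = - half * S1 $$ (l, l) / S1 $$ (k, l)" using llk by (simp add: p_def)
          have e1: "p l * S1 $$ (k, l) = - half * S1 $$ (l, l)" unfolding pl using S1kl by simp
          have "S1 $$ (l, k) = ep * S1 $$ (k, l)" by (rule LL_sym[OF S1 km lm])
          hence e2: "p l * S1 $$ (l, k) = ep * (- half * S1 $$ (l, l))" using e1 by (simp add: mult.left_commute)
          have "ep = 1 \<or> ep = - 1" by (simp add: ep_def dl_def)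
          hence "S2 $$ (l, l) = 0"
          proof
            assume "ep = 1"
            hence "S2 $$ (l, l) = S1 $$ (l, l) - (half + half) * S1 $$ (l, l)"
              unfolding h2[OF lm lm] e1 e2 by (simp only: distrib_right) simp
            thus ?thesis by simp
          next
            assume e: "ep = - 1"
            have "S1 $$ (l, l) = - S1 $$ (l, l)" using LL_sym[OF S1 lm lm] unfolding e mult_minus1 .
            hence "2 * S1 $$ (l, l) = 0" unfolding mult_2 add_eq_0_iff .
            hence "S1 $$ (l, l) = 0" using two by simp
            thus ?thesis unfolding h2[OF lm lm] e1 e2 by simp
          qed
          thus ?thesis using True by simp
        next
          case False
          show ?thesis
          proof (cases "a < k")
            case True
            hence "p a * S1 $$ (k, l) = - S1 $$ (a, l)" using False S1kl by (simp add: p_def)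
            thus ?thesis unfolding h2[OF a(1) lm] using S1k[OF a(1)] False by simp
          next
            case ak: False
            hence "a \<notin> I" using k(2)[of a] a(2) by auto
            thus ?thesis unfolding h2[OF a(1) lm] using pout[OF a(1)] S1outI[OF a(1) _ lI] S1outI[OF a(1) _ k(1)] by simp
          qed
        qed
        have "reduced S2 (I - {k, l})"
        proof (rule reduced_step[OF red])
          show "{k, l} \<subseteq> I" using k lI by simp
          fix a b assume "a < m" "a \<notin> I" "b < m"
          thus "S2 $$ (a, b) = S $$ (a, b)"
            unfolding h2[OF \<open>a < m\<close> \<open>b < m\<close>] using pout S1outI[OF _ _ k(1)] S1out by simp
        next
          fix a assume "a \<in> {k, l}"
          thus "\<exists>d\<in>{k, l}. \<forall>b<m. b \<noteq> d \<longrightarrow> S2 $$ (a, b) = 0"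
            using S2k S2l sym0[OF S2 km] sym0[OF S2 lm] by auto
        qed
        moreover have "S2 = (h * g) * S * (h * g)\<^sup>T"
          unfolding S2_def S1_def by (rule cong_mult[OF unitri_carrier[OF g(1)] unitri_carrier[OF h(1)] LL_carrier[OF S]])
        ultimately show ?thesis using step[OF unitri_mult[OF h(1) g(1)], of "{k, l}"] k(1) lI by simp
      qed
    qed
  qed
qed

lemma normal_form:
  assumes "S \<in> LL"
  obtains g where "g \<in> unitri m" "g * S * g\<^sup>T \<in> LL"
    "\<And>a b c. a < m \<Longrightarrow> b < m \<Longrightarrow> c < m \<Longrightarrow> (g * S * g\<^sup>T) $$ (a, b) \<noteq> 0 \<Longrightarrow> (g * S * g\<^sup>T) $$ (a, c) \<noteq> 0 \<Longrightarrow> b = c"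
proof -
  have "reduced S {..<m}" by (simp add: reduced_def)
  then obtain g where "g \<in> unitri m" "reduced (g * S * g\<^sup>T) {}" using normal_form_aux[OF assms] by blast
  thus thesis using that LL_cong[OF assms] unfolding reduced_def by blast
qed

end

context unipotent_character
begin

lemma GG_cong:
  assumes S: "S \<in> carrier_mat m m" and g: "g \<in> unitri m" and ij: "i < m" "j < m"
  shows "GG \<rho> i j (g * S * g\<^sup>T) = GG \<rho> i j S"
proof -
  have "GG \<rho> i j S = (\<Sum>p\<in>WW i j. \<theta> (\<rho> * bil S (act g (fst p)) (act g (snd p))))"
    unfolding GG_def split_def
    using sum.reindex_bij_betw[OF bij_act_WW[OF g ij], of "\<lambda>p. \<theta> (\<rho> * bil S (fst p) (snd p))"] by simp
  also have "\<dots> = GG \<rho> i j (g * S * g\<^sup>T)"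
    unfolding GG_def split_def bil_cong[OF S unitri_carrier[OF g]] ..
  finally show ?thesis ..
qed

end

section \<open>Basic pairs and superclasses\<close>

text \<open>\<open>R\<close> is antisymmetric; it will be an order on columns. The pivot of
  \<open>M\<close> in row \<open>i\<close> forces one of \<open>M'\<close> in the same row at a
  related column, and conversely. Going there and back returns to the same pivot, so both columns
  agree by antisymmetry.\<close>

lemma unique_pivots:
  fixes M M' :: "nat \<Rightarrow> nat \<Rightarrow> 'b::zero"
  assumes R: "\<And>a b. R a b \<Longrightarrow> R b a \<Longrightarrow> a = b"
    and U: "\<And>i a b. i < m \<Longrightarrow> a < m \<Longrightarrow> b < m \<Longrightarrow> M i a \<noteq> 0 \<Longrightarrow> M i b \<noteq> 0 \<Longrightarrow> a = b"
    and U': "\<And>i a b. i < m \<Longrightarrow> a < m \<Longrightarrow> b < m \<Longrightarrow> M' i a \<noteq> 0 \<Longrightarrow> M' i b \<noteq> 0 \<Longrightarrow> a = b"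
    and s: "\<And>i j. i < m \<Longrightarrow> j < m \<Longrightarrow> M i j \<noteq> 0 \<Longrightarrow> \<exists>b<m. M' i b \<noteq> 0 \<and> R b j \<and> (b = j \<longrightarrow> M' i j = M i j)"
    and s': "\<And>i j. i < m \<Longrightarrow> j < m \<Longrightarrow> M' i j \<noteq> 0 \<Longrightarrow> \<exists>b<m. M i b \<noteq> 0 \<and> R b j \<and> (b = j \<longrightarrow> M i j = M' i j)"
    and ij: "i < m" "j < m"
  shows "M i j = M' i j"
proof (cases "M i j = 0")
  case False
  obtain b where b: "b < m" "M' i b \<noteq> 0" "R b j" "b = j \<longrightarrow> M' i j = M i j" using s[OF ij False] by blast
  obtain c where c: "c < m" "M i c \<noteq> 0" "R c b" using s'[OF ij(1) b(1,2)] by blast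
  have "c = j" using U[OF ij(1) c(1) ij(2) c(2) False] .
  hence "b = j" using R[of b j] b(3) c(3) by simp
  thus ?thesis using b(4) by simp
next
  case True
  show ?thesis
  proof (cases "M' i j = 0")
    case False
    obtain b where b: "b < m" "M i b \<noteq> 0" "R b j" "b = j \<longrightarrow> M i j = M' i j" using s'[OF ij False] by blast
    obtain c where c: "c < m" "M' i c \<noteq> 0" "R c b" using s[OF ij(1) b(1,2)] by blast
    have "c = j" using U'[OF ij(1) c(1) ij(2) c(2) False] .
    hence "b = j" using R[of b j] b(3) c(3) by simp
    thus ?thesis using b(4) by simp
  qed (use True in simp)
qed

text \<open>At a nonzero entry of \<open>M\<close>, the left product reduces to that entry, since
  its column contains no other. The right product is then nonzero, which produces a pivot of
  \<open>M'\<close> at a column related through the shape of \<open>B\<close>. Equality is used at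
  the single position \<open>(i, j)\<close>, so the argument also applies to truncated
  matrices.\<close>

lemma pivot_step:
  fixes M M' A B :: "'b::field mat"
  assumes c: "M \<in> carrier_mat m m" "M' \<in> carrier_mat m m" "A \<in> carrier_mat m m" "B \<in> carrier_mat m m"
    and d: "\<And>i. i < m \<Longrightarrow> A $$ (i, i) = 1" "\<And>i. i < m \<Longrightarrow> B $$ (i, i) = 1"
    and R: "\<And>b j. b < m \<Longrightarrow> j < m \<Longrightarrow> B $$ (b, j) \<noteq> 0 \<Longrightarrow> R b j"
    and col: "\<And>a b j. a < m \<Longrightarrow> b < m \<Longrightarrow> j < m \<Longrightarrow> M $$ (a, j) \<noteq> 0 \<Longrightarrow> M $$ (b, j) \<noteq> 0 \<Longrightarrow> a = b"
    and row: "\<And>i a b. i < m \<Longrightarrow> a < m \<Longrightarrow> b < m \<Longrightarrow> M' $$ (i, a) \<noteq> 0 \<Longrightarrow> M' $$ (i, b) \<noteq> 0 \<Longrightarrow> a = b"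
    and ij: "i < m" "j < m" and eq: "(A * M) $$ (i, j) = (M' * B) $$ (i, j)" and nz: "M $$ (i, j) \<noteq> 0"
  shows "\<exists>b<m. M' $$ (i, b) \<noteq> 0 \<and> R b j \<and> (b = j \<longrightarrow> M' $$ (i, j) = M $$ (i, j))"
proof -
  have "(A * M) $$ (i, j) = (\<Sum>a<m. if a = i then M $$ (i, j) else 0)"
    unfolding mult_index[OF c(3,1) ij]
  proof (intro sum.cong refl)
    fix a assume a: "a \<in> {..<m}"
    show "A $$ (i, a) * M $$ (a, j) = (if a = i then M $$ (i, j) else 0)"
    proof (cases "a = i")
      case True
      thus ?thesis using d(1)[OF ij(1)] by simp
    next
      case False
      hence "M $$ (a, j) = 0" using col[of a i j] a nz ij by blast
      thus ?thesis using False by simp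
    qed
  qed
  hence s: "(\<Sum>b<m. M' $$ (i, b) * B $$ (b, j)) = M $$ (i, j)"
    using eq ij unfolding mult_index[OF c(2,4) ij] by simp
  have "\<exists>b<m. M' $$ (i, b) * B $$ (b, j) \<noteq> 0"
  proof (rule ccontr)
    assume "\<not> ?thesis"
    hence "(\<Sum>b<m. M' $$ (i, b) * B $$ (b, j)) = 0" by (intro sum.neutral) auto
    thus False using s nz by simp
  qed
  then obtain b where b: "b < m" "M' $$ (i, b) \<noteq> 0" "B $$ (b, j) \<noteq> 0" by auto
  have "M' $$ (i, j) = M $$ (i, j)" if bj: "b = j"
  proof -
    have "(\<Sum>a<m. M' $$ (i, a) * B $$ (a, j)) = (\<Sum>a<m. if a = j then M' $$ (i, j) else 0)"
    proof (intro sum.cong refl)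
      fix a assume a: "a \<in> {..<m}"
      show "M' $$ (i, a) * B $$ (a, j) = (if a = j then M' $$ (i, j) else 0)"
      proof (cases "a = j")
        case True
        thus ?thesis using d(2)[OF ij(2)] by simp
      next
        case False
        hence "M' $$ (i, a) = 0" using row[of i a j] a ij b(2) bj by blast
        thus ?thesis using False by simp
      qed
    qed
    thus ?thesis using s ij by simp
  qed
  thus ?thesis using b R[OF b(1) ij(2) b(3)] by blast
qed

context unipotent
begin

text \<open>The root vector times the form, without its sign: two entries exchanged by the symmetry,
  or a single 1 if they coincide.\<close>

definition rcoef :: "root \<Rightarrow> nat \<Rightarrow> nat \<Rightarrow> 'a" where
  "rcoef \<alpha> k l = (if k = ri \<alpha> \<and> l = rj \<alpha> then 1 else if k = rj \<alpha> \<and> l = ri \<alpha> then ep else 0)"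

text \<open>The matrix \<open>e\<^sub>D\<^sub>,\<^sub>\<phi>\<close> multiplied by the matrix of the form.\<close>

definition pS :: "root set \<Rightarrow> (root \<Rightarrow> 'a) \<Rightarrow> 'a mat" where
  "pS D \<phi> = mat m m (\<lambda>(k, l). \<Sum>\<alpha>\<in>D. \<phi> \<alpha> * (rsg \<alpha> * rcoef \<alpha> k l))"

lemma pS_carrier [simp]: "pS D \<phi> \<in> carrier_mat m m" by (simp add: pS_def)

lemma flip_eq: "b < m \<Longrightarrow> c < m \<Longrightarrow> m - Suc b = c \<longleftrightarrow> b = m - Suc c" by auto

lemma mat_unit_index: "a < m \<Longrightarrow> b < m \<Longrightarrow> mat_unit T n i j $$ (a, b) = (if a = idx T n i \<and> b = idx T n j then 1 else 0)"
  by (simp add: mat_unit_def)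

text \<open>Multiplication by the form mirrors the column and contributes the sign of that column,
  which reconciles the different sign conventions of the four kinds of root vectors.\<close>

lemma root_mat_index:
  assumes \<alpha>: "\<alpha> \<in> roots T n" and ab: "a < m" "b < m"
  shows "root_mat T n \<alpha> $$ (a, b) * sg b = rsg \<alpha> * rcoef \<alpha> a (m - Suc b)"
proof -
  have sglow: "sg k = 1" if "k < n" for k using that by (simp add: sg_def)
  have sghigh: "sg (m - k) = dl" if "1 \<le> k" "k \<le> n" for k
    using sg_flip[of "k - 1"] sglow[of "k - 1"] that by (simp add: m_eq)
  have nm: "2 * n \<le> m" by (simp add: m_eq)
  have d: "dim_row (mat_unit T n i j) = m" "dim_col (mat_unit T n i j) = m" for i j by (simp_all add: mat_unit_def)
  show ?thesis
  proof (cases \<alpha>)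
    case (Diff i j)
    hence i: "1 \<le> i" "i < j" "j \<le> n" using \<alpha> by auto
    have r: "rsg \<alpha> = 1" using i Diff by (simp add: rsg_def m_eq sglow)
    have lt: "m - j < m" "i - 1 < m" "m - Suc (m - j) = j - 1" "m - Suc (i - 1) = m - i" "i - 1 \<noteq> m - j" "j - 1 < n" using i nm by arith+
    have "(root_mat T n \<alpha> :: 'a mat) $$ (a, b) = (if a = i - 1 \<and> b = j - 1 then 1 else 0) - (if a = m - j \<and> b = m - i then 1 else 0)"
      using Diff ab i by (simp add: mat_unit_index d)
    moreover have "rcoef \<alpha> a (m - Suc b) = (if a = i - 1 \<and> b = j - 1 then 1 else if a = m - j \<and> b = m - i then ep else 0)"
      unfolding rcoef_def Diff ri.simps rj.simps flip_eq[OF ab(2) lt(1)] flip_eq[OF ab(2) lt(2)] lt(3,4) ..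
    ultimately show ?thesis using sglow[OF lt(6)] sghigh[of i] i lt(5) r by (auto simp: ep_def)
  next
    case (Add i j)
    hence i: "1 \<le> i" "i < j" "j \<le> n" using \<alpha> by auto
    have "Suc (j - 1) = j" "1 \<le> j" using i by auto
    hence r: "rsg \<alpha> = dl" unfolding rsg_def Add rj.simps using sghigh[OF _ i(3)] by (simp only:)
    obtain i' j' where s: "i = Suc i'" "j = Suc j'" using i by (cases i; cases j) auto
    have lt: "j - 1 < m" "i - 1 < m" "m - Suc (j - 1) = m - j" "m - Suc (i - 1) = m - i" "i - 1 \<noteq> j - 1"
      using i nm unfolding s by simp_all
    have "(root_mat T n \<alpha> :: 'a mat) $$ (a, b) = (if a = i - 1 \<and> b = m - j then 1 else 0) + ep * (if a = j - 1 \<and> b = m - i then 1 else 0)"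
    proof (cases "T = Sp")
      case True
      have e1: "ep = 1" unfolding ep_def dl_def if_P[OF True] by simp
      show ?thesis unfolding Add root_mat.simps if_P[OF True] e1 using ab i by (simp add: mat_unit_index d)
    next
      case False
      have e1: "ep = - 1" unfolding ep_def dl_def if_not_P[OF False] ..
      show ?thesis unfolding Add root_mat.simps if_not_P[OF False] e1 using ab i by (simp add: mat_unit_index d)
    qed
    moreover have "rcoef \<alpha> a (m - Suc b) = (if a = i - 1 \<and> b = m - j then 1 else if a = j - 1 \<and> b = m - i then ep else 0)"
      unfolding rcoef_def Add ri.simps rj.simps flip_eq[OF ab(2) lt(1)] flip_eq[OF ab(2) lt(2)] lt(3,4) ..
    ultimately show ?thesis using sghigh[of j] sghigh[of i] i lt(5) r by (auto simp: mult.commute)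
  next
    case (Two i)
    hence i: "1 \<le> i" "i \<le> n" using \<alpha> by auto
    have "Suc (i - 1) = i" using i by auto
    hence r: "rsg \<alpha> = dl" unfolding rsg_def Two rj.simps using sghigh[OF i] by (simp only:)
    have lt: "i - 1 < m" "m - Suc (i - 1) = m - i" using i nm by arith+
    have "(root_mat T n \<alpha> :: 'a mat) $$ (a, b) = (if a = i - 1 \<and> b = m - i then 1 else 0)"
      using Two ab i by (simp add: mat_unit_index d)
    moreover have "rcoef \<alpha> a (m - Suc b) = (if a = i - 1 \<and> b = m - i then 1 else 0)"
      unfolding rcoef_def Two ri.simps rj.simps flip_eq[OF ab(2) lt(1)] lt(2) by simp
    ultimately show ?thesis unfolding r using sghigh[OF i] by (simp only: if_distrib[of "\<lambda>x. x * _"]) (simp split: if_splits)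
  next
    case (One i)
    hence T: "T = OOdd" and i: "1 \<le> i" "i \<le> n" using \<alpha> by auto
    have s1: "sg k = 1" for k using T unfolding sg_def by simp
    have e1: "ep = - 1" using T unfolding ep_def dl_def by simp
    have "r = 1" using T unfolding mid_def by simp
    hence lt: "n < m" "i - 1 < m" "m - Suc n = n" "m - Suc (i - 1) = m - i" "i - 1 \<noteq> n" using i m_eq by arith+
    have "(root_mat T n \<alpha> :: 'a mat) $$ (a, b) = (if a = i - 1 \<and> b = n then 1 else 0) - (if a = n \<and> b = m - i then 1 else 0)"
      using One ab i by (simp add: mat_unit_index d)
    moreover have "rcoef \<alpha> a (m - Suc b) = (if a = i - 1 \<and> b = n then 1 else if a = n \<and> b = m - i then ep else 0)"
      unfolding rcoef_def One ri.simps rj.simps flip_eq[OF ab(2) lt(1)] flip_eq[OF ab(2) lt(2)] lt(3,4) ..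
    ultimately show ?thesis using lt(5) by (auto simp: rsg_def s1 e1)
  qed
qed

lemma pair_mat_carrier [simp]: "pair_mat T n D \<phi> \<in> carrier_mat m m" by (simp add: pair_mat_def)

lemma pair_mat_Om:
  assumes "D \<subseteq> roots T n"
  shows "pair_mat T n D \<phi> * Om = pS D \<phi>"
proof (rule eq_matI)
  fix k l assume "k < dim_row (pS D \<phi>)" "l < dim_col (pS D \<phi>)"
  hence kl: "k < m" "l < m" by (auto simp: pS_def)
  have l': "m - Suc l < m" "m - Suc (m - Suc l) = l" using kl by auto
  have "(pair_mat T n D \<phi> * Om) $$ (k, l) = (\<Sum>\<alpha>\<in>D. \<phi> \<alpha> * (root_mat T n \<alpha> $$ (k, m - Suc l) * sg (m - Suc l)))"
    unfolding Om_mult_right[OF pair_mat_carrier kl] using kl l' by (simp add: pair_mat_def sum_distrib_right mult.assoc)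
  also have "\<dots> = (\<Sum>\<alpha>\<in>D. \<phi> \<alpha> * (rsg \<alpha> * rcoef \<alpha> k l))"
  proof (intro sum.cong refl)
    fix \<alpha> assume "\<alpha> \<in> D"
    hence "\<alpha> \<in> roots T n" using assms by blast
    from root_mat_index[OF this kl(1) l'(1), unfolded l'(2)]
    show "\<phi> \<alpha> * (root_mat T n \<alpha> $$ (k, m - Suc l) * sg (m - Suc l)) = \<phi> \<alpha> * (rsg \<alpha> * rcoef \<alpha> k l)" by (simp only:)
  qed
  finally show "(pair_mat T n D \<phi> * Om) $$ (k, l) = pS D \<phi> $$ (k, l)" using kl by (simp add: pS_def)
qed (auto simp: pS_def pair_mat_def)

lemma root_inj:
  assumes "\<alpha> \<in> roots T n" "\<beta> \<in> roots T n" "ri \<alpha> = ri \<beta>" "rj \<alpha> = rj \<beta>"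
  shows "\<alpha> = \<beta>"
proof -
  have "ri \<alpha> = ri \<beta> \<longrightarrow> rj \<alpha> = rj \<beta> \<longrightarrow> \<alpha> = \<beta>"
    by (rule root_cases[OF assms(1)]; rule root_cases[OF assms(2)]) (auto simp: m_eq)
  thus ?thesis using assms(3,4) by blast
qed

text \<open>Roots correspond to positions on or above the diagonal and strictly above the
  antidiagonal, diagonal positions occurring only for symmetric matrices. The position of
  \<open>j\<close> in the three blocks decides the kind of root.\<close>

lemma root_of_pair:
  assumes "i \<le> j" "i + j + 1 < m" "i = j \<Longrightarrow> ep = 1"
  obtains \<alpha> where "\<alpha> \<in> roots T n" "ri \<alpha> = i" "rj \<alpha> = j"
proof (cases "j < n")
  case True
  show thesis
  proof (cases "i = j")
    case eq: True
    have "ep = 1" using assms(3) eq by simp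
    moreover have "(1::'a) \<noteq> - 1"
    proof
      assume "(1::'a) = - 1"
      hence "(1::'a) + 1 = 0" by (simp only: add_eq_0_iff)
      thus False using two by simp
    qed
    ultimately have "T = Sp" unfolding ep_def dl_def by (simp split: if_splits)
    hence "Two (Suc i) \<in> roots T n" unfolding roots_iff using True eq by simp
    from that[OF this] show thesis using eq by simp
  next
    case False
    thus thesis using that[of "Add (Suc i) (Suc j)"] True assms(1) by simp
  qed
next
  case False
  show thesis
  proof (cases "j < n + r")
    case True
    hence r: "r = 1" "j = n" and T: "T = OOdd" using False r_cases by auto
    have "One (Suc i) \<in> roots T n" unfolding roots_iff using T r assms(2) m_eq by linarith
    from that[OF this] show thesis using r(2) by simp
  next
    case False
    have "1 \<le> Suc i" "Suc i < m - j" "m - j \<le> n" "m - (m - j) = j" using False assms(2) m_eq by linarith+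
    thus thesis using that[of "Diff (Suc i) (m - j)"] by simp
  qed
qed

lemma finite_roots: "finite (roots T n)"
proof -
  have inj: "inj_on (\<lambda>\<alpha>. (ri \<alpha>, rj \<alpha>)) (roots T n)" by (intro inj_onI) (auto intro: root_inj)
  have sub: "(\<lambda>\<alpha>. (ri \<alpha>, rj \<alpha>)) ` roots T n \<subseteq> {..<m} \<times> {..<m}"
  proof clarify
    fix \<alpha> assume "\<alpha> \<in> roots T n"
    from root_bounds(3)[OF this] show "ri \<alpha> \<in> {..<m} \<and> rj \<alpha> \<in> {..<m}" by simp
  qed
  show ?thesis by (rule finite_imageD[OF finite_subset[OF sub] inj]) simp
qed

definition disj :: "root set \<Rightarrow> bool" where
  "disj D \<longleftrightarrow> D \<subseteq> roots T n \<and> (\<forall>\<alpha>\<in>D. \<forall>\<beta>\<in>D. \<alpha> \<noteq> \<beta> \<longrightarrow> {ri \<alpha>, rj \<alpha>} \<inter> {ri \<beta>, rj \<beta>} = {})"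

text \<open>Mirroring columns makes the set of entries symmetric under exchange of row and column.
  Both conditions of \<open>basic\<close> then say that the entries form a partial matching of the
  indices.\<close>

lemma basic_iff_disj: "basic T n D \<longleftrightarrow> disj D"
proof (cases "D \<subseteq> roots T n")
  case False thus ?thesis by (auto simp: basic_def disj_def)
next
  case D: True
  \<comment> \<open>The zero-based position of an entry after multiplication by the form.\<close>
  let ?q = "\<lambda>p. (idx T n (fst p), m - Suc (idx T n (snd p)))"
  let ?E = "\<Union>\<alpha>\<in>D. root_entries \<alpha>"
  have lab: "\<alpha> \<in> roots T n \<Longrightarrow> (x, y) \<in> root_entries \<alpha> \<Longrightarrow>
      (- int n \<le> x \<and> x \<le> int n \<and> (x = 0 \<longrightarrow> r = 1)) \<and> (- int n \<le> y \<and> y \<le> int n \<and> (y = 0 \<longrightarrow> r = 1))" for \<alpha> x y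
    by (erule root_cases) auto
  have idx_inj: "x = y" if "idx T n x = idx T n y" "- int n \<le> x" "x \<le> int n" "x = 0 \<longrightarrow> r = 1"
    "- int n \<le> y" "y \<le> int n" "y = 0 \<longrightarrow> r = 1" for x y
    using that by (auto simp: idx_def m_eq split: if_splits)
  have idx_lt: "idx T n x < m" if "- int n \<le> x" "x \<le> int n" "x = 0 \<longrightarrow> r = 1" for x
    using that by (auto simp: idx_def m_eq)
  have img: "\<alpha> \<in> roots T n \<Longrightarrow> ?q ` root_entries \<alpha> = {(ri \<alpha>, rj \<alpha>), (rj \<alpha>, ri \<alpha>)}" for \<alpha>
    by (erule root_cases) (auto simp: m_eq)
  have memE: "(x, y) \<in> ?E \<Longrightarrow> \<exists>\<alpha>\<in>D. ?q (x, y) = (ri \<alpha>, rj \<alpha>) \<or> ?q (x, y) = (rj \<alpha>, ri \<alpha>)" for x y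
  proof -
    assume "(x, y) \<in> ?E"
    then obtain \<alpha> where \<alpha>: "\<alpha> \<in> D" "(x, y) \<in> root_entries \<alpha>" by blast
    hence "?q (x, y) \<in> ?q ` root_entries \<alpha>" by (intro imageI)
    thus ?thesis using img[of \<alpha>] \<alpha>(1) D by blast
  qed
  have labE: "(x, y) \<in> ?E \<Longrightarrow> (- int n \<le> x \<and> x \<le> int n \<and> (x = 0 \<longrightarrow> r = 1)) \<and> (- int n \<le> y \<and> y \<le> int n \<and> (y = 0 \<longrightarrow> r = 1))" for x y
    using lab D by blast
  show ?thesis
  proof
    assume B: "basic T n D"
    have "{ri \<alpha>, rj \<alpha>} \<inter> {ri \<beta>, rj \<beta>} = {}" if ab: "\<alpha> \<in> D" "\<beta> \<in> D" "\<alpha> \<noteq> \<beta>" for \<alpha> \<beta>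
    proof (rule ccontr)
      assume "{ri \<alpha>, rj \<alpha>} \<inter> {ri \<beta>, rj \<beta>} \<noteq> {}"
      then obtain c d d' where cd: "(c, d) \<in> {(ri \<alpha>, rj \<alpha>), (rj \<alpha>, ri \<alpha>)}" "(c, d') \<in> {(ri \<beta>, rj \<beta>), (rj \<beta>, ri \<beta>)}" by blast
      have R: "\<alpha> \<in> roots T n" "\<beta> \<in> roots T n" using ab D by auto
      obtain x y where xy: "(x, y) \<in> root_entries \<alpha>" "idx T n x = c" "m - Suc (idx T n y) = d"
        using cd(1) unfolding img[OF R(1), symmetric] by auto
      obtain x' y' where xy': "(x', y') \<in> root_entries \<beta>" "idx T n x' = c" "m - Suc (idx T n y') = d'"
        using cd(2) unfolding img[OF R(2), symmetric] by auto
      have "x = x'" using idx_inj[of x x'] lab[OF R(1) xy(1)] lab[OF R(2) xy'(1)] xy(2) xy'(2) by simp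
      hence "y = y'" using B xy(1) xy'(1) ab unfolding basic_def Let_def by blast
      hence "d = d'" using xy(3) xy'(3) by simp
      \<comment> \<open>The unordered index pairs coincide, and \<open>ri\<close> is always the
        smaller index.\<close>
      hence "ri \<alpha> = ri \<beta> \<and> rj \<alpha> = rj \<beta>"
        using cd root_bounds(2)[OF R(1)] root_bounds(2)[OF R(2)] by auto
      thus False using root_inj[OF R] ab(3) by blast
    qed
    thus "disj D" using D by (simp add: disj_def)
  next
    assume "disj D"
    hence dj: "\<And>\<alpha> \<beta>. \<alpha> \<in> D \<Longrightarrow> \<beta> \<in> D \<Longrightarrow> \<alpha> \<noteq> \<beta> \<Longrightarrow> {ri \<alpha>, rj \<alpha>} \<inter> {ri \<beta>, rj \<beta>} = {}" by (auto simp: disj_def)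
    have same: "(idx T n x = idx T n x') \<longleftrightarrow> (idx T n y = idx T n y')" if E: "(x, y) \<in> ?E" "(x', y') \<in> ?E" for x y x' y'
    proof -
      obtain \<alpha> where \<alpha>: "\<alpha> \<in> D" "?q (x, y) = (ri \<alpha>, rj \<alpha>) \<or> ?q (x, y) = (rj \<alpha>, ri \<alpha>)" using memE[OF E(1)] by blast
      obtain \<beta> where \<beta>: "\<beta> \<in> D" "?q (x', y') = (ri \<beta>, rj \<beta>) \<or> ?q (x', y') = (rj \<beta>, ri \<beta>)" using memE[OF E(2)] by blast
      have lt: "idx T n y < m" "idx T n y' < m"
        using idx_lt[of y] idx_lt[of y'] labE[OF E(1)] labE[OF E(2)] by blast+
      have "idx T n y = idx T n y' \<longleftrightarrow> m - Suc (idx T n y) = m - Suc (idx T n y')" using lt by auto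
      also have "\<dots> \<longleftrightarrow> idx T n x = idx T n x'"
        using \<alpha> \<beta> dj[OF \<alpha>(1) \<beta>(1)] by (cases "\<alpha> = \<beta>") auto
      finally show ?thesis by blast
    qed
    have "j = k" if "(i, j) \<in> ?E" "(i, k) \<in> ?E" for i j k
      using same[OF that] idx_inj[of j k] labE[OF that(1)] labE[OF that(2)] by simp
    moreover have "i = j" if "(i, k) \<in> ?E" "(j, k) \<in> ?E" for i j k
      using same[OF that] idx_inj[of i j] labE[OF that(1)] labE[OF that(2)] by simp
    ultimately show "basic T n D" unfolding basic_def Let_def using D by blast
  qed
qed

section \<open>Basic pairs as monomial symmetric matrices\<close>

lemma rcoef_sym: "\<alpha> \<in> roots T n \<Longrightarrow> rcoef \<alpha> l k = ep * rcoef \<alpha> k l"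
proof -
  assume a: "\<alpha> \<in> roots T n"
  have e: "ep * ep = 1" by (simp add: ep_def dl_def)
  show ?thesis
  proof (cases "ri \<alpha> = rj \<alpha>")
    case True
    thus ?thesis using root_bounds(10)[OF a] by (simp add: rcoef_def)
  next
    case False
    thus ?thesis using e by (auto simp: rcoef_def)
  qed
qed

lemma pS_index: "k < m \<Longrightarrow> l < m \<Longrightarrow> pS D \<phi> $$ (k, l) = (\<Sum>\<alpha>\<in>D. \<phi> \<alpha> * (rsg \<alpha> * rcoef \<alpha> k l))"
  by (simp add: pS_def)

lemma rsg_nz [simp]: "rsg \<alpha> \<noteq> 0" by (simp add: rsg_def sg_def)

lemma rsg_sq: "rsg \<alpha> * rsg \<alpha> = 1" by (simp add: rsg_def sg_def)

lemma pS_in_LL: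
  assumes D: "D \<subseteq> roots T n" shows "pS D \<phi> \<in> LL"
proof -
  have s: "pS D \<phi> $$ (l, k) = ep * pS D \<phi> $$ (k, l)" if kl: "k < m" "l < m" for k l
    unfolding pS_index[OF kl] pS_index[OF kl(2,1)] sum_distrib_left
  proof (intro sum.cong refl)
    fix \<alpha> assume "\<alpha> \<in> D"
    hence "rcoef \<alpha> l k = ep * rcoef \<alpha> k l" using D rcoef_sym by blast
    thus "\<phi> \<alpha> * (rsg \<alpha> * rcoef \<alpha> l k) = ep * (\<phi> \<alpha> * (rsg \<alpha> * rcoef \<alpha> k l))" by simp
  qed
  have z: "pS D \<phi> $$ (k, l) = 0" if kl: "k < m" "l < m" "m \<le> k + l + 1" for k l
    unfolding pS_index[OF kl(1,2)]
  proof (intro sum.neutral ballI)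
    fix \<alpha> assume "\<alpha> \<in> D"
    hence "ri \<alpha> + rj \<alpha> + 1 < m" using D root_bounds(3) by blast
    hence "rcoef \<alpha> k l = 0" using kl(3) by (auto simp: rcoef_def)
    thus "\<phi> \<alpha> * (rsg \<alpha> * rcoef \<alpha> k l) = 0" by simp
  qed
  show ?thesis unfolding LL_def using s z pS_carrier by blast
qed

lemma disjD: "disj D \<Longrightarrow> \<alpha> \<in> D \<Longrightarrow> \<beta> \<in> D \<Longrightarrow> {ri \<alpha>, rj \<alpha>} \<inter> {ri \<beta>, rj \<beta>} \<noteq> {} \<Longrightarrow> \<alpha> = \<beta>"
  by (auto simp: disj_def)

lemma disj_roots: "disj D \<Longrightarrow> D \<subseteq> roots T n" by (simp add: disj_def)

lemma pS_value:
  assumes D: "disj D" and \<alpha>: "\<alpha> \<in> D" and kl: "k < m" "l < m" "k = ri \<alpha> \<or> k = rj \<alpha>"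
  shows "pS D \<phi> $$ (k, l) = \<phi> \<alpha> * (rsg \<alpha> * rcoef \<alpha> k l)"
proof -
  have fin: "finite D" using finite_subset[OF disj_roots[OF D] finite_roots] .
  have "(\<Sum>\<beta>\<in>D. \<phi> \<beta> * (rsg \<beta> * rcoef \<beta> k l)) = (\<Sum>\<beta>\<in>D. if \<beta> = \<alpha> then \<phi> \<alpha> * (rsg \<alpha> * rcoef \<alpha> k l) else 0)"
  proof (intro sum.cong refl)
    fix \<beta> assume b: "\<beta> \<in> D"
    have "\<beta> \<noteq> \<alpha> \<Longrightarrow> k \<noteq> ri \<beta> \<and> k \<noteq> rj \<beta>" using disjD[OF D b \<alpha>] kl(3) by blast
    thus "\<phi> \<beta> * (rsg \<beta> * rcoef \<beta> k l) = (if \<beta> = \<alpha> then \<phi> \<alpha> * (rsg \<alpha> * rcoef \<alpha> k l) else 0)"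
      by (auto simp: rcoef_def)
  qed
  thus ?thesis unfolding pS_index[OF kl(1,2)] using fin \<alpha> by simp
qed

lemma root_lt: "\<alpha> \<in> roots T n \<Longrightarrow> ri \<alpha> < m" "\<alpha> \<in> roots T n \<Longrightarrow> rj \<alpha> < m"
  using root_bounds(3)[of \<alpha>] by auto

lemma pS_value_root:
  assumes D: "disj D" and \<alpha>: "\<alpha> \<in> D"
  shows "pS D \<phi> $$ (ri \<alpha>, rj \<alpha>) = \<phi> \<alpha> * rsg \<alpha>"
proof -
  have r: "\<alpha> \<in> roots T n" using disj_roots[OF D] \<alpha> by blast
  show ?thesis using pS_value[OF D \<alpha> root_lt[OF r], of \<phi>] by (simp add: rcoef_def)
qed

lemma pS_nz:
  assumes kl: "k < m" "l < m" and nz: "pS D \<phi> $$ (k, l) \<noteq> 0"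
  obtains \<alpha> where "\<alpha> \<in> D" "k = ri \<alpha> \<and> l = rj \<alpha> \<or> k = rj \<alpha> \<and> l = ri \<alpha>"
proof -
  have "\<exists>\<alpha>\<in>D. rcoef \<alpha> k l \<noteq> 0"
  proof (rule ccontr)
    assume "\<not> ?thesis"
    hence "(\<Sum>\<alpha>\<in>D. \<phi> \<alpha> * (rsg \<alpha> * rcoef \<alpha> k l)) = 0" by (intro sum.neutral) auto
    thus False using nz unfolding pS_index[OF kl] by simp
  qed
  thus thesis using that by (auto simp: rcoef_def split: if_splits)
qed

lemma pS_row:
  assumes D: "disj D" and "i < m" "a < m" "b < m" "pS D \<phi> $$ (i, a) \<noteq> 0" "pS D \<phi> $$ (i, b) \<noteq> 0"
  shows "a = b"
proof -
  obtain \<alpha> where \<alpha>: "\<alpha> \<in> D" "i = ri \<alpha> \<and> a = rj \<alpha> \<or> i = rj \<alpha> \<and> a = ri \<alpha>" using pS_nz[OF assms(2,3,5)] by blast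
  obtain \<beta> where \<beta>: "\<beta> \<in> D" "i = ri \<beta> \<and> b = rj \<beta> \<or> i = rj \<beta> \<and> b = ri \<beta>" using pS_nz[OF assms(2,4,6)] by blast
  have "\<alpha> = \<beta>" using disjD[OF D \<alpha>(1) \<beta>(1)] \<alpha>(2) \<beta>(2) by blast
  thus ?thesis using \<alpha>(2) \<beta>(2) by auto
qed

lemma pS_col:
  assumes D: "disj D" and "a < m" "b < m" "i < m" "pS D \<phi> $$ (a, i) \<noteq> 0" "pS D \<phi> $$ (b, i) \<noteq> 0"
  shows "a = b"
proof -
  obtain \<alpha> where \<alpha>: "\<alpha> \<in> D" "a = ri \<alpha> \<and> i = rj \<alpha> \<or> a = rj \<alpha> \<and> i = ri \<alpha>" using pS_nz[OF assms(2,4,5)] by blast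
  obtain \<beta> where \<beta>: "\<beta> \<in> D" "b = ri \<beta> \<and> i = rj \<beta> \<or> b = rj \<beta> \<and> i = ri \<beta>" using pS_nz[OF assms(3,4,6)] by blast
  have "\<alpha> = \<beta>" using disjD[OF D \<alpha>(1) \<beta>(1)] \<alpha>(2) \<beta>(2) by blast
  thus ?thesis using \<alpha>(2) \<beta>(2) by auto
qed

lemma pS_inj:
  assumes D: "disj D" "disj D'" and nz: "\<And>\<alpha>. \<alpha> \<in> D \<Longrightarrow> \<phi> \<alpha> \<noteq> 0" "\<And>\<alpha>. \<alpha> \<in> D' \<Longrightarrow> \<phi>' \<alpha> \<noteq> 0"
    and eq: "\<And>k l. k < m \<Longrightarrow> l < m \<Longrightarrow> pS D \<phi> $$ (k, l) = pS D' \<phi>' $$ (k, l)"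
  shows "D = D'" "\<And>\<alpha>. \<alpha> \<in> D \<Longrightarrow> \<phi> \<alpha> = \<phi>' \<alpha>"
proof -
  have sub: "D1 \<subseteq> D2" if D1: "disj D1" and D2: "disj D2" and nz1: "\<And>\<alpha>. \<alpha> \<in> D1 \<Longrightarrow> \<phi>1 \<alpha> \<noteq> 0"
    and eq1: "\<And>k l. k < m \<Longrightarrow> l < m \<Longrightarrow> pS D1 \<phi>1 $$ (k, l) = pS D2 \<phi>2 $$ (k, l)" for D1 D2 \<phi>1 \<phi>2
  proof
    fix \<alpha> assume a: "\<alpha> \<in> D1"
    have r: "\<alpha> \<in> roots T n" using disj_roots[OF D1] a by blast
    have "pS D2 \<phi>2 $$ (ri \<alpha>, rj \<alpha>) \<noteq> 0"
      unfolding eq1[OF root_lt[OF r], symmetric] pS_value_root[OF D1 a] using nz1[OF a] by simp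
    then obtain \<beta> where b: "\<beta> \<in> D2" "ri \<alpha> = ri \<beta> \<and> rj \<alpha> = rj \<beta> \<or> ri \<alpha> = rj \<beta> \<and> rj \<alpha> = ri \<beta>"
      using pS_nz[OF root_lt[OF r]] by blast
    have rb: "\<beta> \<in> roots T n" using disj_roots[OF D2] b(1) by blast
    have "ri \<alpha> = ri \<beta> \<and> rj \<alpha> = rj \<beta>" using b(2) root_bounds(2)[OF r] root_bounds(2)[OF rb] by linarith
    hence "\<alpha> = \<beta>" using root_inj[OF r rb] by blast
    thus "\<alpha> \<in> D2" using b(1) by simp
  qed
  show e: "D = D'" using sub[OF D nz(1) eq] sub[OF D(2,1) nz(2) eq[symmetric]] by blast
  fix \<alpha> assume a: "\<alpha> \<in> D"
  have r: "\<alpha> \<in> roots T n" using disj_roots[OF D(1)] a by blast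
  have a': "\<alpha> \<in> D'" using a e by simp
  show "\<phi> \<alpha> = \<phi>' \<alpha>"
    using eq[OF root_lt[OF r]] pS_value_root[OF D(1) a, of \<phi>] pS_value_root[OF D(2) a', of \<phi>'] by simp
qed

lemma basic_pairsD:
  assumes "(D, \<phi>) \<in> basic_pairs T n"
  shows "disj D" "\<And>\<alpha>. \<alpha> \<in> D \<Longrightarrow> \<phi> \<alpha> \<noteq> (0::'a)" "\<phi> \<in> extensional D"
  using assms by (auto simp: basic_pairs_def basic_iff_disj PiE_def)

lemma basic_pairs_eqI:
  assumes p: "(D, \<phi>) \<in> basic_pairs T n" "(D', \<phi>') \<in> basic_pairs T n"
    and e: "D = D'" "\<And>\<alpha>. \<alpha> \<in> D \<Longrightarrow> \<phi> \<alpha> = (\<phi>' \<alpha> :: 'a)"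
  shows "(D, \<phi>) = (D', \<phi>')"
proof -
  have "\<phi> = \<phi>'" by (rule extensionalityI[OF basic_pairsD(3)[OF p(1)] _ e(2)]) (use basic_pairsD(3)[OF p(2)] e(1) in simp_all)
  thus ?thesis using e(1) by simp
qed

text \<open>The roots are the nonzero positions on or above the diagonal, the other half being
  determined by symmetry. The sign in \<phi> undoes the one built into \<open>pS\<close>.\<close>

lemma monomial_pair:
  assumes M: "M \<in> LL" and row: "\<And>i a b. i < m \<Longrightarrow> a < m \<Longrightarrow> b < m \<Longrightarrow> M $$ (i, a) \<noteq> 0 \<Longrightarrow> M $$ (i, b) \<noteq> 0 \<Longrightarrow> a = b"
  obtains D \<phi> where "(D, \<phi>) \<in> basic_pairs T n" "pS D \<phi> = M"
proof -
  define D where "D = {\<alpha> \<in> roots T n. M $$ (ri \<alpha>, rj \<alpha>) \<noteq> 0}"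
  define \<phi> where "\<phi> = (\<lambda>\<alpha>\<in>D. rsg \<alpha> * M $$ (ri \<alpha>, rj \<alpha>))"
  have D: "D \<subseteq> roots T n" by (auto simp: D_def)
  have sym: "M $$ (l, k) \<noteq> 0" if "k < m" "l < m" "M $$ (k, l) \<noteq> 0" for k l
    using LL_sym[OF M that(1,2)] that(3) ep_nz by simp
  have dj: "disj D"
    unfolding disj_def
  proof (intro conjI D ballI impI)
    fix \<alpha> \<beta> assume ab: "\<alpha> \<in> D" "\<beta> \<in> D" "\<alpha> \<noteq> \<beta>"
    hence r: "\<alpha> \<in> roots T n" "\<beta> \<in> roots T n" and
      nz: "M $$ (ri \<alpha>, rj \<alpha>) \<noteq> 0" "M $$ (ri \<beta>, rj \<beta>) \<noteq> 0" by (auto simp: D_def)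
    note lt = root_lt[OF r(1)] root_lt[OF r(2)]
    note nz' = sym[OF lt(1,2) nz(1)] sym[OF lt(3,4) nz(2)]
    show "{ri \<alpha>, rj \<alpha>} \<inter> {ri \<beta>, rj \<beta>} = {}"
    proof (rule ccontr)
      assume "\<not> ?thesis"
      then consider "ri \<alpha> = ri \<beta>" | "ri \<alpha> = rj \<beta>" | "rj \<alpha> = ri \<beta>" | "rj \<alpha> = rj \<beta>" by blast
      hence "ri \<alpha> = ri \<beta> \<and> rj \<alpha> = rj \<beta>"
      proof cases
        case 1
        have "rj \<alpha> = rj \<beta>" by (rule row[OF lt(1) lt(2) lt(4) nz(1)]) (simp add: 1 nz(2))
        thus ?thesis using 1 by simp
      next
        case 2
        have "rj \<alpha> = ri \<beta>" by (rule row[OF lt(1) lt(2) lt(3) nz(1)]) (simp add: 2 nz'(2))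
        thus ?thesis using 2 root_bounds(2)[OF r(1)] root_bounds(2)[OF r(2)] by linarith
      next
        case 3
        have "ri \<alpha> = rj \<beta>" by (rule row[OF lt(2) lt(1) lt(4) nz'(1)]) (simp add: 3 nz(2))
        thus ?thesis using 3 root_bounds(2)[OF r(1)] root_bounds(2)[OF r(2)] by linarith
      next
        case 4
        have "ri \<alpha> = ri \<beta>" by (rule row[OF lt(2) lt(1) lt(3) nz'(1)]) (simp add: 4 nz'(2))
        thus ?thesis using 4 by simp
      qed
      thus False using root_inj[OF r] ab(3) by blast
    qed
  qed
  have nz: "\<phi> \<alpha> \<noteq> 0" if "\<alpha> \<in> D" for \<alpha> using that by (auto simp: \<phi>_def D_def)
  have bp: "(D, \<phi>) \<in> basic_pairs T n"
    unfolding basic_pairs_def using dj nz by (auto simp: basic_iff_disj PiE_def \<phi>_def)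
  have val: "pS D \<phi> $$ (ri \<alpha>, rj \<alpha>) = M $$ (ri \<alpha>, rj \<alpha>)" if "\<alpha> \<in> D" for \<alpha>
  proof -
    have "rsg \<alpha> * M $$ (ri \<alpha>, rj \<alpha>) * rsg \<alpha> = (rsg \<alpha> * rsg \<alpha>) * M $$ (ri \<alpha>, rj \<alpha>)" by (simp only: mult_ac)
    thus ?thesis unfolding pS_value_root[OF dj that] using that rsg_sq by (simp add: \<phi>_def)
  qed
  have le: "pS D \<phi> $$ (k, l) = M $$ (k, l)" if kl: "k \<le> l" "k < m" "l < m" for k l
  proof (cases "\<exists>\<alpha>\<in>D. ri \<alpha> = k \<and> rj \<alpha> = l")
    case True
    thus ?thesis using val by blast
  next
    case False
    have "pS D \<phi> $$ (k, l) = 0"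
    proof (rule ccontr)
      assume "pS D \<phi> $$ (k, l) \<noteq> 0"
      then obtain \<alpha> where a: "\<alpha> \<in> D" "k = ri \<alpha> \<and> l = rj \<alpha> \<or> k = rj \<alpha> \<and> l = ri \<alpha>" using pS_nz[OF kl(2,3)] by blast
      have "ri \<alpha> \<le> rj \<alpha>" using root_bounds(2) D a(1) by blast
      hence "ri \<alpha> = k \<and> rj \<alpha> = l" using a(2) kl(1) by linarith
      thus False using False a(1) by blast
    qed
    moreover have "M $$ (k, l) = 0"
    proof (rule ccontr)
      assume nzM: "M $$ (k, l) \<noteq> 0"
      have lt: "k + l + 1 < m" using LL_zero[OF M kl(2,3)] nzM by linarith
      \<comment> \<open>An alternating matrix has zero diagonal because 2 is invertible, so a
        nonzero diagonal entry always belongs to a root.\<close>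
      have "ep = 1" if "k = l"
      proof (rule ccontr)
        assume "ep \<noteq> 1"
        hence e: "ep = - 1" by (auto simp: ep_def dl_def split: if_splits)
        have "M $$ (k, k) = - 1 * M $$ (k, k)" using LL_sym[OF M kl(2,2)] unfolding e .
        hence "M $$ (k, k) + M $$ (k, k) = 0" by (simp only: mult_minus1 eq_neg_iff_add_eq_0)
        hence "2 * M $$ (k, k) = 0" unfolding mult_2 .
        thus False using two nzM that by simp
      qed
      then obtain \<alpha> where a: "\<alpha> \<in> roots T n" "ri \<alpha> = k" "rj \<alpha> = l" using root_of_pair[OF kl(1) lt] by blast
      hence "\<alpha> \<in> D" using nzM by (simp add: D_def)
      thus False using False a by blast
    qed
    ultimately show ?thesis by simp
  qed
  have "pS D \<phi> = M"
  proof (rule eq_matI)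
    fix k l assume "k < dim_row M" "l < dim_col M"
    hence kl: "k < m" "l < m" using LL_carrier[OF M] by auto
    show "pS D \<phi> $$ (k, l) = M $$ (k, l)"
    proof (cases "k \<le> l")
      case True thus ?thesis using le kl by blast
    next
      case False
      hence "pS D \<phi> $$ (l, k) = M $$ (l, k)" using le kl by simp
      thus ?thesis using LL_sym[OF M kl(2,1)] LL_sym[OF pS_in_LL[OF D] kl(2,1), of \<phi>] by simp
    qed
  qed (use LL_carrier[OF M] in \<open>auto simp: pS_def\<close>)
  thus thesis using that bp by blast
qed

section \<open>Superclasses as orbits of forms\<close>

lemma Om_cancel:
  assumes "A \<in> carrier_mat m m" "B \<in> carrier_mat m m" "A * Om = B * Om"
  shows "A = B"
proof (rule eq_matI)
  fix a b assume "a < dim_row B" "b < dim_col B"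
  hence ab: "a < m" "m - Suc b < m" "m - Suc (m - Suc b) = b" using assms(2) by auto
  have "(A * Om) $$ (a, m - Suc b) = (B * Om) $$ (a, m - Suc b)" using assms(3) by simp
  hence "A $$ (a, b) * sg b = B $$ (a, b) * sg b"
    unfolding Om_mult_right[OF assms(1) ab(1,2)] Om_mult_right[OF assms(2) ab(1,2)] ab(3) .
  thus "A $$ (a, b) = B $$ (a, b)" by (simp add: sg_def split: if_splits)
qed (use assms in auto)

lemma Om_slide: "A \<in> carrier_mat m m \<Longrightarrow> A * Om = Om * (adj A)\<^sup>T"
  using adj_Om[of "adj A"] by (simp add: adj_adj)

text \<open>\<open>SS X\<close> is \<open>X - 1\<close> times \<open>cay X\<close> times the form,
  and unitriangular factors cross the form as transposes of their adjoints. The correction by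
  \<open>cay X\<close> is therefore absorbed in the right factor of the two-sided orbit.\<close>

lemma superclass_two_sided:
  assumes D: "D \<subseteq> roots T n"
  shows "X \<in> superclass T n D \<phi> \<longleftrightarrow> X \<in> UU \<and> (\<exists>x\<in>unitri m. \<exists>z\<in>unitri m. SS X = x * pS D \<phi> * z\<^sup>T)"
proof -
  let ?P = "pair_mat T n D \<phi> :: 'a mat"
  have P: "?P \<in> carrier_mat m m" by simp
  have "X - 1\<^sub>m m \<in> V_orbit T n D \<phi> \<longleftrightarrow> (\<exists>x\<in>unitri m. \<exists>z\<in>unitri m. SS X = x * pS D \<phi> * z\<^sup>T)" if X: "X \<in> UU"
  proof -
    note Xu = UU_unitri[OF X]
    note cy = cay[OF Xu]
    have c: "X - 1\<^sub>m m \<in> carrier_mat m m" "cay X \<in> carrier_mat m m" "mid_mat X \<in> carrier_mat m m"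
      using cy(1) mid_mat_unitri[OF Xu] unitri_carrier by auto
    have S: "SS X = (X - 1\<^sub>m m) * cay X * Om" unfolding SS_def two_minus_cay[OF Xu] ..
    show ?thesis
    proof
      assume "X - 1\<^sub>m m \<in> V_orbit T n D \<phi>"
      then obtain x y where xy: "x \<in> unitri m" "y \<in> unitri m" "X - 1\<^sub>m m = x * ?P * y"
        unfolding V_orbit_def by blast
      note cx = unitri_carrier[OF xy(1)] unitri_carrier[OF xy(2)]
      have u: "y * cay X \<in> unitri m" by (rule unitri_mult[OF xy(2) cy(1)])
      note cu = unitri_carrier[OF u]
      have "SS X = x * ?P * (y * cay X * Om)" unfolding S xy(3) using cx c P by (simp add: mult_assoc)
      also have "\<dots> = x * ?P * (Om * (adj (y * cay X))\<^sup>T)" by (simp only: Om_slide[OF cu])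
      also have "\<dots> = x * (?P * Om) * (adj (y * cay X))\<^sup>T" using cx P by (simp add: mult_assoc)
      finally show "\<exists>x\<in>unitri m. \<exists>z\<in>unitri m. SS X = x * pS D \<phi> * z\<^sup>T"
        unfolding pair_mat_Om[OF D] using xy(1) adj_unitri[OF u] by blast
    next
      assume "\<exists>x\<in>unitri m. \<exists>z\<in>unitri m. SS X = x * pS D \<phi> * z\<^sup>T"
      then obtain x z where xz: "x \<in> unitri m" "z \<in> unitri m" "SS X = x * pS D \<phi> * z\<^sup>T" by blast
      note cx = unitri_carrier[OF xz(1)] unitri_carrier[OF xz(2)]
      have cz: "z\<^sup>T \<in> carrier_mat m m" using cx by simp
      have "(X - 1\<^sub>m m) * cay X * Om = x * ?P * (Om * z\<^sup>T)"
        unfolding S[symmetric] xz(3) pair_mat_Om[OF D, symmetric] using cx cz P by (simp add: mult_assoc)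
      also have "\<dots> = x * ?P * adj z * Om" unfolding adj_Om[OF cx(2), symmetric] using cx P by (simp add: mult_assoc)
      finally have e: "(X - 1\<^sub>m m) * cay X = x * ?P * adj z"
        by (rule Om_cancel[rotated -1]) (use cx c P in simp_all)
      have "X - 1\<^sub>m m = (X - 1\<^sub>m m) * cay X * mid_mat X"
        using c cy(3) by (simp add: mult_assoc)
      also have "\<dots> = x * ?P * (adj z * mid_mat X)" unfolding e using c cx P by (simp add: mult_assoc)
      finally show "X - 1\<^sub>m m \<in> V_orbit T n D \<phi>"
        unfolding V_orbit_def using xz(1) unitri_mult[OF adj_unitri[OF xz(2)] mid_mat_unitri[OF Xu]] by blast
    qed
  qed
  thus ?thesis unfolding superclass_def carrier_U_group by blast
qed

lemma two_sided_half:
  assumes u: "x \<in> unitri m" "z \<in> unitri m" "x' \<in> unitri m" "z' \<in> unitri m"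
    and M: "M \<in> carrier_mat m m" "M' \<in> carrier_mat m m" and eq: "x * M * z\<^sup>T = x' * M' * z'\<^sup>T"
  shows "(uinv x' * x) * M = M' * (uinv z * z')\<^sup>T"
proof -
  note c = u[THEN unitri_carrier]
  have ci: "uinv x' \<in> carrier_mat m m" "uinv z \<in> carrier_mat m m" using uinv(1) u unitri_carrier by auto
  have ct: "z\<^sup>T \<in> carrier_mat m m" "z'\<^sup>T \<in> carrier_mat m m" "(uinv z)\<^sup>T \<in> carrier_mat m m" using c ci by auto
  have z1: "z\<^sup>T * (uinv z)\<^sup>T = 1\<^sub>m m" using transpose_mult[OF ci(2) c(2)] uinv(3)[OF u(2)] by simp
  have "uinv x' * x * M = uinv x' * (x * M * z\<^sup>T) * (uinv z)\<^sup>T"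
    using c ci ct M z1 by (simp add: mult_assoc)
  also have "\<dots> = (uinv x' * x') * M' * (z'\<^sup>T * (uinv z)\<^sup>T)"
    unfolding eq using c ci ct M by (simp add: mult_assoc)
  also have "\<dots> = M' * (uinv z * z')\<^sup>T"
    unfolding uinv(3)[OF u(3)] transpose_mult[OF ci(2) c(4)] using M by simp
  finally show ?thesis .
qed

text \<open>No relation between left and right factors is assumed. Cancelling one factor on each
  side leaves an upper unitriangular matrix on the left and a lower one on the right, so pivots can
  only be compared with pivots further right; antisymmetry of the order fixes them.\<close>

lemma two_sided_unique:
  assumes p: "(D, \<phi>) \<in> basic_pairs T n" "(D', \<phi>') \<in> basic_pairs T n"
    and u: "x \<in> unitri m" "z \<in> unitri m" "x' \<in> unitri m" "z' \<in> unitri m"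
    and eq: "x * pS D \<phi> * z\<^sup>T = x' * pS D' \<phi>' * z'\<^sup>T"
  shows "(D, \<phi>) = (D', \<phi>')"
proof -
  note dj = basic_pairsD(1)[OF p(1)] basic_pairsD(1)[OF p(2)]
  have step: "\<exists>b<m. pS D2 \<phi>2 $$ (i, b) \<noteq> 0 \<and> j \<le> b \<and> (b = j \<longrightarrow> pS D2 \<phi>2 $$ (i, j) = pS D1 \<phi>1 $$ (i, j))"
    if d1: "disj D1" and d2: "disj D2" and v: "x1 \<in> unitri m" "z1 \<in> unitri m" "x2 \<in> unitri m" "z2 \<in> unitri m"
    and e: "x1 * pS D1 \<phi>1 * z1\<^sup>T = x2 * pS D2 \<phi>2 * z2\<^sup>T"
    and ij: "i < m" "j < m" and nz: "pS D1 \<phi>1 $$ (i, j) \<noteq> 0" for D1 \<phi>1 D2 \<phi>2 x1 z1 x2 z2 i j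
  proof -
    have A: "uinv x2 * x1 \<in> unitri m" and B: "uinv z1 * z2 \<in> unitri m" using v uinv(1) unitri_mult by auto
    note half = two_sided_half[OF v pS_carrier pS_carrier e]
    have Bt: "(uinv z1 * z2)\<^sup>T $$ (b, j) = (uinv z1 * z2) $$ (j, b)" if "b < m" "j < m" for b j
      using carrier_matD[OF unitri_carrier[OF B]] that by simp
    have R: "j \<le> b" if "b < m" "j < m" "(uinv z1 * z2)\<^sup>T $$ (b, j) \<noteq> 0" for b j
      using that(3) unitri_zero[OF B that(2), of b] unfolding Bt[OF that(1,2)] by (meson not_le)
    show ?thesis
    proof (rule pivot_step[where A = "uinv x2 * x1" and B = "(uinv z1 * z2)\<^sup>T" and R = "\<lambda>b j. j \<le> b"])
      show "uinv x2 * x1 \<in> carrier_mat m m" "(uinv z1 * z2)\<^sup>T \<in> carrier_mat m m"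
        using unitri_carrier[OF A] unitri_carrier[OF B] by auto
      show "\<And>i. i < m \<Longrightarrow> (uinv z1 * z2)\<^sup>T $$ (i, i) = 1" using Bt unitri_diag[OF B] by simp
      show "(uinv x2 * x1 * pS D1 \<phi>1) $$ (i, j) = (pS D2 \<phi>2 * (uinv z1 * z2)\<^sup>T) $$ (i, j)" unfolding half ..
    qed (fact pS_carrier unitri_diag[OF A] R pS_col[OF d1] pS_row[OF d2] ij nz)+
  qed
  have e: "pS D \<phi> $$ (i, j) = pS D' \<phi>' $$ (i, j)" if "i < m" "j < m" for i j
    by (rule unique_pivots[where R = "\<lambda>b j. j \<le> b" and M = "\<lambda>i j. pS D \<phi> $$ (i, j)" and M' = "\<lambda>i j. pS D' \<phi>' $$ (i, j)",
          OF _ pS_row[OF dj(1)] pS_row[OF dj(2)] step[OF dj u eq] step[OF dj(2,1) u(3,4,1,2) eq[symmetric]] that]) linarith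
  show ?thesis
    by (rule basic_pairs_eqI[OF p pS_inj[OF dj basic_pairsD(2)[OF p(1)] basic_pairsD(2)[OF p(2)] e]])
qed

lemma cong_cancel:
  assumes g: "g \<in> unitri m" and S: "S \<in> carrier_mat m m" and e: "g * S * g\<^sup>T = M"
  shows "S = uinv g * M * (uinv g)\<^sup>T"
proof -
  note c = unitri_carrier[OF g] unitri_carrier[OF uinv(1)[OF g]]
  show ?thesis unfolding e[symmetric] cong_mult[OF c S] uinv(3)[OF g] using S by simp
qed

lemma LL_normal_form:
  assumes "S \<in> LL"
  obtains D \<phi> g where "(D, \<phi>) \<in> basic_pairs T n" "g \<in> unitri m" "g * S * g\<^sup>T = pS D \<phi>"
proof -
  obtain g where g: "g \<in> unitri m" "g * S * g\<^sup>T \<in> LL"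
    "\<And>a b c. a < m \<Longrightarrow> b < m \<Longrightarrow> c < m \<Longrightarrow> (g * S * g\<^sup>T) $$ (a, b) \<noteq> 0 \<Longrightarrow> (g * S * g\<^sup>T) $$ (a, c) \<noteq> 0 \<Longrightarrow> b = c"
    using normal_form[OF assms] by blast
  show thesis
  proof (rule monomial_pair[OF g(2)])
    fix D \<phi> assume "(D, \<phi>) \<in> basic_pairs T n" "pS D \<phi> = g * S * g\<^sup>T"
    from that[OF this(1) g(1) this(2)[symmetric]] show thesis .
  qed (rule g(3))
qed

text \<open>An element of a two-sided orbit has a monomial normal form under congruence. Congruence
  is a special two-sided action, so uniqueness identifies that form with the given one, and the
  larger group does not merge congruence orbits.\<close>

lemma superclass_iff:
  assumes p: "(D, \<phi>) \<in> basic_pairs T n"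
  shows "X \<in> superclass T n D \<phi> \<longleftrightarrow> X \<in> UU \<and> (\<exists>g\<in>unitri m. g * SS X * g\<^sup>T = pS D \<phi>)"
proof -
  note D = disj_roots[OF basic_pairsD(1)[OF p]]
  have "(\<exists>x\<in>unitri m. \<exists>z\<in>unitri m. SS X = x * pS D \<phi> * z\<^sup>T) \<longleftrightarrow> (\<exists>g\<in>unitri m. g * SS X * g\<^sup>T = pS D \<phi>)"
    if X: "X \<in> UU"
  proof
    note Sc = SS_carrier[OF UU_unitri[OF X]]
    { assume "\<exists>x\<in>unitri m. \<exists>z\<in>unitri m. SS X = x * pS D \<phi> * z\<^sup>T"
      then obtain x z where xz: "x \<in> unitri m" "z \<in> unitri m" "SS X = x * pS D \<phi> * z\<^sup>T" by blast
      obtain D' \<phi>' g where g: "(D', \<phi>') \<in> basic_pairs T n" "g \<in> unitri m" "g * SS X * g\<^sup>T = pS D' \<phi>'"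
        using LL_normal_form[OF SS_in_LL[OF X]] by blast
      have "x * pS D \<phi> * z\<^sup>T = uinv g * pS D' \<phi>' * (uinv g)\<^sup>T"
        using cong_cancel[OF g(2) Sc g(3)] xz(3) by simp
      hence "(D, \<phi>) = (D', \<phi>')" by (rule two_sided_unique[OF p g(1) xz(1,2) uinv(1)[OF g(2)] uinv(1)[OF g(2)]])
      thus "\<exists>g\<in>unitri m. g * SS X * g\<^sup>T = pS D \<phi>" using g(2,3) by blast }
    { assume "\<exists>g\<in>unitri m. g * SS X * g\<^sup>T = pS D \<phi>"
      then obtain g where g: "g \<in> unitri m" "g * SS X * g\<^sup>T = pS D \<phi>" by blast
      show "\<exists>x\<in>unitri m. \<exists>z\<in>unitri m. SS X = x * pS D \<phi> * z\<^sup>T"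
        using cong_cancel[OF g(1) Sc g(2)] uinv(1)[OF g(1)] by blast }
  qed
  thus ?thesis unfolding superclass_two_sided[OF D] by blast
qed

lemma superclass_nonempty:
  assumes p: "(D, \<phi>) \<in> basic_pairs T n"
  shows "(superclass T n D \<phi> :: 'a mat set) \<noteq> {}"
proof -
  have "pS D \<phi> \<in> SS ` UU"
    using pS_in_LL[OF disj_roots[OF basic_pairsD(1)[OF p]]] bij_SS unfolding bij_betw_def by simp
  then obtain X where X: "X \<in> UU" "SS X = pS D \<phi>" by auto
  have "1\<^sub>m m * SS X * (1\<^sub>m m)\<^sup>T = pS D \<phi>" unfolding X(2)
    by (simp add: left_mult_one_mat[OF pS_carrier] right_mult_one_mat[OF pS_carrier])
  hence "X \<in> superclass T n D \<phi>" unfolding superclass_iff[OF p] using X(1) unitri_one by blast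
  thus ?thesis by blast
qed

lemma superclass_disjoint:
  assumes p: "(D, \<phi>) \<in> basic_pairs T n" "(D', \<phi>') \<in> basic_pairs T n"
    and X: "(X :: 'a mat) \<in> superclass T n D \<phi>" "X \<in> superclass T n D' \<phi>'"
  shows "(D, \<phi>) = (D', \<phi>')"
proof -
  obtain x z where xz: "x \<in> unitri m" "z \<in> unitri m" "SS X = x * pS D \<phi> * z\<^sup>T"
    using X(1) unfolding superclass_two_sided[OF disj_roots[OF basic_pairsD(1)[OF p(1)]]] by blast
  obtain x' z' where xz': "x' \<in> unitri m" "z' \<in> unitri m" "SS X = x' * pS D' \<phi>' * z'\<^sup>T"
    using X(2) unfolding superclass_two_sided[OF disj_roots[OF basic_pairsD(1)[OF p(2)]]] by blast
  show ?thesis by (rule two_sided_unique[OF p xz(1,2) xz'(1,2)]) (use xz(3) xz'(3) in simp)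
qed

lemma superclass_cover: "(\<Union>(D, \<phi>)\<in>basic_pairs T n. superclass T n D \<phi> :: 'a mat set) = UU"
proof (intro equalityI subsetI)
  fix X assume X: "X \<in> UU"
  obtain D \<phi> g where g: "(D, \<phi>) \<in> basic_pairs T n" "g \<in> unitri m" "g * SS X * g\<^sup>T = pS D \<phi>"
    using LL_normal_form[OF SS_in_LL[OF X]] by blast
  hence "X \<in> superclass T n D \<phi>" unfolding superclass_iff[OF g(1)] using X by blast
  thus "X \<in> (\<Union>(D, \<phi>)\<in>basic_pairs T n. superclass T n D \<phi>)" using g(1) by blast
next
  fix X :: "'a mat" assume "X \<in> (\<Union>(D, \<phi>)\<in>basic_pairs T n. superclass T n D \<phi>)"
  thus "X \<in> UU" by (auto simp: superclass_def carrier_U_group)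
qed

text \<open>The function undefined everywhere is the only extensional function on the empty set;
  this pair indexes the identity class.\<close>

lemma empty_basic_pair: "({}, \<lambda>_. undefined) \<in> basic_pairs T n"
  by (auto simp: basic_pairs_def basic_iff_disj disj_def)

lemma superclass_empty: "superclass T n {} \<phi> = {1\<^sub>m m :: 'a mat}"
proof -
  have P: "pair_mat T n {} \<phi> = (0\<^sub>m m m :: 'a mat)" by (intro eq_matI) (auto simp: pair_mat_def)
  have "V_orbit T n {} \<phi> = {0\<^sub>m m m :: 'a mat}"
  proof -
    have "x * 0\<^sub>m m m * y = 0\<^sub>m m m" if "x \<in> unitri m" "y \<in> unitri m" for x y :: "'a mat"
      using unitri_carrier[OF that(1)] unitri_carrier[OF that(2)] by simp
    note z = this
    show ?thesis
    proof (intro equalityI subsetI)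
      fix A :: "'a mat" assume "A \<in> V_orbit T n {} \<phi>"
      then obtain x y where "x \<in> unitri m" "y \<in> unitri m" "A = x * 0\<^sub>m m m * y" unfolding V_orbit_def P by blast
      thus "A \<in> {0\<^sub>m m m}" using z by simp
    next
      fix A :: "'a mat" assume "A \<in> {0\<^sub>m m m}"
      hence "A = 1\<^sub>m m * 0\<^sub>m m m * 1\<^sub>m m" using z[OF unitri_one unitri_one] by simp
      thus "A \<in> V_orbit T n {} \<phi>" unfolding V_orbit_def P mem_Collect_eq using unitri_one by (intro exI conjI)
    qed
  qed
  moreover have "X = 1\<^sub>m m" if "X \<in> UU" "X - 1\<^sub>m m = 0\<^sub>m m m" for X
  proof (rule eq_matI)
    fix a b assume "a < dim_row (1\<^sub>m m :: 'a mat)" "b < dim_col (1\<^sub>m m :: 'a mat)"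
    hence ab: "a < m" "b < m" by auto
    have "(X - 1\<^sub>m m) $$ (a, b) = (0\<^sub>m m m :: 'a mat) $$ (a, b)" unfolding that(2) ..
    thus "X $$ (a, b) = (1\<^sub>m m :: 'a mat) $$ (a, b)" using ab UU_carrier[OF that(1)] by simp
  qed (use UU_carrier[OF that(1)] in auto)
  moreover have "1\<^sub>m m - 1\<^sub>m m = (0\<^sub>m m m :: 'a mat)" by (intro eq_matI) auto
  ultimately show ?thesis unfolding superclass_def carrier_U_group using UU_one by blast
qed

lemma finite_basic_pairs: "finite (basic_pairs T n :: (root set \<times> (root \<Rightarrow> 'a)) set)"
proof (rule finite_subset)
  show "basic_pairs T n \<subseteq> Sigma (Pow (roots T n)) (\<lambda>D. D \<rightarrow>\<^sub>E (UNIV :: 'a set))"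
    unfolding basic_pairs_def basic_iff_disj using disj_roots by (auto simp: PiE_def)
  show "finite (Sigma (Pow (roots T n)) (\<lambda>D. D \<rightarrow>\<^sub>E (UNIV :: 'a set)))"
  proof (rule finite_SigmaI)
    fix D assume "D \<in> Pow (roots T n)"
    hence "finite D" using finite_subset[OF _ finite_roots] by simp
    thus "finite (D \<rightarrow>\<^sub>E (UNIV :: 'a set))" by (intro finite_PiE) simp_all
  qed (simp add: finite_roots)
qed

section \<open>Orthogonality of supercharacters\<close>

lemma rcoef_bilinear:
  assumes a: "\<alpha> \<in> roots T n"
  shows "(\<Sum>a<m. \<Sum>b<m. x a * rcoef \<alpha> a b * y b) =
    (if ri \<alpha> = rj \<alpha> then x (ri \<alpha>) * y (ri \<alpha>) else x (ri \<alpha>) * y (rj \<alpha>) + ep * (x (rj \<alpha>) * y (ri \<alpha>)))"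
proof -
  note lt = root_lt[OF a]
  have one: "(\<Sum>a<m. \<Sum>b<m. (if a = i then if b = j then c else 0 else 0)) = c" if "i < m" "j < m" for i j and c :: 'a
  proof -
    have "(\<Sum>a<m. \<Sum>b<m. (if a = i then if b = j then c else 0 else 0)) = (\<Sum>a<m. if a = i then c else 0)"
      by (intro sum.cong refl) (use that in simp)
    thus ?thesis using that by simp
  qed
  show ?thesis
  proof (cases "ri \<alpha> = rj \<alpha>")
    case True
    have "(\<Sum>a<m. \<Sum>b<m. x a * rcoef \<alpha> a b * y b) =
      (\<Sum>a<m. \<Sum>b<m. (if a = ri \<alpha> then if b = ri \<alpha> then x (ri \<alpha>) * y (ri \<alpha>) else 0 else 0))"
      by (intro sum.cong refl) (use True in \<open>auto simp: rcoef_def\<close>)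
    thus ?thesis using one[OF lt(1,1)] True by simp
  next
    case False
    have "(\<Sum>a<m. \<Sum>b<m. x a * rcoef \<alpha> a b * y b) =
      (\<Sum>a<m. \<Sum>b<m. (if a = ri \<alpha> then if b = rj \<alpha> then x (ri \<alpha>) * y (rj \<alpha>) else 0 else 0) +
        (if a = rj \<alpha> then if b = ri \<alpha> then ep * (x (rj \<alpha>) * y (ri \<alpha>)) else 0 else 0))"
      by (intro sum.cong refl) (use False in \<open>auto simp: rcoef_def mult_ac\<close>)
    thus ?thesis unfolding sum.distrib using one[OF lt] one[OF lt(2,1)] False by simp
  qed
qed

text \<open>Disjointness of the index pairs prevents two roots from prescribing the same row, and
  the leading entries of the vectors are those of a unitriangular matrix. Unit vectors fill the
  remaining rows.\<close>

lemma unitri_with_rows: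
  assumes D: "disj D" and w: "w \<in> (\<Pi>\<^sub>E \<alpha>\<in>D. WW (ri \<alpha>) (rj \<alpha>))"
  obtains H where "H \<in> unitri m"
    "\<And>\<alpha> b. \<alpha> \<in> D \<Longrightarrow> b < m \<Longrightarrow> H $$ (ri \<alpha>, b) = fst (w \<alpha>) $ b"
    "\<And>\<alpha> b. \<alpha> \<in> D \<Longrightarrow> b < m \<Longrightarrow> H $$ (rj \<alpha>, b) = snd (w \<alpha>) $ b"
proof -
  have W: "fst (w \<alpha>) \<in> VV (ri \<alpha>)" "snd (w \<alpha>) \<in> VV (rj \<alpha>)" "ri \<alpha> = rj \<alpha> \<Longrightarrow> fst (w \<alpha>) = snd (w \<alpha>)" if "\<alpha> \<in> D" for \<alpha>
  proof -
    have "w \<alpha> \<in> WW (ri \<alpha>) (rj \<alpha>)" using w that by (rule PiE_mem)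
    thus "fst (w \<alpha>) \<in> VV (ri \<alpha>)" "snd (w \<alpha>) \<in> VV (rj \<alpha>)" "ri \<alpha> = rj \<alpha> \<Longrightarrow> fst (w \<alpha>) = snd (w \<alpha>)"
      by (auto simp: WW_def)
  qed
  have ex: "\<exists>v\<in>VV a. \<forall>\<alpha>\<in>D. (a = ri \<alpha> \<longrightarrow> v = fst (w \<alpha>)) \<and> (a = rj \<alpha> \<longrightarrow> v = snd (w \<alpha>))" if a: "a < m" for a
  proof (cases "\<exists>\<alpha>\<in>D. a = ri \<alpha> \<or> a = rj \<alpha>")
    case True
    then obtain \<alpha> where \<alpha>: "\<alpha> \<in> D" "a = ri \<alpha> \<or> a = rj \<alpha>" by blast
    have u: "\<beta> = \<alpha>" if "\<beta> \<in> D" "a = ri \<beta> \<or> a = rj \<beta>" for \<beta>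
      using disjD[OF D that(1) \<alpha>(1)] that(2) \<alpha>(2) by blast
    show ?thesis
    proof (cases "a = ri \<alpha>")
      case True
      show ?thesis
      proof (rule bexI[of _ "fst (w \<alpha>)"])
        show "\<forall>\<beta>\<in>D. (a = ri \<beta> \<longrightarrow> fst (w \<alpha>) = fst (w \<beta>)) \<and> (a = rj \<beta> \<longrightarrow> fst (w \<alpha>) = snd (w \<beta>))"
        proof (intro ballI conjI impI)
          fix \<beta> assume b: "\<beta> \<in> D"
          { assume "a = ri \<beta>" thus "fst (w \<alpha>) = fst (w \<beta>)" using u[OF b] by simp }
          { assume r: "a = rj \<beta>"
            have e: "\<beta> = \<alpha>" using u[OF b] r by simp
            have "ri \<alpha> = rj \<alpha>" using True r unfolding e by simp
            thus "fst (w \<alpha>) = snd (w \<beta>)" unfolding e by (rule W(3)[OF \<alpha>(1)]) }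
        qed
        show "fst (w \<alpha>) \<in> VV a" using W(1)[OF \<alpha>(1)] True by simp
      qed
    next
      case False
      hence r: "a = rj \<alpha>" using \<alpha>(2) by simp
      show ?thesis
      proof (rule bexI[of _ "snd (w \<alpha>)"])
        show "\<forall>\<beta>\<in>D. (a = ri \<beta> \<longrightarrow> snd (w \<alpha>) = fst (w \<beta>)) \<and> (a = rj \<beta> \<longrightarrow> snd (w \<alpha>) = snd (w \<beta>))"
        proof (intro ballI conjI impI)
          fix \<beta> assume b: "\<beta> \<in> D"
          { assume r: "a = ri \<beta>"
            have "\<beta> = \<alpha>" using u[OF b] r by simp
            thus "snd (w \<alpha>) = fst (w \<beta>)" using False r by simp }
          { assume "a = rj \<beta>" thus "snd (w \<alpha>) = snd (w \<beta>)" using u[OF b] by simp }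
        qed
        show "snd (w \<alpha>) \<in> VV a" using W(2)[OF \<alpha>(1)] r by simp
      qed
    qed
  next
    case False
    have "unit_vec m a \<in> VV a" using a by (auto simp: VV_def)
    thus ?thesis using False by blast
  qed
  have "\<exists>v. \<forall>a\<in>{..<m}. v a \<in> VV a \<and> (\<forall>\<alpha>\<in>D. (a = ri \<alpha> \<longrightarrow> v a = fst (w \<alpha>)) \<and> (a = rj \<alpha> \<longrightarrow> v a = snd (w \<alpha>)))"
    by (rule bchoice) (use ex in blast)
  then obtain v where v: "\<And>a. a < m \<Longrightarrow> v a \<in> VV a"
    "\<And>a \<alpha>. a < m \<Longrightarrow> \<alpha> \<in> D \<Longrightarrow> a = ri \<alpha> \<Longrightarrow> v a = fst (w \<alpha>)"
    "\<And>a \<alpha>. a < m \<Longrightarrow> \<alpha> \<in> D \<Longrightarrow> a = rj \<alpha> \<Longrightarrow> v a = snd (w \<alpha>)" by blast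
  define H where "H = mat m m (\<lambda>(a, b). v a $ b)"
  have "H \<in> unitri m" unfolding unitri_iff using v(1) by (auto simp: H_def VV_def)
  moreover have "H $$ (ri \<alpha>, b) = fst (w \<alpha>) $ b" "H $$ (rj \<alpha>, b) = snd (w \<alpha>) $ b" if "\<alpha> \<in> D" "b < m" for \<alpha> b
  proof -
    have "\<alpha> \<in> roots T n" using disj_roots[OF D] that(1) by blast
    note lt = root_lt[OF this]
    show "H $$ (ri \<alpha>, b) = fst (w \<alpha>) $ b" using v(2)[OF lt(1) that(1) refl] lt that(2) by (simp add: H_def)
    show "H $$ (rj \<alpha>, b) = snd (w \<alpha>) $ b" using v(3)[OF lt(2) that(1) refl] lt that(2) by (simp add: H_def)
  qed
  ultimately show thesis using that by blast
qed

text \<open>Symmetrizing the form counts the diagonal roots twice.\<close>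

definition dbl :: "(root \<Rightarrow> 'a) \<Rightarrow> root \<Rightarrow> 'a" where
  "dbl \<phi> \<alpha> = (if ri \<alpha> = rj \<alpha> then 2 * \<phi> \<alpha> else \<phi> \<alpha>)"

text \<open>The phase of a family of vectors is a linear functional of \<open>S\<close>. Against
  matrices with symmetry sign \<open>ep\<close> only its symmetrized coefficient matrix matters, and
  this is the monomial matrix transformed by a unitriangular \<open>H\<close> whose rows are the
  vectors.\<close>

lemma symmetrized_form:
  assumes D: "disj D" and H: "H \<in> unitri m"
    and rows: "\<And>\<alpha> b. \<alpha> \<in> D \<Longrightarrow> b < m \<Longrightarrow> H $$ (ri \<alpha>, b) = fst (w \<alpha>) $ b"
    "\<And>\<alpha> b. \<alpha> \<in> D \<Longrightarrow> b < m \<Longrightarrow> H $$ (rj \<alpha>, b) = snd (w \<alpha>) $ b"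
    and kl: "k < m" "l < m"
  shows "(H\<^sup>T * pS D (dbl \<phi>) * H) $$ (k, l) =
    (\<Sum>\<alpha>\<in>D. \<phi> \<alpha> * rsg \<alpha> * (fst (w \<alpha>) $ k * snd (w \<alpha>) $ l)) +
    ep * (\<Sum>\<alpha>\<in>D. \<phi> \<alpha> * rsg \<alpha> * (fst (w \<alpha>) $ l * snd (w \<alpha>) $ k))"
proof -
  note c = unitri_carrier[OF H]
  have ct: "H\<^sup>T \<in> carrier_mat m m" "H\<^sup>T * pS D (dbl \<phi>) \<in> carrier_mat m m" using c by auto
  have "(H\<^sup>T * pS D (dbl \<phi>) * H) $$ (k, l) = (\<Sum>b<m. \<Sum>a<m. H $$ (a, k) * pS D (dbl \<phi>) $$ (a, b) * H $$ (b, l))"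
    unfolding mult_index[OF ct(2) c kl] using c kl
    by (intro sum.cong refl) (simp add: mult_index[OF ct(1) pS_carrier] sum_distrib_right)
  also have "\<dots> = (\<Sum>a<m. \<Sum>b<m. \<Sum>\<alpha>\<in>D. dbl \<phi> \<alpha> * rsg \<alpha> * (H $$ (a, k) * rcoef \<alpha> a b * H $$ (b, l)))"
    by (subst sum.swap, intro sum.cong refl)
       (simp add: pS_index sum_distrib_left sum_distrib_right mult_ac)
  also have "\<dots> = (\<Sum>\<alpha>\<in>D. \<Sum>a<m. \<Sum>b<m. dbl \<phi> \<alpha> * rsg \<alpha> * (H $$ (a, k) * rcoef \<alpha> a b * H $$ (b, l)))"
    unfolding sum.swap[of _ D] ..
  also have "\<dots> = (\<Sum>\<alpha>\<in>D. dbl \<phi> \<alpha> * rsg \<alpha> * (\<Sum>a<m. \<Sum>b<m. H $$ (a, k) * rcoef \<alpha> a b * H $$ (b, l)))"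
    unfolding sum_distrib_left ..
  also have "\<dots> = (\<Sum>\<alpha>\<in>D. \<phi> \<alpha> * rsg \<alpha> * (fst (w \<alpha>) $ k * snd (w \<alpha>) $ l) +
    ep * (\<phi> \<alpha> * rsg \<alpha> * (fst (w \<alpha>) $ l * snd (w \<alpha>) $ k)))"
  proof (intro sum.cong refl)
    fix \<alpha> assume a: "\<alpha> \<in> D"
    have r: "\<alpha> \<in> roots T n" using disj_roots[OF D] a by blast
    note bl = rcoef_bilinear[OF r, of "\<lambda>a. H $$ (a, k)" "\<lambda>b. H $$ (b, l)"]
    note rk = rows(1)[OF a kl(1)] rows(1)[OF a kl(2)] rows(2)[OF a kl(1)] rows(2)[OF a kl(2)]
    show "dbl \<phi> \<alpha> * rsg \<alpha> * (\<Sum>a<m. \<Sum>b<m. H $$ (a, k) * rcoef \<alpha> a b * H $$ (b, l)) =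
      \<phi> \<alpha> * rsg \<alpha> * (fst (w \<alpha>) $ k * snd (w \<alpha>) $ l) + ep * (\<phi> \<alpha> * rsg \<alpha> * (fst (w \<alpha>) $ l * snd (w \<alpha>) $ k))"
    proof (cases "ri \<alpha> = rj \<alpha>")
      case True
      have ep: "ep = 1" using root_bounds(10)[OF r True] by blast
      have s: "fst (w \<alpha>) $ k = snd (w \<alpha>) $ k" "fst (w \<alpha>) $ l = snd (w \<alpha>) $ l"
        using rk unfolding True by simp_all
      show ?thesis unfolding bl if_P[OF True] rk s ep dbl_def by (simp add: algebra_simps)
    next
      case False
      show ?thesis unfolding bl if_not_P[OF False] rk dbl_def by (simp add: algebra_simps)
    qed
  qed
  finally show ?thesis unfolding sum.distrib sum_distrib_left .
qed

text \<open>Moving the unitriangular factors to opposite sides forms entry \<open>(i, j)\<close>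
  from entries with smaller or equal indices. The region above the antidiagonal is closed under
  decreasing indices, so knowledge on that region suffices.\<close>

lemma truncated_half:
  assumes H: "H \<in> unitri m" "H' \<in> unitri m" and M: "M \<in> carrier_mat m m" "M' \<in> carrier_mat m m"
    and eq: "\<And>k l. k + l + 1 < m \<Longrightarrow> (H\<^sup>T * M * H) $$ (k, l) = (H'\<^sup>T * M' * H') $$ (k, l)"
    and ij: "i + j + 1 < m"
  shows "((H * uinv H')\<^sup>T * M) $$ (i, j) = (M' * (H' * uinv H)) $$ (i, j)"
proof -
  let ?G = "uinv H" and ?G' = "uinv H'"
  have lt: "i < m" "j < m" using ij by auto
  have Gu: "?G \<in> unitri m" "?G' \<in> unitri m" using H uinv(1) by auto
  note c = H[THEN unitri_carrier] Gu[THEN unitri_carrier]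
  have ct: "H\<^sup>T \<in> carrier_mat m m" "H'\<^sup>T \<in> carrier_mat m m" "?G'\<^sup>T \<in> carrier_mat m m" using c by auto
  have sum: "(?G'\<^sup>T * Q * ?G) $$ (i, j) = (\<Sum>l<m. \<Sum>k<m. ?G' $$ (k, i) * Q $$ (k, l) * ?G $$ (l, j))"
    if Q: "Q \<in> carrier_mat m m" for Q
  proof -
    have cQ: "?G'\<^sup>T * Q \<in> carrier_mat m m" using ct Q by auto
    show ?thesis unfolding mult_index[OF cQ c(3) lt] using c lt
      by (intro sum.cong refl) (simp add: mult_index[OF ct(3) Q] sum_distrib_right)
  qed
  have cQ: "H\<^sup>T * M * H \<in> carrier_mat m m" "H'\<^sup>T * M' * H' \<in> carrier_mat m m" using c ct M by auto
  have e: "(?G'\<^sup>T * (H\<^sup>T * M * H) * ?G) $$ (i, j) = (?G'\<^sup>T * (H'\<^sup>T * M' * H') * ?G) $$ (i, j)"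
    unfolding sum[OF cQ(1)] sum[OF cQ(2)]
  proof (intro sum.cong refl)
    fix l k assume "l \<in> {..<m}" "k \<in> {..<m}"
    hence kl: "l < m" "k < m" by auto
    show "?G' $$ (k, i) * (H\<^sup>T * M * H) $$ (k, l) * ?G $$ (l, j) = ?G' $$ (k, i) * (H'\<^sup>T * M' * H') $$ (k, l) * ?G $$ (l, j)"
    proof (cases "k \<le> i \<and> l \<le> j")
      case True
      hence "k + l + 1 < m" using ij by linarith
      from eq[OF this] show ?thesis by (simp only:)
    next
      case False
      then consider "i < k" | "j < l" by linarith
      thus ?thesis
      proof cases
        case 1 thus ?thesis using unitri_zero[OF Gu(2) kl(2) 1] by simp
      next
        case 2 thus ?thesis using unitri_zero[OF Gu(1) kl(1) 2] by simp
      qed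
    qed
  qed
  have t1: "(H * ?G')\<^sup>T = ?G'\<^sup>T * H\<^sup>T" by (rule transpose_mult[OF c(1,4)])
  have t2: "?G'\<^sup>T * H'\<^sup>T = 1\<^sub>m m" using transpose_mult[OF c(2,4)] uinv(2)[OF H(2)] by simp
  have "?G'\<^sup>T * (H\<^sup>T * M * H) * ?G = (?G'\<^sup>T * H\<^sup>T) * M * (H * ?G)" using c ct M by (simp add: mult_assoc)
  hence l: "?G'\<^sup>T * (H\<^sup>T * M * H) * ?G = (H * ?G')\<^sup>T * M" unfolding t1 uinv(2)[OF H(1)] using ct M by simp
  have "?G'\<^sup>T * (H'\<^sup>T * M' * H') * ?G = (?G'\<^sup>T * H'\<^sup>T) * M' * (H' * ?G)" using c ct M by (simp add: mult_assoc)
  hence r: "?G'\<^sup>T * (H'\<^sup>T * M' * H') * ?G = M' * (H' * ?G)" unfolding t2 using c M by simp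
  show ?thesis using e unfolding l r .
qed

text \<open>All pivots lie strictly above the antidiagonal, where the comparison is available. The
  factor on the right is now upper triangular, so the order on columns is the reverse of that in
  \<open>two_sided_unique\<close>.\<close>

lemma truncated_unique:
  assumes dj: "disj D" "disj D'" and H: "H \<in> unitri m" "H' \<in> unitri m"
    and eq: "\<And>k l. k + l + 1 < m \<Longrightarrow> (H\<^sup>T * pS D \<phi> * H) $$ (k, l) = (H'\<^sup>T * pS D' \<phi>' * H') $$ (k, l)"
    and ij: "i < m" "j < m"
  shows "pS D \<phi> $$ (i, j) = pS D' \<phi>' $$ (i, j)"
proof -
  have step: "\<exists>b<m. pS D2 \<phi>2 $$ (i, b) \<noteq> 0 \<and> b \<le> j \<and> (b = j \<longrightarrow> pS D2 \<phi>2 $$ (i, j) = pS D1 \<phi>1 $$ (i, j))"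
    if d1: "disj D1" and d2: "disj D2" and v: "H1 \<in> unitri m" "H2 \<in> unitri m"
    and e: "\<And>k l. k + l + 1 < m \<Longrightarrow> (H1\<^sup>T * pS D1 \<phi>1 * H1) $$ (k, l) = (H2\<^sup>T * pS D2 \<phi>2 * H2) $$ (k, l)"
    and ij: "i < m" "j < m" and nz: "pS D1 \<phi>1 $$ (i, j) \<noteq> 0" for D1 \<phi>1 D2 \<phi>2 H1 H2 i j
  proof -
    have A: "H1 * uinv H2 \<in> unitri m" and B: "H2 * uinv H1 \<in> unitri m" using v uinv(1) unitri_mult by auto
    have "i + j + 1 < m" using LL_zero[OF pS_in_LL[OF disj_roots[OF d1]] ij] nz by (meson not_le)
    have half: "((H1 * uinv H2)\<^sup>T * pS D1 \<phi>1) $$ (i, j) = (pS D2 \<phi>2 * (H2 * uinv H1)) $$ (i, j)"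
      by (rule truncated_half[OF v pS_carrier pS_carrier _ \<open>i + j + 1 < m\<close>]) (rule e)
    have At: "(H1 * uinv H2)\<^sup>T $$ (i, i) = (H1 * uinv H2) $$ (i, i)" if "i < m" for i
      using carrier_matD[OF unitri_carrier[OF A]] that by simp
    have R: "b \<le> j" if "b < m" "j < m" "(H2 * uinv H1) $$ (b, j) \<noteq> 0" for b j
      using that(3) unitri_zero[OF B that(1), of j] by (meson not_le)
    show ?thesis
    proof (rule pivot_step[where A = "(H1 * uinv H2)\<^sup>T" and B = "H2 * uinv H1" and R = "\<lambda>b j. b \<le> j"])
      show "(H1 * uinv H2)\<^sup>T \<in> carrier_mat m m" "H2 * uinv H1 \<in> carrier_mat m m"
        using unitri_carrier[OF A] unitri_carrier[OF B] by auto
      show "\<And>i. i < m \<Longrightarrow> (H1 * uinv H2)\<^sup>T $$ (i, i) = 1" using At unitri_diag[OF A] by simp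
    qed (fact pS_carrier unitri_diag[OF B] R pS_col[OF d1] pS_row[OF d2] ij nz half)+
  qed
  show ?thesis
    by (rule unique_pivots[where R = "\<lambda>b j. b \<le> j" and M = "\<lambda>i j. pS D \<phi> $$ (i, j)" and M' = "\<lambda>i j. pS D' \<phi>' $$ (i, j)",
          OF _ pS_row[OF dj(1)] pS_row[OF dj(2)] step[OF dj H eq] step[OF dj(2,1) H(2,1) eq[symmetric]] ij]) linarith
qed

end

section \<open>Fourier analysis on the space of forms\<close>

context unipotent_character
begin

text \<open>Translating \<open>LL\<close> by a symmetric matrix supported at \<open>(k, l)\<close>
  and \<open>(l, k)\<close> multiplies the sum by a value of \<theta>, which can be made different
  from 1 if the symmetrized coefficient is nonzero.\<close>

lemma sum_LL:
  fixes N :: "nat \<Rightarrow> nat \<Rightarrow> 'a"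
  assumes kl: "k + l + 1 < m" and nz: "N k l + ep * N l k \<noteq> 0"
  shows "(\<Sum>S\<in>LL. \<theta> (\<Sum>a<m. \<Sum>b<m. N a b * S $$ (a, b))) = 0"
proof -
  let ?L = "\<lambda>S. \<Sum>a<m. \<Sum>b<m. N a b * S $$ (a, b)"
  have lt: "k < m" "l < m" using kl by auto
  obtain x where x: "\<theta> ((N k l + ep * N l k) * x) \<noteq> 1" using th_scaled[OF nz] by blast
  \<comment> \<open>The two terms are added, so for \<open>k = l\<close> they combine on the
    diagonal; in every case the functional takes the value of the symmetrized coefficient times
    \<open>x\<close>.\<close>
  define E where "E = mat m m (\<lambda>(a, b). (if a = k then if b = l then x else 0 else 0) + (if a = l then if b = k then ep * x else 0 else 0))"
  have E: "E \<in> carrier_mat m m" by (simp add: E_def)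
  have ee: "ep * (ep * y) = y" for y by (simp add: ep_def)
  have s: "E $$ (b, a) = ep * E $$ (a, b)" if "a < m" "b < m" for a b
    using that by (simp add: E_def ee distrib_left)
  have z: "E $$ (a, b) = 0" if "a < m" "b < m" "m \<le> a + b + 1" for a b
    using that kl by (auto simp: E_def)
  have plus: "S + E \<in> LL" "S - E \<in> LL" if S: "S \<in> LL" for S
  proof -
    have c: "S + E \<in> carrier_mat m m" "S - E \<in> carrier_mat m m" using E LL_carrier[OF S] by auto
    have i: "(S + E) $$ (a, b) = S $$ (a, b) + E $$ (a, b)" "(S - E) $$ (a, b) = S $$ (a, b) - E $$ (a, b)"
      if "a < m" "b < m" for a b using that E by auto
    have "(S + E) $$ (b, a) = ep * (S + E) $$ (a, b)" "(S - E) $$ (b, a) = ep * (S - E) $$ (a, b)" if ab: "a < m" "b < m" for a b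
      unfolding i[OF ab] i[OF ab(2,1)] LL_sym[OF S ab] s[OF ab] by (simp_all only: distrib_left right_diff_distrib)
    moreover have "(S + E) $$ (a, b) = 0" "(S - E) $$ (a, b) = 0" if ab: "a < m" "b < m" "m \<le> a + b + 1" for a b
      unfolding i[OF ab(1,2)] LL_zero[OF S ab] z[OF ab] by simp_all
    ultimately show "S + E \<in> LL" "S - E \<in> LL" unfolding LL_def using c by blast+
  qed
  have bij: "bij_betw (\<lambda>S. S + E) LL LL"
  proof (rule bij_betw_byWitness[where f' = "\<lambda>S. S - E"])
    show "\<forall>S\<in>LL. S + E - E = S" "\<forall>S\<in>LL. S - E + E = S"
    proof safe
      fix S assume "S \<in> LL"
      hence "S \<in> carrier_mat m m" by (rule LL_carrier)
      thus "S + E - E = S" "S - E + E = S" using E by (intro eq_matI; simp)+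
    qed
  qed (use plus in auto)
  have one: "(\<Sum>a<m. \<Sum>b<m. N a b * (if a = i then if b = j then c else 0 else 0)) = N i j * c" if ij: "i < m" "j < m" for i j c
  proof -
    have "(\<Sum>a<m. \<Sum>b<m. N a b * (if a = i then if b = j then c else 0 else 0)) = (\<Sum>a<m. if a = i then N i j * c else 0)"
    proof (intro sum.cong refl)
      fix a
      have "(\<Sum>b<m. N a b * (if a = i then if b = j then c else 0 else 0)) = (\<Sum>b<m. if b = j then (if a = i then N i j * c else 0) else 0)"
        by (intro sum.cong refl) auto
      thus "(\<Sum>b<m. N a b * (if a = i then if b = j then c else 0 else 0)) = (if a = i then N i j * c else 0)" using ij by simp
    qed
    thus ?thesis using ij by simp
  qed
  have "?L E = (\<Sum>a<m. \<Sum>b<m. N a b * (if a = k then if b = l then x else 0 else 0)) +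
      (\<Sum>a<m. \<Sum>b<m. N a b * (if a = l then if b = k then ep * x else 0 else 0))"
    by (simp add: E_def distrib_left sum.distrib)
  hence LE: "?L E = (N k l + ep * N l k) * x" unfolding one[OF lt] one[OF lt(2,1)] by (simp add: algebra_simps)
  have "(\<Sum>S\<in>LL. \<theta> (?L S)) = (\<Sum>S\<in>LL. \<theta> (?L (S + E)))" using sum.reindex_bij_betw[OF bij, of "\<lambda>S. \<theta> (?L S)"] by simp
  also have "\<dots> = (\<Sum>S\<in>LL. \<theta> (?L E) * \<theta> (?L S))"
  proof (intro sum.cong refl)
    fix S assume "S \<in> LL"
    have "?L (S + E) = ?L E + ?L S" unfolding sum.distrib[symmetric]
      by (intro sum.cong refl) (use E in \<open>simp add: distrib_left add.commute\<close>)
    thus "\<theta> (?L (S + E)) = \<theta> (?L E) * \<theta> (?L S)" by (simp only: th_add)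
  qed
  also have "\<dots> = \<theta> (?L E) * (\<Sum>S\<in>LL. \<theta> (?L S))" by (simp only: sum_distrib_left)
  finally have "(1 - \<theta> (?L E)) * (\<Sum>S\<in>LL. \<theta> (?L S)) = 0" by (simp add: left_diff_distrib)
  thus ?thesis using x unfolding LE by simp
qed

lemma prod_GG:
  assumes fin: "finite D"
  shows "(\<Prod>\<alpha>\<in>D. GG (c \<alpha>) (ri \<alpha>) (rj \<alpha>) S) =
    (\<Sum>w\<in>(\<Pi>\<^sub>E \<alpha>\<in>D. WW (ri \<alpha>) (rj \<alpha>)). \<theta> (\<Sum>\<alpha>\<in>D. c \<alpha> * bil S (fst (w \<alpha>)) (snd (w \<alpha>))))"
proof -
  have "(\<Prod>\<alpha>\<in>D. GG (c \<alpha>) (ri \<alpha>) (rj \<alpha>) S) = (\<Prod>\<alpha>\<in>D. \<Sum>p\<in>WW (ri \<alpha>) (rj \<alpha>). \<theta> (c \<alpha> * bil S (fst p) (snd p)))"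
    unfolding GG_def split_def ..
  also have "\<dots> = (\<Sum>w\<in>(\<Pi>\<^sub>E \<alpha>\<in>D. WW (ri \<alpha>) (rj \<alpha>)). \<Prod>\<alpha>\<in>D. \<theta> (c \<alpha> * bil S (fst (w \<alpha>)) (snd (w \<alpha>))))"
    by (rule prod_sum_PiE[OF fin finite_WW])
  finally show ?thesis unfolding th_sum[OF fin] .
qed

text \<open>Every pair of vector families vanishes separately. A nonzero sum over \<open>LL\<close>
  would make the two symmetrized coefficient matrices agree above the antidiagonal, and the
  uniqueness of pivots would then identify the two basic pairs.\<close>

lemma orthogonality_GG:
  assumes p: "(D, \<phi>) \<in> basic_pairs T n" "(D', \<phi>') \<in> basic_pairs T n" and ne: "(D, \<phi>) \<noteq> (D', \<phi>')"
  shows "(\<Sum>S\<in>LL. (\<Prod>\<alpha>\<in>D. GG (\<phi> \<alpha> * rsg \<alpha>) (ri \<alpha>) (rj \<alpha>) S) * cnj (\<Prod>\<alpha>\<in>D'. GG (\<phi>' \<alpha> * rsg \<alpha>) (ri \<alpha>) (rj \<alpha>) S)) = 0"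
proof -
  note dj = basic_pairsD(1)[OF p(1)] basic_pairsD(1)[OF p(2)]
  have fin: "finite D" "finite D'" using finite_subset[OF disj_roots finite_roots] dj by auto
  let ?W = "\<lambda>D. \<Pi>\<^sub>E \<alpha>\<in>D. WW (ri \<alpha>) (rj \<alpha>)"
  define N where "N D \<phi> w a b = (\<Sum>\<alpha>\<in>D. \<phi> \<alpha> * rsg \<alpha> * (fst (w \<alpha>) $ a * snd (w \<alpha>) $ b))"
    for D \<phi> and w :: "root \<Rightarrow> 'a vec \<times> 'a vec" and a b
  have lin: "(\<Sum>\<alpha>\<in>D. \<phi> \<alpha> * rsg \<alpha> * bil S (fst (w \<alpha>)) (snd (w \<alpha>))) = (\<Sum>a<m. \<Sum>b<m. N D \<phi> w a b * S $$ (a, b))" for D \<phi> w S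
  proof -
    have "(\<Sum>a<m. \<Sum>b<m. N D \<phi> w a b * S $$ (a, b)) =
      (\<Sum>a<m. \<Sum>b<m. \<Sum>\<alpha>\<in>D. \<phi> \<alpha> * rsg \<alpha> * (fst (w \<alpha>) $ a * S $$ (a, b) * snd (w \<alpha>) $ b))"
      unfolding N_def sum_distrib_right by (intro sum.cong refl) (simp only: mult_ac)
    also have "\<dots> = (\<Sum>\<alpha>\<in>D. \<Sum>a<m. \<Sum>b<m. \<phi> \<alpha> * rsg \<alpha> * (fst (w \<alpha>) $ a * S $$ (a, b) * snd (w \<alpha>) $ b))"
      unfolding sum.swap[of _ D] ..
    finally show ?thesis unfolding bil_double sum_distrib_left ..
  qed
  have zero: "(\<Sum>S\<in>LL. \<theta> (\<Sum>a<m. \<Sum>b<m. (N D \<phi> w a b - N D' \<phi>' w' a b) * S $$ (a, b))) = 0"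
    if w: "w \<in> ?W D" and w': "w' \<in> ?W D'" for w w'
  proof (rule ccontr)
    assume nz: "\<not> ?thesis"
    have sym: "N D \<phi> w k l - N D' \<phi>' w' k l + ep * (N D \<phi> w l k - N D' \<phi>' w' l k) = 0" if "k + l + 1 < m" for k l
      using sum_LL[OF that, of "\<lambda>a b. N D \<phi> w a b - N D' \<phi>' w' a b"] nz by blast
    obtain H where H: "H \<in> unitri m"
      "\<And>\<alpha> b. \<alpha> \<in> D \<Longrightarrow> b < m \<Longrightarrow> H $$ (ri \<alpha>, b) = fst (w \<alpha>) $ b"
      "\<And>\<alpha> b. \<alpha> \<in> D \<Longrightarrow> b < m \<Longrightarrow> H $$ (rj \<alpha>, b) = snd (w \<alpha>) $ b" using unitri_with_rows[OF dj(1) w] by blast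
    obtain H' where H': "H' \<in> unitri m"
      "\<And>\<alpha> b. \<alpha> \<in> D' \<Longrightarrow> b < m \<Longrightarrow> H' $$ (ri \<alpha>, b) = fst (w' \<alpha>) $ b"
      "\<And>\<alpha> b. \<alpha> \<in> D' \<Longrightarrow> b < m \<Longrightarrow> H' $$ (rj \<alpha>, b) = snd (w' \<alpha>) $ b" using unitri_with_rows[OF dj(2) w'] by blast
    have "(H\<^sup>T * pS D (dbl \<phi>) * H) $$ (k, l) = (H'\<^sup>T * pS D' (dbl \<phi>') * H') $$ (k, l)" if kl: "k + l + 1 < m" for k l
    proof -
      have lt: "k < m" "l < m" using kl by auto
      have "N D \<phi> w k l + ep * N D \<phi> w l k = N D' \<phi>' w' k l + ep * N D' \<phi>' w' l k"
        using sym[OF kl] by (simp add: algebra_simps)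
      moreover have "(H\<^sup>T * pS D (dbl \<phi>) * H) $$ (k, l) = N D \<phi> w k l + ep * N D \<phi> w l k"
        unfolding N_def by (rule symmetrized_form[OF dj(1) H lt])
      moreover have "(H'\<^sup>T * pS D' (dbl \<phi>') * H') $$ (k, l) = N D' \<phi>' w' k l + ep * N D' \<phi>' w' l k"
        unfolding N_def by (rule symmetrized_form[OF dj(2) H' lt])
      ultimately show ?thesis by simp
    qed
    hence e: "pS D (dbl \<phi>) $$ (i, j) = pS D' (dbl \<phi>') $$ (i, j)" if "i < m" "j < m" for i j
      using truncated_unique[OF dj H(1) H'(1) _ that] by blast
    \<comment> \<open>Doubling is injective and preserves nonzero values since 2 is invertible, so
      nothing is lost in passing from \<phi> to \<open>dbl \<phi>\<close>.\<close>
    have d: "dbl \<psi> \<alpha> \<noteq> 0" if "\<psi> \<alpha> \<noteq> 0" for \<psi> \<alpha> using that two by (simp add: dbl_def)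
    have D: "D = D'" by (rule pS_inj(1)[OF dj d[OF basic_pairsD(2)[OF p(1)]] d[OF basic_pairsD(2)[OF p(2)]] e])
    have "\<phi> \<alpha> = \<phi>' \<alpha>" if "\<alpha> \<in> D" for \<alpha>
    proof -
      have "dbl \<phi> \<alpha> = dbl \<phi>' \<alpha>"
        by (rule pS_inj(2)[OF dj d[OF basic_pairsD(2)[OF p(1)]] d[OF basic_pairsD(2)[OF p(2)]] e that])
      thus ?thesis using two by (simp add: dbl_def split: if_splits)
    qed
    hence "(D, \<phi>) = (D', \<phi>')" by (rule basic_pairs_eqI[OF p D])
    thus False using ne by blast
  qed
  have expand: "(\<Prod>\<alpha>\<in>D. GG (\<phi> \<alpha> * rsg \<alpha>) (ri \<alpha>) (rj \<alpha>) S) * cnj (\<Prod>\<alpha>\<in>D'. GG (\<phi>' \<alpha> * rsg \<alpha>) (ri \<alpha>) (rj \<alpha>) S) =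
    (\<Sum>w\<in>?W D. \<Sum>w'\<in>?W D'. \<theta> (\<Sum>a<m. \<Sum>b<m. (N D \<phi> w a b - N D' \<phi>' w' a b) * S $$ (a, b)))" for S
    unfolding prod_GG[OF fin(1)] prod_GG[OF fin(2)] lin cnj_sum cnj_th sum_product th_add[symmetric]
    by (simp add: left_diff_distrib sum_subtractf)
  have "(\<Sum>S\<in>LL. (\<Prod>\<alpha>\<in>D. GG (\<phi> \<alpha> * rsg \<alpha>) (ri \<alpha>) (rj \<alpha>) S) * cnj (\<Prod>\<alpha>\<in>D'. GG (\<phi>' \<alpha> * rsg \<alpha>) (ri \<alpha>) (rj \<alpha>) S)) =
    (\<Sum>w\<in>?W D. \<Sum>w'\<in>?W D'. \<Sum>S\<in>LL. \<theta> (\<Sum>a<m. \<Sum>b<m. (N D \<phi> w a b - N D' \<phi>' w' a b) * S $$ (a, b)))"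
    unfolding expand sum.swap[of _ LL] ..
  also have "\<dots> = 0" by (intro sum.neutral ballI zero)
  finally show ?thesis .
qed

lemma supercharacter_formula:
  assumes p: "(D, \<phi>) \<in> basic_pairs T n"
  obtains C where "\<And>X. X \<in> UU \<Longrightarrow>
    supercharacter T n \<theta> D \<phi> X = C * (\<Prod>\<alpha>\<in>D. GG (\<phi> \<alpha> * rsg \<alpha>) (ri \<alpha>) (rj \<alpha>) (SS X))"
proof -
  note D = disj_roots[OF basic_pairsD(1)[OF p]]
  have "\<exists>c. \<forall>X\<in>UU. elementary_char T n \<theta> \<alpha> (\<phi> \<alpha>) X = c * GG (\<phi> \<alpha> * rsg \<alpha>) (ri \<alpha>) (rj \<alpha>) (SS X)" if a: "\<alpha> \<in> D" for \<alpha>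
  proof -
    have r: "\<alpha> \<in> roots T n" using D a by blast
    obtain C where "\<And>X. X \<in> UU \<Longrightarrow> elementary_char T n \<theta> \<alpha> (\<phi> \<alpha>) X = C * GG (\<phi> \<alpha> * rsg \<alpha>) (ri \<alpha>) (rj \<alpha>) (SS X)"
      using elementary_char_formula[OF r basic_pairsD(2)[OF p a]] by blast
    thus ?thesis by blast
  qed
  hence "\<exists>c. \<forall>\<alpha>\<in>D. \<forall>X\<in>UU. elementary_char T n \<theta> \<alpha> (\<phi> \<alpha>) X = c \<alpha> * GG (\<phi> \<alpha> * rsg \<alpha>) (ri \<alpha>) (rj \<alpha>) (SS X)"
    by (intro bchoice ballI)
  then obtain c where c: "\<And>\<alpha> X. \<alpha> \<in> D \<Longrightarrow> X \<in> UU \<Longrightarrow>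
    elementary_char T n \<theta> \<alpha> (\<phi> \<alpha>) X = c \<alpha> * GG (\<phi> \<alpha> * rsg \<alpha>) (ri \<alpha>) (rj \<alpha>) (SS X)" by blast
  show thesis
  proof (rule that)
    fix X assume X: "X \<in> UU"
    have "(\<Prod>\<alpha>\<in>D. elementary_char T n \<theta> \<alpha> (\<phi> \<alpha>) X) = (\<Prod>\<alpha>\<in>D. c \<alpha> * GG (\<phi> \<alpha> * rsg \<alpha>) (ri \<alpha>) (rj \<alpha>) (SS X))"
      by (intro prod.cong refl c X)
    thus "supercharacter T n \<theta> D \<phi> X = (\<Prod>\<alpha>\<in>D. c \<alpha>) * (\<Prod>\<alpha>\<in>D. GG (\<phi> \<alpha> * rsg \<alpha>) (ri \<alpha>) (rj \<alpha>) (SS X))"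
      using X by (simp add: supercharacter_def carrier_U_group prod.distrib)
  qed
qed

lemma supercharacter_const:
  assumes p: "(D, \<phi>) \<in> basic_pairs T n" and q: "(D', \<phi>') \<in> basic_pairs T n"
    and XY: "X \<in> superclass T n D' \<phi>'" "Y \<in> superclass T n D' \<phi>'"
  shows "supercharacter T n \<theta> D \<phi> X = supercharacter T n \<theta> D \<phi> Y"
proof -
  obtain C where C: "\<And>X. X \<in> UU \<Longrightarrow>
    supercharacter T n \<theta> D \<phi> X = C * (\<Prod>\<alpha>\<in>D. GG (\<phi> \<alpha> * rsg \<alpha>) (ri \<alpha>) (rj \<alpha>) (SS X))"
    using supercharacter_formula[OF p] by blast
  have "supercharacter T n \<theta> D \<phi> Z = C * (\<Prod>\<alpha>\<in>D. GG (\<phi> \<alpha> * rsg \<alpha>) (ri \<alpha>) (rj \<alpha>) (pS D' \<phi>'))"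
    if Z: "Z \<in> superclass T n D' \<phi>'" for Z
  proof -
    obtain g where g: "Z \<in> UU" "g \<in> unitri m" "g * SS Z * g\<^sup>T = pS D' \<phi>'" using Z unfolding superclass_iff[OF q] by blast
    have "GG (\<phi> \<alpha> * rsg \<alpha>) (ri \<alpha>) (rj \<alpha>) (SS Z) = GG (\<phi> \<alpha> * rsg \<alpha>) (ri \<alpha>) (rj \<alpha>) (pS D' \<phi>')" if "\<alpha> \<in> D" for \<alpha>
    proof -
      have r: "\<alpha> \<in> roots T n" using disj_roots[OF basic_pairsD(1)[OF p]] that by blast
      show ?thesis unfolding g(3)[symmetric] by (rule GG_cong[OF SS_carrier[OF UU_unitri[OF g(1)]] g(2) root_lt[OF r], symmetric])
    qed
    thus ?thesis unfolding C[OF g(1)] by simp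
  qed
  thus ?thesis using XY by simp
qed

lemma supercharacter_orthogonal:
  assumes p: "(D, \<phi>) \<in> basic_pairs T n" "(D', \<phi>') \<in> basic_pairs T n" and ne: "(D, \<phi>) \<noteq> (D', \<phi>')"
  shows "(\<Sum>X\<in>UU. supercharacter T n \<theta> D \<phi> X * cnj (supercharacter T n \<theta> D' \<phi>' X)) = 0"
proof -
  let ?F = "\<lambda>D \<phi> S. \<Prod>\<alpha>\<in>D. GG (\<phi> \<alpha> * rsg \<alpha>) (ri \<alpha>) (rj \<alpha>) S"
  obtain C where C: "\<And>X. X \<in> UU \<Longrightarrow> supercharacter T n \<theta> D \<phi> X = C * ?F D \<phi> (SS X)"
    using supercharacter_formula[OF p(1)] by blast
  obtain C' where C': "\<And>X. X \<in> UU \<Longrightarrow> supercharacter T n \<theta> D' \<phi>' X = C' * ?F D' \<phi>' (SS X)"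
    using supercharacter_formula[OF p(2)] by blast
  have "(\<Sum>X\<in>UU. supercharacter T n \<theta> D \<phi> X * cnj (supercharacter T n \<theta> D' \<phi>' X)) =
      (\<Sum>X\<in>UU. C * cnj C' * (?F D \<phi> (SS X) * cnj (?F D' \<phi>' (SS X))))"
  proof (intro sum.cong refl)
    fix X assume X: "X \<in> UU"
    show "supercharacter T n \<theta> D \<phi> X * cnj (supercharacter T n \<theta> D' \<phi>' X) = C * cnj C' * (?F D \<phi> (SS X) * cnj (?F D' \<phi>' (SS X)))"
      unfolding C[OF X] C'[OF X] complex_cnj_mult by (simp only: mult_ac)
  qed
  also have "\<dots> = C * cnj C' * (\<Sum>X\<in>UU. ?F D \<phi> (SS X) * cnj (?F D' \<phi>' (SS X)))"
    unfolding sum_distrib_left ..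
  also have "(\<Sum>X\<in>UU. ?F D \<phi> (SS X) * cnj (?F D' \<phi>' (SS X))) = 0"
    \<comment> \<open>The bijection between the group and the space of forms replaces the sum over U
      by one to which additive characters apply.\<close>
    using sum.reindex_bij_betw[OF bij_SS, of "\<lambda>S. ?F D \<phi> S * cnj (?F D' \<phi>' S)"] orthogonality_GG[OF p ne] by simp
  finally show ?thesis by simp
qed

lemma supercharacter_urep:
  assumes p: "(D, \<phi>) \<in> basic_pairs T n"
  shows "\<exists>(I :: (root \<Rightarrow> 'a mat) set) \<rho>. urep (U_group T n) I \<rho> \<and>
    supercharacter T n \<theta> D \<phi> = (\<lambda>X\<in>carrier (U_group T n). utrace I \<rho> X)"
proof -
  note D = disj_roots[OF basic_pairsD(1)[OF p]]
  have fin: "finite D" by (rule finite_subset[OF D finite_roots])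
  have "\<exists>q :: 'a mat set \<times> ('a mat \<Rightarrow> 'a mat \<Rightarrow> 'a mat \<Rightarrow> complex). urep (U_group T n) (fst q) (snd q) \<and> (\<forall>X\<in>UU. utrace (fst q) (snd q) X = elementary_char T n \<theta> \<alpha> (\<phi> \<alpha>) X)"
    if a: "\<alpha> \<in> D" for \<alpha>
  proof -
    have r: "\<alpha> \<in> roots T n" using D a by blast
    obtain I :: "'a mat set" and \<sigma> where "urep (U_group T n) I \<sigma>" "\<forall>X\<in>UU. utrace I \<sigma> X = elementary_char T n \<theta> \<alpha> (\<phi> \<alpha>) X"
      using elementary_char_urep[OF r] by blast
    thus ?thesis by (intro exI[of _ "(I, \<sigma>)"]) simp
  qed
  hence "\<exists>q :: root \<Rightarrow> 'a mat set \<times> ('a mat \<Rightarrow> 'a mat \<Rightarrow> 'a mat \<Rightarrow> complex). \<forall>\<alpha>\<in>D. urep (U_group T n) (fst (q \<alpha>)) (snd (q \<alpha>)) \<and>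
      (\<forall>X\<in>UU. utrace (fst (q \<alpha>)) (snd (q \<alpha>)) X = elementary_char T n \<theta> \<alpha> (\<phi> \<alpha>) X)"
    by (intro bchoice ballI)
  then obtain q :: "root \<Rightarrow> 'a mat set \<times> ('a mat \<Rightarrow> 'a mat \<Rightarrow> 'a mat \<Rightarrow> complex)" where q: "\<And>\<alpha>. \<alpha> \<in> D \<Longrightarrow> urep (U_group T n) (fst (q \<alpha>)) (snd (q \<alpha>))"
      "\<And>\<alpha> X. \<alpha> \<in> D \<Longrightarrow> X \<in> UU \<Longrightarrow> utrace (fst (q \<alpha>)) (snd (q \<alpha>)) X = elementary_char T n \<theta> \<alpha> (\<phi> \<alpha>) X"
    by blast
  \<comment> \<open>The tensor product of the induced representations attached to the roots of
    \<open>D\<close>.\<close>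
  let ?I = "\<Pi>\<^sub>E \<alpha>\<in>D. fst (q \<alpha>)" and ?\<rho> = "\<lambda>g f f'. \<Prod>\<alpha>\<in>D. snd (q \<alpha>) g (f \<alpha>) (f' \<alpha>)"
  have "urep (U_group T n) ?I ?\<rho>" by (rule urep_PiE[OF fin q(1)])
  moreover have "supercharacter T n \<theta> D \<phi> = (\<lambda>X\<in>carrier (U_group T n). utrace ?I ?\<rho> X)"
    unfolding supercharacter_def carrier_U_group
  proof (rule restrict_ext)
    fix X assume X: "X \<in> UU"
    have "utrace ?I ?\<rho> X = (\<Prod>\<alpha>\<in>D. utrace (fst (q \<alpha>)) (snd (q \<alpha>)) X)"
      by (rule utrace_PiE[OF fin urepD(1)[OF q(1)]])
    also have "\<dots> = (\<Prod>\<alpha>\<in>D. elementary_char T n \<theta> \<alpha> (\<phi> \<alpha>) X)" by (intro prod.cong refl q(2) X)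
    finally show "(\<Prod>\<alpha>\<in>D. elementary_char T n \<theta> \<alpha> (\<phi> \<alpha>) X) = utrace ?I ?\<rho> X" ..
  qed
  ultimately show ?thesis by blast
qed

lemma supercharacter_theory_U_group:
  "supercharacter_theory (U_group T n) (superclasses T n) (supercharacters T n \<theta>)"
proof -
  let ?P = "basic_pairs T n :: (root set \<times> (root \<Rightarrow> 'a)) set"
  let ?\<xi> = "\<lambda>p. supercharacter T n \<theta> (fst p) (snd p)" and ?\<kappa> = "\<lambda>p. superclass T n (fst p) (snd p) :: 'a mat set"
  have mem: "(fst p, snd p) \<in> basic_pairs T n" if "p \<in> ?P" for p using that by simp
  have "supercharacter_theory (U_group T n) (?\<kappa> ` ?P) (?\<xi> ` ?P)"
  proof (rule supercharacter_theoryI[where ?p0.0 = "({}, \<lambda>_. undefined)"])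
    show "group (U_group T n :: 'a mat monoid)" by (rule group_U_group)
    show "finite (carrier (U_group T n :: 'a mat monoid))" unfolding carrier_U_group by (rule finite_UU)
    show "finite ?P" by (rule finite_basic_pairs)
    show "\<exists>(I :: (root \<Rightarrow> 'a mat) set) \<rho>. urep (U_group T n) I \<rho> \<and> ?\<xi> p = (\<lambda>X\<in>carrier (U_group T n). utrace I \<rho> X)"
      if "p \<in> ?P" for p by (rule supercharacter_urep[OF mem[OF that]])
    show "(\<Sum>X\<in>carrier (U_group T n). ?\<xi> p X * cnj (?\<xi> q X)) = 0" if pq: "p \<in> ?P" "q \<in> ?P" "p \<noteq> q" for p q
      unfolding carrier_U_group by (rule supercharacter_orthogonal[OF mem[OF pq(1)] mem[OF pq(2)]]) (use pq(3) in simp)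
    show "?\<kappa> p \<noteq> {}" if "p \<in> ?P" for p by (rule superclass_nonempty[OF mem[OF that]])
    show "?\<kappa> p \<inter> ?\<kappa> q = {}" if pq: "p \<in> ?P" "q \<in> ?P" "p \<noteq> q" for p q
    proof (rule ccontr)
      assume "?\<kappa> p \<inter> ?\<kappa> q \<noteq> {}"
      then obtain X where "X \<in> ?\<kappa> p" "X \<in> ?\<kappa> q" by blast
      from superclass_disjoint[OF mem[OF pq(1)] mem[OF pq(2)] this] show False using pq(3) by simp
    qed
    show "(\<Union>p\<in>?P. ?\<kappa> p) = carrier (U_group T n)"
      unfolding carrier_U_group superclass_cover[symmetric] split_def ..
    show "({}, \<lambda>_. undefined) \<in> ?P" by (rule empty_basic_pair)
    show "?\<kappa> ({}, \<lambda>_. undefined) = {\<one>\<^bsub>U_group T n\<^esub>}" unfolding fst_conv snd_conv superclass_empty U_group_ops ..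
    show "?\<xi> p X = ?\<xi> p Y" if pq: "p \<in> ?P" "q \<in> ?P" and XY: "X \<in> ?\<kappa> q" "Y \<in> ?\<kappa> q" for p q X Y
      by (rule supercharacter_const[OF mem[OF pq(1)] mem[OF pq(2)] XY])
  qed
  moreover have "?\<kappa> ` ?P = superclasses T n" "?\<xi> ` ?P = supercharacters T n \<theta>"
    unfolding superclasses_def supercharacters_def by force+
  ultimately show ?thesis by simp
qed

end

theorem mainTheorem1:
  fixes p e n :: nat
    and T :: family
    and \<theta> :: "'a::{field,finite} \<Rightarrow> complex"
  assumes "prime p" and "odd p" and "e \<ge> 1"
    and "CARD('a) = p ^ e"
    and "n \<ge> 1"
    and "nontrivial_additive_character \<theta>"
  shows "supercharacter_theory (U_group T n) (superclasses T n) (supercharacters T n \<theta>)"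
proof -
  \<comment> \<open>The order of the field is a power of an odd prime, hence odd, while
    characteristic two would make it even.\<close>
  have "(2::'a) \<noteq> 0"
  proof
    assume two: "(2::'a) = 0"
    have inv: "x + 1 + 1 = x" for x :: 'a using two by (simp add: add.assoc)
    text \<open>In characteristic two the cosets of \<open>{0, 1}\<close> have two elements each.\<close>
    let ?C = "(\<lambda>x :: 'a. {x, x + 1}) ` UNIV"
    have "card (\<Union>?C) = (\<Sum>c\<in>?C. card c)"
    proof (rule card_Union_disjoint)
      show "pairwise disjnt ?C"
      proof (rule pairwiseI)
        fix c d assume cd: "c \<in> ?C" "d \<in> ?C" "c \<noteq> d"
        then obtain x y where xy: "c = {x, x + 1}" "d = {y, y + 1}" by blast
        have "x \<noteq> y" "x \<noteq> y + 1" "x + 1 \<noteq> y" using cd(3) unfolding xy by (auto simp: inv)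
        thus "disjnt c d" unfolding xy disjnt_def by auto
      qed
    qed auto
    also have "\<dots> = (\<Sum>c\<in>?C. 2)" by (intro sum.cong refl) auto
    also have "\<Union>?C = UNIV" by blast
    finally have "even CARD('a)" by simp
    thus False using assms(2,4) by simp
  qed
  then interpret unipotent_character T n "TYPE('a)" \<theta>
    using assms(6) by unfold_locales
  show ?thesis by (rule supercharacter_theory_U_group)
qed

end
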